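(* For $\tau=(\alpha,\beta,\gamma)\in\mathbf Q^3$ let $\Gamma_\tau$ be the covariant of binary quintics of degree-order $(17,5)$ defined by $$\Gamma_\tau=W\big((x_1^2,\mathbb F)_1,\ (x_1x_2,\mathbb F)_1,\ (x_2^2,\mathbb F)_1,\ \mathcal U,\ \mathcal V\big),$$ where $\mathcal U=\vartheta_{33}\vartheta_{22}-\alpha\,\vartheta_{40}\,\mathbb F$ and $\mathcal V=\vartheta_{51}\vartheta_{22}^2-\beta\,\vartheta_{40}^2\,\mathbb F-\gamma\,\vartheta_{80}\,\mathbb F$. Let $\mathfrak b_\tau\subseteq R$ be the ideal generated by the coefficients of $\Gamma_\tau$ (as a form in $x_1,x_2$), and $V_\tau=V(\mathfrak b_\tau)\subseteq\mathbb P^5$ the corresponding subvariety. Then: (1) For any $\tau\in\mathbf Q^3$, the ideal $\mathfrak b_\tau$ is perfect of height two, with minimal resolution $$0\leftarrow R/\mathfrak b_\tau\leftarrow R\leftarrow R(-17)\otimes S_5\leftarrow R(-18)\otimes S_2\ \oplus\ R(-22)\ \oplus\ R(-26)\leftarrow0 .$$ (2) There is an inclusion of varieties $\mathcal B\subseteq V_\tau$, which is an equality if and only if $\tau$ is one of the triples $$(0,0,0),\qquad(2/5,\,14/75,\,-2/5),\qquad(1/6,\,2/45,\,-1/3).$$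
   Context: The base field is $\mathbf C$. $S_m$ is the space of binary forms of order (homogeneous degree) $m$ in $x_1,x_2$, an $SL_2$-representation of dimension $m+1$. For forms $A,B$ of orders $m,n$ the $r$-th transvectant is $$(A,B)_r=\frac{(m-r)!\,(n-r)!}{m!\,n!}\sum_{i=0}^r(-1)^i\binom ri\frac{\partial^rA}{\partial x_1^{r-i}\partial x_2^i}\,\frac{\partial^rB}{\partial x_1^i\partial x_2^{r-i}},$$ and $(A,B)_r=0$ if $r>\min(m,n)$. $\mathbb F=\sum_{i=0}^5\binom5i a_i x_1^{5-i}x_2^i$ is the generic binary quintic, $R=\mathbf C[a_0,\dots,a_5]$, $\mathbb P^5=\mathbb P S_5=\mathrm{Proj}\,R$. A covariant of degree-order $(m,q)$ is an $SL_2$-equivariant form of order $q$ in $x_1,x_2$ whose coefficients are homogeneous of degree $m$ in the $a_i$. The covariants used are $\vartheta_{22}=(\mathbb F,\mathbb F)_4$, $\vartheta_{26}=(\mathbb F,\mathbb F)_2$, $\vartheta_{33}=(\vartheta_{22},\mathbb F)_2$, $\vartheta_{40}=(\vartheta_{22},\vartheta_{22})_2$, $\vartheta_{51}=(\vartheta_{22}^2,\mathbb F)_4$, $\vartheta_{80}=(\vartheta_{22}^3,\vartheta_{26})_6$. The Wronskian of binary forms $A_1,\dots,A_m$ of order $n$ (with $m\le n+1$) is $W(A_1,\dots,A_m)=\det\big(\partial^{m-1}A_i/\partial x_1^{m-j}\partial x_2^{j-1}\big)_{1\le i,j\le m}$. $\mathcal B\subseteq\mathbb P^5$ is the closed set given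 by the union of the $SL_2(\mathbf C)$-orbits of $x_1^5+x_2^5$, $x_1x_2(x_1-x_2)(x_1^2+x_1x_2+x_2^2)$, $x_1^3x_2(x_1+x_2)$, $x_1^3x_2^2$, $x_1^4x_2$ and $x_1^5$. *)

theory Defs
  imports
    Complex_Main
    "HOL-Library.Poly_Mapping"
    "HOL-Library.Numeral_Type"
    "HOL-Library.Extended_Nat"
    "Jordan_Normal_Form.Determinant"
begin

section \<open>Multivariate polynomials\<close>

type_synonym ('v, 'c) mpol = "('v \<Rightarrow>\<^sub>0 nat) \<Rightarrow>\<^sub>0 'c"

definition Const :: "'c::zero \<Rightarrow> ('v, 'c) mpol" where
  "Const c = Poly_Mapping.single 0 c"

definition Var :: "'v \<Rightarrow> ('v, 'c::comm_ring_1) mpol" where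
  "Var v = Poly_Mapping.single (Poly_Mapping.single v 1) 1"

definition mdeg :: "('v \<Rightarrow>\<^sub>0 nat) \<Rightarrow> nat" where
  "mdeg m = (\<Sum>v\<in>Poly_Mapping.keys m. Poly_Mapping.lookup m v)"

text \<open>Apply \<open>h\<close> to the coefficients and substitute \<open>f v\<close> for the variable \<open>v\<close>.\<close>

definition subst_poly ::
    "('c::comm_ring_1 \<Rightarrow> 'd::comm_ring_1) \<Rightarrow> ('v \<Rightarrow> 'd) \<Rightarrow> ('v, 'c) mpol \<Rightarrow> 'd" where
  "subst_poly h f p =
     (\<Sum>m\<in>Poly_Mapping.keys p. h (Poly_Mapping.lookup p m) *
        (\<Prod>v\<in>Poly_Mapping.keys m. f v ^ Poly_Mapping.lookup m v))"

definition partial :: "'v \<Rightarrow> ('v, 'c::comm_ring_1) mpol \<Rightarrow> ('v, 'c) mpol" where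
  "partial v p =
     (\<Sum>m\<in>Poly_Mapping.keys p.
        Poly_Mapping.single (m - Poly_Mapping.single v 1)
          (of_nat (Poly_Mapping.lookup m v) * Poly_Mapping.lookup p m))"


section \<open>Binary forms and their covariants\<close>

text \<open>The variables \<open>x\<^sub>1, x\<^sub>2\<close> are \<open>Var 0, Var 1\<close>, indexed by the two-element type \<open>2\<close>;
  the variables \<open>a\<^sub>0, \<dots>, a\<^sub>5\<close> of \<open>R\<close> are indexed by the six-element type \<open>6\<close>.\<close>

type_synonym 'c bform = "(2, 'c) mpol"
type_synonym quintic_ring = "(6, complex) mpol"

definition forms :: "nat \<Rightarrow> 'c::zero bform set" where
  "forms q = {A. \<forall>m\<in>Poly_Mapping.keys A. mdeg m = q}"

abbreviation x1 :: "'c::comm_ring_1 bform" where "x1 \<equiv> Var 0"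
abbreviation x2 :: "'c::comm_ring_1 bform" where "x2 \<equiv> Var 1"

definition quintic_mon :: "nat \<Rightarrow> (2 \<Rightarrow>\<^sub>0 nat)" where
  "quintic_mon i = Poly_Mapping.single 0 (5 - i) + Poly_Mapping.single 1 i"

definition generic_quintic :: "quintic_ring bform" where
  "generic_quintic =
     (\<Sum>i\<le>5. Const (of_nat (5 choose i) * Var (of_nat i)) * x1 ^ (5 - i) * x2 ^ i)"

definition scalar :: "complex \<Rightarrow> quintic_ring bform" where
  "scalar c = Const (Const c)"

text \<open>The orders \<open>m, n\<close> are arguments, since they are not determined by a form that may be zero.\<close>

definition transvectant ::
    "nat \<Rightarrow> nat \<Rightarrow> quintic_ring bform \<Rightarrow> quintic_ring bform \<Rightarrow> nat \<Rightarrow> quintic_ring bform" where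
  "transvectant m n A B r =
     (if r > min m n then 0
      else scalar (fact (m - r) * fact (n - r) / (fact m * fact n)) *
        (\<Sum>i\<le>r. (-1) ^ i * of_nat (r choose i) *
           (partial 0 ^^ (r - i)) ((partial 1 ^^ i) A) *
           (partial 0 ^^ i) ((partial 1 ^^ (r - i)) B)))"

definition wronskian :: "'c::comm_ring_1 bform list \<Rightarrow> 'c bform" where
  "wronskian As =
     (let m = length As in
      det (mat m m (\<lambda>(i, j). (partial 0 ^^ (m - 1 - j)) ((partial 1 ^^ j) (As ! i)))))"

definition theta22 :: "quintic_ring bform" where
  "theta22 = transvectant 5 5 generic_quintic generic_quintic 4"
definition theta26 :: "quintic_ring bform" where
  "theta26 = transvectant 5 5 generic_quintic generic_quintic 2"
definition theta33 :: "quintic_ring bform" where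
  "theta33 = transvectant 2 5 theta22 generic_quintic 2"
definition theta40 :: "quintic_ring bform" where
  "theta40 = transvectant 2 2 theta22 theta22 2"
definition theta51 :: "quintic_ring bform" where
  "theta51 = transvectant 4 5 (theta22 ^ 2) generic_quintic 4"
definition theta80 :: "quintic_ring bform" where
  "theta80 = transvectant 6 6 (theta22 ^ 3) theta26 6"

definition cov_U :: "rat \<Rightarrow> quintic_ring bform" where
  "cov_U \<alpha> = theta33 * theta22 - scalar (of_rat \<alpha>) * theta40 * generic_quintic"

definition cov_V :: "rat \<Rightarrow> rat \<Rightarrow> quintic_ring bform" where
  "cov_V \<beta> \<gamma> = theta51 * theta22 ^ 2 - scalar (of_rat \<beta>) * theta40 ^ 2 * generic_quintic
     - scalar (of_rat \<gamma>) * theta80 * generic_quintic"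

definition cov_Gamma :: "rat \<times> rat \<times> rat \<Rightarrow> quintic_ring bform" where
  "cov_Gamma = (\<lambda>(\<alpha>, \<beta>, \<gamma>).
     wronskian
       [transvectant 2 5 (x1 ^ 2) generic_quintic 1,
        transvectant 2 5 (x1 * x2) generic_quintic 1,
        transvectant 2 5 (x2 ^ 2) generic_quintic 1,
        cov_U \<alpha>,
        cov_V \<beta> \<gamma>])"


section \<open>Ideals: height, grade, projective dimension\<close>

lemma module_ring: "Modules.module ((*) :: 'a::comm_ring_1 \<Rightarrow> 'a \<Rightarrow> 'a)"
  by unfold_locales (auto simp: algebra_simps)

abbreviation ideal_gen :: "'a::comm_ring_1 set \<Rightarrow> 'a set" where
  "ideal_gen \<equiv> module.span (*)"

definition prime_ideal :: "'a::comm_ring_1 set \<Rightarrow> bool" where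
  "prime_ideal P \<longleftrightarrow> module.subspace (*) P \<and> P \<noteq> UNIV \<and>
     (\<forall>x y. x * y \<in> P \<longrightarrow> x \<in> P \<or> y \<in> P)"

definition prime_height :: "'a::comm_ring_1 set \<Rightarrow> enat" where
  "prime_height P = Sup {enat n | n. \<exists>Q. (\<forall>i\<le>n. prime_ideal (Q i)) \<and>
     (\<forall>i<n. Q i \<subset> Q (Suc i)) \<and> Q n = P}"

definition ideal_height :: "'a::comm_ring_1 set \<Rightarrow> enat" where
  "ideal_height I = Inf (prime_height ` {P. prime_ideal P \<and> I \<subseteq> P})"

definition regular_sequence :: "'a::comm_ring_1 list \<Rightarrow> bool" where
  "regular_sequence xs \<longleftrightarrow> ideal_gen (set xs) \<noteq> UNIV \<and>
     (\<forall>i<length xs. \<forall>y. xs ! i * y \<in> ideal_gen (set (take i xs)) \<longrightarrow>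
        y \<in> ideal_gen (set (take i xs)))"

definition grade :: "'a::comm_ring_1 set \<Rightarrow> enat" where
  "grade I = Sup {enat (length xs) | xs. set xs \<subseteq> I \<and> regular_sequence xs}"

definition linear_on ::
    "('a \<Rightarrow> 'm \<Rightarrow> 'm::ab_group_add) \<Rightarrow> 'm set \<Rightarrow> 'm set \<Rightarrow> ('m \<Rightarrow> 'm) \<Rightarrow> bool" where
  "linear_on scl M N f \<longleftrightarrow> f ` M \<subseteq> N \<and>
     (\<forall>v\<in>M. \<forall>w\<in>M. f (v + w) = f v + f w) \<and>
     (\<forall>c. \<forall>v\<in>M. f (scl c v) = scl c (f v))"

text \<open>The free module of countable rank over \<open>'a\<close> is \<open>nat \<Rightarrow>\<^sub>0 'a\<close>; projective modules
  are its direct summands. This is every countably generated projective module up to isomorphism,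
  which over a Noetherian ring is enough to compute the projective dimension of a
  finitely generated module.\<close>

definition scale :: "'a::comm_ring_1 \<Rightarrow> (nat \<Rightarrow>\<^sub>0 'a) \<Rightarrow> (nat \<Rightarrow>\<^sub>0 'a)" where
  "scale c = Poly_Mapping.map ((*) c)"

lemma lookup_scale: "Poly_Mapping.lookup (scale c v) k = c * Poly_Mapping.lookup v k"
  by (auto simp: scale_def map.rep_eq when_def)

lemma module_scale: "Modules.module (scale :: 'a::comm_ring_1 \<Rightarrow> _)"
  by unfold_locales (auto simp: lookup_scale lookup_add algebra_simps intro!: poly_mapping_eqI)

definition projective :: "(nat \<Rightarrow>\<^sub>0 'a::comm_ring_1) set \<Rightarrow> bool" where
  "projective P \<longleftrightarrow> module.subspace scale P \<and>
     (\<exists>Q. module.subspace scale Q \<and> P \<inter> Q = {0} \<and> (\<forall>v. \<exists>p\<in>P. \<exists>q\<in>Q. v = p + q))"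

definition coset :: "'a::ab_group_add set \<Rightarrow> 'a \<Rightarrow> 'a set" where
  "coset I x = {x + y | y. y \<in> I}"

text \<open>\<open>e\<close> is a surjective homomorphism from \<open>P\<close> onto the module of cosets of \<open>I\<close>.\<close>

definition augmentation ::
    "'a::comm_ring_1 set \<Rightarrow> (nat \<Rightarrow>\<^sub>0 'a) set \<Rightarrow> ((nat \<Rightarrow>\<^sub>0 'a) \<Rightarrow> 'a set) \<Rightarrow> bool" where
  "augmentation I P e \<longleftrightarrow> e ` P = range (coset I) \<and>
     (\<forall>v\<in>P. \<forall>w\<in>P. \<forall>x\<in>e v. \<forall>y\<in>e w. x + y \<in> e (v + w)) \<and>
     (\<forall>c. \<forall>v\<in>P. \<forall>x\<in>e v. c * x \<in> e (scale c v))"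

text \<open>\<open>0 \<rightarrow> P\<^sub>n \<rightarrow> \<dots> \<rightarrow> P\<^sub>0 \<rightarrow> 'a/I \<rightarrow> 0\<close> with \<open>d i : P\<^sub>i\<^sub>+\<^sub>1 \<rightarrow> P\<^sub>i\<close>.\<close>

definition projective_resolution ::
    "'a::comm_ring_1 set \<Rightarrow> nat \<Rightarrow> (nat \<Rightarrow> (nat \<Rightarrow>\<^sub>0 'a) set) \<Rightarrow>
     (nat \<Rightarrow> (nat \<Rightarrow>\<^sub>0 'a) \<Rightarrow> (nat \<Rightarrow>\<^sub>0 'a)) \<Rightarrow> ((nat \<Rightarrow>\<^sub>0 'a) \<Rightarrow> 'a set) \<Rightarrow> bool" where
  "projective_resolution I n P d e \<longleftrightarrow>
     (\<forall>i\<le>n. projective (P i)) \<and> (\<forall>i>n. P i = {0}) \<and>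
     (\<forall>i. linear_on scale (P (Suc i)) (P i) (d i)) \<and>
     augmentation I (P 0) e \<and>
     d 0 ` P 1 = {v \<in> P 0. e v = I} \<and>
     (\<forall>i. d (Suc i) ` P (Suc (Suc i)) = {v \<in> P (Suc i). d i v = 0})"

text \<open>Projective dimension of the cyclic module \<open>'a/I\<close>.\<close>

definition proj_dim_quot :: "'a::comm_ring_1 set \<Rightarrow> enat" where
  "proj_dim_quot I = Inf {enat n | n. \<exists>P d e. projective_resolution I n P d e}"

definition perfect_ideal :: "'a::comm_ring_1 set \<Rightarrow> bool" where
  "perfect_ideal I \<longleftrightarrow> module.subspace (*) I \<and> I \<noteq> UNIV \<and> proj_dim_quot I = grade I"

definition cov_ideal :: "rat \<times> rat \<times> rat \<Rightarrow> quintic_ring set" where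
  "cov_ideal \<tau> = ideal_gen {Poly_Mapping.lookup (cov_Gamma \<tau>) m | m. True}"


section \<open>Actions of the special linear group\<close>

definition SL2 :: "complex mat set" where
  "SL2 = {g \<in> carrier_mat 2 2. det g = 1}"

text \<open>\<open>x\<^sub>j \<mapsto> g\<^sub>1\<^sub>j x\<^sub>1 + g\<^sub>2\<^sub>j x\<^sub>2\<close>\<close>

definition lin_subst :: "'c::comm_ring_1 mat \<Rightarrow> 2 \<Rightarrow> 'c bform" where
  "lin_subst g v = (let j = (if v = 0 then 0 else 1) in
     Const (g $$ (0, j)) * x1 + Const (g $$ (1, j)) * x2)"

definition act_form :: "'c::comm_ring_1 mat \<Rightarrow> 'c bform \<Rightarrow> 'c bform" where
  "act_form g = subst_poly Const (lin_subst g)"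

definition idx :: "6 \<Rightarrow> nat" where
  "idx i = (LEAST k. of_nat k = i)"

text \<open>\<open>(g \<cdot> p)(f) = p(g\<^sup>-\<^sup>1 \<cdot> f)\<close> for \<open>p\<close> in \<open>R\<close> regarded as a function on quintics \<open>f\<close>: the variable
  \<open>a\<^sub>i\<close> goes to the \<open>i\<close>-th normalized coefficient of the generic quintic acted on by \<open>g\<^sup>-\<^sup>1\<close>,
  which for \<open>g\<close> of determinant 1 is the adjugate.\<close>

definition act_coeff :: "complex mat \<Rightarrow> quintic_ring \<Rightarrow> quintic_ring" where
  "act_coeff g = subst_poly Const
     (\<lambda>i. Const (1 / of_nat (5 choose idx i)) *
        Poly_Mapping.lookup (act_form (map_mat Const (adj_mat g)) generic_quintic)
          (quintic_mon (idx i)))"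

text \<open>The diagonal action on forms with coefficients in \<open>R\<close>.\<close>

definition act_cov :: "complex mat \<Rightarrow> quintic_ring bform \<Rightarrow> quintic_ring bform" where
  "act_cov g = subst_poly (\<lambda>p. Const (act_coeff g p)) (lin_subst (map_mat Const g))"


section \<open>Equivariant graded minimal free resolutions\<close>

text \<open>A list of pairs \<open>(s, q)\<close> encodes the direct sum of the modules \<open>R(-s) \<otimes> S\<^sub>q\<close>. Its elements
  are sequences of forms, the \<open>j\<close>-th one being of order \<open>q\<close> if \<open>(s, q)\<close> is the \<open>j\<close>-th pair,
  and zero beyond the length of the list.\<close>

definition free_mod :: "(nat \<times> nat) list \<Rightarrow> (nat \<Rightarrow>\<^sub>0 quintic_ring bform) set" where
  "free_mod L = {v. \<forall>j. if j < length L then Poly_Mapping.lookup v j \<in> forms (snd (L ! j))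
                        else Poly_Mapping.lookup v j = 0}"

definition ring_deg :: "int \<Rightarrow> quintic_ring set" where
  "ring_deg t = {p. \<forall>m\<in>Poly_Mapping.keys p. int (mdeg m) = t}"

definition free_deg :: "(nat \<times> nat) list \<Rightarrow> int \<Rightarrow> (nat \<Rightarrow>\<^sub>0 quintic_ring bform) set" where
  "free_deg L t = {v \<in> free_mod L. \<forall>j<length L. \<forall>m.
     Poly_Mapping.lookup (Poly_Mapping.lookup v j) m \<in> ring_deg (t - int (fst (L ! j)))}"

definition scale_free ::
    "quintic_ring \<Rightarrow> (nat \<Rightarrow>\<^sub>0 quintic_ring bform) \<Rightarrow> (nat \<Rightarrow>\<^sub>0 quintic_ring bform)" where
  "scale_free p = Poly_Mapping.map ((*) (Const p))"

definition act_free ::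
    "complex mat \<Rightarrow> (nat \<Rightarrow>\<^sub>0 quintic_ring bform) \<Rightarrow> (nat \<Rightarrow>\<^sub>0 quintic_ring bform)" where
  "act_free g = Poly_Mapping.map (act_cov g)"

definition irrelevant_ideal :: "quintic_ring set" where
  "irrelevant_ideal = ideal_gen (range Var)"

text \<open>\<open>[L\<^sub>0, \<dots>, L\<^sub>n]\<close> are the terms of a resolution of \<open>R/I\<close>. The term \<open>L\<^sub>0\<close> is required to be \<open>R\<close>,
  whose augmentation is the projection \<open>R \<rightarrow> R/I\<close>; an element of \<open>R\<close> sits in \<open>free_mod [(0, 0)]\<close>
  as the constant term of the entry with index 0.\<close>

definition equivariant_minimal_resolution ::
    "quintic_ring set \<Rightarrow> (nat \<times> nat) list list \<Rightarrow> bool" where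
  "equivariant_minimal_resolution I Ls \<longleftrightarrow>
     Ls \<noteq> [] \<and> hd Ls = [(0, 0)] \<and>
     (let L = (\<lambda>i. if i < length Ls then Ls ! i else []);
          F = (\<lambda>i. free_mod (L i))
      in \<exists>d :: nat \<Rightarrow> (nat \<Rightarrow>\<^sub>0 quintic_ring bform) \<Rightarrow> (nat \<Rightarrow>\<^sub>0 quintic_ring bform).
        (\<forall>i. linear_on scale_free (F (Suc i)) (F i) (d i) \<and>
           (\<forall>t. d i ` free_deg (L (Suc i)) t \<subseteq> free_deg (L i) t) \<and>
           (\<forall>g\<in>SL2. \<forall>v\<in>F (Suc i). d i (act_free g v) = act_free g (d i v)) \<and>
           (\<forall>v\<in>F (Suc i). \<forall>j m.
              Poly_Mapping.lookup (Poly_Mapping.lookup (d i v) j) m \<in> irrelevant_ideal)) \<and>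
        d 0 ` F 1 = {v \<in> F 0. Poly_Mapping.lookup (Poly_Mapping.lookup v 0) 0 \<in> I} \<and>
        (\<forall>i. d (Suc i) ` F (Suc (Suc i)) = {v \<in> F (Suc i). d i v = 0}))"


section \<open>The projective space of quintics\<close>

text \<open>A point is the set of nonzero multiples of a nonzero quintic.\<close>

definition line :: "complex bform \<Rightarrow> complex bform set" where
  "line f = {Const c * f | c. c \<noteq> 0}"

definition quintic_space :: "complex bform set set" where
  "quintic_space = {line f | f. f \<in> forms 5 \<and> f \<noteq> 0}"

definition quintic_coord :: "complex bform \<Rightarrow> 6 \<Rightarrow> complex" where
  "quintic_coord f i = Poly_Mapping.lookup f (quintic_mon (idx i)) / of_nat (5 choose idx i)"

definition zero_locus :: "quintic_ring set \<Rightarrow> complex bform set set" where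
  "zero_locus I = {P \<in> quintic_space. \<forall>f\<in>P. \<forall>p\<in>I. subst_poly (\<lambda>c. c) (quintic_coord f) p = 0}"

definition SL2_orbit :: "complex bform \<Rightarrow> complex bform set set" where
  "SL2_orbit f = {line (act_form g f) | g. g \<in> SL2}"

definition locus_B :: "complex bform set set" where
  "locus_B =
     SL2_orbit (x1 ^ 5 + x2 ^ 5) \<union>
     SL2_orbit (x1 * x2 * (x1 - x2) * (x1 ^ 2 + x1 * x2 + x2 ^ 2)) \<union>
     SL2_orbit (x1 ^ 3 * x2 * (x1 + x2)) \<union>
     SL2_orbit (x1 ^ 3 * x2 ^ 2) \<union>
     SL2_orbit (x1 ^ 4 * x2) \<union>
     SL2_orbit (x1 ^ 5)"

end

theory Submission
  imports Defs "HOL-Computational_Algebra.Fundamental_Theorem_Algebra"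
begin

text \<open>In normalised coefficients \<open>\<Gamma>\<^sub>\<tau>\<close> is, up to a constant, the vector of maximal minors of a
  \<open>5 \<times> 6\<close> matrix over \<open>R\<close>, whose rows are the coefficient vectors of the five forms; this is a column
  operation on the Wronskian matrix. Two minors without common factor then give, by Cramer's rule, the
  Hilbert--Burch resolution, hence projective dimension and height two.

  On the geometric side, \<open>\<Gamma>\<^sub>\<tau>(f) = 0\<close> means that the five rows are dependent at \<open>f\<close>. Moving the quadratic
  covariant \<open>\<theta>\<^sub>2\<^sub>2\<close> to a normal form \<open>x\<^sub>1 x\<^sub>2\<close>, \<open>x\<^sub>1\<^sup>2\<close> or \<open>0\<close> shows that such an \<open>f\<close> is equivalent to an even form
  \<open>a\<^sub>0 x\<^sub>1\<^sup>5 + 10 a\<^sub>2 x\<^sub>1\<^sup>3 x\<^sub>2\<^sup>2 + 5 a\<^sub>4 x\<^sub>1 x\<^sub>2\<^sup>4\<close>. For even forms the condition reads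
  \<open>a\<^sub>4\<^sup>3 (u - v) (u + 15 v) q\<^sub>\<tau>(u, v) = 0\<close> with \<open>u = a\<^sub>0 a\<^sub>4\<close>, \<open>v = a\<^sub>2\<^sup>2\<close> and a binary quartic \<open>q\<^sub>\<tau>\<close>; the first three
  factors cut out the orbits in \<open>\<B>\<close>, and the exceptional \<open>\<tau>\<close> are those for which all roots of \<open>q\<^sub>\<tau>\<close> are
  among \<open>u = v\<close> and \<open>u = - 15 v\<close>. In particular the zero locus consists of finitely many orbits of a group
  of dimension four, so some line misses it; this yields the two coprime minors.\<close>

section \<open>Homomorphisms of polynomial rings\<close>

text \<open>Dimension theory is reduced to counting: more than n polynomials in n variables satisfy
  an algebraic relation, because they have more monomials of bounded exponents than the space
  containing these has dimensions. This enters twice. The coefficients of a form in a fixed orbit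
  are polynomials in four matrix entries, so the image of the orbit under projection from
  (1,0,0,1,0,0) to five coordinates lies on a hypersurface. A direction off finitely many such
  hypersurfaces gives the line that misses the zero locus. A regular pair on this line lifts to R by
  induction on the degree, since the minors are homogeneous. For the upper bound on the height,
  quintics with a triple root lie in the zero locus, because the last of the five rows vanishes on
  them up to equivalence. Four coordinates stay independent modulo the prime ideal of this family,
  each step down a chain of primes adds an independent element, and six variables leave room for two
  steps. Equivariance of the Wronskian is checked on shears only, where all matrices involved are
  triangular.\<close>

lemma keys_sum_additive:
  fixes \<phi> :: "'k \<Rightarrow> 'c::comm_monoid_add \<Rightarrow> 'd::comm_monoid_add"
  assumes "\<And>m. \<phi> m 0 = 0" "\<And>m a b. \<phi> m (a + b) = \<phi> m a + \<phi> m b"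
  shows "(\<Sum>m\<in>Poly_Mapping.keys (p + q). \<phi> m (Poly_Mapping.lookup (p + q) m)) =
    (\<Sum>m\<in>Poly_Mapping.keys p. \<phi> m (Poly_Mapping.lookup p m)) +
    (\<Sum>m\<in>Poly_Mapping.keys q. \<phi> m (Poly_Mapping.lookup q m))"
proof -
  let ?S = "Poly_Mapping.keys p \<union> Poly_Mapping.keys q"
  have ext: "(\<Sum>m\<in>Poly_Mapping.keys r. \<phi> m (Poly_Mapping.lookup r m)) =
      (\<Sum>m\<in>?S. \<phi> m (Poly_Mapping.lookup r m))" if "Poly_Mapping.keys r \<subseteq> ?S" for r
    using that by (intro sum.mono_neutral_left) (auto simp: in_keys_iff assms(1))
  show ?thesis
    unfolding ext[OF keys_add] ext[OF Un_upper1] ext[OF Un_upper2]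
    by (simp add: lookup_add assms(2) sum.distrib)
qed

lemma mpol_sum_single:
  "p = (\<Sum>m\<in>Poly_Mapping.keys p. Poly_Mapping.single m (Poly_Mapping.lookup p m))"
  by (rule poly_mapping_eqI) (auto simp: lookup_sum lookup_single when_def in_keys_iff)

lemma Const_0 [simp]: "Const 0 = 0" and Const_1 [simp]: "Const 1 = 1"
  by (simp_all add: Const_def)

lemma Const_add: "Const (a + b) = Const a + Const b"
  by (simp add: Const_def single_add)

lemma Const_mult: "Const (a * b) = Const a * (Const b :: ('v, 'c::comm_ring_1) mpol)"
  by (simp add: Const_def mult_single)

lemma Const_hom: "comm_ring_hom (Const :: 'c::comm_ring_1 \<Rightarrow> ('v, 'c) mpol)"
  by unfold_locales (simp_all add: Const_add Const_mult)

interpretation Const: comm_ring_hom "Const :: 'c::comm_ring_1 \<Rightarrow> ('v, 'c) mpol"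
  by (rule Const_hom)

lemma Const_inject [simp]: "(Const a :: ('v, 'c::comm_ring_1) mpol) = Const b \<longleftrightarrow> a = b"
  unfolding Const_def by (rule inj_eq[OF inj_single])

lemma lookup_Const_mult [simp]:
  "Poly_Mapping.lookup (Const c * p) m = c * Poly_Mapping.lookup (p :: ('v, 'c::comm_ring_1) mpol) m"
  unfolding Const_def mult_map_scale_conv_mult[symmetric] by (simp add: map.rep_eq when_def)

lemma Var_power: "Var v ^ k = Poly_Mapping.single (Poly_Mapping.single v k) 1"
  by (induction k) (simp_all add: Var_def mult_single single_add[symmetric])

lemma single_conv:
  "Poly_Mapping.single m c =
    Const c * (\<Prod>v\<in>Poly_Mapping.keys m. (Var v :: ('v, 'c::comm_ring_1) mpol) ^ Poly_Mapping.lookup m v)"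
proof -
  have *: "Poly_Mapping.single (sum f A) (1::'c) = (\<Prod>v\<in>A. Poly_Mapping.single (f v) 1)"
    if "finite A" for f :: "'v \<Rightarrow> ('v \<Rightarrow>\<^sub>0 nat)" and A
    using that
  proof (induction A rule: finite_induct)
    case (insert x F)
    have "Poly_Mapping.single (f x + sum f F) (1::'c) =
        Poly_Mapping.single (f x) 1 * Poly_Mapping.single (sum f F) 1"
      by (simp add: mult_single)
    then show ?case using insert by simp
  qed simp
  have "Poly_Mapping.single m (1::'c) =
      (\<Prod>v\<in>Poly_Mapping.keys m. Poly_Mapping.single (Poly_Mapping.single v (Poly_Mapping.lookup m v)) 1)"
    using *[of "Poly_Mapping.keys m" "\<lambda>v. Poly_Mapping.single v (Poly_Mapping.lookup m v)"]
    by (simp add: mpol_sum_single[symmetric])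
  then show ?thesis
    by (simp add: Var_power[symmetric]) (metis Const_def add_0 mult.right_neutral mult_single)
qed

lemma mpol_induct [case_names Const Var add mult]:
  fixes p :: "('v, 'c::comm_ring_1) mpol"
  assumes "\<And>c. P (Const c)" "\<And>v. P (Var v)" "\<And>p q. P p \<Longrightarrow> P q \<Longrightarrow> P (p + q)"
    "\<And>p q. P p \<Longrightarrow> P q \<Longrightarrow> P (p * q)"
  shows "P p"
proof -
  have P1: "P 1" using assms(1)[of 1] by simp
  have pow: "P (Var v ^ k)" for v k
    by (induction k) (auto intro: P1 assms)
  have prd: "P (\<Prod>v\<in>A. Var v ^ f v)" if "finite A" for A and f :: "'v \<Rightarrow> nat"
    using that by (induction A rule: finite_induct) (auto intro: P1 assms pow)
  have sm: "P (\<Sum>m\<in>A. Poly_Mapping.single m (g m))" if "finite A" for A and g :: "('v \<Rightarrow>\<^sub>0 nat) \<Rightarrow> 'c"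
    using that
  proof (induction A rule: finite_induct)
    case empty
    then show ?case using assms(1)[of 0] by simp
  next
    case (insert x F)
    then show ?case by (auto simp: single_conv[of x] intro!: assms(1,3,4) prd)
  qed
  show ?thesis
    by (subst mpol_sum_single) (rule sm, simp)
qed

lemma comm_ring_homI:
  assumes "\<And>x y. \<phi> (x + y) = \<phi> x + \<phi> y" "\<And>x y. \<phi> (x * y) = \<phi> x * \<phi> y" "\<phi> 1 = 1"
  shows "comm_ring_hom (\<phi> :: 'a::comm_ring_1 \<Rightarrow> 'b::comm_ring_1)"
proof -
  have "\<phi> 0 = 0" using assms(1)[of 0 0] by simp
  then show ?thesis using assms by unfold_locales auto
qed

lemma hom_comp:
  assumes "comm_ring_hom f" "comm_ring_hom g" shows "comm_ring_hom (\<lambda>x. f (g x))"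
proof -
  interpret f: comm_ring_hom f by fact
  interpret g: comm_ring_hom g by fact
  show ?thesis by (rule comm_ring_homI) (simp_all add: f.hom_add g.hom_add f.hom_mult g.hom_mult)
qed

lemma id_hom: "comm_ring_hom (\<lambda>x. x)"
  by (rule comm_ring_homI) simp_all

text \<open>Polynomials are generated by constants and variables. Most identities below between
  substitutions, evaluations, slices and group actions are instances of this uniqueness, which
  avoids work with finite supports.\<close>

lemma hom_eqI:
  fixes \<phi> \<psi> :: "('v, 'c::comm_ring_1) mpol \<Rightarrow> 'd::comm_ring_1"
  assumes "comm_ring_hom \<phi>" "comm_ring_hom \<psi>"
    "\<And>c. \<phi> (Const c) = \<psi> (Const c)" "\<And>v. \<phi> (Var v) = \<psi> (Var v)"
  shows "\<phi> p = \<psi> p"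
proof -
  interpret a: comm_ring_hom \<phi> by fact
  interpret b: comm_ring_hom \<psi> by fact
  show ?thesis
    by (induction p rule: mpol_induct) (simp_all add: assms a.hom_add a.hom_mult b.hom_add b.hom_mult)
qed

definition mon_val :: "('v \<Rightarrow> 'd::comm_ring_1) \<Rightarrow> ('v \<Rightarrow>\<^sub>0 nat) \<Rightarrow> 'd" where
  "mon_val f m = (\<Prod>v\<in>Poly_Mapping.keys m. f v ^ Poly_Mapping.lookup m v)"

lemma mon_val_0 [simp]: "mon_val f 0 = 1"
  by (simp add: mon_val_def)

lemma mon_val_superset:
  assumes "Poly_Mapping.keys m \<subseteq> S" "finite S"
  shows "mon_val f m = (\<Prod>v\<in>S. f v ^ Poly_Mapping.lookup m v)"
  unfolding mon_val_def using assms by (intro prod.mono_neutral_left) (auto simp: in_keys_iff)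

lemma mon_val_add: "mon_val f (m + m') = mon_val f m * mon_val f m'"
proof -
  let ?S = "Poly_Mapping.keys m \<union> Poly_Mapping.keys m'"
  have "mon_val f k = (\<Prod>v\<in>?S. f v ^ Poly_Mapping.lookup k v)"
    if "Poly_Mapping.keys k \<subseteq> ?S" for k
    using that by (intro mon_val_superset) auto
  then show ?thesis
    using keys_add[of m m'] by (simp add: lookup_add power_add prod.distrib)
qed

lemma subst_poly_alt: "subst_poly h f p =
    (\<Sum>m\<in>Poly_Mapping.keys p. h (Poly_Mapping.lookup p m) * mon_val f m)"
  by (simp add: subst_poly_def mon_val_def)

context
  fixes h :: "'c::comm_ring_1 \<Rightarrow> 'd::comm_ring_1"
  assumes h: "comm_ring_hom h"
begin

interpretation h: comm_ring_hom h by (rule h)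

lemma subst_poly_add: "subst_poly h f (p + q) = subst_poly h f p + subst_poly h f q"
  unfolding subst_poly_alt
  by (rule keys_sum_additive) (simp_all add: h.hom_add ring_distribs)

lemma subst_poly_zero [simp]: "subst_poly h f 0 = 0"
  by (simp add: subst_poly_def)

lemma subst_poly_sum: "subst_poly h f (sum g A) = (\<Sum>i\<in>A. subst_poly h f (g i))"
  by (induction A rule: infinite_finite_induct) (simp_all add: subst_poly_add)

lemma subst_poly_single: "subst_poly h f (Poly_Mapping.single m c) = h c * mon_val f m"
  by (cases "c = 0") (simp_all add: subst_poly_alt)

lemma subst_poly_mult: "subst_poly h f (p * q) = subst_poly h f p * subst_poly h f q"
proof -
  let ?l = Poly_Mapping.lookup and ?k = Poly_Mapping.keys
  have "p * q = (\<Sum>m\<in>?k p. \<Sum>n\<in>?k q. Poly_Mapping.single (m + n) (?l p m * ?l q n))"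
    by (subst mpol_sum_single[of p], subst mpol_sum_single[of q]) (simp add: sum_product mult_single)
  then show ?thesis
    by (simp add: subst_poly_sum subst_poly_single mon_val_add h.hom_mult subst_poly_alt[of h f p]
        subst_poly_alt[of h f q] sum_product mult_ac)
qed

lemma subst_poly_Const [simp]: "subst_poly h f (Const c) = h c"
  by (simp add: Const_def subst_poly_single)

lemma subst_poly_Var [simp]: "subst_poly h f (Var v) = f v"
  by (simp add: Var_def subst_poly_single mon_val_def)

lemma subst_poly_hom: "comm_ring_hom (subst_poly h f)"
  by (rule comm_ring_homI) (use subst_poly_Const[of f 1] in \<open>simp_all add: subst_poly_add subst_poly_mult\<close>)

end

section \<open>Partial derivatives\<close>

lemma partial_single:
  "partial v (Poly_Mapping.single m c) = Poly_Mapping.single (m - Poly_Mapping.single v 1)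
    (of_nat (Poly_Mapping.lookup m v) * c)"
  by (cases "c = 0") (simp_all add: partial_def)

lemma partial_add: "partial v (p + q) = partial v p + partial v q"
  unfolding partial_def
  by (rule keys_sum_additive) (simp_all add: ring_distribs single_add)

lemma partial_0 [simp]: "partial v 0 = 0"
  by (simp add: partial_def)

lemma partial_sum: "partial v (sum g A) = (\<Sum>i\<in>A. partial v (g i))"
  by (induction A rule: infinite_finite_induct) (simp_all add: partial_add)

lemma partial_mult: "partial v (p * q) = partial v p * q + p * partial v (q :: ('v, 'c::comm_ring_1) mpol)"
proof -
  let ?l = Poly_Mapping.lookup and ?k = Poly_Mapping.keys and ?s = Poly_Mapping.single
  \<comment> \<open>Subtraction of exponents is truncated, so it may be moved past \<open>n\<close>
    only if \<open>v\<close> occurs in \<open>m\<close>. Otherwise the factor \<open>?l m v\<close>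
    is zero and both sides vanish.\<close>
  have shift: "?s (m - ?s v 1 + n) (of_nat (?l m v) * c) = ?s (m + n - ?s v 1) (of_nat (?l m v) * c)"
    for m n and c :: 'c
  proof (cases "?l m v = 0")
    case False
    then have "m - ?s v 1 + n = m + n - ?s v 1"
      by (intro poly_mapping_eqI) (auto simp: lookup_add lookup_minus lookup_single when_def)
    then show ?thesis by simp
  qed simp
  have single: "partial v (?s m c * ?s n d) = partial v (?s m c) * ?s n d + ?s m c * partial v (?s n d)"
    for m n and c d :: 'c
    using shift[of m n "c * d"] shift[of n m "c * d"]
    by (simp add: mult_single partial_single lookup_add ring_distribs single_add mult_ac add_ac)
  have "p * q = (\<Sum>m\<in>?k p. \<Sum>n\<in>?k q. ?s m (?l p m) * ?s n (?l q n))"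
    by (subst mpol_sum_single[of p], subst mpol_sum_single[of q]) (simp add: sum_product)
  then have "partial v (p * q) = (\<Sum>m\<in>?k p. \<Sum>n\<in>?k q. partial v (?s m (?l p m)) * ?s n (?l q n)) +
      (\<Sum>m\<in>?k p. \<Sum>n\<in>?k q. ?s m (?l p m) * partial v (?s n (?l q n)))"
    by (simp add: partial_sum single sum.distrib)
  also have "\<dots> = partial v (\<Sum>m\<in>?k p. ?s m (?l p m)) * (\<Sum>n\<in>?k q. ?s n (?l q n)) +
      (\<Sum>m\<in>?k p. ?s m (?l p m)) * partial v (\<Sum>n\<in>?k q. ?s n (?l q n))"
    by (simp add: partial_sum sum_product)
  finally show ?thesis
    by (simp flip: mpol_sum_single)
qed

lemma partial_Const [simp]: "partial v (Const c) = 0"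
  by (simp add: Const_def partial_single)

lemma partial_1 [simp]: "partial v 1 = 0"
  using partial_Const[of v 1] by simp

lemma partial_Var: "partial v (Var w) = (if v = w then 1 else 0)"
  by (simp add: Var_def partial_single lookup_single when_def)

lemma partial_Const_mult: "partial v (Const c * p) = Const c * partial v p"
  by (simp add: partial_mult)

lemma partial_commute: "partial v (partial w p) = partial w (partial v p)"
  by (induction p rule: mpol_induct) (simp_all add: partial_add partial_mult partial_Var)

section \<open>Binary forms in normalised coefficients\<close>

definition pform :: "nat \<Rightarrow> (nat \<Rightarrow> 'c::comm_ring_1) \<Rightarrow> 'c bform" where
  "pform n p = (\<Sum>i\<le>n. Const (p i) * x1 ^ (n - i) * x2 ^ i)"

text \<open>Coefficients divided by binomials, the classical normalisation. With it derivatives only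
  truncate or shift the coefficient sequence, and transvectants and the Wronskian matrix become free
  of combinatorial factors.\<close>

definition nform :: "nat \<Rightarrow> (nat \<Rightarrow> 'c::comm_ring_1) \<Rightarrow> 'c bform" where
  "nform n f = pform n (\<lambda>i. of_nat (n choose i) * f i)"

definition bmon :: "nat \<Rightarrow> nat \<Rightarrow> (2 \<Rightarrow>\<^sub>0 nat)" where
  "bmon n i = Poly_Mapping.single 0 (n - i) + Poly_Mapping.single 1 i"

lemma quintic_mon_bmon: "quintic_mon = bmon 5"
  by (simp add: fun_eq_iff quintic_mon_def bmon_def)

lemma zero_neq_one_2 [simp]: "(0::2) \<noteq> 1" "(1::2) \<noteq> 0"
  by simp_all

lemma UNIV_2: "(UNIV :: 2 set) = {0, 1}"
proof -
  have "card {0, 1::2} = card (UNIV :: 2 set)" by simp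
  then show ?thesis by (metis card_subset_eq finite subset_UNIV)
qed

lemma two_cases: "(v::2) = 0 \<or> v = 1"
  using UNIV_2 by auto

lemma pform_single: "pform n p = (\<Sum>i\<le>n. Poly_Mapping.single (bmon n i) (p i))"
  by (simp add: pform_def Var_power Const_def mult_single bmon_def)

lemma bmon_eq_iff: "i \<le> n \<Longrightarrow> j \<le> n \<Longrightarrow> bmon n i = bmon n j \<longleftrightarrow> i = j"
  by (metis bmon_def lookup_add lookup_single_eq lookup_single_not_eq add_0 zero_neq_one_2)

lemma lookup_pform:
  assumes "i \<le> n" shows "Poly_Mapping.lookup (pform n p) (bmon n i) = p i"
proof -
  have "Poly_Mapping.lookup (pform n p) (bmon n i) = (\<Sum>j\<le>n. if j = i then p i else 0)"
    unfolding pform_single lookup_sum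
    by (rule sum.cong) (auto simp: lookup_single when_def bmon_eq_iff assms)
  then show ?thesis using assms by simp
qed

lemma mdeg_bmon: "i \<le> n \<Longrightarrow> mdeg (bmon n i) = n"
proof -
  have "mdeg m = Poly_Mapping.lookup m 0 + Poly_Mapping.lookup m 1" for m :: "2 \<Rightarrow>\<^sub>0 nat"
  proof -
    have "mdeg m = (\<Sum>v\<in>UNIV. Poly_Mapping.lookup m v)"
      unfolding mdeg_def by (rule sum.mono_neutral_left) (auto simp: in_keys_iff)
    then show ?thesis by (simp add: UNIV_2)
  qed
  then show "i \<le> n \<Longrightarrow> mdeg (bmon n i) = n"
    by (simp add: bmon_def lookup_add lookup_single)
qed

lemma mdeg_2: "mdeg (m :: 2 \<Rightarrow>\<^sub>0 nat) = Poly_Mapping.lookup m 0 + Poly_Mapping.lookup m 1"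
proof -
  have "mdeg m = (\<Sum>v\<in>UNIV. Poly_Mapping.lookup m v)"
    unfolding mdeg_def by (rule sum.mono_neutral_left) (auto simp: in_keys_iff)
  then show ?thesis by (simp add: UNIV_2)
qed

lemma mdeg_eq_bmon:
  assumes "mdeg m = n" shows "m = bmon n (Poly_Mapping.lookup m 1)" "Poly_Mapping.lookup m 1 \<le> n"
proof -
  show "Poly_Mapping.lookup m 1 \<le> n" using assms by (simp add: mdeg_2)
  show "m = bmon n (Poly_Mapping.lookup m 1)"
  proof (rule poly_mapping_eqI)
    fix v :: 2
    show "Poly_Mapping.lookup m v = Poly_Mapping.lookup (bmon n (Poly_Mapping.lookup m 1)) v"
      using two_cases[of v] assms
      by (auto simp: bmon_def lookup_add lookup_single mdeg_2 when_def)
  qed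
qed

lemma keys_pform: "Poly_Mapping.keys (pform n p) \<subseteq> bmon n ` {..n}"
proof -
  have "Poly_Mapping.keys (pform n p) \<subseteq> (\<Union>i\<le>n. Poly_Mapping.keys (Poly_Mapping.single (bmon n i) (p i)))"
    unfolding pform_single by (rule Poly_Mapping.keys_sum)
  then show ?thesis by (auto split: if_splits)
qed

lemma pform_in_forms [simp]: "pform n p \<in> forms n"
  using keys_pform[of n p] by (auto simp: forms_def mdeg_bmon)

lemma nform_in_forms [simp]: "nform n p \<in> forms n"
  by (simp add: nform_def)

lemma forms_pform:
  assumes "A \<in> forms n"
  shows "A = pform n (\<lambda>i. Poly_Mapping.lookup A (bmon n i))" (is "_ = ?B")
proof (rule poly_mapping_eqI)
  fix m
  show "Poly_Mapping.lookup A m = Poly_Mapping.lookup ?B m"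
  proof (cases "mdeg m = n")
    case True
    then show ?thesis using mdeg_eq_bmon[OF True] lookup_pform by metis
  next
    case False
    then have "m \<notin> Poly_Mapping.keys A" "m \<notin> Poly_Mapping.keys ?B"
      using assms pform_in_forms[of n] by (auto simp: forms_def)
    then show ?thesis by (simp add: in_keys_iff)
  qed
qed

lemma pform_cong: "(\<And>i. i \<le> n \<Longrightarrow> p i = q i) \<Longrightarrow> pform n p = pform n q"
  by (simp add: pform_def)

lemma nform_cong: "(\<And>i. i \<le> n \<Longrightarrow> p i = q i) \<Longrightarrow> nform n p = nform n q"
  unfolding nform_def by (rule pform_cong) simp

lemma pform_add: "pform n (\<lambda>i. p i + q i) = pform n p + pform n q"
  by (simp add: pform_def Const_add ring_distribs sum.distrib)

lemma pform_Const_mult: "pform n (\<lambda>i. c * p i) = Const c * pform n p"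
  by (simp add: pform_def Const_mult sum_distrib_left mult_ac)

lemma nform_add: "nform n (\<lambda>i. p i + q i) = nform n p + nform n q"
  by (simp add: nform_def pform_add[symmetric] ring_distribs)

lemma nform_Const_mult: "nform n (\<lambda>i. c * p i) = Const c * nform n p"
  by (simp add: nform_def pform_Const_mult[symmetric] mult_ac)

lemma nform_diff: "nform n (\<lambda>i. p i - q i) = nform n p - nform n q"
  using nform_add[of n p "\<lambda>i. - 1 * q i"] nform_Const_mult[of n "-1" q] by (simp add: Const.hom_uminus)

lemma pform_inject: "pform n p = pform n q \<longleftrightarrow> (\<forall>i\<le>n. p i = q i)"
  by (metis lookup_pform pform_cong)

lemma partial_power: "partial v (p ^ k) = of_nat k * p ^ (k - 1) * partial v (p :: ('v, 'c::comm_ring_1) mpol)"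
proof (induction k)
  case (Suc k)
  then show ?case by (cases k) (simp_all add: partial_mult algebra_simps)
qed simp

lemma partial0_term: "partial 0 (x1 ^ a * x2 ^ b :: 'c::comm_ring_1 bform) = of_nat a * x1 ^ (a - 1) * x2 ^ b"
  and partial1_term: "partial 1 (x1 ^ a * x2 ^ b :: 'c::comm_ring_1 bform) = of_nat b * x1 ^ a * x2 ^ (b - 1)"
  by (simp_all add: partial_mult partial_power partial_Var mult_ac)

lemma partial0_pform:
  "partial 0 (pform (Suc n) p) = pform n (\<lambda>i. of_nat (Suc n - i) * p i)"
proof -
  have "Const (p i) * (of_nat (Suc n - i) * x1 ^ (Suc n - i - 1) * x2 ^ i) =
      Const (of_nat (Suc n - i) * p i) * x1 ^ (n - i) * x2 ^ i" if "i \<le> n" for i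
    using that by (simp only: Const_mult Const.hom_of_nat Suc_diff_le diff_Suc_1 mult_ac)
  then show ?thesis
    unfolding pform_def partial_sum mult.assoc partial_Const_mult partial0_term
    unfolding sum.atMost_Suc
    by (simp add: mult.assoc)
qed

lemma partial1_pform:
  "partial 1 (pform (Suc n) p) = pform n (\<lambda>i. of_nat (Suc i) * p (Suc i))"
proof -
  have "Const (p (Suc i)) * (of_nat (Suc i) * x1 ^ (Suc n - Suc i) * x2 ^ (Suc i - 1)) =
      Const (of_nat (Suc i) * p (Suc i)) * x1 ^ (n - i) * x2 ^ i" for i
    by (simp only: Const_mult Const.hom_of_nat diff_Suc_Suc diff_Suc_1 mult_ac)
  then show ?thesis
    unfolding pform_def partial_sum mult.assoc partial_Const_mult partial1_term
    unfolding sum.atMost_Suc_shift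
    by (simp add: mult.assoc)
qed

text \<open>The factor n - i from differentiation is absorbed by the binomial coefficient, so
  differentiating in \<open>x1\<close> truncates the sequence of normalised coefficients;
  differentiating in \<open>x2\<close> shifts it as well.\<close>

lemma partial0_nform: "partial 0 (nform (Suc n) f) = of_nat (Suc n) * nform n f"
proof -
  have "(Suc n - i) * (Suc n choose i) = Suc n * (n choose i)" if "i \<le> n" for i
    using binomial_absorb_comp[of "Suc n" i] by simp
  then have *: "of_nat (Suc n - i) * (of_nat (Suc n choose i) * f i) = of_nat (Suc n) * (of_nat (n choose i) * f i)"
    if "i \<le> n" for i
    by (metis (no_types, lifting) mult.assoc of_nat_mult that)
  show ?thesis
    unfolding nform_def partial0_pform
    using pform_cong[of n _ "\<lambda>i. of_nat (Suc n) * (of_nat (n choose i) * f i)", OF *]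
    by (simp only: pform_Const_mult Const.hom_of_nat)
qed

lemma partial1_nform: "partial 1 (nform (Suc n) f) = of_nat (Suc n) * nform n (\<lambda>i. f (Suc i))"
proof -
  have *: "of_nat (Suc i) * (of_nat (Suc n choose Suc i) * f (Suc i)) = of_nat (Suc n) * (of_nat (n choose i) * f (Suc i))" for i
    using Suc_times_binomial[of i n] by (metis (no_types, lifting) mult.assoc of_nat_mult)
  show ?thesis
    unfolding nform_def partial1_pform
    using pform_cong[of n _ "\<lambda>i. of_nat (Suc n) * (of_nat (n choose i) * f (Suc i))", OF *]
    by (simp only: pform_Const_mult Const.hom_of_nat)
qed

section \<open>Transvectants through Cayley's Omega process\<close>

fun omega :: "nat \<Rightarrow> 'c::comm_ring_1 bform \<Rightarrow> 'c bform \<Rightarrow> 'c bform" where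
  "omega 0 A B = A * B"
| "omega (Suc r) A B = omega r (partial 0 A) (partial 1 B) - omega r (partial 1 A) (partial 0 B)"

lemma partial_funpow_swap: "(partial v ^^ k) (partial w A) = partial w ((partial v ^^ k) A)"
  by (induction k) (simp_all add: partial_commute)

text \<open>Pascal's rule. The recursive description is the one suited to equivariance, as each
  recursion step contributes one determinant factor; the sum is the one that occurs in the
  definition of transvectants.\<close>

lemma omega_sum:
  "omega r A B = (\<Sum>i\<le>r. (-1) ^ i * of_nat (r choose i) *
     (partial 0 ^^ (r - i)) ((partial 1 ^^ i) A) * (partial 0 ^^ i) ((partial 1 ^^ (r - i)) B))"
proof (induction r arbitrary: A B)
  case (Suc r)
  define t where "t i = (partial 0 ^^ (Suc r - i)) ((partial 1 ^^ i) A) *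
     (partial 0 ^^ i) ((partial 1 ^^ (Suc r - i)) B)" for i
  have "omega r (partial 0 A) (partial 1 B) = (\<Sum>i\<le>r. (-1) ^ i * of_nat (r choose i) * t i)"
    unfolding Suc.IH
    by (rule sum.cong) (auto simp: t_def Suc_diff_le funpow_swap1[symmetric] partial_funpow_swap mult_ac)
  moreover have "omega r (partial 1 A) (partial 0 B) = (\<Sum>i\<le>r. (-1) ^ i * of_nat (r choose i) * t (Suc i))"
    unfolding Suc.IH
    by (rule sum.cong) (auto simp: t_def funpow_swap1[symmetric] partial_funpow_swap mult_ac)
  moreover have "(\<Sum>i\<le>Suc r. (-1) ^ i * of_nat (Suc r choose i) * t i) =
      t 0 + (\<Sum>i\<le>r. (-1) ^ Suc i * of_nat (r choose i) * t (Suc i)) +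
      (\<Sum>i\<le>r. (-1) ^ Suc i * of_nat (r choose Suc i) * t (Suc i))"
    by (subst sum.atMost_Suc_shift) (simp add: ring_distribs sum.distrib sum_subtractf sum_negf)
  moreover have "(\<Sum>i\<le>r. (-1) ^ i * of_nat (r choose i) * t i) =
      t 0 + (\<Sum>i\<le>r. (-1) ^ Suc i * of_nat (r choose Suc i) * t (Suc i))"
  proof -
    have "(\<Sum>i\<le>r. (-1) ^ i * of_nat (r choose i) * t i) = (\<Sum>i\<le>Suc r. (-1) ^ i * of_nat (r choose i) * t i)"
      by (simp add: binomial_eq_0)
    also have "\<dots> = t 0 + (\<Sum>i\<le>r. (-1) ^ Suc i * of_nat (r choose Suc i) * t (Suc i))"
      by (subst sum.atMost_Suc_shift) (simp add: binomial_eq_0)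
    finally show ?thesis .
  qed
  ultimately have "omega (Suc r) A B = (\<Sum>i\<le>Suc r. (-1) ^ i * of_nat (Suc r choose i) * t i)"
    by (simp add: sum_negf)
  then show ?case by (simp only: t_def mult.assoc)
qed simp

lemma transvectant_omega:
  "r \<le> min m n \<Longrightarrow> transvectant m n A B r = scalar (fact (m - r) * fact (n - r) / (fact m * fact n)) * omega r A B"
  unfolding transvectant_def omega_sum by (subst if_not_P) auto

lemma scalar_mult: "scalar (a * b) = scalar a * scalar b"
  by (simp add: scalar_def Const_mult)

lemma scalar_1 [simp]: "scalar 1 = 1"
  by (simp add: scalar_def)

lemma scalar_of_nat: "scalar (of_nat k) = of_nat k"
  by (simp add: scalar_def Const.hom_of_nat)

lemma partial_scalar_mult: "partial v (scalar c * A) = scalar c * partial v A"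
  by (simp add: scalar_def partial_Const_mult)

lemma partial_funpow_scalar: "(partial v ^^ k) (scalar c * A) = scalar c * (partial v ^^ k) A"
  by (induction k) (simp_all add: partial_scalar_mult)

lemma partial0_funpow_nform:
  "(partial 0 ^^ q) (nform (n + q) f) = scalar (fact (n + q) / fact n) * (nform n f :: quintic_ring bform)"
proof (induction q arbitrary: n)
  case (Suc q)
  have "(partial 0 ^^ Suc q) (nform (n + Suc q) f) = partial 0 ((partial 0 ^^ q) (nform (Suc n + q) f))"
    by simp
  also have "\<dots> = scalar (fact (Suc n + q) / fact (Suc n)) * (scalar (of_nat (Suc n)) * nform n f)"
    unfolding Suc.IH partial_scalar_mult partial0_nform scalar_of_nat ..
  also have "\<dots> = scalar (fact (Suc n + q) / fact (Suc n) * of_nat (Suc n)) * nform n f"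
    by (simp only: scalar_mult mult.assoc)
  also have "fact (Suc n + q) / fact (Suc n) * of_nat (Suc n) = (fact (n + Suc q) / fact n :: complex)"
    using of_nat_neq_0[of n, where 'a=complex] by (simp del: of_nat_Suc add: fact_Suc[of n])
  finally show ?case .
qed simp

lemma partial1_funpow_nform:
  "(partial 1 ^^ q) (nform (n + q) f) =
    scalar (fact (n + q) / fact n) * (nform n (\<lambda>k. f (k + q)) :: quintic_ring bform)"
proof (induction q arbitrary: n)
  case (Suc q)
  have "(partial 1 ^^ Suc q) (nform (n + Suc q) f) = partial 1 ((partial 1 ^^ q) (nform (Suc n + q) f))"
    by simp
  also have "\<dots> = scalar (fact (Suc n + q) / fact (Suc n)) * (scalar (of_nat (Suc n)) * nform n (\<lambda>k. f (Suc k + q)))"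
    unfolding Suc.IH partial_scalar_mult partial1_nform scalar_of_nat ..
  also have "\<dots> = scalar (fact (Suc n + q) / fact (Suc n) * of_nat (Suc n)) * nform n (\<lambda>k. f (k + Suc q))"
    by (simp only: scalar_mult mult.assoc add_Suc add_Suc_right)
  also have "fact (Suc n + q) / fact (Suc n) * of_nat (Suc n) = (fact (n + Suc q) / fact n :: complex)"
    using of_nat_neq_0[of n, where 'a=complex] by (simp del: of_nat_Suc add: fact_Suc[of n])
  finally show ?case .
qed simp

lemma partial_funpow_nform:
  assumes "p + q \<le> m"
  shows "(partial 0 ^^ p) ((partial 1 ^^ q) (nform m f)) =
    scalar (fact m / fact (m - p - q)) * (nform (m - p - q) (\<lambda>k. f (k + q)) :: quintic_ring bform)"
proof -
  define n where "n = m - p - q"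
  have m: "m = n + p + q" using assms by (simp add: n_def)
  have "fact m / fact (n + p) * (fact (n + p) / fact n) = (fact m / fact n :: complex)"
    by simp
  then show ?thesis
    unfolding n_def[symmetric] unfolding m partial1_funpow_nform partial_funpow_scalar partial0_funpow_nform
    by (metis (no_types, lifting) m mult.assoc scalar_mult)
qed

text \<open>The factorial prefactor of a transvectant is exactly the inverse of what the derivatives
  of two forms in normalised coefficients produce, so only the binomials of the alternating sum
  remain.\<close>

lemma transvectant_nform:
  assumes r: "r \<le> m" "r \<le> n"
  shows "transvectant m n (nform m f) (nform n g) r =
    (\<Sum>i\<le>r. (-1) ^ i * of_nat (r choose i) * nform (m - r) (\<lambda>k. f (k + i)) *
      nform (n - r) (\<lambda>k. g (k + (r - i))))"
proof -
  define C :: complex where "C = fact (m - r) * fact (n - r) / (fact m * fact n)"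
  have C: "scalar C * (scalar (fact m / fact (m - r)) * scalar (fact n / fact (n - r))) = 1"
    unfolding scalar_mult[symmetric] by (simp add: C_def)
  have "transvectant m n (nform m f) (nform n g) r = scalar C * omega r (nform m f) (nform n g)"
    using r by (simp add: transvectant_omega C_def)
  also have "\<dots> = (\<Sum>i\<le>r. scalar C * ((-1) ^ i * of_nat (r choose i) *
      (scalar (fact m / fact (m - r)) * nform (m - r) (\<lambda>k. f (k + i))) *
      (scalar (fact n / fact (n - r)) * nform (n - r) (\<lambda>k. g (k + (r - i))))))"
    unfolding omega_sum sum_distrib_left
  proof (rule sum.cong)
    fix i assume "i \<in> {..r}"
    then have "m - (r - i) - i = m - r" "n - i - (r - i) = n - r" "r - i + i \<le> m" "i + (r - i) \<le> n"
      using r by auto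
    then show "scalar C * ((- 1) ^ i * of_nat (r choose i) * (partial 0 ^^ (r - i)) ((partial 1 ^^ i) (nform m f)) *
        (partial 0 ^^ i) ((partial 1 ^^ (r - i)) (nform n g))) =
      scalar C * ((-1) ^ i * of_nat (r choose i) *
      (scalar (fact m / fact (m - r)) * nform (m - r) (\<lambda>k. f (k + i))) *
      (scalar (fact n / fact (n - r)) * nform (n - r) (\<lambda>k. g (k + (r - i)))))"
      by (simp only: partial_funpow_nform)
  qed simp
  also have "\<dots> = (\<Sum>i\<le>r. (scalar C * (scalar (fact m / fact (m - r)) * scalar (fact n / fact (n - r)))) *
      ((-1) ^ i * of_nat (r choose i) * nform (m - r) (\<lambda>k. f (k + i)) *
      nform (n - r) (\<lambda>k. g (k + (r - i)))))"
    by (simp only: mult_ac)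
  finally show ?thesis by (simp add: C)
qed

section \<open>The covariants in coordinates\<close>

lemma of_nat_complex_cancel:
  assumes "k \<noteq> 0"
  shows "of_nat k * (Const (1 / of_nat k) * y) = (y :: ('v, complex) mpol)"
proof -
  have "of_nat k * (Const (1 / of_nat k) * y) = Const (of_nat k * (1 / of_nat k)) * y"
    by (simp only: Const_mult Const.hom_of_nat mult.assoc)
  then show ?thesis using assms by simp
qed

lemma pform_nform: "pform n p = nform n (\<lambda>i. Const (1 / of_nat (n choose i)) * p i :: ('v, complex) mpol)"
  unfolding nform_def
  by (rule pform_cong) (simp add: of_nat_complex_cancel)

text \<open>The case in which the first form is used up completely. With plain coefficients for it
  and normalised ones for the second form the remaining binomials cancel too. All the covariants
  built from \<open>theta22\<close> are computed this way.\<close>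

lemma transvectant_full:
  assumes "m \<le> n"
  shows "transvectant m n (pform m p) (nform n g) m =
    nform (n - m) (\<lambda>k. \<Sum>i\<le>m. (-1) ^ i * p i * g (k + (m - i)))"
proof -
  have sums: "nform l (\<lambda>k. \<Sum>i\<in>A. F i k) = (\<Sum>i\<in>A. nform l (F i))" if "finite A"
    for l and A and F :: "nat \<Rightarrow> nat \<Rightarrow> quintic_ring"
    using that
  proof (induction A rule: finite_induct)
    case empty
    then show ?case by (simp add: nform_def pform_def)
  qed (simp add: nform_add)
  have "transvectant m n (pform m p) (nform n g) m = (\<Sum>i\<le>m. (-1) ^ i * of_nat (m choose i) *
      nform 0 (\<lambda>k. Const (1 / of_nat (m choose (k + i))) * p (k + i)) * nform (n - m) (\<lambda>k. g (k + (m - i))))"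
    unfolding pform_nform by (subst transvectant_nform) (use assms in auto)
  also have "\<dots> = (\<Sum>i\<le>m. nform (n - m) (\<lambda>k. ((-1) ^ i * p i) * g (k + (m - i))))"
  proof (rule sum.cong)
    fix i assume i: "i \<in> {..m}"
    have "of_nat (m choose i) * nform 0 (\<lambda>k. Const (1 / of_nat (m choose (k + i))) * p (k + i)) =
        Const (of_nat (m choose i) * (Const (1 / of_nat (m choose i)) * p i))"
      by (simp add: nform_def pform_def Const_mult Const.hom_of_nat)
    also have "\<dots> = Const (p i)"
      using i by (subst of_nat_complex_cancel) auto
    finally have *: "of_nat (m choose i) * nform 0 (\<lambda>k. Const (1 / of_nat (m choose (k + i))) * p (k + i)) = Const (p i)" .
    have "Const ((-1) ^ i * p i) = (-1) ^ i * (Const (p i) :: quintic_ring bform)"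
      by (simp only: Const_mult Const.hom_power Const.hom_uminus Const_1)
    then show "(-1) ^ i * of_nat (m choose i) *
      nform 0 (\<lambda>k. Const (1 / of_nat (m choose (k + i))) * p (k + i)) * nform (n - m) (\<lambda>k. g (k + (m - i))) =
      nform (n - m) (\<lambda>k. ((-1) ^ i * p i) * g (k + (m - i)))"
      unfolding nform_Const_mult by (simp only: mult.assoc * flip: *)
  qed simp
  also have "\<dots> = nform (n - m) (\<lambda>k. \<Sum>i\<le>m. (-1) ^ i * p i * g (k + (m - i)))"
    by (rule sums[symmetric]) simp
  finally show ?thesis .
qed

text \<open>The guard keeps the convolution inside both ranges: a coefficient function has arbitrary
  values beyond the order of its form, and \<open>k - i\<close> is truncated.\<close>

lemma pform_mult:
  "pform m p * pform n q = pform (m + n) (\<lambda>k. \<Sum>i\<le>m. if i \<le> k \<and> k \<le> i + n then p i * q (k - i) else 0)"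
proof -
  let ?X = "\<lambda>k. x1 ^ (m + n - k) * x2 ^ k"
  have "pform (m + n) (\<lambda>k. \<Sum>i\<le>m. if i \<le> k \<and> k \<le> i + n then p i * q (k - i) else 0) =
      (\<Sum>k\<le>m+n. \<Sum>i\<le>m. if i \<le> k \<and> k \<le> i + n then Const (p i * q (k - i)) * ?X k else 0)"
    unfolding pform_def by (rule sum.cong) (auto simp: Const.hom_sum sum_distrib_right mult.assoc intro!: sum.cong)
  also have "\<dots> = (\<Sum>i\<le>m. \<Sum>k\<le>m+n. if i \<le> k \<and> k \<le> i + n then Const (p i * q (k - i)) * ?X k else 0)"
    by (rule sum.swap)
  also have "\<dots> = (\<Sum>i\<le>m. \<Sum>j\<le>n. Const (p i * q j) * ?X (i + j))"
  proof (rule sum.cong[OF refl])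
    fix i assume i: "i \<in> {..m}"
    have "(\<Sum>k\<le>m+n. if i \<le> k \<and> k \<le> i + n then Const (p i * q (k - i)) * ?X k else 0) =
        (\<Sum>k\<in>{i..i+n}. Const (p i * q (k - i)) * ?X k)"
      using i by (intro sum.mono_neutral_cong_right) auto
    also have "\<dots> = (\<Sum>j\<le>n. Const (p i * q j) * ?X (i + j))"
      by (rule sum.reindex_bij_witness[where i = "\<lambda>j. i + j" and j = "\<lambda>k. k - i"]) auto
    finally show "(\<Sum>k\<le>m+n. if i \<le> k \<and> k \<le> i + n then Const (p i * q (k - i)) * ?X k else 0) =
        (\<Sum>j\<le>n. Const (p i * q j) * ?X (i + j))" .
  qed
  also have "\<dots> = pform m p * pform n q"
    unfolding pform_def sum_product
  proof (intro sum.cong refl)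
    fix i j assume "i \<in> {..m}" "j \<in> {..n}"
    then have "m + n - (i + j) = (m - i) + (n - j)" by auto
    then show "Const (p i * q j) * ?X (i + j) = Const (p i) * x1 ^ (m - i) * x2 ^ i * (Const (q j) * x1 ^ (n - j) * x2 ^ j)"
      by (simp only: Const_mult power_add mult_ac)
  qed
  finally show ?thesis by simp
qed

lemma atMost_simps:
  "{..0::nat} = {0}" "{..1::nat} = {0, 1}" "{..Suc 0} = {0, 1}" "{..2::nat} = {0, 1, 2}" "{..3::nat} = {0, 1, 2, 3}" "{..4::nat} = {0, 1, 2, 3, 4}"
  "{..5::nat} = {0, 1, 2, 3, 4, 5}" "{..6::nat} = {0, 1, 2, 3, 4, 5, 6}"
  by auto

lemma choose_simps:
  "(3::nat) choose 2 = 3" "(4::nat) choose 2 = 6" "(4::nat) choose 3 = 4" "(5::nat) choose 2 = 10" "(5::nat) choose 3 = 10"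
  "(5::nat) choose 4 = 5" "(6::nat) choose 2 = 15" "(6::nat) choose 3 = 20" "(6::nat) choose 4 = 15" "(6::nat) choose 5 = 6"
  by (simp_all add: numeral_eq_Suc)

lemma le_cases:
  "(k::nat) \<le> 2 \<longleftrightarrow> k = 0 \<or> k = 1 \<or> k = 2" "(k::nat) \<le> 3 \<longleftrightarrow> k = 0 \<or> k = 1 \<or> k = 2 \<or> k = 3"
  "(k::nat) \<le> 4 \<longleftrightarrow> k = 0 \<or> k = 1 \<or> k = 2 \<or> k = 3 \<or> k = 4"
  "(k::nat) \<le> 5 \<longleftrightarrow> k = 0 \<or> k = 1 \<or> k = 2 \<or> k = 3 \<or> k = 4 \<or> k = 5"
  "(k::nat) \<le> 6 \<longleftrightarrow> k = 0 \<or> k = 1 \<or> k = 2 \<or> k = 3 \<or> k = 4 \<or> k = 5 \<or> k = 6"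
  by auto

text \<open>Here and below: coefficient formulas over an arbitrary ring, to be used over R and at
  complex points alike. Normalised coefficients: \<open>tq\<close> of \<open>theta22\<close>,
  \<open>rq\<close> of \<open>theta33\<close>, \<open>sq\<close> of \<open>theta51\<close>. Plain
  coefficients: \<open>wq\<close> and \<open>zq\<close> of the square and cube of
  \<open>theta22\<close>, \<open>yq\<close> of \<open>theta26\<close>, \<open>pq\<close> of
  \<open>theta33 * theta22\<close>, \<open>qq\<close> of \<open>theta51 * theta22 ^ 2\<close>.
  \<open>I4\<close> and \<open>I8\<close> are the invariants \<open>theta40\<close> and
  \<open>theta80\<close>.\<close>

definition tq :: "(nat \<Rightarrow> 'c::comm_ring_1) \<Rightarrow> nat \<Rightarrow> 'c" where
  "tq a k = [2 * (a 0 * a 4 - 4 * a 1 * a 3 + 3 * a 2 ^ 2), a 0 * a 5 - 3 * a 1 * a 4 + 2 * a 2 * a 3,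
     2 * (a 1 * a 5 - 4 * a 2 * a 4 + 3 * a 3 ^ 2)] ! k"

definition rq :: "(nat \<Rightarrow> 'c::comm_ring_1) \<Rightarrow> nat \<Rightarrow> 'c" where
  "rq a k = tq a 0 * a (k + 2) - 2 * tq a 1 * a (k + 1) + tq a 2 * a k"

definition I4 :: "(nat \<Rightarrow> 'c::comm_ring_1) \<Rightarrow> 'c" where
  "I4 a = 2 * (tq a 0 * tq a 2 - tq a 1 ^ 2)"

definition wq :: "(nat \<Rightarrow> 'c::comm_ring_1) \<Rightarrow> nat \<Rightarrow> 'c" where
  "wq a k = [tq a 0 ^ 2, 4 * tq a 0 * tq a 1, 2 * tq a 0 * tq a 2 + 4 * tq a 1 ^ 2, 4 * tq a 1 * tq a 2, tq a 2 ^ 2] ! k"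

definition sq :: "(nat \<Rightarrow> 'c::comm_ring_1) \<Rightarrow> nat \<Rightarrow> 'c" where
  "sq a k = wq a 0 * a (k + 4) - wq a 1 * a (k + 3) + wq a 2 * a (k + 2) - wq a 3 * a (k + 1) + wq a 4 * a k"

definition zq :: "(nat \<Rightarrow> 'c::comm_ring_1) \<Rightarrow> nat \<Rightarrow> 'c" where
  "zq a k = [tq a 0 ^ 3, 6 * tq a 0 ^ 2 * tq a 1, 3 * tq a 0 ^ 2 * tq a 2 + 12 * tq a 0 * tq a 1 ^ 2,
     12 * tq a 0 * tq a 1 * tq a 2 + 8 * tq a 1 ^ 3, 3 * tq a 0 * tq a 2 ^ 2 + 12 * tq a 1 ^ 2 * tq a 2,
     6 * tq a 1 * tq a 2 ^ 2, tq a 2 ^ 3] ! k"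

definition yq :: "(nat \<Rightarrow> 'c::comm_ring_1) \<Rightarrow> nat \<Rightarrow> 'c" where
  "yq a k = [2 * (a 0 * a 2 - a 1 ^ 2), 6 * (a 0 * a 3 - a 1 * a 2), 6 * (a 0 * a 4 + a 1 * a 3 - 2 * a 2 ^ 2),
     2 * (a 0 * a 5 + 7 * a 1 * a 4 - 8 * a 2 * a 3), 6 * (a 1 * a 5 + a 2 * a 4 - 2 * a 3 ^ 2),
     6 * (a 2 * a 5 - a 3 * a 4), 2 * (a 3 * a 5 - a 4 ^ 2)] ! k"

text \<open>The map \<open>\<kappa>\<close> embeds complex constants into the ring, since the
  formula contains fractions: \<open>Const\<close> over R, the identity over the complex
  numbers.\<close>

definition I8 :: "(complex \<Rightarrow> 'c) \<Rightarrow> (nat \<Rightarrow> 'c::comm_ring_1) \<Rightarrow> 'c" where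
  "I8 \<kappa> a = (\<Sum>i\<le>6. (-1) ^ i * zq a i * (\<kappa> (1 / of_nat (6 choose (6 - i))) * yq a (6 - i)))"

definition pq :: "(nat \<Rightarrow> 'c::comm_ring_1) \<Rightarrow> nat \<Rightarrow> 'c" where
  "pq a k = [rq a 0 * tq a 0, 2 * rq a 0 * tq a 1 + 3 * rq a 1 * tq a 0,
     rq a 0 * tq a 2 + 6 * rq a 1 * tq a 1 + 3 * rq a 2 * tq a 0,
     3 * rq a 1 * tq a 2 + 6 * rq a 2 * tq a 1 + rq a 3 * tq a 0,
     3 * rq a 2 * tq a 2 + 2 * rq a 3 * tq a 1, rq a 3 * tq a 2] ! k"

definition qq :: "(nat \<Rightarrow> 'c::comm_ring_1) \<Rightarrow> nat \<Rightarrow> 'c" where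
  "qq a k = [sq a 0 * wq a 0, sq a 0 * wq a 1 + sq a 1 * wq a 0, sq a 0 * wq a 2 + sq a 1 * wq a 1,
     sq a 0 * wq a 3 + sq a 1 * wq a 2, sq a 0 * wq a 4 + sq a 1 * wq a 3, sq a 1 * wq a 4] ! k"

text \<open>The first three rows are the Lie algebra of SL2 acting on the quintic: up to scalars
  \<open>rowE\<close> is x1 d/dx2, \<open>rowF\<close> is x2 d/dx1 and \<open>rowH\<close> is the
  weight operator. The factor of \<open>rowE\<close> is zero at j = 5 and that of
  \<open>rowF\<close> at j = 0, so the indices 6 and \<open>0 - 1\<close> do no harm.\<close>

definition rowE :: "(complex \<Rightarrow> 'c) \<Rightarrow> (nat \<Rightarrow> 'c::comm_ring_1) \<Rightarrow> nat \<Rightarrow> 'c" where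
  "rowE \<kappa> a j = \<kappa> ((5 - of_nat j) / 5) * a (j + 1)"
definition rowH :: "(complex \<Rightarrow> 'c) \<Rightarrow> (nat \<Rightarrow> 'c::comm_ring_1) \<Rightarrow> nat \<Rightarrow> 'c" where
  "rowH \<kappa> a j = \<kappa> ((2 * of_nat j - 5) / 10) * a j"
definition rowF :: "(complex \<Rightarrow> 'c) \<Rightarrow> (nat \<Rightarrow> 'c::comm_ring_1) \<Rightarrow> nat \<Rightarrow> 'c" where
  "rowF \<kappa> a j = \<kappa> (- of_nat j / 5) * a (j - 1)"
definition rowU :: "(complex \<Rightarrow> 'c) \<Rightarrow> (nat \<Rightarrow> 'c::comm_ring_1) \<Rightarrow> rat \<Rightarrow> nat \<Rightarrow> 'c" where
  "rowU \<kappa> a \<alpha> j = \<kappa> (1 / of_nat (5 choose j)) * pq a j - \<kappa> (of_rat \<alpha>) * I4 a * a j"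
definition rowV :: "(complex \<Rightarrow> 'c) \<Rightarrow> (nat \<Rightarrow> 'c::comm_ring_1) \<Rightarrow> rat \<Rightarrow> rat \<Rightarrow> nat \<Rightarrow> 'c" where
  "rowV \<kappa> a \<beta> \<gamma> j = \<kappa> (1 / of_nat (5 choose j)) * qq a j - \<kappa> (of_rat \<beta>) * I4 a ^ 2 * a j
     - \<kappa> (of_rat \<gamma>) * I8 \<kappa> a * a j"

fun alpha :: "(complex \<Rightarrow> 'c) \<Rightarrow> (nat \<Rightarrow> 'c::comm_ring_1) \<Rightarrow> rat \<times> rat \<times> rat \<Rightarrow> nat \<Rightarrow> nat \<Rightarrow> 'c" where
  "alpha \<kappa> a (\<alpha>, \<beta>, \<gamma>) i j = (if i = 0 then rowE \<kappa> a j else if i = 1 then rowH \<kappa> a j else if i = 2 then rowF \<kappa> a j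
     else if i = 3 then rowU \<kappa> a \<alpha> j else rowV \<kappa> a \<beta> \<gamma> j)"

section \<open>The covariants of the generic quintic\<close>

definition av :: "nat \<Rightarrow> quintic_ring" where "av i = Var (of_nat i)"

lemma generic_quintic_nform: "generic_quintic = nform 5 av"
  by (simp add: generic_quintic_def nform_def pform_def av_def)

lemmas suc_simps = numeral_2_eq_2[symmetric] numeral_3_eq_3[symmetric]

lemma theta22_pform: "theta22 = pform 2 (\<lambda>k. of_nat (2 choose k) * tq av k)"
proof -
  have "theta22 = (\<Sum>i\<le>4. (-1) ^ i * of_nat (4 choose i) * nform 1 (\<lambda>k. av (k + i)) * nform 1 (\<lambda>k. av (k + (4 - i))))"
    unfolding theta22_def generic_quintic_nform by (subst transvectant_nform) auto
  also have "\<dots> = pform 2 (\<lambda>k. of_nat (2 choose k) * tq av k)"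
    by (simp add: nform_def pform_def atMost_simps choose_simps tq_def Const_mult Const_add Const.hom_minus Const.hom_power
        Const.hom_numeral power2_eq_square suc_simps algebra_simps)
  finally show ?thesis .
qed

lemma theta22_nform: "theta22 = nform 2 (tq av)"
  by (simp add: theta22_pform nform_def)

lemma theta33_nform: "theta33 = nform 3 (rq av)"
  unfolding theta33_def theta22_pform generic_quintic_nform
  by (subst transvectant_full) (auto simp: rq_def atMost_simps algebra_simps intro!: nform_cong)

lemma theta40_eq: "theta40 = Const (I4 av)"
proof -
  have "theta40 = nform 0 (\<lambda>k. \<Sum>i\<le>2. (-1) ^ i * (of_nat (2 choose i) * tq av i) * tq av (k + (2 - i)))"
    unfolding theta40_def by (subst theta22_pform, subst theta22_nform, subst transvectant_full) auto
  then show ?thesis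
    by (simp add: nform_def pform_def atMost_simps I4_def algebra_simps power2_eq_square suc_simps)
qed

lemma theta22_sq: "theta22 ^ 2 = pform 4 (wq av)"
  unfolding power2_eq_square theta22_pform pform_mult
  by (auto simp: wq_def atMost_simps le_cases power2_eq_square algebra_simps intro!: pform_cong)

lemma theta22_cube: "theta22 ^ 3 = pform 6 (zq av)"
proof -
  have "theta22 ^ 3 = theta22 ^ 2 * theta22" by (simp add: numeral_eq_Suc mult_ac)
  also have "\<dots> = pform 6 (zq av)"
    unfolding theta22_sq unfolding theta22_pform pform_mult
    by (auto simp: wq_def zq_def atMost_simps le_cases power2_eq_square power3_eq_cube algebra_simps intro!: pform_cong)
  finally show ?thesis .
qed

lemma theta51_nform: "theta51 = nform 1 (sq av)"
  unfolding theta51_def theta22_sq generic_quintic_nform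
  by (subst transvectant_full) (auto simp: sq_def atMost_simps algebra_simps intro!: nform_cong)

lemma theta26_pform: "theta26 = pform 6 (yq av)"
proof -
  have "theta26 = (\<Sum>i\<le>2. (-1) ^ i * of_nat (2 choose i) * nform 3 (\<lambda>k. av (k + i)) * nform 3 (\<lambda>k. av (k + (2 - i))))"
    unfolding theta26_def generic_quintic_nform by (subst transvectant_nform) auto
  also have "\<dots> = nform 3 av * nform 3 (\<lambda>k. av (k + 2)) - Const 2 * (nform 3 (\<lambda>k. av (k + 1)) * nform 3 (\<lambda>k. av (k + 1)))
      + nform 3 (\<lambda>k. av (k + 2)) * nform 3 av"
    by (simp add: atMost_simps Const.hom_numeral)
  also have "\<dots> = pform 6 (yq av)"
    unfolding nform_def pform_mult pform_Const_mult[symmetric] pform_add[symmetric] 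
      add_uminus_conv_diff[symmetric]
    unfolding pform_def by (simp add: atMost_simps choose_simps yq_def Const_mult Const_add Const.hom_minus Const.hom_power
        Const.hom_numeral power2_eq_square suc_simps algebra_simps)
  finally show ?thesis .
qed

lemma theta80_eq: "theta80 = Const (I8 Const av)"
  unfolding theta80_def theta22_cube theta26_pform
  by (subst (2) pform_nform, subst transvectant_full) (auto simp: nform_def pform_def I8_def)

lemma cov_U_nform: "cov_U \<alpha> = nform 5 (rowU Const av \<alpha>)"
proof -
  have "theta33 * theta22 = pform 5 (pq av)"
    unfolding theta33_nform nform_def theta22_pform pform_mult
    by (auto simp: pq_def atMost_simps choose_simps suc_simps le_cases algebra_simps intro!: pform_cong)
  then show ?thesis
    unfolding cov_U_def theta40_eq generic_quintic_nform scalar_def pform_nform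
    by (simp only: Const_mult[symmetric] nform_Const_mult[symmetric] nform_diff[symmetric] rowU_def[abs_def])
qed

lemma cov_V_nform: "cov_V \<beta> \<gamma> = nform 5 (rowV Const av \<beta> \<gamma>)"
proof -
  have "theta51 * theta22 ^ 2 = pform 5 (qq av)"
    unfolding theta51_nform nform_def theta22_sq pform_mult
    by (auto simp: qq_def atMost_simps le_cases algebra_simps intro!: pform_cong)
  then show ?thesis
    unfolding cov_V_def theta40_eq theta80_eq generic_quintic_nform scalar_def pform_nform
    by (simp only: Const_mult[symmetric] Const.hom_power[symmetric] nform_Const_mult[symmetric] nform_diff[symmetric] rowV_def[abs_def])
qed

lemma x_pform:
  "(x1 ^ 2 :: 'c::comm_ring_1 bform) = pform 2 (\<lambda>k. if k = 0 then 1 else 0)"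
  "(x1 * x2 :: 'c bform) = pform 2 (\<lambda>k. if k = 1 then 1 else 0)"
  "(x2 ^ 2 :: 'c bform) = pform 2 (\<lambda>k. if k = 2 then 1 else 0)"
  by (simp_all add: pform_def atMost_simps)

lemma Const_numeral_conv: "(numeral n :: ('v, complex) mpol) = Const (numeral n)"
  by (simp add: Const.hom_numeral)

lemma transvectant_rows:
  "transvectant 2 5 (x1 ^ 2) generic_quintic 1 = nform 5 (rowE Const av)"
  "transvectant 2 5 (x1 * x2) generic_quintic 1 = nform 5 (rowH Const av)"
  "transvectant 2 5 (x2 ^ 2) generic_quintic 1 = nform 5 (rowF Const av)"
proof -
  have gen: "transvectant 2 5 (nform 2 f) generic_quintic 1 =
      pform 1 (\<lambda>i. f i) * pform 4 (\<lambda>k. of_nat (4 choose k) * av (k + 1)) -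
      pform 1 (\<lambda>i. f (i + 1)) * pform 4 (\<lambda>k. of_nat (4 choose k) * av k)" for f
    unfolding generic_quintic_nform
    by (subst transvectant_nform) (auto simp: atMost_simps nform_def le_Suc_eq intro!: arg_cong2[where f="(-)"] arg_cong2[where f="(*)"] pform_cong)
  note s = gen pform_mult add_uminus_conv_diff[symmetric]
  have m: "- pform 5 p = pform 5 (\<lambda>k. - 1 * p k)" for p :: "nat \<Rightarrow> quintic_ring"
    using pform_Const_mult[of 5 "-1" p] by (simp add: Const.hom_uminus)
  have c: "numeral n * (Const c * y) = Const (numeral n * c) * (y :: quintic_ring)" for n c y
    by (simp add: Const_mult Const.hom_numeral)
  have d: "Const c * y - Const d * y = Const (c - d) * (y :: quintic_ring)" "- (Const c * y) = Const (- c) * y" "- y = Const (- 1) * y" for c d y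
    by (simp_all add: Const.hom_minus Const.hom_uminus left_diff_distrib)
  show "transvectant 2 5 (x1 ^ 2) generic_quintic 1 = nform 5 (rowE Const av)"
    "transvectant 2 5 (x1 * x2) generic_quintic 1 = nform 5 (rowH Const av)"
    "transvectant 2 5 (x2 ^ 2) generic_quintic 1 = nform 5 (rowF Const av)"
    unfolding x_pform pform_nform[of 2] s
    by (auto simp: m pform_add[symmetric] nform_def[of 5] atMost_simps choose_simps le_cases suc_simps c
        Const_numeral_conv Const_mult[symmetric] mult.assoc[symmetric] Const.hom_uminus[symmetric]
        rowE_def rowH_def rowF_def choose_one binomial_n_n simp del: One_nat_def intro!: pform_cong)
      (simp_all add: d(1,2), simp_all add: Const.hom_uminus)
qed

section \<open>The Wronskian as a vector of maximal minors\<close>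

text \<open>Signed maximal minors of a 5 by 6 matrix, as cofactors along an added sixth row. Laplace
  expansion and adjugates of the square matrix \<open>aug\<close> then apply to any choice of that
  row.\<close>

definition cof :: "(nat \<Rightarrow> nat \<Rightarrow> 'c::comm_ring_1) \<Rightarrow> nat \<Rightarrow> 'c" where
  "cof \<alpha> j = cofactor (mat 6 6 (\<lambda>(i, k). if i < 5 then \<alpha> i k else 0)) 5 j"

definition aug :: "(nat \<Rightarrow> nat \<Rightarrow> 'c::comm_ring_1) \<Rightarrow> (nat \<Rightarrow> 'c) \<Rightarrow> 'c mat" where
  "aug \<alpha> w = mat 6 6 (\<lambda>(i, k). if i < 5 then \<alpha> i k else w k)"

lemma aug_carrier [simp]: "aug \<alpha> w \<in> carrier_mat 6 6" "dim_row (aug \<alpha> w) = 6" "dim_col (aug \<alpha> w) = 6"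
  by (simp_all add: aug_def)

lemma cofactor_aug: "j < 6 \<Longrightarrow> cofactor (aug \<alpha> w) 5 j = cof \<alpha> j"
  unfolding cofactor_def cof_def aug_def
  by (intro arg_cong2[where f = "(*)"] arg_cong[where f = det] refl) (auto simp: mat_delete_def)

lemma det_aug: "det (aug \<alpha> w) = (\<Sum>j<6. w j * cof \<alpha> j)"
proof -
  have "det (aug \<alpha> w) = (\<Sum>j<6. aug \<alpha> w $$ (5, j) * cofactor (aug \<alpha> w) 5 j)"
    by (rule laplace_expansion_row) simp_all
  also have "\<dots> = (\<Sum>j<6. w j * cof \<alpha> j)"
    by (rule sum.cong) (auto simp: cofactor_aug, simp add: aug_def)
  finally show ?thesis .
qed

lemma cof_hom:
  assumes "comm_ring_hom \<phi>" shows "\<phi> (cof \<alpha> j) = cof (\<lambda>i k. \<phi> (\<alpha> i k)) j"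
proof -
  interpret comm_ring_hom \<phi> by fact
  have "map_mat \<phi> (mat_delete (mat 6 6 (\<lambda>(i, k). if i < 5 then \<alpha> i k else 0)) 5 j) =
      mat_delete (mat 6 6 (\<lambda>(i, k). if i < 5 then \<phi> (\<alpha> i k) else 0)) 5 j"
    by (rule eq_matI) (auto simp: mat_delete_def)
  then show ?thesis
    by (simp add: cof_def cofactor_def hom_mult hom_power hom_uminus flip: hom_det)
qed

text \<open>The column operation \<open>C\<^sub>j \<mapsto> x\<^sub>1 C\<^sub>j + x\<^sub>2 C\<^sub>j\<^sub>+\<^sub>1\<close> annihilates the last row of the augmented
  matrix up to its final entry.\<close>

lemma det_bidiagonal:
  fixes \<alpha> :: "nat \<Rightarrow> nat \<Rightarrow> 'c::idom"
  shows "det (mat 5 5 (\<lambda>(i, j). \<alpha> i j * x + \<alpha> i (j + 1) * y)) * x ^ 5 =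
    - (det (aug \<alpha> (\<lambda>j. (- x) ^ j * y ^ (5 - j))) * x ^ 5)"
proof -
  let ?B = "aug \<alpha> (\<lambda>j. (- x) ^ j * y ^ (5 - j))"
  \<comment> \<open>Lower bidiagonal with diagonal x, x, x, x, x, 1: right multiplication carries
    out the operation on the first five columns and keeps the last one, at the price of the factor
    \<open>x ^ 5\<close>.\<close>
  define T where "T = mat 6 6 (\<lambda>(i, j). if j = 5 then (if i = 5 then 1 else 0)
    else if i = j then x else if i = j + 1 then y else (0::'c))"
  have T: "T \<in> carrier_mat 6 6" by (simp add: T_def)
  have "det T = prod_list (diag_mat T)"
    by (rule det_lower_triangular[OF _ T]) (auto simp: T_def)
  also have "diag_mat T = [x, x, x, x, x, 1]"
    by (simp add: diag_mat_def T_def numeral_eq_Suc)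
  finally have detT: "det T = x ^ 5" by (simp add: numeral_eq_Suc)
  have BT: "?B * T \<in> carrier_mat 6 6" using T by auto
  have entry: "(?B * T) $$ (i, j) = (if j = 5 then ?B $$ (i, 5) else ?B $$ (i, j) * x + ?B $$ (i, j + 1) * y)"
    if "i < 6" "j < 6" for i j
  proof -
    have "(?B * T) $$ (i, j) = (\<Sum>k\<in>{0..<6}. ?B $$ (i, k) * T $$ (k, j))"
      using that T by (simp add: scalar_prod_def)
    also have "\<dots> = (\<Sum>k\<in>{0..<6}. if j = 5 then (if k = 5 then ?B $$ (i, k) else 0)
        else (if k = j then ?B $$ (i, k) * x else 0) + (if k = j + 1 then ?B $$ (i, k) * y else 0))"
      using that by (intro sum.cong) (auto simp: T_def)
    also have "\<dots> = (if j = 5 then ?B $$ (i, 5) else ?B $$ (i, j) * x + ?B $$ (i, j + 1) * y)"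
      using that by (auto simp: sum.distrib)
    finally show ?thesis .
  qed
  have B5: "?B $$ (5, j) = (- x) ^ j * y ^ (5 - j)" if "j < 6" for j
    using that by (simp add: aug_def)
  have last: "(?B * T) $$ (5, j) = (if j = 5 then - (x ^ 5) else 0)" if "j < 6" for j
  proof (cases "j = 5")
    case True
    then have "(?B * T) $$ (5, j) = ?B $$ (5, 5)" using entry[of 5 j] by simp
    then show ?thesis using B5[of 5] True by simp
  next
    case False
    then have j: "j < 5" using that by simp
    then have "y ^ (5 - j) = y * y ^ (5 - (j + 1))"
      by (metis Suc_diff_Suc Suc_eq_plus1 power_Suc)
    moreover have "(?B * T) $$ (5, j) = ?B $$ (5, j) * x + ?B $$ (5, j + 1) * y"
      using entry[of 5 j] j by simp
    ultimately show ?thesis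
      using B5[of j] B5[of "j + 1"] j by (simp add: algebra_simps power_add del: One_nat_def)
  qed
  have "det ?B * x ^ 5 = det (?B * T)"
    using det_mult[OF aug_carrier(1) T] by (simp add: detT)
  also have "\<dots> = (\<Sum>j<6. (?B * T) $$ (5, j) * cofactor (?B * T) 5 j)"
    by (rule laplace_expansion_row[OF BT]) simp
  also have "\<dots> = (\<Sum>j<6::nat. if j = 5 then - (x ^ 5) * cofactor (?B * T) 5 5 else 0)"
    by (rule sum.cong) (auto simp: last)
  also have "\<dots> = - (x ^ 5) * det (mat_delete (?B * T) 5 5)"
    by (simp add: cofactor_def)
  also have "mat_delete (?B * T) 5 5 = mat 5 5 (\<lambda>(i, j). \<alpha> i j * x + \<alpha> i (j + 1) * y)"
  proof (rule eq_matI)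
    fix i j assume "i < dim_row (mat 5 5 (\<lambda>(i, j). \<alpha> i j * x + \<alpha> i (j + 1) * y))"
      "j < dim_col (mat 5 5 (\<lambda>(i, j). \<alpha> i j * x + \<alpha> i (j + 1) * y))"
    then have ij: "i < 5" "j < 5" by auto
    then have "mat_delete (?B * T) 5 5 $$ (i, j) = (?B * T) $$ (i, j)"
      unfolding mat_delete_def using BT by (subst index_mat) auto
    also have "\<dots> = ?B $$ (i, j) * x + ?B $$ (i, j + 1) * y"
      using ij by (subst entry) auto
    finally show "mat_delete (?B * T) 5 5 $$ (i, j) = mat 5 5 (\<lambda>(i, j). \<alpha> i j * x + \<alpha> i (j + 1) * y) $$ (i, j)"
      using ij by (simp add: aug_def)
  qed (use BT in \<open>auto simp: mat_delete_def\<close>)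
  finally show ?thesis by (simp add: mult.commute)
qed

lemma Var_nonzero [simp]: "(Var v :: ('v, 'c::comm_ring_1) mpol) \<noteq> 0"
  unfolding Var_def by (metis lookup_single_eq lookup_zero one_neq_zero)

lemma nform_1: "nform 1 f = Const (f 0) * x1 + Const (f 1) * x2"
  by (simp add: nform_def pform_def atMost_simps)

text \<open>Fourth derivatives of a quintic are linear forms: entry (i, j) of the Wronskian matrix
  is 5! times \<open>\<alpha> i j * x1 + \<alpha> i (j + 1) * x2\<close>. This is the matrix of
  \<open>det_bidiagonal\<close>, where \<open>x1 ^ 5\<close> can be cancelled; expanding along the
  row of powers exhibits the minors as coefficients.\<close>

lemma wronskian_nform:
  "wronskian [nform 5 (\<alpha> 0), nform 5 (\<alpha> 1), nform 5 (\<alpha> 2), nform 5 (\<alpha> 3), nform 5 (\<alpha> 4)] =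
    pform 5 (\<lambda>i. Const (120 ^ 5) * (- ((-1) ^ (5 - i) * cof \<alpha> (5 - i))) :: quintic_ring)"
proof -
  let ?As = "[nform 5 (\<alpha> 0), nform 5 (\<alpha> 1), nform 5 (\<alpha> 2), nform 5 (\<alpha> 3), nform 5 (\<alpha> 4)]"
  let ?D = "mat 5 5 (\<lambda>(i, j). Const (\<alpha> i j) * x1 + Const (\<alpha> i (j + 1)) * x2)"
  have nth: "?As ! i = nform 5 (\<alpha> i)" if "i < 5" for i
    using that by (auto simp: numeral_eq_Suc less_Suc_eq)
  have "mat 5 5 (\<lambda>(i, j). (partial 0 ^^ (5 - 1 - j)) ((partial 1 ^^ j) (?As ! i))) = scalar 120 \<cdot>\<^sub>m ?D"
  proof (rule eq_matI)
    fix i j assume "i < dim_row (scalar 120 \<cdot>\<^sub>m ?D)" "j < dim_col (scalar 120 \<cdot>\<^sub>m ?D)"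
    then have ij: "i < 5" "j < 5" by auto
    then have "5 - (4 - j) - j = 1" "4 - j + j \<le> 5" by auto
    then have "(partial 0 ^^ (4 - j)) ((partial 1 ^^ j) (nform 5 (\<alpha> i))) =
        scalar (fact 5 / fact 1) * nform 1 (\<lambda>k. \<alpha> i (k + j))"
      by (simp only: partial_funpow_nform)
    then show "mat 5 5 (\<lambda>(i, j). (partial 0 ^^ (5 - 1 - j)) ((partial 1 ^^ j) (?As ! i))) $$ (i, j) =
        (scalar 120 \<cdot>\<^sub>m ?D) $$ (i, j)"
      using ij by (simp add: nth nform_1 fact_numeral add.commute[of 1 j] del: One_nat_def)
  qed auto
  moreover have "length ?As = 5" by simp
  ultimately have "wronskian ?As = det (scalar 120 \<cdot>\<^sub>m ?D)"
    by (simp only: wronskian_def Let_def)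
  also have "\<dots> = scalar (120 ^ 5) * det ?D"
    by (simp only: det_smult dim_col_mat scalar_def Const.hom_power)
  also have "det ?D = - det (aug (\<lambda>i j. Const (\<alpha> i j)) (\<lambda>j. (- x1) ^ j * x2 ^ (5 - j)))"
    using det_bidiagonal[of "\<lambda>i j. Const (\<alpha> i j)" "x1 :: quintic_ring bform" x2]
    by (simp only: mult_minus_left[symmetric] mult_cancel_right power_eq_0_iff Var_nonzero) simp
  also have "\<dots> = - (\<Sum>j\<le>5. (- x1) ^ j * x2 ^ (5 - j) * Const (cof \<alpha> j))"
  proof -
    have "{..<6} = {..5::nat}" by auto
    then show ?thesis by (simp add: det_aug cof_hom[OF Const_hom])
  qed
  also have "(\<Sum>j\<le>5. (- x1) ^ j * x2 ^ (5 - j) * Const (cof \<alpha> j)) =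
      (\<Sum>i\<le>5. (- x1) ^ (5 - i) * x2 ^ i * Const (cof \<alpha> (5 - i)))"
    by (rule sum.reindex_bij_witness[where i = "\<lambda>i. 5 - i" and j = "\<lambda>i. 5 - i"]) auto
  also have "\<dots> = (\<Sum>i\<le>5. Const ((-1) ^ (5 - i) * cof \<alpha> (5 - i)) * x1 ^ (5 - i) * x2 ^ i)"
    by (intro sum.cong refl) (simp add: Const_mult Const.hom_power Const.hom_uminus power_minus[of x1] mult_ac)
  finally have "wronskian ?As = scalar (120 ^ 5) * - pform 5 (\<lambda>i. (-1) ^ (5 - i) * cof \<alpha> (5 - i))"
    by (simp add: pform_def)
  also have "- pform 5 (\<lambda>i. (-1) ^ (5 - i) * cof \<alpha> (5 - i)) = pform 5 (\<lambda>i. - ((-1) ^ (5 - i) * cof \<alpha> (5 - i)))"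
    by (simp add: pform_def Const.hom_uminus sum_negf)
  finally show ?thesis
    by (simp only: scalar_def pform_Const_mult)
qed

abbreviation gcof :: "rat \<times> rat \<times> rat \<Rightarrow> nat \<Rightarrow> quintic_ring" where
  "gcof \<tau> \<equiv> cof (alpha Const av \<tau>)"

lemma cov_Gamma_pform:
  "cov_Gamma \<tau> = pform 5 (\<lambda>i. Const (120 ^ 5) * (- ((-1) ^ (5 - i) * gcof \<tau> (5 - i))))"
proof (cases \<tau>)
  case (fields \<alpha> \<beta> \<gamma>)
  have "rowE Const av = alpha Const av \<tau> 0" "rowH Const av = alpha Const av \<tau> 1" "rowF Const av = alpha Const av \<tau> 2"
    "rowU Const av \<alpha> = alpha Const av \<tau> 3" "rowV Const av \<beta> \<gamma> = alpha Const av \<tau> 4"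
    by (simp_all add: fun_eq_iff fields)
  then have "cov_Gamma \<tau> = wronskian [nform 5 (alpha Const av \<tau> 0), nform 5 (alpha Const av \<tau> 1),
      nform 5 (alpha Const av \<tau> 2), nform 5 (alpha Const av \<tau> 3), nform 5 (alpha Const av \<tau> 4)]"
    by (simp only: cov_Gamma_def fields prod.case transvectant_rows cov_U_nform cov_V_nform)
  then show ?thesis
    by (simp only: wronskian_nform)
qed

section \<open>The minors as generators of the ideal\<close>

lemmas ideal_base = module.span_base[OF module_ring]
  and ideal_scale = module.span_scale[OF module_ring]
  and ideal_zero = module.span_zero[OF module_ring]
  and ideal_add = module.span_add[OF module_ring]
  and ideal_minimal = module.span_minimal[OF module_ring]
  and ideal_subspace = module.subspace_span[OF module_ring]

text \<open>Coefficients of \<Gamma> and minors differ by a sign, the unit \<open>120 ^ 5\<close>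
  and the reversal of the index.\<close>

lemma cov_ideal_gcof: "cov_ideal \<tau> = ideal_gen (gcof \<tau> ` {..<6})"
proof -
  let ?c = "\<lambda>i. Const (120 ^ 5) * (- ((-1) ^ (5 - i) * gcof \<tau> (5 - i)))"
  have unit: "gcof \<tau> j = ((-1) ^ Suc j * Const (1 / 120 ^ 5)) * ?c (5 - j)" if "j < 6" for j
  proof -
    have gen: "(- 1 * s) * K' * (K * (- (s * g))) = (s * s) * ((K' * K) * g)" for s K' K g :: quintic_ring
      by (simp add: algebra_simps)
    have "((-1) ^ j * (-1) ^ j) = (1 :: quintic_ring)"
      by (rule minus_one_mult_self)
    moreover have "Const (1 / 120 ^ 5) * Const (120 ^ 5) = (1 :: quintic_ring)"
      unfolding Const_mult[symmetric] by simp
    moreover have "5 - (5 - j) = j" using that by simp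
    ultimately show ?thesis
      by (simp only: gen power_Suc mult_1_left)
  qed
  have "Poly_Mapping.lookup (cov_Gamma \<tau>) m \<in> ideal_gen (gcof \<tau> ` {..<6})" for m
  proof (cases "m \<in> bmon 5 ` {..5}")
    case True
    then obtain i where i: "i \<le> 5" "m = bmon 5 i" by auto
    have "Poly_Mapping.lookup (cov_Gamma \<tau>) m = (- Const (120 ^ 5) * (-1) ^ (5 - i)) * gcof \<tau> (5 - i)"
      by (simp add: cov_Gamma_pform i lookup_pform)
    also have "\<dots> \<in> ideal_gen (gcof \<tau> ` {..<6})"
      by (rule ideal_scale, rule ideal_base) auto
    finally show ?thesis .
  next
    case False
    then have "Poly_Mapping.lookup (cov_Gamma \<tau>) m = 0"
      using keys_pform[of 5] by (auto simp: cov_Gamma_pform in_keys_iff subset_iff)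
    then show ?thesis by (simp add: ideal_zero)
  qed
  then have "cov_ideal \<tau> \<subseteq> ideal_gen (gcof \<tau> ` {..<6})"
    unfolding cov_ideal_def
    by (intro ideal_minimal) (auto simp: ideal_subspace)
  moreover have "gcof \<tau> j \<in> cov_ideal \<tau>" if "j < 6" for j
  proof -
    have "?c (5 - j) = Poly_Mapping.lookup (cov_Gamma \<tau>) (bmon 5 (5 - j))"
      by (simp add: cov_Gamma_pform lookup_pform)
    then have "?c (5 - j) \<in> cov_ideal \<tau>"
      unfolding cov_ideal_def by (intro ideal_base) blast
    then show ?thesis
      unfolding unit[OF that] cov_ideal_def by (rule ideal_scale)
  qed
  then have "ideal_gen (gcof \<tau> ` {..<6}) \<subseteq> cov_ideal \<tau>"
    unfolding cov_ideal_def by (intro ideal_minimal) (auto simp: ideal_subspace)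
  ultimately show ?thesis by blast
qed

section \<open>Equivariance\<close>

lemma omega_add_left: "omega r (A + A') B = omega r A B + omega r A' B"
  by (induction r arbitrary: A A' B) (simp_all add: partial_add ring_distribs)

lemma omega_add_right: "omega r A (B + B') = omega r A B + omega r A B'"
  by (induction r arbitrary: A B B') (simp_all add: partial_add ring_distribs)

lemma omega_Const_left: "omega r (Const c * A) B = Const c * omega r A B"
  by (induction r arbitrary: A B) (simp_all add: partial_Const_mult right_diff_distrib mult.assoc)

lemma omega_Const_right: "omega r A (Const c * B) = Const c * omega r A B"
proof (induction r arbitrary: A B)
  case 0
  show ?case by (simp add: mult_ac)
qed (simp add: partial_Const_mult right_diff_distrib)

text \<open>Covers both substitutions that fix the coefficients and the diagonal action, which moves
  them. The chain rule only needs that constants go to constants and that the variables change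
  linearly.\<close>

locale linear_change =
  fixes \<Phi> :: "'c::comm_ring_1 bform \<Rightarrow> 'c bform" and a b c d :: 'c
  assumes \<Phi>: "comm_ring_hom \<Phi>"
    and \<Phi>_Const: "\<And>p. \<exists>q. \<Phi> (Const p) = Const q"
    and \<Phi>_x1: "\<Phi> x1 = Const a * x1 + Const c * x2"
    and \<Phi>_x2: "\<Phi> x2 = Const b * x1 + Const d * x2"
begin

sublocale \<Phi>: comm_ring_hom \<Phi> by (rule \<Phi>)

lemma \<Phi>_Const_partial: "partial v (\<Phi> (Const p)) = 0"
  using \<Phi>_Const[of p] by auto

lemma partial0_\<Phi>: "partial 0 (\<Phi> A) = Const a * \<Phi> (partial 0 A) + Const b * \<Phi> (partial 1 A)"
proof (induction A rule: mpol_induct)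
  case (Var v)
  then show ?case
    using two_cases[of v] by (auto simp: \<Phi>_x1 \<Phi>_x2 partial_Var partial_add partial_Const_mult)
qed (simp_all add: \<Phi>_Const_partial partial_add partial_mult \<Phi>.hom_add \<Phi>.hom_mult algebra_simps)

lemma partial1_\<Phi>: "partial 1 (\<Phi> A) = Const c * \<Phi> (partial 0 A) + Const d * \<Phi> (partial 1 A)"
proof (induction A rule: mpol_induct)
  case (Var v)
  then show ?case
    using two_cases[of v] by (auto simp: \<Phi>_x1 \<Phi>_x2 partial_Var partial_add partial_Const_mult)
qed (simp_all add: \<Phi>_Const_partial partial_add partial_mult \<Phi>.hom_add \<Phi>.hom_mult algebra_simps)

text \<open>By the chain rule each step of the Omega process acquires the factor ad - bc; the terms
  with a repeated derivative cancel.\<close>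

lemma omega_\<Phi>:
  assumes det: "a * d - b * c = 1"
  shows "omega r (\<Phi> A) (\<Phi> B) = \<Phi> (omega r A B)"
proof (induction r arbitrary: A B)
  case (Suc r)
  let ?O = "\<lambda>i j. omega r (\<Phi> (partial i A)) (\<Phi> (partial j B))"
  have "omega (Suc r) (\<Phi> A) (\<Phi> B) = (Const a * Const d - Const b * Const c) * (?O 0 1 - ?O 1 0)"
    unfolding omega.simps partial0_\<Phi> partial1_\<Phi> omega_add_left omega_add_right omega_Const_left omega_Const_right
    by (simp add: algebra_simps)
  also have "Const a * Const d - Const b * Const c = (1 :: 'c bform)"
    by (simp add: det flip: Const_mult Const.hom_minus)
  finally show ?case by (simp add: Suc.IH \<Phi>.hom_minus)
qed (simp add: \<Phi>.hom_mult)

end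

section \<open>Matrices acting on forms\<close>

lemma act_form_hom: "comm_ring_hom (act_form g)"
  unfolding act_form_def by (rule subst_poly_hom[OF Const_hom])

lemma act_form_Const [simp]: "act_form g (Const c) = Const c"
  unfolding act_form_def by (rule subst_poly_Const[OF Const_hom])

lemma act_form_x1: "act_form g x1 = Const (g $$ (0, 0)) * x1 + Const (g $$ (1, 0)) * x2"
  and act_form_x2: "act_form g x2 = Const (g $$ (0, 1)) * x1 + Const (g $$ (1, 1)) * x2"
  unfolding act_form_def by (simp_all add: subst_poly_Var[OF Const_hom] lin_subst_def)

interpretation act_form: linear_change "act_form g" "g $$ (0, 0)" "g $$ (0, 1)" "g $$ (1, 0)" "g $$ (1, 1)"
  by (rule linear_change.intro) (auto simp: act_form_hom act_form_x1 act_form_x2)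

lemma mat_mult_2:
  assumes "g \<in> carrier_mat 2 2" "h \<in> carrier_mat 2 2" "i < 2" "j < 2"
  shows "(g * h) $$ (i, j) = g $$ (i, 0) * h $$ (0, j) + g $$ (i, 1) * h $$ (1, j)"
  using assms by (simp add: scalar_prod_def numeral_2_eq_2)

lemma act_form_mult:
  assumes "g \<in> carrier_mat 2 2" "h \<in> carrier_mat 2 2"
  shows "act_form (g * h) A = act_form g (act_form h A)"
proof (rule hom_eqI[OF act_form_hom hom_comp[OF act_form_hom act_form_hom]])
  fix v :: 2
  show "act_form (g * h) (Var v) = act_form g (act_form h (Var v))"
    using two_cases[of v] assms
    by (auto simp: act_form_x1 act_form_x2 act_form.\<Phi>.hom_add act_form.\<Phi>.hom_mult mat_mult_2
        Const_add Const_mult algebra_simps simp del: index_mult_mat One_nat_def)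
qed simp

lemma act_form_one [simp]: "act_form (1\<^sub>m 2) A = A"
proof (rule hom_eqI[OF act_form_hom id_hom])
  fix v :: 2
  show "act_form (1\<^sub>m 2) (Var v) = Var v"
    using two_cases[of v] by (auto simp: act_form_x1 act_form_x2)
qed simp

lemma forms_add: "A \<in> forms n \<Longrightarrow> B \<in> forms n \<Longrightarrow> A + B \<in> forms n"
  using keys_add[of A B] by (auto simp: forms_def)

lemma forms_0 [simp]: "0 \<in> forms n"
  by (simp add: forms_def)

lemma forms_sum: "(\<And>i. i \<in> S \<Longrightarrow> f i \<in> forms n) \<Longrightarrow> sum f S \<in> forms n"
  by (induction S rule: infinite_finite_induct) (auto intro: forms_add)

lemma forms_mult:
  fixes A B :: "'c::comm_ring_1 bform"
  assumes "A \<in> forms m" "B \<in> forms n" shows "A * B \<in> forms (m + n)"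
proof -
  obtain p q where "A = pform m p" "B = pform n q"
    using forms_pform[OF assms(1)] forms_pform[OF assms(2)] by blast
  then show ?thesis by (simp add: pform_mult)
qed

lemma forms_Const [simp]: "(Const c :: 'c::comm_ring_1 bform) \<in> forms 0"
  by (auto simp: forms_def Const_def mdeg_def)

lemma forms_Const_mult: "(A :: 'c::comm_ring_1 bform) \<in> forms n \<Longrightarrow> Const c * A \<in> forms n"
  using forms_mult[of "Const c" 0 A n] by simp

lemma forms_Var [simp]: "(Var v :: 'c::comm_ring_1 bform) \<in> forms 1"
  by (auto simp: forms_def Var_def mdeg_def)

lemma forms_1 [simp]: "(1 :: 'c::comm_ring_1 bform) \<in> forms 0"
  unfolding Const_1[symmetric] by (rule forms_Const)

lemma forms_power: "(A :: 'c::comm_ring_1 bform) \<in> forms m \<Longrightarrow> A ^ k \<in> forms (k * m)"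
  by (induction k) (auto intro: forms_mult)

lemma forms_0_Const: "(A :: 'c::comm_ring_1 bform) \<in> forms 0 \<Longrightarrow> A = Const (Poly_Mapping.lookup A 0)"
  using forms_pform[of A 0] by (simp add: pform_def bmon_def)

context linear_change begin

lemma \<Phi>_forms:
  assumes "A \<in> forms n" shows "\<Phi> A \<in> forms n"
proof -
  obtain p where A: "A = pform n p" using forms_pform[OF assms] by blast
  have lin: "\<Phi> (Var v) \<in> forms 1" for v
    using two_cases[of v] by (auto simp: \<Phi>_x1 \<Phi>_x2 intro!: forms_add forms_Const_mult simp del: One_nat_def)
  have "\<Phi> (Const (p i)) * \<Phi> x1 ^ (n - i) * \<Phi> x2 ^ i \<in> forms n" if "i \<le> n" for i
  proof -
    have "\<Phi> (Const (p i)) \<in> forms 0" using \<Phi>_Const[of "p i"] by auto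
    from forms_mult[OF forms_mult[OF this forms_power[OF lin[of 0], of "n - i"]] forms_power[OF lin[of 1], of i]]
    show ?thesis using that by simp
  qed
  then show ?thesis
    unfolding A pform_def \<Phi>.hom_sum \<Phi>.hom_mult \<Phi>.hom_power by (intro forms_sum) auto
qed

end

section \<open>Indices of the coefficient variables\<close>

lemma of_nat_6_neq: "i < j \<Longrightarrow> j < 6 \<Longrightarrow> (of_nat i :: 6) \<noteq> of_nat j"
proof
  assume a: "i < j" "j < 6" "(of_nat i :: 6) = of_nat j"
  then have "(of_nat (j - i) :: 6) = 0" by (simp add: of_nat_diff)
  moreover have "j - i \<in> {1,2,3,4,5}" using a by auto
  ultimately show False by auto
qed

lemma of_nat_6_inj: "i < 6 \<Longrightarrow> j < 6 \<Longrightarrow> (of_nat i :: 6) = of_nat j \<longleftrightarrow> i = j"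
  by (metis linorder_neqE_nat of_nat_6_neq)

lemma idx_of_nat: "i < 6 \<Longrightarrow> idx (of_nat i) = i"
  unfolding idx_def
proof (rule Least_equality)
  fix k assume i: "i < 6" and k: "(of_nat k :: 6) = of_nat i"
  show "i \<le> k"
  proof (rule ccontr)
    assume "\<not> i \<le> k"
    then have "k < 6" "k \<noteq> i" using i by linarith+
    with of_nat_6_inj[OF \<open>k < 6\<close> i] k show False by (metis (no_types))
  qed
qed simp

lemma surj_of_nat_6: "\<exists>i<6. v = (of_nat i :: 6)"
proof -
  have "inj_on (of_nat :: nat \<Rightarrow> 6) {..<6}"
  proof (rule inj_onI)
    fix x y assume "x \<in> {..<6::nat}" "y \<in> {..<6::nat}" and eq: "(of_nat x :: 6) = of_nat y"
    then have "x < 6" "y < 6" by blast+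
    from of_nat_6_inj[OF this] eq show "x = y" by (rule iffD1)
  qed
  then have "card (of_nat ` {..<6} :: 6 set) = card (UNIV :: 6 set)"
    by (simp add: card_image)
  then have "(of_nat ` {..<6} :: 6 set) = UNIV"
    by (metis card_subset_eq finite subset_UNIV)
  then show ?thesis by blast
qed

lemma adj_mat_mult: "g \<in> SL2 \<Longrightarrow> g * adj_mat g = 1\<^sub>m 2" "g \<in> SL2 \<Longrightarrow> adj_mat g * g = 1\<^sub>m 2"
  "g \<in> SL2 \<Longrightarrow> adj_mat g \<in> carrier_mat 2 2"
  using adj_mat[of g 2] by (auto simp: SL2_def)

lemma map_Const_mult:
  "g \<in> carrier_mat n n \<Longrightarrow> h \<in> carrier_mat n n \<Longrightarrow>
    map_mat Const (g * h) = map_mat (Const :: 'c::comm_ring_1 \<Rightarrow> ('v, 'c) mpol) g * map_mat Const h"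
  by (rule Const.mat_hom_mult)

lemma map_Const_one: "map_mat (Const :: 'c::comm_ring_1 \<Rightarrow> ('v, 'c) mpol) (1\<^sub>m n) = 1\<^sub>m n"
  by (rule Const.mat_hom_one)

section \<open>Actions on coefficients and on covariants\<close>

lemma act_coeff_hom: "comm_ring_hom (act_coeff g)"
  unfolding act_coeff_def by (rule subst_poly_hom[OF Const_hom])

lemma act_coeff_Const [simp]: "act_coeff g (Const c) = Const c"
  unfolding act_coeff_def by (rule subst_poly_Const[OF Const_hom])

lemma act_coeff_av:
  assumes "i < 6"
  shows "of_nat (5 choose i) * act_coeff g (av i) =
    Poly_Mapping.lookup (act_form (map_mat Const (adj_mat g)) generic_quintic) (bmon 5 i)"
proof -
  have "5 choose i \<noteq> 0" using assms by simp
  then show ?thesis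
    unfolding act_coeff_def av_def subst_poly_Var[OF Const_hom] idx_of_nat[OF assms] quintic_mon_bmon
    by (rule of_nat_complex_cancel)
qed

lemma act_cov_hom: "comm_ring_hom (act_cov g)"
  unfolding act_cov_def by (intro subst_poly_hom hom_comp[OF Const_hom act_coeff_hom])

lemma act_cov_Const [simp]: "act_cov g (Const p) = Const (act_coeff g p)"
  unfolding act_cov_def by (rule subst_poly_Const[OF hom_comp[OF Const_hom act_coeff_hom]])

lemma act_cov_Var: "act_cov g (Var v) = act_form (map_mat Const g) (Var v)"
  unfolding act_cov_def act_form_def
  by (simp add: subst_poly_Var[OF hom_comp[OF Const_hom act_coeff_hom]] subst_poly_Var[OF Const_hom])

lemma act_cov_linear:
  assumes "g \<in> carrier_mat 2 2"
  shows "linear_change (act_cov g) (Const (g $$ (0, 0))) (Const (g $$ (0, 1))) (Const (g $$ (1, 0))) (Const (g $$ (1, 1)))"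
  by (rule linear_change.intro) (use assms in \<open>auto simp: act_cov_hom act_cov_Var act_form_x1 act_form_x2\<close>)

lemma det_2:
  assumes "g \<in> carrier_mat 2 2"
  shows "det g = g $$ (0, 0) * g $$ (1, 1) - g $$ (0, 1) * (g $$ (1, 0) :: 'c::comm_ring_1)"
proof -
  have 2: "{..<2::nat} = {0, 1}" by auto
  have "mat_delete g 0 0 = mat 1 1 (\<lambda>_. g $$ (1, 1))" "mat_delete g 0 1 = mat 1 1 (\<lambda>_. g $$ (1, 0))"
    using assms by (auto simp: mat_delete_def)
  then have "cofactor g 0 0 = g $$ (1, 1)" "cofactor g 0 1 = - (g $$ (1, 0))"
    unfolding cofactor_def by (simp_all add: det_single)
  then show ?thesis
    using laplace_expansion_row[OF assms, of 0] unfolding 2 by simp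
qed

text \<open>The coefficients are moved by the adjugate of \<open>g\<close> and the variables by
  \<open>g\<close>, and the two substitutions cancel. Every covariant obtained from the generic
  quintic by transvectants inherits invariance from this.\<close>

lemma act_cov_quintic:
  assumes g: "g \<in> SL2" shows "act_cov g generic_quintic = generic_quintic"
proof -
  interpret hom: comm_ring_hom "act_cov g" by (rule act_cov_hom)
  interpret cf: comm_ring_hom "act_coeff g" by (rule act_coeff_hom)
  let ?T = "act_form (map_mat Const g)" and ?A = "act_form (map_mat Const (adj_mat g)) generic_quintic"
  have gc: "g \<in> carrier_mat 2 2" using g by (simp add: SL2_def)
  have A: "?A \<in> forms 5"
    unfolding generic_quintic_nform by (rule act_form.\<Phi>_forms) simp
  have "act_cov g generic_quintic =
      (\<Sum>i\<le>5. Const (Poly_Mapping.lookup ?A (bmon 5 i)) * ?T x1 ^ (5 - i) * ?T x2 ^ i)"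
  proof -
    have "act_coeff g (of_nat (5 choose i) * av i) = Poly_Mapping.lookup ?A (bmon 5 i)" if "i \<le> 5" for i
      using act_coeff_av[of i g] that by (simp add: cf.hom_mult cf.hom_of_nat)
    then show ?thesis
      unfolding generic_quintic_nform nform_def pform_def hom.hom_sum hom.hom_mult hom.hom_power act_cov_Const act_cov_Var
      by (intro sum.cong refl) simp
  qed
  also have "\<dots> = ?T (pform 5 (\<lambda>i. Poly_Mapping.lookup ?A (bmon 5 i)))"
    by (simp add: pform_def act_form.\<Phi>.hom_sum act_form.\<Phi>.hom_mult act_form.\<Phi>.hom_power)
  also have "\<dots> = ?T ?A"
    by (simp flip: forms_pform[OF A])
  also have "\<dots> = act_form (map_mat Const g * map_mat Const (adj_mat g)) generic_quintic"
    using gc adj_mat_mult(3)[OF g] by (subst act_form_mult) auto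
  also have "map_mat Const g * map_mat Const (adj_mat g) = (1\<^sub>m 2 :: quintic_ring mat)"
    using map_Const_mult[OF gc adj_mat_mult(3)[OF g], symmetric] by (simp add: adj_mat_mult(1)[OF g] map_Const_one)
  finally show ?thesis by simp
qed

lemma act_cov_scalar [simp]: "act_cov g (scalar c) = scalar c"
  by (simp add: scalar_def)

lemma SL2_D: "g \<in> SL2 \<Longrightarrow> g \<in> carrier_mat 2 2" "g \<in> SL2 \<Longrightarrow> g $$ (0, 0) * g $$ (1, 1) - g $$ (0, 1) * g $$ (1, 0) = 1"
  using det_2[of g] by (auto simp: SL2_def)

lemma act_cov_transvectant:
  assumes g: "g \<in> SL2"
  shows "act_cov g (transvectant m n A B r) = transvectant m n (act_cov g A) (act_cov g B) r"
proof -
  interpret linear_change "act_cov g" "Const (g $$ (0, 0))" "Const (g $$ (0, 1))" "Const (g $$ (1, 0))" "Const (g $$ (1, 1))"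
    by (rule act_cov_linear[OF SL2_D(1)[OF g]])
  have "Const (g $$ (0, 0)) * Const (g $$ (1, 1)) - Const (g $$ (0, 1)) * Const (g $$ (1, 0)) = (1 :: quintic_ring)"
    using SL2_D(2)[OF g] by (simp flip: Const_mult Const.hom_minus)
  note omega = omega_\<Phi>[OF this]
  show ?thesis
  proof (cases "r \<le> min m n")
    case True
    then show ?thesis by (simp add: transvectant_omega \<Phi>.hom_mult omega)
  next
    case False
    then have "min m n < r" by linarith
    then show ?thesis by (simp add: transvectant_def)
  qed
qed

context
  fixes g assumes g: "g \<in> SL2"
begin

interpretation hom: comm_ring_hom "act_cov g" by (rule act_cov_hom)

lemma act_cov_theta22: "act_cov g theta22 = theta22"
  unfolding theta22_def act_cov_transvectant[OF g] act_cov_quintic[OF g] ..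

lemma act_cov_theta26: "act_cov g theta26 = theta26"
  unfolding theta26_def act_cov_transvectant[OF g] act_cov_quintic[OF g] ..

lemma act_cov_U: "act_cov g (cov_U \<alpha>) = cov_U \<alpha>"
  unfolding cov_U_def theta33_def theta40_def hom.hom_minus hom.hom_mult act_cov_transvectant[OF g]
    act_cov_quintic[OF g] act_cov_theta22 act_cov_scalar ..

lemma act_cov_V: "act_cov g (cov_V \<beta> \<gamma>) = cov_V \<beta> \<gamma>"
  unfolding cov_V_def theta51_def theta40_def theta80_def hom.hom_minus hom.hom_mult hom.hom_power act_cov_transvectant[OF g]
    act_cov_quintic[OF g] act_cov_theta22 act_cov_theta26 act_cov_scalar ..

end

section \<open>Wronskians under shears\<close>

lemma pascal_sum:
  "(\<Sum>k\<le>n. of_nat (n choose k) * (u k + u (Suc k))) = (\<Sum>k\<le>Suc n. of_nat (Suc n choose k) * (u k :: 'a::comm_ring_1))"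
proof -
  have "(\<Sum>k\<le>Suc n. of_nat (Suc n choose k) * u k) =
      u 0 + (\<Sum>k\<le>n. of_nat (n choose k) * u (Suc k)) + (\<Sum>k\<le>n. of_nat (n choose Suc k) * u (Suc k))"
    by (subst sum.atMost_Suc_shift) (simp add: ring_distribs sum.distrib)
  moreover have "(\<Sum>k\<le>Suc n. of_nat (n choose k) * u k) = u 0 + (\<Sum>k\<le>n. of_nat (n choose Suc k) * u (Suc k))"
    by (subst sum.atMost_Suc_shift) simp
  ultimately show ?thesis
    by (simp add: ring_distribs sum.distrib binomial_eq_0)
qed

lemma partial_of_nat_mult: "partial v (of_nat n * p) = of_nat n * partial v p"
  using partial_Const_mult[of v "of_nat n" p] by (simp add: Const.hom_of_nat)

context linear_change begin

text \<open>For a = 1 the chain rule transforms the derivative into a sum of two commuting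
  operators, and this is the binomial theorem for its powers.\<close>

lemma partial0_funpow_\<Phi>:
  assumes "a = 1"
  shows "(partial 0 ^^ n) (\<Phi> A) =
    (\<Sum>k\<le>n. of_nat (n choose k) * (Const (b ^ k) * \<Phi> ((partial 0 ^^ (n - k)) ((partial 1 ^^ k) A))))"
proof (induction n)
  case (Suc n)
  define u where "u k = Const (b ^ k) * \<Phi> ((partial 0 ^^ (Suc n - k)) ((partial 1 ^^ k) A))" for k
  have "partial 0 (of_nat (n choose k) * (Const (b ^ k) * \<Phi> ((partial 0 ^^ (n - k)) ((partial 1 ^^ k) A)))) =
      of_nat (n choose k) * (u k + u (Suc k))" if "k \<le> n" for k
  proof -
    have "partial 0 (Const (b ^ k) * \<Phi> ((partial 0 ^^ (n - k)) ((partial 1 ^^ k) A))) = u k + u (Suc k)"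
      using that unfolding partial_Const_mult partial0_\<Phi> assms u_def
      by (simp add: Suc_diff_le partial_funpow_swap[symmetric] ring_distribs Const_mult mult_ac)
    then show ?thesis
      by (simp only: partial_of_nat_mult)
  qed
  then have "(partial 0 ^^ Suc n) (\<Phi> A) = (\<Sum>k\<le>n. of_nat (n choose k) * (u k + u (Suc k)))"
    by (simp add: Suc.IH partial_sum)
  also have "\<dots> = (\<Sum>k\<le>Suc n. of_nat (Suc n choose k) * u k)"
    by (rule pascal_sum)
  finally show ?case by (simp only: u_def)
qed simp

lemma partial1_funpow_\<Phi>:
  assumes "d = 1"
  shows "(partial 1 ^^ n) (\<Phi> A) =
    (\<Sum>k\<le>n. of_nat (n choose k) * (Const (c ^ k) * \<Phi> ((partial 1 ^^ (n - k)) ((partial 0 ^^ k) A))))"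
proof (induction n)
  case (Suc n)
  define u where "u k = Const (c ^ k) * \<Phi> ((partial 1 ^^ (Suc n - k)) ((partial 0 ^^ k) A))" for k
  have "partial 1 (of_nat (n choose k) * (Const (c ^ k) * \<Phi> ((partial 1 ^^ (n - k)) ((partial 0 ^^ k) A)))) =
      of_nat (n choose k) * (u k + u (Suc k))" if "k \<le> n" for k
  proof -
    have "partial 1 (Const (c ^ k) * \<Phi> ((partial 1 ^^ (n - k)) ((partial 0 ^^ k) A))) = u k + u (Suc k)"
      using that unfolding partial_Const_mult partial1_\<Phi> assms u_def
      by (simp add: Suc_diff_le partial_funpow_swap[symmetric] ring_distribs Const_mult mult_ac add_ac)
    then show ?thesis
      by (simp only: partial_of_nat_mult)
  qed
  then have "(partial 1 ^^ Suc n) (\<Phi> A) = (\<Sum>k\<le>n. of_nat (n choose k) * (u k + u (Suc k)))"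
    by (simp add: Suc.IH partial_sum)
  also have "\<dots> = (\<Sum>k\<le>Suc n. of_nat (Suc n choose k) * u k)"
    by (rule pascal_sum)
  finally show ?case by (simp only: u_def)
qed simp

end

definition wder :: "nat \<Rightarrow> 'c::comm_ring_1 bform \<Rightarrow> 'c bform" where
  "wder j A = (partial 0 ^^ (4 - j)) ((partial 1 ^^ j) A)"

lemma wronskian_wder:
  assumes "length As = 5" shows "wronskian As = det (mat 5 5 (\<lambda>(i, j). wder j (As ! i)))"
proof -
  have "5 - 1 - j = 4 - j" for j :: nat by simp
  then show ?thesis by (simp only: wronskian_def assms Let_def wder_def)
qed

text \<open>A change of variables multiplies the matrix of fourth derivatives on the right by its
  action on derivatives of order four. Only the determinant of that factor matters; for shears it is
  triangular with unit diagonal.\<close>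

lemma (in linear_change) wronskian_\<Phi>:
  assumes "length As = 5" and S: "S \<in> carrier_mat 5 5" "det S = 1"
    and wder: "\<And>A j. j < 5 \<Longrightarrow> wder j (\<Phi> A) = (\<Sum>l<5. \<Phi> (wder l A) * S $$ (l, j))"
  shows "wronskian (map \<Phi> As) = \<Phi> (wronskian As)"
proof -
  let ?M = "mat 5 5 (\<lambda>(i, j). wder j (As ! i))"
  have "mat 5 5 (\<lambda>(i, j). wder j (map \<Phi> As ! i)) = map_mat \<Phi> ?M * S"
    by (rule eq_matI) (use assms in \<open>auto simp: scalar_prod_def wder atLeast0LessThan intro!: sum.cong\<close>)
  then have "wronskian (map \<Phi> As) = det (map_mat \<Phi> ?M * S)"
    using assms(1) by (simp add: wronskian_wder)
  also have "\<dots> = det (map_mat \<Phi> ?M) * det S"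
    by (rule det_mult[of _ 5]) (use S in auto)
  finally show ?thesis
    using assms(1) S by (simp add: wronskian_wder)
qed

context linear_change begin

lemma wronskian_upper:
  assumes "length As = 5" "a = 1" "c = 0" "d = 1"
  shows "wronskian (map \<Phi> As) = \<Phi> (wronskian As)"
proof -
  define S :: "'c bform mat" where
    "S = mat 5 5 (\<lambda>(l, j). if j \<le> l then of_nat (4 - j choose (l - j)) * Const (b ^ (l - j)) else 0)"
  have S: "S \<in> carrier_mat 5 5" by (simp add: S_def)
  have "det S = prod_list (diag_mat S)"
    by (rule det_lower_triangular[OF _ S]) (auto simp: S_def)
  also have "diag_mat S = replicate 5 1"
    by (rule nth_equalityI) (auto simp: diag_mat_def S_def)
  finally have det: "det S = 1" by simp
  show ?thesis
  proof (rule wronskian_\<Phi>[OF assms(1) S det])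
    fix A :: "'c bform" and j assume j: "j < (5::nat)"
    have "(partial 1 ^^ n) (\<Phi> A) = \<Phi> ((partial 1 ^^ n) A)" for n
      by (induction n) (simp_all add: partial1_\<Phi> assms)
    then have "wder j (\<Phi> A) = (\<Sum>k\<le>4-j. of_nat (4 - j choose k) * (Const (b ^ k) *
        \<Phi> ((partial 0 ^^ (4 - j - k)) ((partial 1 ^^ k) ((partial 1 ^^ j) A)))))"
      by (simp only: wder_def partial0_funpow_\<Phi>[OF assms(2)])
    also have "\<dots> = (\<Sum>l\<in>{j..4}. \<Phi> (wder l A) * S $$ (l, j))"
    proof (rule sum.reindex_bij_witness[where i = "\<lambda>l. l - j" and j = "\<lambda>k. k + j"])
      fix k assume k: "k \<in> {..4 - j}"
      have S: "S $$ (k + j, j) = of_nat (4 - j choose k) * Const (b ^ k)"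
        using j k by (simp add: S_def)
      have "4 - (k + j) = 4 - j - k" by simp
      then have w: "wder (k + j) A = (partial 0 ^^ (4 - j - k)) ((partial 1 ^^ k) ((partial 1 ^^ j) A))"
        by (simp only: wder_def funpow_add o_apply)
      show "\<Phi> (wder (k + j) A) * S $$ (k + j, j) = of_nat (4 - j choose k) * (Const (b ^ k) *
        \<Phi> ((partial 0 ^^ (4 - j - k)) ((partial 1 ^^ k) ((partial 1 ^^ j) A))))"
        by (simp only: S w mult_ac)
    qed (use j in auto)
    also have "\<dots> = (\<Sum>l<5. \<Phi> (wder l A) * S $$ (l, j))"
      using j by (intro sum.mono_neutral_left) (auto simp: S_def)
    finally show "wder j (\<Phi> A) = (\<Sum>l<5. \<Phi> (wder l A) * S $$ (l, j))" .
  qed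
qed

lemma wronskian_lower:
  assumes "length As = 5" "a = 1" "b = 0" "d = 1"
  shows "wronskian (map \<Phi> As) = \<Phi> (wronskian As)"
proof -
  define S :: "'c bform mat" where
    "S = mat 5 5 (\<lambda>(l, j). if l \<le> j then of_nat (j choose (j - l)) * Const (c ^ (j - l)) else 0)"
  have S: "S \<in> carrier_mat 5 5" by (simp add: S_def)
  have "det S = prod_list (diag_mat S)"
    by (rule det_upper_triangular[OF _ S]) (auto simp: S_def upper_triangular_def)
  also have "diag_mat S = replicate 5 1"
    by (rule nth_equalityI) (auto simp: diag_mat_def S_def)
  finally have det: "det S = 1" by simp
  show ?thesis
  proof (rule wronskian_\<Phi>[OF assms(1) S det])
    fix A :: "'c bform" and j assume j: "j < (5::nat)"
    have p0: "(partial 0 ^^ n) (\<Phi> B) = \<Phi> ((partial 0 ^^ n) B)" for n B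
      by (induction n) (simp_all add: partial0_\<Phi> assms)
    have lin: "(partial 0 ^^ n) (\<Sum>k\<in>K. of_nat (f k) * (Const (e k) * B k)) =
        (\<Sum>k\<in>K. of_nat (f k) * (Const (e k) * (partial 0 ^^ n) (B k)))"
      for n K f e and B :: "nat \<Rightarrow> 'c bform"
    proof (induction n)
      case (Suc n)
      show ?case by (simp add: Suc.IH partial_sum partial_of_nat_mult partial_Const_mult)
    qed simp
    have swap: "(partial 1 ^^ m) ((partial 0 ^^ k) A) = (partial 0 ^^ k) ((partial 1 ^^ m) A)" for m k
      by (induction k) (simp_all add: partial_funpow_swap)
    have "wder j (\<Phi> A) = (\<Sum>k\<le>j. of_nat (j choose k) * (Const (c ^ k) *
        \<Phi> ((partial 0 ^^ (4 - j)) ((partial 1 ^^ (j - k)) ((partial 0 ^^ k) A)))))"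
      by (simp only: wder_def partial1_funpow_\<Phi>[OF assms(4)] lin p0)
    also have "\<dots> = (\<Sum>l\<in>{..j}. \<Phi> (wder l A) * S $$ (l, j))"
    proof (rule sum.reindex_bij_witness[where i = "\<lambda>l. j - l" and j = "\<lambda>k. j - k"])
      fix k assume k: "k \<in> {..j}"
      have S: "S $$ (j - k, j) = of_nat (j choose k) * Const (c ^ k)"
        using j k by (simp add: S_def)
      have "4 - (j - k) = 4 - j + k" using j k by auto
      then have w: "wder (j - k) A = (partial 0 ^^ (4 - j)) ((partial 1 ^^ (j - k)) ((partial 0 ^^ k) A))"
        by (simp only: wder_def funpow_add o_apply swap)
      show "\<Phi> (wder (j - k) A) * S $$ (j - k, j) = of_nat (j choose k) * (Const (c ^ k) *
        \<Phi> ((partial 0 ^^ (4 - j)) ((partial 1 ^^ (j - k)) ((partial 0 ^^ k) A))))"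
        by (simp only: S w mult_ac)
    qed (use j in auto)
    also have "\<dots> = (\<Sum>l<5. \<Phi> (wder l A) * S $$ (l, j))"
      using j by (intro sum.mono_neutral_left) (auto simp: S_def)
    finally show "wder j (\<Phi> A) = (\<Sum>l<5. \<Phi> (wder l A) * S $$ (l, j))" .
  qed
qed

end

section \<open>Generation of SL2 by shears\<close>

definition shearU :: "'c::comm_ring_1 \<Rightarrow> 'c mat" where
  "shearU t = mat 2 2 (\<lambda>(i, j). if i = j then 1 else if i = 0 then t else 0)"

definition shearL :: "'c::comm_ring_1 \<Rightarrow> 'c mat" where
  "shearL t = mat 2 2 (\<lambda>(i, j). if i = j then 1 else if i = 0 then 0 else t)"

lemma shear_SL2: "shearU t \<in> SL2" "shearL t \<in> SL2"
  by (auto simp: SL2_def shearU_def shearL_def det_2)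

lemma SL2_mult: "g \<in> SL2 \<Longrightarrow> h \<in> SL2 \<Longrightarrow> g * h \<in> SL2"
  by (auto simp: SL2_def det_mult[of _ 2])

lemma mat_2_eqI:
  assumes "g \<in> carrier_mat 2 2" "h \<in> carrier_mat 2 2" "g $$ (0, 0) = h $$ (0, 0)" "g $$ (0, 1) = h $$ (0, 1)"
    "g $$ (1, 0) = h $$ (1, 0)" "g $$ (1, 1) = h $$ (1, 1)"
  shows "g = h"
proof (rule eq_matI)
  fix i j assume "i < dim_row h" "j < dim_col h"
  then have "i = 0 \<or> i = 1" "j = 0 \<or> j = 1" using assms(2) by auto
  then show "g $$ (i, j) = h $$ (i, j)" using assms by auto
qed (use assms in auto)

text \<open>If c is nonzero, the matrix with rows (a, b), (c, d) is the product of the upper shear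
  by (a - 1) / c, the lower shear by c and the upper shear by (d - 1) / c. If c = 0, then d is
  nonzero, and multiplying by the lower shear by 1 makes the lower left entry d; the inverse shear
  restores the matrix.\<close>

lemma SL2_induct [consumes 1, case_names upper lower mult]:
  assumes "g \<in> SL2" and upper: "\<And>t. P (shearU t)" and lower: "\<And>t. P (shearL t)"
    and mult: "\<And>g h. g \<in> SL2 \<Longrightarrow> h \<in> SL2 \<Longrightarrow> P g \<Longrightarrow> P h \<Longrightarrow> P (g * h)"
  shows "P g"
proof -
  note sh [simp] = shearU_def shearL_def
  have gen: "P h" if h: "h \<in> SL2" and c: "h $$ (1, 0) \<noteq> 0" for h
  proof -
    define a b c d where "a = h $$ (0, 0)" and "b = h $$ (0, 1)" and "c = h $$ (1, 0)" and "d = h $$ (1, 1)"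
    have det: "a * d - b * c = 1" using SL2_D(2)[OF h] by (simp add: a_def b_def c_def d_def)
    have c0: "c \<noteq> 0" using c by (simp add: c_def)
    let ?U = "shearU ((a - 1) / c)" and ?L = "shearL c" and ?V = "shearU ((d - 1) / c)"
    have "h = ?U * ?L * ?V"
    proof (rule mat_2_eqI)
      show "h \<in> carrier_mat 2 2" by (rule SL2_D(1)[OF h])
      show "?U * ?L * ?V \<in> carrier_mat 2 2" by auto
      have UL: "?U * ?L \<in> carrier_mat 2 2" "?U \<in> carrier_mat 2 2" "?L \<in> carrier_mat 2 2" "?V \<in> carrier_mat 2 2" by auto
      have sU: "shearU t $$ (0, 0) = 1" "shearU t $$ (0, 1) = t" "shearU t $$ (1, 0) = 0" "shearU t $$ (1, 1) = 1"
        and sL: "shearL t $$ (0, 0) = 1" "shearL t $$ (0, 1) = 0" "shearL t $$ (1, 0) = t" "shearL t $$ (1, 1) = 1" for t :: complex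
        by simp_all
      have e: "(?U * ?L) $$ (0, 0) = a" "(?U * ?L) $$ (0, 1) = (a - 1) / c" "(?U * ?L) $$ (1, 0) = c" "(?U * ?L) $$ (1, 1) = 1"
        using mat_mult_2[OF UL(2,3), of 0 0] mat_mult_2[OF UL(2,3), of 0 1] mat_mult_2[OF UL(2,3), of 1 0]
          mat_mult_2[OF UL(2,3), of 1 1] c0
        by (simp_all only: sU sL) simp_all
      have b: "b = a * ((d - 1) / c) + (a - 1) / c"
        using c0 det by (simp add: field_simps)
      show "h $$ (0, 0) = (?U * ?L * ?V) $$ (0, 0)" "h $$ (0, 1) = (?U * ?L * ?V) $$ (0, 1)"
        "h $$ (1, 0) = (?U * ?L * ?V) $$ (1, 0)" "h $$ (1, 1) = (?U * ?L * ?V) $$ (1, 1)"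
        using mat_mult_2[OF UL(1,4), of 0 0] mat_mult_2[OF UL(1,4), of 0 1] mat_mult_2[OF UL(1,4), of 1 0]
          mat_mult_2[OF UL(1,4), of 1 1] c0 b
        unfolding a_def[symmetric] b_def[symmetric] c_def[symmetric] d_def[symmetric]
        by (simp_all only: e sU sL) simp_all
    qed
    then show ?thesis
      using mult[OF SL2_mult[OF shear_SL2(1,2)] shear_SL2(1) mult[OF shear_SL2(1,2) upper lower] upper] by metis
  qed
  show ?thesis
  proof (cases "g $$ (1, 0) = 0")
    case False
    then show ?thesis using gen assms(1) by blast
  next
    case True
    have gc: "g \<in> carrier_mat 2 2" and d: "g $$ (1, 1) \<noteq> 0"
      using SL2_D[OF assms(1)] True by auto
    have sc: "shearL 1 \<in> carrier_mat 2 2" "shearL (-1) \<in> carrier_mat 2 2" by auto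
    have "P (g * shearL 1)"
    proof (rule gen[OF SL2_mult[OF assms(1) shear_SL2(2)]])
      show "(g * shearL 1) $$ (1, 0) \<noteq> 0"
        using d True by (subst mat_mult_2[OF gc sc(1)]) auto
    qed
    then have P: "P (g * shearL 1 * shearL (-1))"
      by (rule mult[OF SL2_mult[OF assms(1) shear_SL2(2)] shear_SL2(2) _ lower])
    note m = mat_mult_2[OF sc]
    have "shearL 1 * shearL (-1) = (1\<^sub>m 2 :: complex mat)"
    proof (rule mat_2_eqI)
      show "(shearL 1 * shearL (- 1)) $$ (0, 0) = (1\<^sub>m 2 :: complex mat) $$ (0, 0)" by (subst m) auto
      show "(shearL 1 * shearL (- 1)) $$ (0, 1) = (1\<^sub>m 2 :: complex mat) $$ (0, 1)" by (subst m) auto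
      show "(shearL 1 * shearL (- 1)) $$ (1, 0) = (1\<^sub>m 2 :: complex mat) $$ (1, 0)" by (subst m) auto
      show "(shearL 1 * shearL (- 1)) $$ (1, 1) = (1\<^sub>m 2 :: complex mat) $$ (1, 1)" by (subst m) auto
    qed auto
    then have "g * shearL 1 * shearL (-1) = g"
      using assoc_mult_mat[OF gc sc] gc by simp
    with P show ?thesis by simp
  qed
qed

lemma of_nat_cancel:
  assumes "k \<noteq> 0" "of_nat k * x = of_nat k * (y :: quintic_ring)" shows "x = y"
  using assms by simp

section \<open>Compatibility of the actions with products\<close>

definition map_coeff :: "('c::comm_ring_1 \<Rightarrow> 'c) \<Rightarrow> 'c bform \<Rightarrow> 'c bform" where
  "map_coeff h = subst_poly (\<lambda>p. Const (h p)) Var"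

lemma map_coeff_hom: "comm_ring_hom h \<Longrightarrow> comm_ring_hom (map_coeff h)"
  unfolding map_coeff_def by (intro subst_poly_hom hom_comp[OF Const_hom])

lemma map_coeff_Const [simp]: "comm_ring_hom h \<Longrightarrow> map_coeff h (Const c) = Const (h c)"
  unfolding map_coeff_def by (rule subst_poly_Const[OF hom_comp[OF Const_hom]])

lemma map_coeff_Var [simp]: "comm_ring_hom h \<Longrightarrow> map_coeff h (Var v) = Var v"
  unfolding map_coeff_def by (rule subst_poly_Var[OF hom_comp[OF Const_hom]])

lemma map_coeff_pform:
  assumes "comm_ring_hom h" shows "map_coeff h (pform n p) = pform n (\<lambda>i. h (p i))"
proof -
  interpret m: comm_ring_hom "map_coeff h" by (rule map_coeff_hom[OF assms])
  show ?thesis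
    by (simp add: pform_def m.hom_sum m.hom_mult m.hom_power assms)
qed

lemma adj_mat_times:
  assumes "g \<in> SL2" "h \<in> SL2" shows "adj_mat (g * h) = adj_mat h * adj_mat g"
proof -
  note c = SL2_D(1)[OF assms(1)] SL2_D(1)[OF assms(2)] adj_mat_mult(3)[OF assms(1)] adj_mat_mult(3)[OF assms(2)]
    adj_mat_mult(3)[OF SL2_mult[OF assms]]
  have "h * (adj_mat h * adj_mat g) = (h * adj_mat h) * adj_mat g"
    by (rule assoc_mult_mat[symmetric]) (use c in auto)
  also have "\<dots> = adj_mat g"
    unfolding adj_mat_mult(1)[OF assms(2)] by (rule left_mult_one_mat) (use c in auto)
  finally have hg: "h * (adj_mat h * adj_mat g) = adj_mat g" .
  have "(g * h) * (adj_mat h * adj_mat g) = g * (h * (adj_mat h * adj_mat g))"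
    by (rule assoc_mult_mat) (use c in auto)
  then have inv: "(g * h) * (adj_mat h * adj_mat g) = 1\<^sub>m 2"
    unfolding hg adj_mat_mult(1)[OF assms(1)] .
  have "adj_mat (g * h) = adj_mat (g * h) * ((g * h) * (adj_mat h * adj_mat g))"
    unfolding inv by (rule right_mult_one_mat[symmetric]) (use c in auto)
  also have "\<dots> = (adj_mat (g * h) * (g * h)) * (adj_mat h * adj_mat g)"
    by (rule assoc_mult_mat[symmetric]) (use c in auto)
  also have "\<dots> = adj_mat h * adj_mat g"
    unfolding adj_mat_mult(2)[OF SL2_mult[OF assms]] by (rule left_mult_one_mat) (use c in auto)
  finally show ?thesis .
qed

lemma map_coeff_act_coeff_quintic:
  "map_coeff (act_coeff g) generic_quintic = act_form (map_mat Const (adj_mat g)) generic_quintic" (is "_ = ?A")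
proof -
  interpret c: comm_ring_hom "act_coeff g" by (rule act_coeff_hom)
  have A: "?A \<in> forms 5"
    unfolding generic_quintic_nform by (rule act_form.\<Phi>_forms) simp
  have "map_coeff (act_coeff g) generic_quintic = pform 5 (\<lambda>i. of_nat (5 choose i) * act_coeff g (av i))"
    unfolding generic_quintic_nform nform_def map_coeff_pform[OF act_coeff_hom] by (simp add: c.hom_mult c.hom_of_nat)
  also have "\<dots> = pform 5 (\<lambda>i. Poly_Mapping.lookup ?A (bmon 5 i))"
    by (rule pform_cong) (simp add: act_coeff_av)
  finally show ?thesis by (simp flip: forms_pform[OF A])
qed

lemma map_coeff_act_form:
  assumes k: "k \<in> carrier_mat 2 2"
  shows "map_coeff (act_coeff g) (act_form (map_mat Const k) A) = act_form (map_mat Const k) (map_coeff (act_coeff g) A)"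
proof (rule hom_eqI[OF hom_comp[OF map_coeff_hom[OF act_coeff_hom] act_form_hom] hom_comp[OF act_form_hom map_coeff_hom[OF act_coeff_hom]]])
  fix v :: 2
  interpret m: comm_ring_hom "map_coeff (act_coeff g)" by (rule map_coeff_hom[OF act_coeff_hom])
  note s = map_coeff_Const[OF act_coeff_hom] map_coeff_Var[OF act_coeff_hom]
  show "map_coeff (act_coeff g) (act_form (map_mat Const k) (Var v)) = act_form (map_mat Const k) (map_coeff (act_coeff g) (Var v))"
  proof (cases "v = 0")
    case True
    show ?thesis using k by (simp add: True act_form_x1 m.hom_add m.hom_mult s)
  next
    case False
    then have "v = 1" using two_cases[of v] by simp
    then show ?thesis using k by (simp add: act_form_x2 m.hom_add m.hom_mult s)
  qed
next
  fix c
  show "map_coeff (act_coeff g) (act_form (map_mat Const k) (Const c)) = act_form (map_mat Const k) (map_coeff (act_coeff g) (Const c))"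
    by (simp add: map_coeff_Const[OF act_coeff_hom])
qed

text \<open>Applying \<open>act_coeff g\<close> to coefficients commutes with substitutions for the
  variables by complex matrices. The matrices therefore accumulate as
  \<open>adj_mat h * adj_mat g\<close>, which is the adjugate of \<open>g * h\<close>, and a left
  action results.\<close>

lemma act_coeff_mult:
  assumes g: "g \<in> SL2" and h: "h \<in> SL2"
  shows "act_coeff (g * h) p = act_coeff g (act_coeff h p)"
proof (rule hom_eqI[OF act_coeff_hom hom_comp[OF act_coeff_hom act_coeff_hom]])
  fix v :: 6
  obtain i where i: "i < 6" and vi: "v = of_nat i"
    using surj_of_nat_6[of v] by blast
  have v: "Var v = av i" by (simp only: av_def vi)
  interpret c: comm_ring_hom "act_coeff g" by (rule act_coeff_hom)
  let ?H = "act_form (map_mat Const (adj_mat h)) generic_quintic"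
  have H: "?H \<in> forms 5"
    unfolding generic_quintic_nform by (rule act_form.\<Phi>_forms) simp
  have "of_nat (5 choose i) * act_coeff g (act_coeff h (av i)) = act_coeff g (Poly_Mapping.lookup ?H (bmon 5 i))"
    by (simp only: act_coeff_av[OF i, symmetric] c.hom_mult c.hom_of_nat)
  also have "\<dots> = Poly_Mapping.lookup (map_coeff (act_coeff g) ?H) (bmon 5 i)"
  proof -
    have "map_coeff (act_coeff g) ?H = pform 5 (\<lambda>i. act_coeff g (Poly_Mapping.lookup ?H (bmon 5 i)))"
      using arg_cong[OF forms_pform[OF H], of "map_coeff (act_coeff g)"]
      unfolding map_coeff_pform[OF act_coeff_hom] .
    then show ?thesis using i by (simp only: lookup_pform)
  qed
  also have "map_coeff (act_coeff g) ?H = act_form (map_mat Const (adj_mat h)) (act_form (map_mat Const (adj_mat g)) generic_quintic)"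
    by (simp only: map_coeff_act_form[OF adj_mat_mult(3)[OF h]] map_coeff_act_coeff_quintic)
  also have "\<dots> = act_form (map_mat Const (adj_mat h) * map_mat Const (adj_mat g)) generic_quintic"
    by (rule act_form_mult[symmetric]) (use adj_mat_mult(3)[OF h] adj_mat_mult(3)[OF g] in auto)
  also have "map_mat Const (adj_mat h) * map_mat Const (adj_mat g) = (map_mat Const (adj_mat (g * h)) :: quintic_ring mat)"
    unfolding adj_mat_times[OF g h] by (rule map_Const_mult[symmetric]) (use adj_mat_mult(3)[OF h] adj_mat_mult(3)[OF g] in auto)
  also have "Poly_Mapping.lookup (act_form (map_mat Const (adj_mat (g * h))) generic_quintic) (bmon 5 i) =
      of_nat (5 choose i) * act_coeff (g * h) (av i)"
    by (rule act_coeff_av[OF i, symmetric])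
  finally have "of_nat (5 choose i) * act_coeff g (act_coeff h (av i)) = of_nat (5 choose i) * act_coeff (g * h) (av i)" .
  moreover have "5 choose i \<noteq> 0" using i by simp
  ultimately have "act_coeff (g * h) (av i) = act_coeff g (act_coeff h (av i))"
    by (rule of_nat_cancel[rotated, symmetric])
  then show "act_coeff (g * h) (Var v) = act_coeff g (act_coeff h (Var v))"
    by (simp only: v)
qed simp

lemma act_cov_mult:
  assumes g: "g \<in> SL2" and h: "h \<in> SL2"
  shows "act_cov (g * h) A = act_cov g (act_cov h A)"
proof (rule hom_eqI[OF act_cov_hom hom_comp[OF act_cov_hom act_cov_hom]])
  fix v :: 2
  interpret c: comm_ring_hom "act_cov g" by (rule act_cov_hom)
  have "act_cov g (act_form (map_mat Const h) (Var v)) = act_form (map_mat Const g) (act_form (map_mat Const h) (Var v))"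
    using two_cases[of v] SL2_D(1)[OF h]
    by (auto simp: act_form_x1 act_form_x2 c.hom_add c.hom_mult act_cov_Var act_form.\<Phi>.hom_add act_form.\<Phi>.hom_mult)
  also have "\<dots> = act_form (map_mat Const (g * h)) (Var v)"
    unfolding map_Const_mult[OF SL2_D(1)[OF g] SL2_D(1)[OF h]]
    by (rule act_form_mult[symmetric]) (use SL2_D(1)[OF g] SL2_D(1)[OF h] in auto)
  finally show "act_cov (g * h) (Var v) = act_cov g (act_cov h (Var v))"
    by (simp add: act_cov_Var)
qed (simp add: act_coeff_mult[OF g h])

lemma transvectant_big: "\<not> r \<le> min m n \<Longrightarrow> transvectant m n A B r = 0"
proof -
  assume "\<not> r \<le> min m n"
  then have "r > min m n" by linarith
  then show ?thesis by (simp only: transvectant_def if_True)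
qed

lemma transvectant_add_left: "transvectant m n (A + A') B r = transvectant m n A B r + transvectant m n A' B r"
  by (cases "r \<le> min m n")
    (simp_all only: transvectant_omega transvectant_big omega_add_left ring_distribs not_False_eq_True add_0)

lemma transvectant_Const_left: "transvectant m n (Const c * A) B r = Const c * transvectant m n A B r"
  by (cases "r \<le> min m n")
    (simp_all only: transvectant_omega transvectant_big omega_Const_left mult.left_commute not_False_eq_True mult_zero_right)

section \<open>Invariance of the covariant \<Gamma>\<close>

lemma wronskian_combination:
  fixes As :: "'c::comm_ring_1 bform list"
  assumes len: "length As = 5" "length Bs = 5" and S: "S \<in> carrier_mat 5 5" "det S = 1"
    and Bs: "\<And>i. i < 5 \<Longrightarrow> Bs ! i = (\<Sum>l<5. Const (S $$ (i, l)) * As ! l)"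
  shows "wronskian Bs = wronskian As"
proof -
  let ?M = "\<lambda>As. mat 5 5 (\<lambda>(i, j). wder j (As ! i))"
  have lin: "wder j (\<Sum>l\<in>K. Const (f l) * B l) = (\<Sum>l\<in>K. Const (f l) * wder j (B l))" for j K f and B :: "nat \<Rightarrow> 'c bform"
  proof -
    have "(partial v ^^ n) (\<Sum>l\<in>K. Const (f l) * B l) = (\<Sum>l\<in>K. Const (f l) * (partial v ^^ n) (B l))"
      for n v and B :: "nat \<Rightarrow> 'c bform"
      by (induction n) (simp_all add: partial_sum partial_Const_mult)
    then show ?thesis by (simp add: wder_def)
  qed
  have "?M Bs = map_mat Const S * ?M As"
    by (rule eq_matI) (use S in \<open>auto simp: Bs lin scalar_prod_def atLeast0LessThan intro!: sum.cong\<close>)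
  then have "wronskian Bs = det (map_mat Const S :: 'c bform mat) * det (?M As)"
    using len det_mult[of "map_mat Const S" 5 "?M As"] S by (simp add: wronskian_wder)
  then show ?thesis
    using len S by (simp add: wronskian_wder)
qed

definition Gamma_list :: "rat \<times> rat \<times> rat \<Rightarrow> quintic_ring bform list" where
  "Gamma_list = (\<lambda>(\<alpha>, \<beta>, \<gamma>). [transvectant 2 5 (x1 ^ 2) generic_quintic 1,
        transvectant 2 5 (x1 * x2) generic_quintic 1,
        transvectant 2 5 (x2 ^ 2) generic_quintic 1,
        cov_U \<alpha>, cov_V \<beta> \<gamma>])"

lemma cov_Gamma_list: "cov_Gamma \<tau> = wronskian (Gamma_list \<tau>)" "length (Gamma_list \<tau>) = 5"
  by (simp_all add: cov_Gamma_def Gamma_list_def split_beta)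

lemma less_5_cases: "(i::nat) < 5 \<longleftrightarrow> i = 0 \<or> i = 1 \<or> i = 2 \<or> i = 3 \<or> i = 4"
  by auto

lemma less_234_cases: "(i::nat) < 2 \<longleftrightarrow> i = 0 \<or> i = 1" "(i::nat) < 3 \<longleftrightarrow> i = 0 \<or> i = 1 \<or> i = 2"
  "(i::nat) < 4 \<longleftrightarrow> i = 0 \<or> i = 1 \<or> i = 2 \<or> i = 3"
  by auto

lemma lessThan_5: "{..<5::nat} = {0, 1, 2, 3, 4}"
  by auto

text \<open>Transvectants are bilinear and equivariant, so the first three forms transform like
  x1^2, x1 x2, x2^2, while the last two are covariants and stay fixed.\<close>

lemma map_act_cov_Gamma_list:
  assumes g: "g \<in> SL2" and i: "i < 5"
  defines "a \<equiv> Const (g $$ (0, 0))" and "b \<equiv> Const (g $$ (0, 1))" and "c \<equiv> Const (g $$ (1, 0))" and "d \<equiv> Const (g $$ (1, 1))"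
  shows "map (act_cov g) (Gamma_list \<tau>) ! i = (\<Sum>l<5. Const (mat_of_rows_list 5
    [[a ^ 2, 2 * a * c, c ^ 2, 0, 0], [a * b, a * d + b * c, c * d, 0, 0], [b ^ 2, 2 * b * d, d ^ 2, 0, 0],
     [0, 0, 0, 1, 0], [0, 0, 0, 0, 1]] $$ (i, l)) * Gamma_list \<tau> ! l)"
proof -
  interpret h: comm_ring_hom "act_cov g" by (rule act_cov_hom)
  obtain \<alpha> \<beta> \<gamma> where \<tau>: "\<tau> = (\<alpha>, \<beta>, \<gamma>)" by (cases \<tau>)
  have x: "act_cov g x1 = Const a * x1 + Const c * x2" "act_cov g x2 = Const b * x1 + Const d * x2"
    using SL2_D(1)[OF g] by (simp_all add: act_cov_Var act_form_x1 act_form_x2 a_def b_def c_def d_def)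
  have q: "act_cov g (x1 ^ 2) = Const (a ^ 2) * x1 ^ 2 + (Const (2 * a * c) * (x1 * x2) + Const (c ^ 2) * x2 ^ 2)"
    "act_cov g (x1 * x2) = Const (a * b) * x1 ^ 2 + (Const (a * d + b * c) * (x1 * x2) + Const (c * d) * x2 ^ 2)"
    "act_cov g (x2 ^ 2) = Const (b ^ 2) * x1 ^ 2 + (Const (2 * b * d) * (x1 * x2) + Const (d ^ 2) * x2 ^ 2)"
    by (simp_all add: h.hom_mult h.hom_power x Const_mult Const_add Const.hom_power Const.hom_numeral power2_eq_square algebra_simps)
  show ?thesis
    using i unfolding less_5_cases lessThan_5
    by (auto simp: Gamma_list_def \<tau> mat_of_rows_list_def act_cov_transvectant[OF g] q act_cov_quintic[OF g]
        transvectant_add_left transvectant_Const_left act_cov_U[OF g] act_cov_V[OF g] add_ac simp del: One_nat_def)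
qed

text \<open>Two factors have to be trivial: the column factor from the chain rule and the row factor
  from the action on quadratic forms. For a shear both matrices are triangular with ones on the
  diagonal.\<close>

lemma act_cov_Gamma:
  assumes "g \<in> SL2" shows "act_cov g (cov_Gamma \<tau>) = cov_Gamma \<tau>"
  using assms
proof (induction g rule: SL2_induct)
  case (upper t)
  let ?g = "shearU t"
  interpret linear_change "act_cov ?g" "Const (?g $$ (0, 0))" "Const (?g $$ (0, 1))" "Const (?g $$ (1, 0))" "Const (?g $$ (1, 1))"
    by (rule act_cov_linear[OF SL2_D(1)[OF shear_SL2(1)]])
  note comb = map_act_cov_Gamma_list[OF shear_SL2(1)]
  have "act_cov ?g (cov_Gamma \<tau>) = wronskian (map (act_cov ?g) (Gamma_list \<tau>))"
    unfolding cov_Gamma_list by (rule wronskian_upper[symmetric]) (simp_all add: cov_Gamma_list shearU_def)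
  also have "\<dots> = wronskian (Gamma_list \<tau>)"
  proof (rule wronskian_combination[OF cov_Gamma_list(2) _ _ _ comb])
    let ?S = "mat_of_rows_list 5
      [[Const (?g $$ (0, 0)) ^ 2, 2 * Const (?g $$ (0, 0)) * Const (?g $$ (1, 0)), Const (?g $$ (1, 0)) ^ 2, 0, 0],
       [Const (?g $$ (0, 0)) * Const (?g $$ (0, 1)), Const (?g $$ (0, 0)) * Const (?g $$ (1, 1)) + Const (?g $$ (0, 1)) * Const (?g $$ (1, 0)),
        Const (?g $$ (1, 0)) * Const (?g $$ (1, 1)), 0, 0],
       [Const (?g $$ (0, 1)) ^ 2, 2 * Const (?g $$ (0, 1)) * Const (?g $$ (1, 1)), Const (?g $$ (1, 1)) ^ 2, 0, 0],
       [0, 0, 0, 1, 0], [0, 0, 0, 0, 1 :: quintic_ring]]"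
    have S: "?S \<in> carrier_mat 5 5" by (simp add: mat_of_rows_list_def numeral_eq_Suc)
    then show "?S \<in> carrier_mat 5 5" .
    have "det ?S = prod_list (diag_mat ?S)"
      by (rule det_lower_triangular[OF _ S])
        (auto simp: less_5_cases less_234_cases mat_of_rows_list_def shearU_def simp del: One_nat_def)
    also have "diag_mat ?S = [1, 1, 1, 1, 1]"
      by (simp add: diag_mat_def mat_of_rows_list_def shearU_def numeral_eq_Suc)
    finally show "det ?S = 1" by simp
  qed (simp_all add: cov_Gamma_list)
  finally show ?case by (simp add: cov_Gamma_list)
next
  case (lower t)
  let ?g = "shearL t"
  interpret linear_change "act_cov ?g" "Const (?g $$ (0, 0))" "Const (?g $$ (0, 1))" "Const (?g $$ (1, 0))" "Const (?g $$ (1, 1))"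
    by (rule act_cov_linear[OF SL2_D(1)[OF shear_SL2(2)]])
  note comb = map_act_cov_Gamma_list[OF shear_SL2(2)]
  have "act_cov ?g (cov_Gamma \<tau>) = wronskian (map (act_cov ?g) (Gamma_list \<tau>))"
    unfolding cov_Gamma_list by (rule wronskian_lower[symmetric]) (simp_all add: cov_Gamma_list shearL_def)
  also have "\<dots> = wronskian (Gamma_list \<tau>)"
  proof (rule wronskian_combination[OF cov_Gamma_list(2) _ _ _ comb])
    let ?S = "mat_of_rows_list 5
      [[Const (?g $$ (0, 0)) ^ 2, 2 * Const (?g $$ (0, 0)) * Const (?g $$ (1, 0)), Const (?g $$ (1, 0)) ^ 2, 0, 0],
       [Const (?g $$ (0, 0)) * Const (?g $$ (0, 1)), Const (?g $$ (0, 0)) * Const (?g $$ (1, 1)) + Const (?g $$ (0, 1)) * Const (?g $$ (1, 0)),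
        Const (?g $$ (1, 0)) * Const (?g $$ (1, 1)), 0, 0],
       [Const (?g $$ (0, 1)) ^ 2, 2 * Const (?g $$ (0, 1)) * Const (?g $$ (1, 1)), Const (?g $$ (1, 1)) ^ 2, 0, 0],
       [0, 0, 0, 1, 0], [0, 0, 0, 0, 1 :: quintic_ring]]"
    have S: "?S \<in> carrier_mat 5 5" by (simp add: mat_of_rows_list_def numeral_eq_Suc)
    then show "?S \<in> carrier_mat 5 5" .
    have "det ?S = prod_list (diag_mat ?S)"
      by (rule det_upper_triangular[OF _ S])
        (unfold upper_triangular_def carrier_matD(1)[OF S],
         auto simp: less_5_cases less_234_cases mat_of_rows_list_def shearL_def simp del: One_nat_def)
    also have "diag_mat ?S = [1, 1, 1, 1, 1]"
      by (simp add: diag_mat_def mat_of_rows_list_def shearL_def numeral_eq_Suc)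
    finally show "det ?S = 1" by simp
  qed (simp_all add: cov_Gamma_list)
  finally show ?case by (simp add: cov_Gamma_list)
next
  case (mult g h)
  then show ?case by (simp add: act_cov_mult)
qed

section \<open>Hilbert--Burch\<close>

lemma ideal_gen_single: "ideal_gen {f} = {y. f dvd (y :: 'a::comm_ring_1)}"
  by (auto simp: module.span_singleton[OF module_ring] dvd_def mult.commute)

lemma ideal_gen_empty: "ideal_gen {} = {0 :: 'a::comm_ring_1}"
  by (rule module.span_empty[OF module_ring])

lemma ideal_gen_image:
  "ideal_gen (c ` {..<n::nat}) = {\<Sum>j<n. c j * x j | x. True}" (is "_ = ?R")
proof
  have "module.subspace (*) ?R"
    unfolding module.subspace_def[OF module_ring]
  proof (intro conjI ballI allI)
    show "0 \<in> ?R" by (rule CollectI, rule exI[of _ "\<lambda>_. 0"]) simp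
  next
    fix a b assume "a \<in> ?R" "b \<in> ?R"
    then obtain x y where "a = (\<Sum>j<n. c j * x j)" "b = (\<Sum>j<n. c j * y j)" by auto
    then have "a + b = (\<Sum>j<n. c j * (x j + y j))" by (simp add: ring_distribs sum.distrib)
    then show "a + b \<in> ?R" by (intro CollectI exI[of _ "\<lambda>j. x j + y j"] conjI TrueI)
  next
    fix r a assume "a \<in> ?R"
    then obtain x where "a = (\<Sum>j<n. c j * x j)" by auto
    then have "r * a = (\<Sum>j<n. c j * (r * x j))" by (simp add: sum_distrib_left mult.left_commute)
    then show "r * a \<in> ?R" by (intro CollectI exI[of _ "\<lambda>j. r * x j"] conjI TrueI)
  qed
  moreover have "c ` {..<n} \<subseteq> ?R"
  proof
    fix y assume "y \<in> c ` {..<n}"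
    then obtain k where k: "k < n" "y = c k" by auto
    have "(\<Sum>j<n. c j * (if j = k then 1 else 0)) = (\<Sum>j<n. if j = k then c j else 0)"
      by (rule sum.cong) auto
    then have "y = (\<Sum>j<n. c j * (if j = k then 1 else 0))" using k by simp
    then show "y \<in> ?R" by (intro CollectI exI[of _ "\<lambda>j. if j = k then 1 else 0"] conjI TrueI)
  qed
  ultimately show "ideal_gen (c ` {..<n}) \<subseteq> ?R" by (intro ideal_minimal)
  show "?R \<subseteq> ideal_gen (c ` {..<n})"
  proof
    fix y assume "y \<in> ?R"
    then obtain x where y: "y = (\<Sum>j<n. x j * c j)" by (auto simp: mult.commute)
    show "y \<in> ideal_gen (c ` {..<n})"
      unfolding y by (intro module.span_sum[OF module_ring] ideal_scale ideal_base) auto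
  qed
qed

text \<open>Augmenting by the k-th unit row gives a matrix M of determinant
  \<open>cof \<alpha> k\<close>. Writing \<open>det M\<close> times v as v adj(M) M expresses it by
  the rows of M; the coefficient of the added row is the pairing of v with the minors, which is
  zero.\<close>

lemma cramer_row:
  fixes \<alpha> :: "nat \<Rightarrow> nat \<Rightarrow> 'a::comm_ring_1"
  assumes k: "k < 6" and v: "(\<Sum>j<6. cof \<alpha> j * v j) = 0"
  shows "\<exists>\<beta>. \<forall>j<6. cof \<alpha> k * v j = (\<Sum>i<5. \<beta> i * \<alpha> i j)"
proof -
  define M where "M = aug \<alpha> (\<lambda>j. if j = k then 1 else 0)"
  have M: "M \<in> carrier_mat 6 6" by (simp add: M_def)
  have "(\<Sum>j<6. (if j = k then 1 else 0) * cof \<alpha> j) = (\<Sum>j<6. if j = k then cof \<alpha> j else 0)"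
    by (rule sum.cong) auto
  then have detM: "det M = cof \<alpha> k" using k by (simp add: M_def det_aug)
  define b where "b i = (\<Sum>l<6. v l * adj_mat M $$ (l, i))" for i
  have adj: "(\<Sum>i<6. adj_mat M $$ (l, i) * M $$ (i, j)) = (if l = j then cof \<alpha> k else 0)" if "l < 6" "j < 6" for l j
  proof -
    have "(adj_mat M * M) $$ (l, j) = (\<Sum>i<6. adj_mat M $$ (l, i) * M $$ (i, j))"
      using that M adj_mat(1)[OF M] by (simp add: scalar_prod_def atLeast0LessThan)
    then show ?thesis using adj_mat(3)[OF M] that by (cases "l = j") (auto simp: detM)
  qed
  have b5: "b 5 = 0"
  proof -
    have "adj_mat M $$ (l, 5) = cof \<alpha> l" if "l < 6" for l
      using that by (simp add: adj_mat_def M_def cofactor_aug)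
    then show ?thesis using v by (simp add: b_def mult.commute)
  qed
  have "cof \<alpha> k * v j = (\<Sum>i<5. b i * \<alpha> i j)" if j: "j < 6" for j
  proof -
    have "(\<Sum>i<6. b i * M $$ (i, j)) = (\<Sum>l<6. v l * (\<Sum>i<6. adj_mat M $$ (l, i) * M $$ (i, j)))"
      unfolding b_def sum_distrib_left sum_distrib_right by (subst sum.swap) (simp add: mult.assoc)
    also have "\<dots> = (\<Sum>l<6. if l = j then v l * cof \<alpha> k else 0)"
      using j by (intro sum.cong) (auto simp: adj)
    also have "\<dots> = cof \<alpha> k * v j" using j by (simp add: mult.commute)
    finally have e: "(\<Sum>i<6. b i * M $$ (i, j)) = cof \<alpha> k * v j" .
    have s6: "{..<6::nat} = insert 5 {..<5}" by auto
    have "(\<Sum>i<6. b i * M $$ (i, j)) = (\<Sum>i<5. b i * M $$ (i, j))"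
      unfolding s6 by (simp add: b5)
    also have "\<dots> = (\<Sum>i<5. b i * \<alpha> i j)"
      using j by (intro sum.cong) (auto simp: M_def aug_def)
    finally show ?thesis using e by simp
  qed
  then show ?thesis by blast
qed

lemma cramer_ideal:
  fixes \<alpha> :: "nat \<Rightarrow> nat \<Rightarrow> 'a::comm_ring_1"
  assumes h: "h \<in> ideal_gen (cof \<alpha> ` {..<6})" and v: "(\<Sum>j<6. cof \<alpha> j * v j) = 0"
  shows "\<exists>\<beta>. \<forall>j<6. h * v j = (\<Sum>i<5. \<beta> i * \<alpha> i j)"
proof -
  obtain x where x: "h = (\<Sum>k<6. cof \<alpha> k * x k)"
    using h by (auto simp: ideal_gen_image)
  obtain B where B: "\<And>k j. k < 6 \<Longrightarrow> j < 6 \<Longrightarrow> cof \<alpha> k * v j = (\<Sum>i<5. B k i * \<alpha> i j)"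
    using cramer_row[OF _ v] by metis
  have "h * v j = (\<Sum>i<5. (\<Sum>k<6. x k * B k i) * \<alpha> i j)" if "j < 6" for j
  proof -
    have "h * v j = (\<Sum>k<6. x k * (cof \<alpha> k * v j))"
      by (simp only: x sum_distrib_left mult_ac)
    also have "\<dots> = (\<Sum>k<6. \<Sum>i<5. x k * B k i * \<alpha> i j)"
      using that by (intro sum.cong) (auto simp: B sum_distrib_left mult.assoc)
    also have "\<dots> = (\<Sum>i<5. (\<Sum>k<6. x k * B k i) * \<alpha> i j)"
      by (subst sum.swap) (simp add: sum_distrib_right)
    finally show ?thesis .
  qed
  then show ?thesis by (intro exI[of _ "\<lambda>i. \<Sum>k<6. x k * B k i"]) blast
qed

text \<open>Multiplication of a relation by the adjugate of the matrix augmented by the k-th unit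
  row isolates one coefficient times the nonzero minor \<open>cof \<alpha> k\<close>.\<close>

lemma rows_independent:
  fixes \<alpha> :: "nat \<Rightarrow> nat \<Rightarrow> 'a::idom"
  assumes k: "k < 6" "cof \<alpha> k \<noteq> 0" and \<delta>: "\<And>j. j < 6 \<Longrightarrow> (\<Sum>i<5. \<delta> i * \<alpha> i j) = 0" and i: "i < 5"
  shows "\<delta> i = 0"
proof -
  define M where "M = aug \<alpha> (\<lambda>j. if j = k then 1 else 0)"
  have M: "M \<in> carrier_mat 6 6" by (simp add: M_def)
  have "(\<Sum>j<6. (if j = k then 1 else 0) * cof \<alpha> j) = (\<Sum>j<6. if j = k then cof \<alpha> j else 0)"
    by (rule sum.cong) auto
  then have detM: "det M = cof \<alpha> k" using k by (simp add: M_def det_aug)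
  have adj: "(\<Sum>l<6. M $$ (m, l) * adj_mat M $$ (l, i)) = (if m = i then cof \<alpha> k else 0)" if "m < 5" for m
  proof -
    have "(M * adj_mat M) $$ (m, i) = (\<Sum>l<6. M $$ (m, l) * adj_mat M $$ (l, i))"
      using that i M adj_mat(1)[OF M] by (simp add: scalar_prod_def atLeast0LessThan)
    then show ?thesis using adj_mat(2)[OF M] that i by (cases "m = i") (auto simp: detM)
  qed
  have "\<delta> i * cof \<alpha> k = (\<Sum>m<5. if m = i then \<delta> m * cof \<alpha> k else 0)"
    using i by simp
  also have "\<dots> = (\<Sum>m<5. \<delta> m * (\<Sum>l<6. M $$ (m, l) * adj_mat M $$ (l, i)))"
    by (intro sum.cong) (auto simp: adj)
  also have "\<dots> = (\<Sum>l<6. (\<Sum>m<5. \<delta> m * M $$ (m, l)) * adj_mat M $$ (l, i))"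
    unfolding sum_distrib_left sum_distrib_right by (subst sum.swap) (simp add: mult.assoc)
  also have "\<dots> = (\<Sum>l<6. (\<Sum>m<5. \<delta> m * \<alpha> m l) * adj_mat M $$ (l, i))"
    by (intro sum.cong arg_cong2[where f = "(*)"] refl) (auto simp: M_def aug_def)
  also have "\<dots> = 0" by (intro sum.neutral) (auto simp: \<delta>)
  finally show ?thesis using k by simp
qed

text \<open>In a domain this is regularity of the sequence f, g in terms of divisibility, without
  asking that f and g generate a proper ideal. Nonzero complex constants are thus allowed as f,
  which is where the induction in \<open>regular_pair_binary\<close> starts.\<close>

definition regular_pair :: "'a::comm_ring_1 \<Rightarrow> 'a \<Rightarrow> bool" where
  "regular_pair f g \<longleftrightarrow> f \<noteq> 0 \<and> (\<forall>y. f dvd g * y \<longrightarrow> f dvd y)"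

lemma cof_nonzero:
  assumes "h \<in> ideal_gen (cof \<alpha> ` {..<6})" "h \<noteq> 0" shows "\<exists>k<6. cof \<alpha> k \<noteq> 0"
proof (rule ccontr)
  assume "\<not> (\<exists>k<6. cof \<alpha> k \<noteq> 0)"
  then have "h = 0" using assms(1) unfolding ideal_gen_image by auto
  with assms(2) show False by simp
qed

text \<open>Cramer's rule writes f v and g v as combinations of the rows with coefficients p and q.
  Independence of the rows gives g p = f q, so f divides p by regularity and can be
  cancelled.\<close>

theorem hilbert_burch_exact:
  fixes \<alpha> :: "nat \<Rightarrow> nat \<Rightarrow> 'a::idom"
  assumes fg: "f \<in> ideal_gen (cof \<alpha> ` {..<6})" "g \<in> ideal_gen (cof \<alpha> ` {..<6})" "regular_pair f g"
    and v: "(\<Sum>j<6. cof \<alpha> j * v j) = 0"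
  shows "\<exists>\<beta>. \<forall>j<6. v j = (\<Sum>i<5. \<beta> i * \<alpha> i j)"
proof -
  have f0: "f \<noteq> 0" using fg(3) by (simp add: regular_pair_def)
  obtain k where k: "k < 6" "cof \<alpha> k \<noteq> 0" using cof_nonzero[OF fg(1) f0] by blast
  obtain p where p: "\<And>j. j < 6 \<Longrightarrow> f * v j = (\<Sum>i<5. p i * \<alpha> i j)" using cramer_ideal[OF fg(1) v] by blast
  obtain q where q: "\<And>j. j < 6 \<Longrightarrow> g * v j = (\<Sum>i<5. q i * \<alpha> i j)" using cramer_ideal[OF fg(2) v] by blast
  have "f dvd p i" if i: "i < 5" for i
  proof -
    have "(\<Sum>i<5. (g * p i - f * q i) * \<alpha> i j) = 0" if "j < 6" for j
    proof -
      have "(\<Sum>i<5. (g * p i - f * q i) * \<alpha> i j) = g * (\<Sum>i<5. p i * \<alpha> i j) - f * (\<Sum>i<5. q i * \<alpha> i j)"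
        by (simp add: left_diff_distrib sum_subtractf sum_distrib_left mult.assoc)
      also have "\<dots> = g * (f * v j) - f * (g * v j)" using that by (simp add: p q)
      finally show ?thesis by (simp add: mult.left_commute)
    qed
    then have "g * p i - f * q i = 0" by (rule rows_independent[OF k _ i])
    then have "g * p i = f * q i" by (simp only: right_minus_eq)
    then have "f dvd g * p i" by (rule dvdI)
    then show ?thesis using fg(3) unfolding regular_pair_def by blast
  qed
  then obtain w where w: "\<And>i. i < 5 \<Longrightarrow> p i = f * w i" unfolding dvd_def by metis
  have "v j = (\<Sum>i<5. w i * \<alpha> i j)" if "j < 6" for j
  proof -
    have "f * v j = (\<Sum>i<5. f * w i * \<alpha> i j)"
      unfolding p[OF that] by (intro sum.cong refl) (simp only: w lessThan_iff)
    also have "\<dots> = f * (\<Sum>i<5. w i * \<alpha> i j)"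
      by (simp only: sum_distrib_left mult.assoc)
    finally show ?thesis using f0 by (simp only: mult_cancel_left simp_thms)
  qed
  then show ?thesis by blast
qed

section \<open>Regular sequences and chains of primes\<close>

lemma subspace_ideal:
  assumes "module.subspace (*) (I :: 'a::comm_ring_1 set)"
  shows "0 \<in> I" "a \<in> I \<Longrightarrow> b \<in> I \<Longrightarrow> a + b \<in> I" "a \<in> I \<Longrightarrow> c * a \<in> I" "a \<in> I \<Longrightarrow> b \<in> I \<Longrightarrow> a - b \<in> I"
proof -
  show *: "0 \<in> I" "a \<in> I \<Longrightarrow> b \<in> I \<Longrightarrow> a + b \<in> I" "a \<in> I \<Longrightarrow> c * a \<in> I" for a b c
    using assms unfolding module.subspace_def[OF module_ring] by auto
  show "a \<in> I \<Longrightarrow> b \<in> I \<Longrightarrow> a - b \<in> I" using *(2)[of a "-1 * b"] *(3)[of b "-1"] by simp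
qed

lemma ideal_one: "module.subspace (*) I \<Longrightarrow> (1 :: 'a::comm_ring_1) \<in> I \<longleftrightarrow> I = UNIV"
  using subspace_ideal(3)[of I 1] by fastforce

text \<open>A maximal ideal among those containing \<open>J\<close> and missing a multiplicatively closed set.\<close>

lemma prime_avoiding:
  fixes J S :: "'a::comm_ring_1 set"
  assumes J: "module.subspace (*) J" and S: "1 \<in> S" "\<And>s t. s \<in> S \<Longrightarrow> t \<in> S \<Longrightarrow> s * t \<in> S" and disj: "J \<inter> S = {}"
  shows "\<exists>Q. prime_ideal Q \<and> J \<subseteq> Q \<and> Q \<inter> S = {}"
proof -
  define \<A> where "\<A> = {Q. module.subspace (*) Q \<and> J \<subseteq> Q \<and> Q \<inter> S = {}}"
  have "\<exists>M\<in>\<A>. \<forall>X\<in>\<A>. M \<subseteq> X \<longrightarrow> X = M"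
  proof (rule subset_Zorn_nonempty)
    show "\<A> \<noteq> {}" using J disj by (auto simp: \<A>_def)
    fix C assume C: "C \<noteq> {}" "subset.chain \<A> C"
    have sub: "module.subspace (*) X" if "X \<in> C" for X using C that by (auto simp: subset.chain_def \<A>_def)
    have "module.subspace (*) (\<Union>C)"
      unfolding module.subspace_def[OF module_ring]
    proof (intro conjI ballI allI)
      show "0 \<in> \<Union>C" using C(1) sub subspace_ideal(1) by blast
      fix a b assume "a \<in> \<Union>C" "b \<in> \<Union>C"
      then obtain X Y where XY: "X \<in> C" "Y \<in> C" "a \<in> X" "b \<in> Y" by blast
      then have "X \<subseteq> Y \<or> Y \<subseteq> X" using C(2) by (auto simp: subset.chain_def)
      then show "a + b \<in> \<Union>C" using XY sub subspace_ideal(2) by blast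
    next
      fix c a assume "a \<in> \<Union>C"
      then show "c * a \<in> \<Union>C" using sub subspace_ideal(3) by blast
    qed
    moreover have CA: "C \<subseteq> \<A>" using C(2) by (simp add: subset.chain_def)
    moreover from C(1) obtain X where "X \<in> C" by blast
    then have "J \<subseteq> \<Union>C" using CA by (auto simp: \<A>_def)
    moreover have "\<Union>C \<inter> S = {}" using CA by (auto simp: \<A>_def)
    ultimately show "\<Union>C \<in> \<A>" by (simp add: \<A>_def)
  qed
  then obtain M where M: "M \<in> \<A>" and max: "\<And>X. X \<in> \<A> \<Longrightarrow> M \<subseteq> X \<Longrightarrow> X = M" by blast
  have Ms: "module.subspace (*) M" and JM: "J \<subseteq> M" and MS: "M \<inter> S = {}" using M by (auto simp: \<A>_def)
  note Mi = subspace_ideal[OF Ms]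
  have extend: "\<exists>s\<in>S. \<exists>r. s - r * x \<in> M" if x: "x \<notin> M" for x
  proof -
    let ?X = "{m + r * x | m r. m \<in> M}"
    have "module.subspace (*) ?X"
      unfolding module.subspace_def[OF module_ring]
    proof (intro conjI ballI allI)
      show "0 \<in> ?X" using Mi(1) by (intro CollectI exI[of _ 0]) auto
    next
      fix a b assume "a \<in> ?X" "b \<in> ?X"
      then obtain m r m' r' where "a = m + r * x" "b = m' + r' * x" "m \<in> M" "m' \<in> M" by blast
      then have "a + b = (m + m') + (r + r') * x" "m + m' \<in> M" using Mi(2) by (auto simp: algebra_simps)
      then show "a + b \<in> ?X" by blast
    next
      fix c a assume "a \<in> ?X"
      then obtain m r where "a = m + r * x" "m \<in> M" by blast
      then have "c * a = c * m + (c * r) * x" by (simp add: algebra_simps)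
      moreover have "c * m \<in> M" using \<open>m \<in> M\<close> by (rule Mi(3))
      ultimately show "c * a \<in> ?X" by blast
    qed
    moreover have "M \<subseteq> ?X"
    proof
      fix m assume "m \<in> M"
      then show "m \<in> ?X" by (intro CollectI exI[of _ m] exI[of _ 0]) auto
    qed
    moreover have "x \<in> ?X" using Mi(1) by (intro CollectI exI[of _ 0] exI[of _ 1]) auto
    ultimately have "?X \<inter> S \<noteq> {}" using max[of ?X] JM x unfolding \<A>_def by blast
    then obtain m r where "m + r * x \<in> S" "m \<in> M" by blast
    then show ?thesis by (intro bexI[of _ "m + r * x"] exI[of _ r]) auto
  qed
  have "x \<in> M \<or> y \<in> M" if xy: "x * y \<in> M" for x y
  proof (rule ccontr)
    assume "\<not> (x \<in> M \<or> y \<in> M)"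
    then obtain s r t q where st: "s \<in> S" "t \<in> S" "s - r * x \<in> M" "t - q * y \<in> M" using extend by metis
    \<comment> \<open>Modulo \<open>M\<close> one has s = r x and t = q y, so s t would be congruent
      to (r q) (x y), which lies in \<open>M\<close>, although s t belongs to
      \<open>S\<close>.\<close>
    have "t * (s - r * x) + (r * x) * (t - q * y) + (r * q) * (x * y) \<in> M"
      using st(3,4) xy Mi(2,3) by blast
    moreover have "t * (s - r * x) + (r * x) * (t - q * y) + (r * q) * (x * y) = s * t"
      by (simp add: algebra_simps)
    ultimately show False using S(2)[OF st(1,2)] MS by auto
  qed
  moreover have "M \<noteq> UNIV" using MS S(1) by auto
  ultimately show ?thesis using Ms JM MS unfolding prime_ideal_def by blast
qed

lemma prime_ideal_D:
  assumes "prime_ideal P"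
  shows "module.subspace (*) P" "1 \<notin> P" "x * y \<in> P \<Longrightarrow> x \<in> P \<or> y \<in> P"
  using assms ideal_one[of P] by (auto simp: prime_ideal_def)

definition prime_chain :: "nat \<Rightarrow> (nat \<Rightarrow> 'a::comm_ring_1 set) \<Rightarrow> bool" where
  "prime_chain n Q \<longleftrightarrow> (\<forall>i\<le>n. prime_ideal (Q i)) \<and> (\<forall>i<n. Q i \<subset> Q (Suc i))"

text \<open>The last element x is regular modulo the ideal J of the others, so J misses the
  multiplicative set of all s x^k with s outside P. A prime Q over J that misses this set is
  contained in P and does not contain x; the induction continues with Q.\<close>

lemma regular_sequence_prime_chain:
  fixes xs :: "'a::comm_ring_1 list"
  shows "prime_ideal P \<Longrightarrow> set xs \<subseteq> P \<Longrightarrow> regular_sequence xs \<Longrightarrow> \<exists>Q. prime_chain (length xs) Q \<and> Q (length xs) = P"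
proof (induction xs arbitrary: P rule: rev_induct)
  case Nil
  then show ?case by (intro exI[of _ "\<lambda>_. P"]) (simp add: prime_chain_def)
next
  case (snoc x xs)
  let ?J = "ideal_gen (set xs)"
  note Pi = subspace_ideal[OF prime_ideal_D(1)[OF snoc.prems(1)]]
  have JP: "?J \<subseteq> P" using snoc.prems by (intro ideal_minimal) (auto intro: prime_ideal_D)
  have reg: "x * y \<in> ?J \<Longrightarrow> y \<in> ?J" for y
    using snoc.prems(3) unfolding regular_sequence_def by (auto dest!: spec[of _ "length xs"])
  have reg_pow: "x ^ k * y \<in> ?J \<Longrightarrow> y \<in> ?J" for k y
    by (induction k) (auto simp: mult.assoc dest: reg)
  define S where "S = {s * x ^ k | s k. s \<notin> P}"
  have "\<exists>Q. prime_ideal Q \<and> ?J \<subseteq> Q \<and> Q \<inter> S = {}"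
  proof (rule prime_avoiding)
    show "module.subspace (*) ?J" by (rule ideal_subspace)
    show "1 \<in> S" unfolding S_def using prime_ideal_D(2)[OF snoc.prems(1)] by (intro CollectI exI[of _ 1] exI[of _ 0]) auto
    fix s t assume "s \<in> S" "t \<in> S"
    then obtain a k b l where "s = a * x ^ k" "t = b * x ^ l" "a \<notin> P" "b \<notin> P" by (auto simp: S_def)
    then have "s * t = (a * b) * x ^ (k + l)" "a * b \<notin> P"
      using prime_ideal_D(3)[OF snoc.prems(1)] by (auto simp: power_add mult_ac)
    then show "s * t \<in> S" unfolding S_def by blast
  next
    show "?J \<inter> S = {}"
    proof (rule ccontr)
      assume "?J \<inter> S \<noteq> {}"
      then obtain s k where "x ^ k * s \<in> ?J" "s \<notin> P" by (auto simp: S_def mult.commute)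
      then show False using reg_pow JP by blast
    qed
  qed
  then obtain Q where Q: "prime_ideal Q" "?J \<subseteq> Q" "Q \<inter> S = {}" by blast
  have "Q \<subseteq> P"
  proof
    fix s assume "s \<in> Q"
    show "s \<in> P"
    proof (rule ccontr)
      assume "s \<notin> P"
      then have "s * x ^ 0 \<in> S" unfolding S_def by blast
      then show False using Q(3) \<open>s \<in> Q\<close> by auto
    qed
  qed
  moreover have "x \<notin> Q"
  proof -
    have "1 * x ^ 1 \<in> S" unfolding S_def using prime_ideal_D(2)[OF snoc.prems(1)] by blast
    then show ?thesis using Q(3) by auto
  qed
  ultimately have QP: "Q \<subset> P" using snoc.prems(2) by auto
  have "set xs \<subseteq> Q" using Q(2) ideal_base by blast
  moreover have "regular_sequence xs"
  proof -
    have "ideal_gen (set xs) \<subseteq> ideal_gen (set (xs @ [x]))"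
      by (rule module.span_mono[OF module_ring]) auto
    then have "ideal_gen (set xs) \<noteq> UNIV" using JP prime_ideal_D(2)[OF snoc.prems(1)] by auto
    moreover have "\<forall>i<length xs. \<forall>y. xs ! i * y \<in> ideal_gen (set (take i xs)) \<longrightarrow> y \<in> ideal_gen (set (take i xs))"
    proof (intro allI impI)
      fix i y assume "i < length xs" "xs ! i * y \<in> ideal_gen (set (take i xs))"
      then show "y \<in> ideal_gen (set (take i xs))"
        using snoc.prems(3) unfolding regular_sequence_def by (auto simp: nth_append dest!: spec[of _ i])
    qed
    ultimately show ?thesis by (simp add: regular_sequence_def)
  qed
  ultimately obtain R where R: "prime_chain (length xs) R" "R (length xs) = Q"
    using snoc.IH[OF Q(1)] by blast
  define R' where "R' i = (if i \<le> length xs then R i else P)" for i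
  have "prime_chain (Suc (length xs)) R'"
    unfolding prime_chain_def
  proof (intro conjI allI impI)
    fix i assume "i \<le> Suc (length xs)"
    then show "prime_ideal (R' i)" using R(1) snoc.prems(1) by (auto simp: R'_def prime_chain_def)
  next
    fix i assume i: "i < Suc (length xs)"
    then show "R' i \<subset> R' (Suc i)"
      using R QP by (cases "i = length xs") (auto simp: R'_def prime_chain_def)
  qed
  moreover have "R' (Suc (length xs)) = P" by (simp add: R'_def)
  ultimately have "prime_chain (length (xs @ [x])) R' \<and> R' (length (xs @ [x])) = P" by simp
  then show ?case by (rule exI[of _ R'])
qed

lemma prime_height_chain:
  "prime_height P = Sup {enat n | n. \<exists>Q. prime_chain n Q \<and> Q n = P}"
  unfolding prime_height_def prime_chain_def by (simp add: conj_assoc)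

lemma regular_pair_sequence:
  fixes f g :: "'a::idom"
  assumes "regular_pair f g" "ideal_gen {f, g} \<noteq> UNIV"
  shows "regular_sequence [f, g]"
  unfolding regular_sequence_def
proof (intro conjI allI impI)
  show "ideal_gen (set [f, g]) \<noteq> UNIV" using assms(2) by simp
  fix i y assume i: "i < length [f, g]" and y: "[f, g] ! i * y \<in> ideal_gen (set (take i [f, g]))"
  show "y \<in> ideal_gen (set (take i [f, g]))"
  proof (cases i)
    case 0
    have e: "[f, g] ! i = f" "set (take i [f, g]) = {}" using 0 by auto
    have "f * y = 0" using y unfolding e ideal_gen_empty by (rule singletonD)
    then have "y = 0" using assms(1) unfolding regular_pair_def by (metis mult_eq_0_iff)
    then show ?thesis unfolding e ideal_gen_empty by (simp only: singleton_iff)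
  next
    case (Suc k)
    then have i1: "i = 1" using i by simp
    have e: "[f, g] ! i = g" "set (take i [f, g]) = {f}" unfolding i1 by auto
    have "f dvd g * y" using y unfolding e ideal_gen_single by (rule CollectD)
    then have "f dvd y" using assms(1) unfolding regular_pair_def by blast
    then show ?thesis unfolding e ideal_gen_single by (rule CollectI)
  qed
qed

section \<open>Projective resolutions of a cyclic module\<close>

lemma scale_simps:
  "scale c (v + w) = scale c v + scale c (w :: nat \<Rightarrow>\<^sub>0 'a::comm_ring_1)"
  "scale (c + d) v = scale c v + scale d v" "scale c (scale d v) = scale (c * d) v" "scale 1 v = v" "scale 0 v = 0" "scale c 0 = 0"
  by (rule poly_mapping_eqI, simp add: lookup_scale lookup_add algebra_simps)+

lemma coset_mem: "a \<in> coset I x \<longleftrightarrow> (\<exists>y\<in>I. a = x + y)"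
  by (auto simp: coset_def)

lemma coset_eq_ideal:
  fixes I :: "'a::comm_ring_1 set"
  assumes I: "module.subspace (*) I" and a: "a \<in> I" "a \<in> coset I z"
  shows "coset I z = I"
proof -
  note Ii = subspace_ideal[OF I]
  obtain y where y: "y \<in> I" "a = z + y" using a(2) by (auto simp: coset_mem)
  then have "z = a - y" by simp
  then have z: "z \<in> I" using Ii(4)[OF a(1) y(1)] by (simp only:)
  show ?thesis
  proof (intro equalityI subsetI)
    fix x assume "x \<in> coset I z"
    then show "x \<in> I" using Ii(2)[OF z] by (auto simp: coset_mem)
  next
    fix x assume "x \<in> I"
    then have "x - z \<in> I" using Ii(4) z by blast
    moreover have "x = z + (x - z)" by simp
    ultimately show "x \<in> coset I z" unfolding coset_mem by blast
  qed
qed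

lemma coset_self: "module.subspace (*) I \<Longrightarrow> x \<in> coset I (x :: 'a::comm_ring_1)"
  unfolding coset_mem by (rule bexI[of _ 0]) (simp_all add: subspace_ideal(1))

text \<open>Comparing \<open>f p\<close> and \<open>g p\<close> in the kernel of \<open>P\<^sub>0 \<rightarrow> 'a/I\<close> shows that the kernel cannot be
  projective, since \<open>f, g\<close> are regular on a projective module.\<close>

lemma projective_resolution_length:
  fixes I :: "'a::idom set"
  assumes I: "module.subspace (*) I" "I \<noteq> UNIV" and fg: "f \<in> I" "g \<in> I" "regular_pair f g"
    and res: "projective_resolution I n P d e"
  shows "2 \<le> n"
proof (rule ccontr)
  assume n: "\<not> 2 \<le> n"
  note r = res[unfolded projective_resolution_def]
  have f0: "f \<noteq> 0" using fg(3) by (simp add: regular_pair_def)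
  have P2: "P 2 = {0}" using r n by auto
  have sub: "module.subspace scale {0 :: nat \<Rightarrow>\<^sub>0 'a}"
    unfolding module.subspace_def[OF module_scale] by (auto simp: scale_simps)
  have proj1: "projective (P 1)"
  proof (cases "n = 0")
    case True
    then have "P 1 = {0}" using r by auto
    moreover have "projective {0 :: nat \<Rightarrow>\<^sub>0 'a}"
      unfolding projective_def
    proof (intro conjI exI[of _ UNIV] allI)
      show "module.subspace scale (UNIV :: (nat \<Rightarrow>\<^sub>0 'a) set)"
        unfolding module.subspace_def[OF module_scale] by simp
      show "\<exists>p\<in>{0}. \<exists>q\<in>UNIV. v = p + q" for v :: "nat \<Rightarrow>\<^sub>0 'a"
        by (intro bexI[of _ 0] bexI[of _ v]) simp_all
    qed (simp_all add: sub)
    ultimately show ?thesis by simp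
  qed (use r n in auto)
  have sub1: "module.subspace scale (P 1)" using proj1 by (simp add: projective_def)
  have sub0: "module.subspace scale (P 0)" using r by (simp add: projective_def)
  note S1 = sub1[unfolded module.subspace_def[OF module_scale]] and S0 = sub0[unfolded module.subspace_def[OF module_scale]]
  have lin0: "linear_on scale (P 1) (P 0) (d 0)" and lin1: "linear_on scale (P 2) (P 1) (d 1)"
    using r by (simp_all add: numeral_2_eq_2)
  have add0: "d 0 (v + w) = d 0 v + d 0 w" if "v \<in> P 1" "w \<in> P 1" for v w using lin0 that by (auto simp: linear_on_def)
  have scale0: "d 0 (scale c v) = scale c (d 0 v)" if "v \<in> P 1" for c v using lin0 that by (auto simp: linear_on_def)
  have aug: "augmentation I (P 0) e" and ex0: "d 0 ` P 1 = {v \<in> P 0. e v = I}"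
    and ex1: "d 1 ` P 2 = {v \<in> P 1. d 0 v = 0}"
    using r by (simp_all add: numeral_2_eq_2)
  have "coset I 1 \<in> e ` P 0" using aug by (simp add: augmentation_def)
  then obtain p where p: "p \<in> P 0" "e p = coset I 1" by auto
  have ker: "scale h p \<in> {v \<in> P 0. e v = I}" if h: "h \<in> I" for h
  proof -
    have hp: "scale h p \<in> P 0" using S0 p(1) by blast
    have "1 \<in> e p" using p(2) coset_self[OF I(1)] by simp
    moreover have "\<forall>c. \<forall>v\<in>P 0. \<forall>x\<in>e v. c * x \<in> e (scale c v)" and eP: "e ` P 0 = range (coset I)"
      using aug unfolding augmentation_def by blast+
    ultimately have "h * 1 \<in> e (scale h p)" using p(1) by blast
    moreover obtain z where z: "e (scale h p) = coset I z"
      using eP hp by blast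
    ultimately have "h \<in> coset I z" by (simp only: mult_1_right)
    then have "coset I z = I" by (rule coset_eq_ideal[OF I(1) h])
    then have "e (scale h p) = I" using z by (simp only:)
    then show ?thesis using hp by blast
  qed
  have "scale f p \<in> d 0 ` P 1" "scale g p \<in> d 0 ` P 1" using ker[OF fg(1)] ker[OF fg(2)] ex0 by simp_all
  then obtain u v where uv: "u \<in> P 1" "v \<in> P 1" "d 0 u = scale f p" "d 0 v = scale g p" by auto
  have gu: "scale g u \<in> P 1" "scale (- f) v \<in> P 1" using S1 uv by blast+
  \<comment> \<open>With u and v over f p and g p, the element g u - f v is a cycle, and it vanishes
    because \<open>P 2\<close> is zero. Regularity applied to each coordinate then makes u divisible
    by f.\<close>
  have "d 0 (scale g u + scale (- f) v) = scale (g * f) p + scale (- f * g) p"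
    using gu uv by (simp add: add0 scale0 scale_simps)
  also have "\<dots> = 0" by (simp add: scale_simps(5) flip: scale_simps(2))
  finally have "scale g u + scale (- f) v \<in> d 1 ` P 2" using ex1 S1 gu by blast
  moreover have "d 1 0 = 0"
  proof -
    have "d 1 (scale 0 0) = scale 0 (d 1 0)" using lin1 P2 by (auto simp: linear_on_def)
    then show ?thesis by (simp add: scale_simps)
  qed
  ultimately have z: "scale g u + scale (- f) v = 0" using P2 by auto
  have guv: "g * Poly_Mapping.lookup u k = f * Poly_Mapping.lookup v k" for k
  proof -
    have "Poly_Mapping.lookup (scale g u + scale (- f) v) k = 0" by (simp only: z lookup_zero)
    then show ?thesis by (simp add: lookup_add lookup_scale)
  qed
  have "\<exists>w. u = scale f w"
  proof -
    have "\<exists>x. Poly_Mapping.lookup u k = f * x" for k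
    proof -
      have "f dvd g * Poly_Mapping.lookup u k" unfolding guv by (rule dvd_triv_left)
      then have "f dvd Poly_Mapping.lookup u k" using fg(3) unfolding regular_pair_def by blast
      then show ?thesis unfolding dvd_def .
    qed
    then obtain x where x: "\<And>k. Poly_Mapping.lookup u k = f * x k" by metis
    have "finite {k. x k \<noteq> 0}"
      by (rule finite_subset[OF _ finite_keys[of u]]) (auto simp: in_keys_iff x f0)
    then have "Poly_Mapping.lookup (Abs_poly_mapping x) = x" by simp
    then have "u = scale f (Abs_poly_mapping x)"
      by (intro poly_mapping_eqI) (simp add: lookup_scale x)
    then show ?thesis ..
  qed
  then obtain w where w: "u = scale f w" ..
  obtain Q where Q: "module.subspace scale Q" "P 1 \<inter> Q = {0}" "\<And>v. \<exists>p\<in>P 1. \<exists>q\<in>Q. v = p + q"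
    using proj1 unfolding projective_def by blast
  obtain p1 q1 where pq: "p1 \<in> P 1" "q1 \<in> Q" "w = p1 + q1" using Q(3) by blast
  \<comment> \<open>The quotient w = u / f has to be brought back into \<open>P 1\<close>. Since f w
    = u lies in \<open>P 1\<close>, f times the component of w in the complement lies in both
    summands, hence is zero. Then p = d w is a boundary although it maps to 1.\<close>
  have "scale f q1 = u + scale (-1) (scale f p1)"
    unfolding w pq(3) by (rule poly_mapping_eqI) (simp add: lookup_scale lookup_add algebra_simps)
  also have "\<dots> \<in> P 1" using S1 uv(1) pq(1) by blast
  finally have "scale f q1 \<in> P 1 \<inter> Q"
    using Q(1)[unfolded module.subspace_def[OF module_scale]] pq(2) by blast
  then have fq: "scale f q1 = 0" using Q(2) by blast
  have "q1 = 0"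
  proof (rule poly_mapping_eqI)
    fix k
    have "Poly_Mapping.lookup (scale f q1) k = 0" by (simp only: fq lookup_zero)
    then show "Poly_Mapping.lookup q1 k = Poly_Mapping.lookup 0 k" using f0 by (simp add: lookup_scale)
  qed
  then have wP: "w \<in> P 1" using pq by simp
  have "scale f (d 0 w) = scale f p" using scale0[OF wP] uv(3) w by simp
  have "d 0 w = p"
  proof (rule poly_mapping_eqI)
    fix k
    have "Poly_Mapping.lookup (scale f (d 0 w)) k = Poly_Mapping.lookup (scale f p) k"
      by (simp only: \<open>scale f (d 0 w) = scale f p\<close>)
    then show "Poly_Mapping.lookup (d 0 w) k = Poly_Mapping.lookup p k" using f0 by (simp add: lookup_scale)
  qed
  then have "p \<in> {v \<in> P 0. e v = I}" using ex0 wP by blast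
  then have "coset I 1 = I" using p(2) by simp
  then have "1 \<in> I" using coset_self[OF I(1), of 1] by simp
  then show False using ideal_one[OF I(1)] I(2) by simp
qed

definition coord_mod :: "nat \<Rightarrow> (nat \<Rightarrow>\<^sub>0 'a::comm_ring_1) set" where
  "coord_mod r = {v. \<forall>k\<ge>r. Poly_Mapping.lookup v k = 0}"

lemma subspace_coord: "module.subspace scale (coord_mod r)"
  unfolding module.subspace_def[OF module_scale] by (auto simp: coord_mod_def lookup_add lookup_scale)

lemma projective_coord: "projective (coord_mod r :: (nat \<Rightarrow>\<^sub>0 'a::comm_ring_1) set)"
  unfolding projective_def
proof (intro conjI exI allI)
  let ?Q = "{v :: nat \<Rightarrow>\<^sub>0 'a. \<forall>k<r. Poly_Mapping.lookup v k = 0}"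
  show "module.subspace scale (coord_mod r :: (nat \<Rightarrow>\<^sub>0 'a) set)" by (rule subspace_coord)
  show "module.subspace scale ?Q"
    unfolding module.subspace_def[OF module_scale] by (auto simp: lookup_add lookup_scale)
  show "coord_mod r \<inter> ?Q = {0}"
  proof
    show "coord_mod r \<inter> ?Q \<subseteq> {0}"
    proof
      fix v :: "nat \<Rightarrow>\<^sub>0 'a" assume v: "v \<in> coord_mod r \<inter> ?Q"
      have "v = 0"
      proof (rule poly_mapping_eqI)
        fix k show "Poly_Mapping.lookup v k = Poly_Mapping.lookup 0 k"
          using v by (cases "k < r") (auto simp: coord_mod_def)
      qed
      then show "v \<in> {0}" by simp
    qed
  qed (auto simp: coord_mod_def)
  fix v :: "nat \<Rightarrow>\<^sub>0 'a"
  define p where "p = (\<Sum>k<r. Poly_Mapping.single k (Poly_Mapping.lookup v k))"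
  have p: "Poly_Mapping.lookup p k = (if k < r then Poly_Mapping.lookup v k else 0)" for k
    by (auto simp: p_def lookup_sum lookup_single when_def)
  show "\<exists>p\<in>coord_mod r. \<exists>q\<in>?Q. v = p + q"
  proof (intro bexI)
    show "v = p + (v - p)" by simp
    show "v - p \<in> ?Q" by (auto simp: lookup_minus p)
    show "p \<in> coord_mod r" by (auto simp: coord_mod_def p)
  qed
qed

lemma lookup_sum_single: "Poly_Mapping.lookup (\<Sum>k<(r::nat). Poly_Mapping.single k (f k)) j = (if j < r then f j else 0)"
  unfolding lookup_sum lookup_single when_def by simp

text \<open>The maps are the row of minors and the matrix itself, on free modules of ranks 5, 6 and
  1. Exactness in the middle is \<open>hilbert_burch_exact\<close>, injectivity on the left is
  \<open>rows_independent\<close>.\<close>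

lemma hilbert_burch_resolution:
  fixes \<alpha> :: "nat \<Rightarrow> nat \<Rightarrow> 'a::idom"
  defines "I \<equiv> ideal_gen (cof \<alpha> ` {..<6})"
  assumes fg: "f \<in> I" "g \<in> I" "regular_pair f g"
  shows "\<exists>P d e. projective_resolution I 2 P d e"
proof -
  let ?l = Poly_Mapping.lookup
  define r :: "nat \<Rightarrow> nat" where "r i = (if i = 0 then 1 else if i = 1 then 6 else if i = 2 then 5 else 0)" for i
  define P :: "nat \<Rightarrow> (nat \<Rightarrow>\<^sub>0 'a) set" where "P i = coord_mod (r i)" for i
  define d :: "nat \<Rightarrow> (nat \<Rightarrow>\<^sub>0 'a) \<Rightarrow> (nat \<Rightarrow>\<^sub>0 'a)" where
    "d i v = (if i = 0 then Poly_Mapping.single 0 (\<Sum>j<6. cof \<alpha> j * ?l v j)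
      else if i = 1 then (\<Sum>j<6. Poly_Mapping.single j (\<Sum>i<5. ?l v i * \<alpha> i j)) else 0)" for i v
  define e :: "(nat \<Rightarrow>\<^sub>0 'a) \<Rightarrow> 'a set" where "e v = coset I (?l v 0)" for v
  have Is: "module.subspace (*) I" unfolding I_def by (rule ideal_subspace)
  have f0: "f \<noteq> 0" using fg(3) by (simp add: regular_pair_def)
  obtain k0 where k0: "k0 < 6" "cof \<alpha> k0 \<noteq> 0" using cof_nonzero[OF fg(1)[unfolded I_def] f0] by blast
  have Pz: "coord_mod 0 = {0 :: nat \<Rightarrow>\<^sub>0 'a}"
    by (auto simp: coord_mod_def intro: poly_mapping_eqI)
  have eI: "e v = I \<longleftrightarrow> ?l v 0 \<in> I" for v
  proof
    assume "e v = I"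
    then show "?l v 0 \<in> I" using coset_self[OF Is, of "?l v 0"] by (simp add: e_def)
  next
    assume "?l v 0 \<in> I"
    then show "e v = I" unfolding e_def using coset_eq_ideal[OF Is] coset_self[OF Is] by blast
  qed
  have l0: "?l (d 0 v) k = (if k = 0 then \<Sum>j<6. cof \<alpha> j * ?l v j else 0)" for v k
    by (simp add: d_def lookup_single when_def)
  have l1: "?l (d 1 v) j = (if j < 6 then \<Sum>i<5. ?l v i * \<alpha> i j else 0)" for v j
    by (simp add: d_def lookup_sum_single)
  have lin: "linear_on scale (P (Suc i)) (P i) (d i)" for i
    unfolding linear_on_def
  proof (intro conjI ballI allI)
    show "d i ` P (Suc i) \<subseteq> P i"
    proof (cases "i = 0 \<or> i = 1")
      case True
      then show ?thesis
        by (elim disjE) (auto simp: P_def r_def coord_mod_def l0 l1[unfolded One_nat_def])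
    next
      case False
      then have "d i v = 0" for v by (simp add: d_def)
      then show ?thesis by (auto simp: P_def coord_mod_def)
    qed
    fix v w
    show "d i (v + w) = d i v + d i w"
      by (rule poly_mapping_eqI)
        (simp add: d_def lookup_single lookup_add when_def lookup_sum_single ring_distribs sum.distrib)
  next
    fix c v
    have m: "cof \<alpha> j * (c * x) = c * (cof \<alpha> j * x)" "c * x * y = c * (x * y)" for j x y by (simp_all only: mult_ac)
    show "d i (scale c v) = scale c (d i v)"
      by (rule poly_mapping_eqI)
        (simp add: d_def lookup_single when_def lookup_sum_single lookup_scale m sum_distrib_left)
  qed
  have ex0: "d 0 ` P 1 = {v \<in> P 0. e v = I}"
  proof
    show "d 0 ` P 1 \<subseteq> {v \<in> P 0. e v = I}"
      by (auto simp: eI l0 P_def r_def coord_mod_def) (auto simp: I_def ideal_gen_image)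
    show "{v \<in> P 0. e v = I} \<subseteq> d 0 ` P 1"
    proof
      fix v assume v: "v \<in> {v \<in> P 0. e v = I}"
      then have "?l v 0 \<in> I" by (simp add: eI)
      then obtain x where x: "?l v 0 = (\<Sum>j<6. cof \<alpha> j * x j)"
        unfolding I_def ideal_gen_image by auto
      define w where "w = (\<Sum>k<6. Poly_Mapping.single k (x k))"
      have "v = d 0 w"
      proof (rule poly_mapping_eqI)
        fix k
        show "?l v k = ?l (d 0 w) k"
          using v x by (auto simp: l0 w_def lookup_sum_single P_def r_def coord_mod_def intro: sum.cong)
      qed
      moreover have "w \<in> P 1" by (auto simp: P_def r_def coord_mod_def w_def lookup_sum_single)
      ultimately show "v \<in> d 0 ` P 1" by blast
    qed
  qed
  have zero_iff: "d 0 v = 0 \<longleftrightarrow> (\<Sum>j<6. cof \<alpha> j * ?l v j) = 0" for v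
    by (simp add: d_def poly_mapping_eq_iff fun_eq_iff lookup_single when_def)
  have comp: "(\<Sum>j<6. cof \<alpha> j * \<alpha> i j) = 0" if i: "i < 5" for i
  proof -
    have "det (aug \<alpha> (\<alpha> i)) = 0"
      by (rule det_identical_rows[of _ 6 i 5]) (use i in \<open>auto simp: aug_def intro!: eq_vecI\<close>)
    then show ?thesis by (simp add: det_aug mult.commute)
  qed
  have ex1: "d (Suc i) ` P (Suc (Suc i)) = {v \<in> P (Suc i). d i v = 0}" for i
  proof -
    consider "i = 0" | "i = 1" | "i \<ge> 2" by linarith
    then show ?thesis
    proof cases
      case 1
      have "d 1 ` P 2 = {v \<in> P 1. d 0 v = 0}"
      proof
        show "d 1 ` P 2 \<subseteq> {v \<in> P 1. d 0 v = 0}"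
        proof
          fix y assume "y \<in> d 1 ` P 2"
          then obtain w where y: "y = d 1 w" by auto
          have "(\<Sum>j<6. cof \<alpha> j * ?l y j) = (\<Sum>j<6. \<Sum>i<5. ?l w i * (cof \<alpha> j * \<alpha> i j))"
            by (intro sum.cong refl) (simp add: y l1[unfolded One_nat_def] sum_distrib_left mult.left_commute)
          also have "\<dots> = (\<Sum>i<5. ?l w i * (\<Sum>j<6. cof \<alpha> j * \<alpha> i j))"
            by (subst sum.swap) (simp add: sum_distrib_left)
          also have "\<dots> = 0" by (intro sum.neutral) (auto simp: comp)
          finally have "d 0 y = 0" by (simp add: zero_iff)
          moreover have "y \<in> P 1" by (auto simp: y P_def r_def coord_mod_def l1[unfolded One_nat_def])
          ultimately show "y \<in> {v \<in> P 1. d 0 v = 0}" by blast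
        qed
        show "{v \<in> P 1. d 0 v = 0} \<subseteq> d 1 ` P 2"
        proof
          fix v assume v: "v \<in> {v \<in> P 1. d 0 v = 0}"
          then obtain \<beta> where \<beta>: "\<And>j. j < 6 \<Longrightarrow> ?l v j = (\<Sum>i<5. \<beta> i * \<alpha> i j)"
            using hilbert_burch_exact[OF fg(1,2)[unfolded I_def] fg(3), of "?l v"] by (auto simp: zero_iff)
          define w where "w = (\<Sum>k<5. Poly_Mapping.single k (\<beta> k))"
          have "v = d 1 w"
          proof (rule poly_mapping_eqI)
            fix k
            show "?l v k = ?l (d 1 w) k"
              using v \<beta>[of k] by (auto simp: l1[unfolded One_nat_def] w_def lookup_sum_single P_def r_def coord_mod_def intro: sum.cong)
          qed
          moreover have "w \<in> P 2" by (auto simp: P_def r_def coord_mod_def w_def lookup_sum_single)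
          ultimately show "v \<in> d 1 ` P 2" by blast
        qed
      qed
      then show ?thesis using 1 by (simp add: numeral_2_eq_2)
    next
      case 2
      have P3: "P 3 = {0}" by (simp add: P_def r_def Pz)
      have d2: "d 2 v = 0" for v by (simp add: d_def)
      have "{v \<in> P 2. d 1 v = 0} = {0}"
      proof
        show "{v \<in> P 2. d 1 v = 0} \<subseteq> {0}"
        proof
          fix v assume v: "v \<in> {v \<in> P 2. d 1 v = 0}"
          then have vP: "v \<in> P 2" and dv: "d 1 v = 0" by blast+
          have "?l v i = 0" if i: "i < 5" for i
          proof (rule rows_independent[OF k0 _ i])
            fix j :: nat assume j: "j < 6"
            have "?l (d 1 v) j = 0" unfolding dv by (rule lookup_zero)
            then show "(\<Sum>i<5. ?l v i * \<alpha> i j) = 0" unfolding l1 using j by (simp only: if_True)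
          qed
          moreover have "?l v i = 0" if "\<not> i < 5" for i
            using vP that unfolding P_def r_def coord_mod_def by simp
          ultimately have "v = 0" by (intro poly_mapping_eqI) (metis lookup_zero)
          then show "v \<in> {0}" by simp
        qed
        show "{0} \<subseteq> {v \<in> P 2. d 1 v = 0}"
          by (auto simp: P_def coord_mod_def d_def)
      qed
      then show ?thesis using 2 P3 d2 by (auto simp: numeral_2_eq_2 numeral_3_eq_3)
    next
      case 3
      then have "P (Suc i) = {0}" "P (Suc (Suc i)) = {0}" "\<And>v. d i v = 0" "\<And>v. d (Suc i) v = 0"
        by (simp_all add: P_def r_def Pz d_def)
      then show ?thesis by auto
    qed
  qed
  have aug: "augmentation I (P 0) e"
    unfolding augmentation_def
  proof (intro conjI ballI allI)
    show "e ` P 0 = range (coset I)"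
    proof
      show "e ` P 0 \<subseteq> range (coset I)" by (auto simp: e_def)
      show "range (coset I) \<subseteq> e ` P 0"
      proof
        fix X assume "X \<in> range (coset I)"
        then obtain x where "X = coset I x" by auto
        then have "X = e (Poly_Mapping.single 0 x)" by (simp add: e_def)
        moreover have "Poly_Mapping.single 0 x \<in> P 0" by (auto simp: P_def r_def coord_mod_def lookup_single when_def)
        ultimately show "X \<in> e ` P 0" by blast
      qed
    qed
    fix v w x y assume "x \<in> e v" "y \<in> e w"
    then obtain a b where "a \<in> I" "b \<in> I" "x = ?l v 0 + a" "y = ?l w 0 + b" by (auto simp: e_def coset_mem)
    then have "x + y = ?l (v + w) 0 + (a + b)" "a + b \<in> I" using subspace_ideal(2)[OF Is] by (simp_all add: lookup_add)
    then show "x + y \<in> e (v + w)" unfolding e_def coset_mem by blast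
  next
    fix c v x assume "x \<in> e v"
    then obtain a where a: "a \<in> I" "x = ?l v 0 + a" by (auto simp: e_def coset_mem)
    have "c * x = ?l (scale c v) 0 + c * a" by (simp add: a(2) lookup_scale ring_distribs)
    moreover have "c * a \<in> I" using subspace_ideal(3)[OF Is a(1)] .
    ultimately show "c * x \<in> e (scale c v)" unfolding e_def coset_mem by blast
  qed
  have "projective_resolution I 2 P d e"
    unfolding projective_resolution_def
    using lin aug ex0 ex1 by (auto simp: P_def projective_coord r_def Pz)
  then show ?thesis by blast
qed

text \<open>The pair f, g yields a chain of length two below every prime over the ideal, which
  bounds the height from below. Conversely any regular sequence in the ideal yields a chain below P,
  so the height of P bounds the grade as well as the height from above.\<close>

lemma perfect_height_two:
  fixes \<alpha> :: "nat \<Rightarrow> nat \<Rightarrow> 'a::idom"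
  defines "I \<equiv> ideal_gen (cof \<alpha> ` {..<6})"
  assumes fg: "f \<in> I" "g \<in> I" "regular_pair f g" and P: "prime_ideal P" "I \<subseteq> P" "prime_height P \<le> 2"
  shows "ideal_height I = 2" "perfect_ideal I"
proof -
  have Is: "module.subspace (*) I" unfolding I_def by (rule ideal_subspace)
  have two: "(2 :: enat) = enat 2" by (simp add: numeral_eq_enat)
  have fgI: "ideal_gen {f, g} \<subseteq> I" using fg Is by (intro ideal_minimal) auto
  have "1 \<notin> I" using P prime_ideal_D(2) by blast
  then have IU: "I \<noteq> UNIV" by auto
  then have rs: "regular_sequence [f, g]" using fgI by (intro regular_pair_sequence fg) auto
  have chain_height: "enat (length xs) \<le> prime_height Q" if "prime_ideal Q" "set xs \<subseteq> Q" "regular_sequence xs" for Q and xs :: "'a list"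
    using regular_sequence_prime_chain[OF that] unfolding prime_height_chain by (intro Sup_upper) blast
  have low: "2 \<le> prime_height Q" if "prime_ideal Q" "I \<subseteq> Q" for Q
    using chain_height[OF that(1) _ rs] fg that(2) unfolding two by (auto simp: numeral_2_eq_2)
  have PP: "P \<in> {P. prime_ideal P \<and> I \<subseteq> P}" using P by simp
  show "ideal_height I = 2"
  proof (rule antisym)
    show "ideal_height I \<le> 2" unfolding ideal_height_def using INF_lower[OF PP, of prime_height] P(3) by (rule order.trans)
    show "2 \<le> ideal_height I" unfolding ideal_height_def by (rule INF_greatest) (use low in auto)
  qed
  have "grade I = 2"
  proof (rule antisym)
    show "grade I \<le> 2"
      unfolding grade_def
    proof (rule Sup_least, clarify)
      fix xs assume "set xs \<subseteq> I" "regular_sequence xs"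
      then have "enat (length xs) \<le> prime_height P" using chain_height[OF P(1)] P(2) by blast
      then show "enat (length xs) \<le> 2" using P(3) by (rule order.trans)
    qed
    have "enat (length [f, g]) \<in> {enat (length xs) | xs. set xs \<subseteq> I \<and> regular_sequence xs}"
      using rs fg by (intro CollectI exI[of _ "[f, g]"]) auto
    then have "enat (length [f, g]) \<le> grade I" unfolding grade_def by (rule Sup_upper)
    then show "2 \<le> grade I" by (simp add: two numeral_2_eq_2)
  qed
  moreover have "proj_dim_quot I = 2"
  proof (rule antisym)
    show "proj_dim_quot I \<le> 2"
      unfolding proj_dim_quot_def two using hilbert_burch_resolution[OF fg[unfolded I_def]]
      by (intro Inf_lower) (auto simp: I_def)
    show "2 \<le> proj_dim_quot I"
      unfolding proj_dim_quot_def
    proof (rule Inf_greatest, clarify)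
      fix n Q d e assume "projective_resolution I n Q d e"
      then have "2 \<le> n" by (rule projective_resolution_length[OF Is IU fg])
      then show "2 \<le> enat n" by (simp add: two)
    qed
  qed
  ultimately show "perfect_ideal I" using Is IU by (simp add: perfect_ideal_def)
qed

section \<open>The minimal resolution\<close>

definition rd :: "quintic_ring \<Rightarrow> nat \<Rightarrow> bool" where
  "rd p n \<longleftrightarrow> (\<forall>m\<in>Poly_Mapping.keys p. mdeg m = n)"

lemma mdeg_6: "mdeg (m :: 6 \<Rightarrow>\<^sub>0 nat) = (\<Sum>v\<in>UNIV. Poly_Mapping.lookup m v)"
  unfolding mdeg_def by (rule sum.mono_neutral_left) (auto simp: in_keys_iff)

lemma mdeg_add: "mdeg (m + m') = mdeg m + mdeg (m' :: 6 \<Rightarrow>\<^sub>0 nat)"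
  by (simp add: mdeg_6 lookup_add sum.distrib)

lemma ring_deg_rd: "p \<in> ring_deg (int n) \<longleftrightarrow> rd p n"
  by (auto simp: ring_deg_def rd_def)

lemma ring_deg_add: "p \<in> ring_deg t \<Longrightarrow> q \<in> ring_deg t \<Longrightarrow> p + q \<in> ring_deg t"
  using keys_add[of p q] by (auto simp: ring_deg_def)

lemma ring_deg_0: "0 \<in> ring_deg t"
  by (simp add: ring_deg_def)

lemma ring_deg_sum: "(\<And>i. i \<in> S \<Longrightarrow> f i \<in> ring_deg t) \<Longrightarrow> sum f S \<in> ring_deg t"
  by (induction S rule: infinite_finite_induct) (auto intro: ring_deg_add ring_deg_0)

lemma ring_deg_mult: "p \<in> ring_deg s \<Longrightarrow> q \<in> ring_deg t \<Longrightarrow> p * q \<in> ring_deg (s + t)"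
  using keys_mult[of p q] by (fastforce simp: ring_deg_def mdeg_add)

lemma rd_cong: "rd p a \<Longrightarrow> a = b \<Longrightarrow> rd p b" by simp

lemma rd_mult: "rd p a \<Longrightarrow> rd q b \<Longrightarrow> rd (p * q) (a + b)"
  using ring_deg_mult[of p "int a" q "int b"] by (simp add: ring_deg_rd flip: of_nat_add)

lemma rd_add: "rd p a \<Longrightarrow> rd q b \<Longrightarrow> b = a \<Longrightarrow> rd (p + q) a"
  using ring_deg_add[of p "int a" q] by (simp add: ring_deg_rd)

lemma rd_uminus: "rd p a \<Longrightarrow> rd (- p) a"
  by (simp add: rd_def)

lemma rd_diff: "rd p a \<Longrightarrow> rd q b \<Longrightarrow> b = a \<Longrightarrow> rd (p - q) a"
  using rd_add[OF _ rd_uminus, of p a q b] by simp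

lemma rd_Const: "rd (Const c) 0"
  by (simp add: rd_def Const_def mdeg_def)

lemma rd_1: "rd 1 0"
  using rd_Const[of 1] by simp

lemma rd_numeral: "rd (numeral n) 0"
  using rd_Const[of "numeral n"] by (simp add: Const.hom_numeral)

lemma rd_av: "rd (av i) 1"
  by (simp add: rd_def av_def Var_def mdeg_def)

lemma rd_power: "rd p a \<Longrightarrow> rd (p ^ k) (k * a)"
  by (induction k) (simp_all add: rd_1 rd_mult)

lemma rd_sum: "(\<And>i. i \<in> S \<Longrightarrow> rd (f i) a) \<Longrightarrow> rd (sum f S) a"
  using ring_deg_sum[of S f "int a"] by (simp add: ring_deg_rd)

lemma rd_prod: "finite S \<Longrightarrow> (\<And>i. i \<in> S \<Longrightarrow> rd (f i) (e i)) \<Longrightarrow> rd (prod f S) (sum e S)"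
  by (induction S rule: finite_induct) (auto simp: rd_1 intro: rd_mult)

lemmas rd_rules = rd_add rd_diff rd_mult rd_power rd_uminus rd_numeral rd_Const rd_1 rd_av

lemma tq_simps:
  "tq a 0 = 2 * (a 0 * a 4 - 4 * a 1 * a 3 + 3 * a 2 ^ 2)" "tq a 1 = a 0 * a 5 - 3 * a 1 * a 4 + 2 * a 2 * a 3"
  "tq a 2 = 2 * (a 1 * a 5 - 4 * a 2 * a 4 + 3 * a 3 ^ 2)"
  by (simp_all add: tq_def)

lemma wq_simps:
  "wq a 0 = tq a 0 ^ 2" "wq a 1 = 4 * tq a 0 * tq a 1" "wq a 2 = 2 * tq a 0 * tq a 2 + 4 * tq a 1 ^ 2"
  "wq a 3 = 4 * tq a 1 * tq a 2" "wq a 4 = tq a 2 ^ 2"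
  by (simp_all add: wq_def)

lemma zq_simps:
  "zq a 0 = tq a 0 ^ 3" "zq a 1 = 6 * tq a 0 ^ 2 * tq a 1" "zq a 2 = 3 * tq a 0 ^ 2 * tq a 2 + 12 * tq a 0 * tq a 1 ^ 2"
  "zq a 3 = 12 * tq a 0 * tq a 1 * tq a 2 + 8 * tq a 1 ^ 3" "zq a 4 = 3 * tq a 0 * tq a 2 ^ 2 + 12 * tq a 1 ^ 2 * tq a 2"
  "zq a 5 = 6 * tq a 1 * tq a 2 ^ 2" "zq a 6 = tq a 2 ^ 3"
  by (simp_all add: zq_def)

lemma yq_simps:
  "yq a 0 = 2 * (a 0 * a 2 - a 1 ^ 2)" "yq a 1 = 6 * (a 0 * a 3 - a 1 * a 2)" "yq a 2 = 6 * (a 0 * a 4 + a 1 * a 3 - 2 * a 2 ^ 2)"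
  "yq a 3 = 2 * (a 0 * a 5 + 7 * a 1 * a 4 - 8 * a 2 * a 3)" "yq a 4 = 6 * (a 1 * a 5 + a 2 * a 4 - 2 * a 3 ^ 2)"
  "yq a 5 = 6 * (a 2 * a 5 - a 3 * a 4)" "yq a 6 = 2 * (a 3 * a 5 - a 4 ^ 2)"
  by (simp_all add: yq_def)

lemma pq_simps:
  "pq a 0 = rq a 0 * tq a 0" "pq a 1 = 2 * rq a 0 * tq a 1 + 3 * rq a 1 * tq a 0"
  "pq a 2 = rq a 0 * tq a 2 + 6 * rq a 1 * tq a 1 + 3 * rq a 2 * tq a 0"
  "pq a 3 = 3 * rq a 1 * tq a 2 + 6 * rq a 2 * tq a 1 + rq a 3 * tq a 0"
  "pq a 4 = 3 * rq a 2 * tq a 2 + 2 * rq a 3 * tq a 1" "pq a 5 = rq a 3 * tq a 2"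
  by (simp_all add: pq_def)

lemma qq_simps:
  "qq a 0 = sq a 0 * wq a 0" "qq a 1 = sq a 0 * wq a 1 + sq a 1 * wq a 0" "qq a 2 = sq a 0 * wq a 2 + sq a 1 * wq a 1"
  "qq a 3 = sq a 0 * wq a 3 + sq a 1 * wq a 2" "qq a 4 = sq a 0 * wq a 4 + sq a 1 * wq a 3" "qq a 5 = sq a 1 * wq a 4"
  by (simp_all add: qq_def)

lemma rd_tq: "rd (tq av 0) 2" "rd (tq av 1) 2" "rd (tq av 2) 2"
  unfolding tq_simps by (rule rd_cong, (rule rd_rules | simp add: numeral_2_eq_2[symmetric] del: One_nat_def)+)+

lemma rd_wq: "rd (wq av 0) 4" "rd (wq av 1) 4" "rd (wq av 2) 4" "rd (wq av 3) 4" "rd (wq av 4) 4"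
  unfolding wq_simps by (rule rd_cong, (rule rd_rules rd_tq | simp add: numeral_2_eq_2[symmetric] del: One_nat_def)+)+

lemma rd_zq: "i \<le> 6 \<Longrightarrow> rd (zq av i) 6"
proof -
  have "rd (zq av 0) 6" "rd (zq av 1) 6" "rd (zq av 2) 6" "rd (zq av 3) 6" "rd (zq av 4) 6" "rd (zq av 5) 6" "rd (zq av 6) 6"
    unfolding zq_simps by (rule rd_cong, (rule rd_rules rd_tq | simp add: numeral_2_eq_2[symmetric] del: One_nat_def)+)+
  then show "i \<le> 6 \<Longrightarrow> rd (zq av i) 6" unfolding le_cases by blast
qed

lemma rd_yq: "i \<le> 6 \<Longrightarrow> rd (yq av i) 2"
proof -
  have "rd (yq av 0) 2" "rd (yq av 1) 2" "rd (yq av 2) 2" "rd (yq av 3) 2" "rd (yq av 4) 2" "rd (yq av 5) 2" "rd (yq av 6) 2"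
    unfolding yq_simps by (rule rd_cong, (rule rd_rules | simp add: numeral_2_eq_2[symmetric] del: One_nat_def)+)+
  then show "i \<le> 6 \<Longrightarrow> rd (yq av i) 2" unfolding le_cases by blast
qed

lemma rd_rq: "rd (rq av k) 3"
  unfolding rq_def by (rule rd_cong, (rule rd_rules rd_tq | simp add: numeral_2_eq_2[symmetric] del: One_nat_def)+)

lemma rd_sq: "rd (sq av k) 5"
  unfolding sq_def by (rule rd_cong, (rule rd_rules rd_wq | simp add: numeral_2_eq_2[symmetric] del: One_nat_def)+)

lemma rd_I4: "rd (I4 av) 4"
  unfolding I4_def by (rule rd_cong, (rule rd_rules rd_tq | simp add: numeral_2_eq_2[symmetric] del: One_nat_def)+)

lemma rd_I8: "rd (I8 Const av) 8"
  unfolding I8_def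
proof (rule rd_sum)
  fix i assume "i \<in> {..6::nat}"
  then have "i \<le> 6" "6 - i \<le> 6" by auto
  from rd_mult[OF rd_mult[OF rd_power[OF rd_uminus[OF rd_1], of i] rd_zq[OF this(1)]]
      rd_mult[OF rd_Const[of "1 / of_nat (6 choose (6 - i))"] rd_yq[OF this(2)]]]
  show "rd ((- 1) ^ i * zq av i * (Const (1 / complex_of_nat (6 choose (6 - i))) * yq av (6 - i))) 8" by simp
qed

lemma rd_pq: "j < 6 \<Longrightarrow> rd (pq av j) 5"
proof -
  have "rd (pq av 0) 5" "rd (pq av 1) 5" "rd (pq av 2) 5" "rd (pq av 3) 5" "rd (pq av 4) 5" "rd (pq av 5) 5"
    unfolding pq_simps by (rule rd_cong, (rule rd_rules rd_tq rd_rq | simp add: numeral_2_eq_2[symmetric] del: One_nat_def)+)+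
  moreover assume "j < 6"
  then have "j \<le> 5" by simp
  ultimately show "rd (pq av j) 5" unfolding le_cases by blast
qed

lemma rd_qq: "j < 6 \<Longrightarrow> rd (qq av j) 9"
proof -
  have "rd (qq av 0) 9" "rd (qq av 1) 9" "rd (qq av 2) 9" "rd (qq av 3) 9" "rd (qq av 4) 9" "rd (qq av 5) 9"
    unfolding qq_simps by (rule rd_cong, (rule rd_rules rd_wq rd_sq | simp add: numeral_2_eq_2[symmetric] del: One_nat_def)+)+
  moreover assume "j < 6"
  then have "j \<le> 5" by simp
  ultimately show "rd (qq av j) 9" unfolding le_cases by blast
qed

definition row_deg :: "nat \<Rightarrow> nat" where
  "row_deg i = (if i < 3 then 1 else if i = 3 then 5 else 9)"

lemma rd_alpha:
  assumes "j < 6" shows "rd (alpha Const av \<tau> i j) (row_deg i)"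
proof (cases \<tau>)
  case (fields \<alpha> \<beta> \<gamma>)
  have E: "rd (rowE Const av j) 1" "rd (rowH Const av j) 1" "rd (rowF Const av j) 1"
    unfolding rowE_def rowH_def rowF_def by (rule rd_cong, (rule rd_rules | simp add: numeral_2_eq_2[symmetric] del: One_nat_def)+)+
  have U: "rd (rowU Const av \<alpha> j) 5"
    unfolding rowU_def by (rule rd_cong, (rule rd_rules rd_pq[OF assms] rd_I4 | simp add: numeral_2_eq_2[symmetric] del: One_nat_def)+)
  have V: "rd (rowV Const av \<beta> \<gamma> j) 9"
    unfolding rowV_def by (rule rd_cong, (rule rd_rules rd_qq[OF assms] rd_I4 rd_I8 | simp add: numeral_2_eq_2[symmetric] del: One_nat_def)+)
  show ?thesis using E U V unfolding fields row_deg_def alpha.simps by (simp add: numeral_3_eq_3 less_Suc_eq)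
qed

text \<open>Each term of the determinant takes one entry from every row, so its degree is 1 + 1 + 1
  + 5 + 9.\<close>

lemma rd_gcof: "rd (gcof \<tau> j) 17"
proof -
  let ?A = "mat_delete (mat 6 6 (\<lambda>(i, k). if i < 5 then alpha Const av \<tau> i k else 0)) 5 j"
  have A: "?A \<in> carrier_mat 5 5" by (simp add: mat_delete_def)
  have entry: "rd (?A $$ (i, k)) (row_deg i)" if "i < 5" "k < 5" for i k
    using that by (auto simp: mat_delete_def rd_alpha)
  have "rd (det ?A) 17"
    unfolding det_def'[OF A]
  proof (rule rd_sum)
    fix p assume "p \<in> {p. p permutes {0..<5::nat}}"
    then have p: "p permutes {0..<5}" by simp
    have s: "sum row_deg {0..<5} = 17" by (simp add: row_deg_def numeral_eq_Suc)
    have "rd (\<Prod>i = 0..<5. ?A $$ (i, p i)) (sum row_deg {0..<5})"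
    proof (rule rd_prod)
      fix i assume i: "i \<in> {0..<5::nat}"
      then have "p i \<in> {0..<5}" using permutes_in_image[OF p] by blast
      then show "rd (?A $$ (i, p i)) (row_deg i)" using entry i by simp
    qed simp
    moreover have "rd (signof p) 0" by (simp add: sign_def rd_1 rd_uminus)
    ultimately show "rd (signof p * (\<Prod>i = 0..<5. ?A $$ (i, p i))) 17"
      using rd_mult[of "signof p" 0] s by simp
  qed
  then show ?thesis
    unfolding cof_def cofactor_def using rd_mult[OF rd_power[OF rd_uminus[OF rd_1], of "5 + j"]] by simp
qed

lemma irrelevant_rd: "rd p n \<Longrightarrow> n > 0 \<Longrightarrow> p \<in> irrelevant_ideal"
proof -
  assume p: "rd p n" and n: "n > 0"
  have "Poly_Mapping.single m (Poly_Mapping.lookup p m) \<in> irrelevant_ideal" if m: "m \<in> Poly_Mapping.keys p" for m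
  proof -
    have "mdeg m = n" using p m by (simp add: rd_def)
    then have "Poly_Mapping.keys m \<noteq> {}" using n by (auto simp: mdeg_def)
    then obtain v where v: "v \<in> Poly_Mapping.keys m" by blast
    have "m = (m - Poly_Mapping.single v 1) + Poly_Mapping.single v 1"
      using v by (intro poly_mapping_eqI) (auto simp: lookup_add lookup_minus lookup_single when_def in_keys_iff)
    then have "Poly_Mapping.single m (Poly_Mapping.lookup p m) =
        Poly_Mapping.single (m - Poly_Mapping.single v 1) (Poly_Mapping.lookup p m) * Var v"
      unfolding Var_def mult_single by simp
    then show ?thesis
      unfolding irrelevant_ideal_def by (simp only:) (intro ideal_scale ideal_base rangeI)
  qed
  then have "(\<Sum>m\<in>Poly_Mapping.keys p. Poly_Mapping.single m (Poly_Mapping.lookup p m)) \<in> irrelevant_ideal"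
    unfolding irrelevant_ideal_def by (rule module.span_sum[OF module_ring])
  then show ?thesis by (simp flip: mpol_sum_single)
qed

section \<open>The two differentials\<close>

definition pairing :: "rat \<times> rat \<times> rat \<Rightarrow> (nat \<Rightarrow> quintic_ring) \<Rightarrow> quintic_ring" where
  "pairing \<tau> v = Const (120 ^ 5) * (\<Sum>j<6. gcof \<tau> j * v j)"

text \<open>The alternating signs of the full transvectant and those in the coefficients of \<Gamma>
  combine to one, and both reverse the index. Contraction with \<Gamma> is therefore the pairing
  with the minors, and as a transvectant it is visibly equivariant.\<close>

lemma transvectant_Gamma: "transvectant 5 5 (cov_Gamma \<tau>) (nform 5 v) 5 = Const (pairing \<tau> v)"
proof -
  let ?p = "\<lambda>i. Const (120 ^ 5) * (- ((-1) ^ (5 - i) * gcof \<tau> (5 - i)))"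
  have "transvectant 5 5 (cov_Gamma \<tau>) (nform 5 v) 5 = nform 0 (\<lambda>k. \<Sum>i\<le>5. (-1) ^ i * ?p i * v (k + (5 - i)))"
    unfolding cov_Gamma_pform by (subst transvectant_full) auto
  also have "\<dots> = Const (\<Sum>i\<le>5. (-1) ^ i * ?p i * v (5 - i))"
    by (simp add: nform_def pform_def)
  also have "(\<Sum>i\<le>5. (-1) ^ i * ?p i * v (5 - i)) = (\<Sum>i\<le>5. Const (120 ^ 5) * (gcof \<tau> (5 - i) * v (5 - i)))"
  proof (rule sum.cong)
    fix i assume "i \<in> {..5::nat}"
    then have i: "i \<le> 5" by simp
    have "(-1 :: quintic_ring) ^ i * (-1) ^ (5 - i) = (-1) ^ (i + (5 - i))" by (rule power_add[symmetric])
    also have "i + (5 - i) = 5" using i by simp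
    finally have s: "(-1 :: quintic_ring) ^ i * (-1) ^ (5 - i) = -1" by simp
    have "(-1) ^ i * ?p i * v (5 - i) = - ((-1) ^ i * (-1) ^ (5 - i)) * (Const (120 ^ 5) * (gcof \<tau> (5 - i) * v (5 - i)))"
      by (simp only: mult_minus_right mult_minus_left mult_ac)
    then show "(-1) ^ i * ?p i * v (5 - i) = Const (120 ^ 5) * (gcof \<tau> (5 - i) * v (5 - i))"
      unfolding s by (simp only: minus_minus mult_1_left)
  qed simp
  also have "\<dots> = (\<Sum>j\<le>5. Const (120 ^ 5) * (gcof \<tau> j * v j))"
    by (rule sum.reindex_bij_witness[where i = "\<lambda>i. 5 - i" and j = "\<lambda>i. 5 - i"]) auto
  also have "{..5} = {..<6::nat}" by auto
  finally show ?thesis by (simp only: pairing_def sum_distrib_left)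
qed

lemma nform_sum: "nform n (\<lambda>j. \<Sum>i\<in>A. f i j) = (\<Sum>i\<in>A. nform n (f i))"
proof (induction A rule: infinite_finite_induct)
  case (insert x F)
  then show ?case by (simp add: nform_add)
qed (simp_all add: nform_def pform_def)

text \<open>The matrix of rows without coordinates: the first three rows assemble to the contraction
  of a quadratic form with the generic quintic. The row degrees 1, 5, 9 explain the twists 18, 22,
  26 as 17 plus the degree.\<close>

definition relations :: "rat \<times> rat \<times> rat \<Rightarrow> quintic_ring bform \<Rightarrow> quintic_ring bform \<Rightarrow> quintic_ring bform \<Rightarrow> quintic_ring bform" where
  "relations \<tau> q a b = transvectant 2 5 q generic_quintic 1 + a * cov_U (fst \<tau>) + b * cov_V (fst (snd \<tau>)) (snd (snd \<tau>))"

lemma relations_nform: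
  "relations \<tau> (pform 2 \<beta>) (Const (\<beta> 3)) (Const (\<beta> 4)) = nform 5 (\<lambda>j. \<Sum>i<5. \<beta> i * alpha Const av \<tau> i j)"
proof -
  obtain \<alpha> b \<gamma> where \<tau>: "\<tau> = (\<alpha>, b, \<gamma>)" by (cases \<tau>)
  have q: "pform 2 \<beta> = Const (\<beta> 0) * x1 ^ 2 + (Const (\<beta> 1) * (x1 * x2) + Const (\<beta> 2) * x2 ^ 2)"
    by (simp add: pform_def atMost_simps add_ac mult_ac)
  have r: "alpha Const av \<tau> 0 = rowE Const av" "alpha Const av \<tau> 1 = rowH Const av" "alpha Const av \<tau> 2 = rowF Const av"
    "alpha Const av \<tau> 3 = rowU Const av \<alpha>" "alpha Const av \<tau> 4 = rowV Const av b \<gamma>"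
    by (simp_all add: fun_eq_iff \<tau>)
  have "nform 5 (\<lambda>j. \<Sum>i<5. \<beta> i * alpha Const av \<tau> i j) = (\<Sum>i<5. Const (\<beta> i) * nform 5 (alpha Const av \<tau> i))"
    unfolding nform_sum nform_Const_mult ..
  also have "\<dots> = Const (\<beta> 0) * nform 5 (rowE Const av) + Const (\<beta> 1) * nform 5 (rowH Const av) + Const (\<beta> 2) * nform 5 (rowF Const av)
      + Const (\<beta> 3) * nform 5 (rowU Const av \<alpha>) + Const (\<beta> 4) * nform 5 (rowV Const av b \<gamma>)"
    unfolding lessThan_5 by (simp add: r add_ac del: alpha.simps One_nat_def)
  also have "\<dots> = relations \<tau> (pform 2 \<beta>) (Const (\<beta> 3)) (Const (\<beta> 4))"
    unfolding relations_def q transvectant_add_left transvectant_Const_left transvectant_rows \<tau> fst_conv snd_conv cov_U_nform cov_V_nform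
    by (simp only: add_ac)
  finally show ?thesis by simp
qed

lemma forms_nform:
  fixes A :: "quintic_ring bform"
  assumes "A \<in> forms n" shows "\<exists>v. A = nform n v \<and> (\<forall>i. v i = Const (1 / of_nat (n choose i)) * Poly_Mapping.lookup A (bmon n i))"
  using forms_pform[OF assms] unfolding pform_nform by blast

lemma lookup_map_mult: "Poly_Mapping.lookup (scale_free p v) k = Const p * Poly_Mapping.lookup v k"
  by (auto simp: scale_free_def map.rep_eq when_def)

lemma lookup_act_free: "Poly_Mapping.lookup (act_free g v) k = act_cov g (Poly_Mapping.lookup v k)"
proof -
  have "act_cov g 0 = 0" by (simp add: act_cov_def subst_poly_def)
  then show ?thesis by (auto simp: act_free_def map.rep_eq when_def)
qed

lemma pform_lookup_closed:
  assumes "0 \<in> X" "\<And>i. i \<le> n \<Longrightarrow> p i \<in> X" shows "Poly_Mapping.lookup (pform n p) m \<in> X"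
proof (cases "m \<in> bmon n ` {..n}")
  case True
  then show ?thesis using assms(2) by (auto simp: lookup_pform)
next
  case False
  then have "Poly_Mapping.lookup (pform n p) m = 0" using keys_pform[of n p] by (auto simp: in_keys_iff subset_iff)
  then show ?thesis using assms(1) by simp
qed

lemma nform_lookup_closed:
  assumes "0 \<in> X" "\<And>i. i \<le> n \<Longrightarrow> of_nat (n choose i) * p i \<in> X" shows "Poly_Mapping.lookup (nform n p) m \<in> X"
  unfolding nform_def by (rule pform_lookup_closed) (use assms in auto)

lemma ring_deg_Const_mult: "p \<in> ring_deg t \<Longrightarrow> Const c * p \<in> ring_deg t"
  using ring_deg_mult[of "Const c" 0 p t] by (simp add: ring_deg_def Const_def mdeg_def)

lemma ring_deg_of_nat_mult: "p \<in> ring_deg t \<Longrightarrow> of_nat n * p \<in> ring_deg t"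
  using ring_deg_Const_mult[of p t "of_nat n"] by (simp add: Const.hom_of_nat)

lemma transvectant_add_right: "transvectant m n A (B + B') r = transvectant m n A B r + transvectant m n A B' r"
  by (cases "r \<le> min m n")
    (simp_all only: transvectant_omega transvectant_big omega_add_right ring_distribs not_False_eq_True add_0)

lemma transvectant_Const_right: "transvectant m n A (Const c * B) r = Const c * transvectant m n A B r"
  by (cases "r \<le> min m n")
    (simp_all only: transvectant_omega transvectant_big omega_Const_right mult.left_commute not_False_eq_True mult_zero_right)

lemma lookup_Const_0: "Poly_Mapping.lookup (Const c) m = (if m = 0 then c else 0)"
  by (auto simp: Const_def lookup_single when_def)

lemma Gamma_rows_zero: "i < 5 \<Longrightarrow> (\<Sum>j<6. gcof \<tau> j * alpha Const av \<tau> i j) = 0"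
proof -
  assume i: "i < 5"
  have "det (aug (alpha Const av \<tau>) (alpha Const av \<tau> i)) = 0"
    by (rule det_identical_rows[of _ 6 i 5]) (use i in \<open>auto simp: aug_def simp del: alpha.simps intro!: eq_vecI\<close>)
  then show ?thesis by (simp only: det_aug mult.commute)
qed

definition res_d :: "rat \<times> rat \<times> rat \<Rightarrow> nat \<Rightarrow> (nat \<Rightarrow>\<^sub>0 quintic_ring bform) \<Rightarrow> (nat \<Rightarrow>\<^sub>0 quintic_ring bform)" where
  "res_d \<tau> i v = (if i = 0 then Poly_Mapping.single 0 (transvectant 5 5 (cov_Gamma \<tau>) (Poly_Mapping.lookup v 0) 5)
     else if i = 1 then Poly_Mapping.single 0 (relations \<tau> (Poly_Mapping.lookup v 0) (Poly_Mapping.lookup v 1) (Poly_Mapping.lookup v 2))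
     else 0)"

definition res_L :: "nat \<Rightarrow> (nat \<times> nat) list" where
  "res_L i = (if i = 0 then [(0, 0)] else if i = 1 then [(17, 5)] else if i = 2 then [(18, 2), (22, 0), (26, 0)] else [])"

lemma free_mod_iff:
  "v \<in> free_mod (res_L 0) \<longleftrightarrow> Poly_Mapping.lookup v 0 \<in> forms 0 \<and> (\<forall>j\<ge>1. Poly_Mapping.lookup v j = 0)"
  "v \<in> free_mod (res_L 1) \<longleftrightarrow> Poly_Mapping.lookup v 0 \<in> forms 5 \<and> (\<forall>j\<ge>1. Poly_Mapping.lookup v j = 0)"
  "v \<in> free_mod (res_L 2) \<longleftrightarrow> Poly_Mapping.lookup v 0 \<in> forms 2 \<and> Poly_Mapping.lookup v 1 \<in> forms 0 \<and>
     Poly_Mapping.lookup v 2 \<in> forms 0 \<and> (\<forall>j\<ge>3. Poly_Mapping.lookup v j = 0)"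
  "i \<ge> 3 \<Longrightarrow> v \<in> free_mod (res_L i) \<longleftrightarrow> v = 0"
proof -
  have l3: "j < 3 \<longleftrightarrow> j = 0 \<or> j = 1 \<or> j = 2" for j :: nat by auto
  show "v \<in> free_mod (res_L 0) \<longleftrightarrow> Poly_Mapping.lookup v 0 \<in> forms 0 \<and> (\<forall>j\<ge>1. Poly_Mapping.lookup v j = 0)"
    "v \<in> free_mod (res_L 1) \<longleftrightarrow> Poly_Mapping.lookup v 0 \<in> forms 5 \<and> (\<forall>j\<ge>1. Poly_Mapping.lookup v j = 0)"
    by (auto simp: free_mod_def res_L_def)
  have len: "length (res_L 2) = 3" by (simp add: res_L_def)
  have e: "snd (res_L 2 ! 0) = 2" "snd (res_L 2 ! 1) = 0" "snd (res_L 2 ! 2) = 0" by (simp_all add: res_L_def)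
  show "v \<in> free_mod (res_L 2) \<longleftrightarrow> Poly_Mapping.lookup v 0 \<in> forms 2 \<and> Poly_Mapping.lookup v 1 \<in> forms 0 \<and>
     Poly_Mapping.lookup v 2 \<in> forms 0 \<and> (\<forall>j\<ge>3. Poly_Mapping.lookup v j = 0)"
    unfolding free_mod_def len mem_Collect_eq
  proof
    assume a: "\<forall>j. if j < 3 then Poly_Mapping.lookup v j \<in> forms (snd (res_L 2 ! j)) else Poly_Mapping.lookup v j = 0"
    show "Poly_Mapping.lookup v 0 \<in> forms 2 \<and> Poly_Mapping.lookup v 1 \<in> forms 0 \<and>
     Poly_Mapping.lookup v 2 \<in> forms 0 \<and> (\<forall>j\<ge>3. Poly_Mapping.lookup v j = 0)"
      using a[rule_format, of 0] a[rule_format, of 1] a[rule_format, of 2] a unfolding e by (simp add: not_less)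
  next
    assume a: "Poly_Mapping.lookup v 0 \<in> forms 2 \<and> Poly_Mapping.lookup v 1 \<in> forms 0 \<and>
     Poly_Mapping.lookup v 2 \<in> forms 0 \<and> (\<forall>j\<ge>3. Poly_Mapping.lookup v j = 0)"
    show "\<forall>j. if j < 3 then Poly_Mapping.lookup v j \<in> forms (snd (res_L 2 ! j)) else Poly_Mapping.lookup v j = 0"
    proof
      fix j show "if j < 3 then Poly_Mapping.lookup v j \<in> forms (snd (res_L 2 ! j)) else Poly_Mapping.lookup v j = 0"
        using a e by (cases "j < 3") (auto simp: l3 not_less simp del: One_nat_def)
    qed
  qed
  show "i \<ge> 3 \<Longrightarrow> v \<in> free_mod (res_L i) \<longleftrightarrow> v = 0"
    by (auto simp: free_mod_def res_L_def intro: poly_mapping_eqI)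
qed

lemma relations_eq:
  assumes "v \<in> free_mod (res_L 2)"
  shows "\<exists>\<beta>. Poly_Mapping.lookup v 0 = pform 2 \<beta> \<and> Poly_Mapping.lookup v 1 = Const (\<beta> 3) \<and> Poly_Mapping.lookup v 2 = Const (\<beta> 4) \<and>
    (\<forall>i<3. \<beta> i = Poly_Mapping.lookup (Poly_Mapping.lookup v 0) (bmon 2 i)) \<and>
    \<beta> 3 = Poly_Mapping.lookup (Poly_Mapping.lookup v 1) 0 \<and> \<beta> 4 = Poly_Mapping.lookup (Poly_Mapping.lookup v 2) 0 \<and>
    (\<forall>\<tau>. relations \<tau> (Poly_Mapping.lookup v 0) (Poly_Mapping.lookup v 1) (Poly_Mapping.lookup v 2) =
      nform 5 (\<lambda>j. \<Sum>i<5. \<beta> i * alpha Const av \<tau> i j))"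
proof -
  let ?l = Poly_Mapping.lookup
  define \<beta> where "\<beta> i = (if i = 3 then ?l (?l v 1) 0 else if i = 4 then ?l (?l v 2) 0 else ?l (?l v 0) (bmon 2 i))" for i
  have "?l v 0 = pform 2 (\<lambda>i. ?l (?l v 0) (bmon 2 i))"
    using assms by (intro forms_pform) (simp add: free_mod_iff)
  also have "\<dots> = pform 2 \<beta>" by (rule pform_cong) (simp add: \<beta>_def)
  finally have 0: "?l v 0 = pform 2 \<beta>" .
  have 1: "?l v 1 = Const (\<beta> 3)" "?l v 2 = Const (\<beta> 4)"
    using assms forms_0_Const[of "?l v 1"] forms_0_Const[of "?l v 2"] by (simp_all add: free_mod_iff \<beta>_def)
  show ?thesis
  proof (intro exI[of _ \<beta>] conjI allI)
    show "relations \<tau> (?l v 0) (?l v 1) (?l v 2) = nform 5 (\<lambda>j. \<Sum>i<5. \<beta> i * alpha Const av \<tau> i j)" for \<tau>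
      unfolding 0 1 by (rule relations_nform)
  qed (use 0 1 in \<open>auto simp: \<beta>_def\<close>)
qed

lemma irrelevant_subspace: "module.subspace (*) irrelevant_ideal"
  unfolding irrelevant_ideal_def by (rule ideal_subspace)

lemma irrelevant_mult_left: "x \<in> irrelevant_ideal \<Longrightarrow> c * x \<in> irrelevant_ideal"
  and irrelevant_mult_right: "x \<in> irrelevant_ideal \<Longrightarrow> x * c \<in> irrelevant_ideal"
  and irrelevant_sum: "(\<And>i. i \<in> S \<Longrightarrow> F i \<in> irrelevant_ideal) \<Longrightarrow> sum F S \<in> irrelevant_ideal"
  and irrelevant_0: "0 \<in> irrelevant_ideal"
proof -
  show *: "x \<in> irrelevant_ideal \<Longrightarrow> c * x \<in> irrelevant_ideal" for x c
    by (rule subspace_ideal(3)[OF irrelevant_subspace])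
  show "x \<in> irrelevant_ideal \<Longrightarrow> x * c \<in> irrelevant_ideal" using *[of x c] by (simp add: mult.commute)
  show "(\<And>i. i \<in> S \<Longrightarrow> F i \<in> irrelevant_ideal) \<Longrightarrow> sum F S \<in> irrelevant_ideal"
    unfolding irrelevant_ideal_def by (rule module.span_sum[OF module_ring])
  show "0 \<in> irrelevant_ideal" by (rule subspace_ideal(1)[OF irrelevant_subspace])
qed

lemma free_mod_Suc0: "v \<in> free_mod (res_L (Suc 0)) \<Longrightarrow> Poly_Mapping.lookup v 0 \<in> forms 5"
  using free_mod_iff(2) unfolding One_nat_def by blast

lemma res_d_lookup:
  "Poly_Mapping.lookup (res_d \<tau> 0 v) k = (if k = 0 then transvectant 5 5 (cov_Gamma \<tau>) (Poly_Mapping.lookup v 0) 5 else 0)"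
  "Poly_Mapping.lookup (res_d \<tau> 1 v) k = (if k = 0 then relations \<tau> (Poly_Mapping.lookup v 0) (Poly_Mapping.lookup v 1) (Poly_Mapping.lookup v 2) else 0)"
  by (simp_all add: res_d_def lookup_single when_def)

lemma res_d_big: "i \<ge> 2 \<Longrightarrow> res_d \<tau> i v = 0"
  by (simp add: res_d_def)

lemma nat_cases3: "i = 0 \<or> i = 1 \<or> i \<ge> (2::nat)"
  by linarith

lemma res_d_zero: "res_d \<tau> i 0 = 0"
proof -
  have 1: "transvectant 5 5 (cov_Gamma \<tau>) 0 5 = 0"
    using transvectant_Const_right[of 5 5 "cov_Gamma \<tau>" 0 0 5] by simp
  have "transvectant 2 5 0 generic_quintic 1 = 0"
    using transvectant_Const_left[of 2 5 0 0 generic_quintic 1] by simp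
  then have "relations \<tau> 0 0 0 = 0" by (simp add: relations_def)
  with 1 show ?thesis by (simp add: res_d_def)
qed

section \<open>Linearity, equivariance, grading and exactness\<close>

lemma res_linear: "linear_on scale_free (free_mod (res_L (Suc i))) (free_mod (res_L i)) (res_d \<tau> i)"
  unfolding linear_on_def
proof (intro conjI ballI allI)
  show "res_d \<tau> i ` free_mod (res_L (Suc i)) \<subseteq> free_mod (res_L i)"
  proof
    fix y assume "y \<in> res_d \<tau> i ` free_mod (res_L (Suc i))"
    then obtain v where v: "v \<in> free_mod (res_L (Suc i))" "y = res_d \<tau> i v" by blast
    consider "i = 0" | "i = 1" | "i \<ge> 2" using nat_cases3[of i] by blast
    then show "y \<in> free_mod (res_L i)"
    proof cases
      case 1
      have "Poly_Mapping.lookup v 0 \<in> forms 5" using v(1) unfolding 1 by (rule free_mod_Suc0)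
      then obtain w where "Poly_Mapping.lookup v 0 = nform 5 w" using forms_nform by blast
      then show ?thesis unfolding v(2) 1 free_mod_iff(1) res_d_lookup by (simp add: transvectant_Gamma)
    next
      case 2
      then have "v \<in> free_mod (res_L 2)" using v(1) by (simp add: numeral_2_eq_2)
      from relations_eq[OF this] obtain \<beta> where
        "relations \<tau> (Poly_Mapping.lookup v 0) (Poly_Mapping.lookup v 1) (Poly_Mapping.lookup v 2) =
          nform 5 (\<lambda>j. \<Sum>i<5. \<beta> i * alpha Const av \<tau> i j)" by blast
      then show ?thesis unfolding v(2) 2 free_mod_iff res_d_lookup by (simp only: nform_in_forms if_True if_False) simp
    next
      case 3
      then show ?thesis by (simp add: v(2) res_d_big free_mod_def)
    qed
  qed
  fix v w
  show "res_d \<tau> i (v + w) = res_d \<tau> i v + res_d \<tau> i w"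
    by (rule poly_mapping_eqI)
      (simp add: res_d_def lookup_single lookup_add when_def transvectant_add_right transvectant_add_left relations_def ring_distribs)
next
  fix c :: quintic_ring and v
  have m: "Const c * x * y = Const c * (x * y)" for x y by (simp only: mult_ac)
  show "res_d \<tau> i (scale_free c v) = scale_free c (res_d \<tau> i v)"
    by (rule poly_mapping_eqI)
      (simp add: res_d_def lookup_single lookup_map_mult when_def transvectant_Const_right transvectant_Const_left relations_def m ring_distribs)
qed

lemma res_equivariant:
  assumes g: "g \<in> SL2"
  shows "res_d \<tau> i (act_free g v) = act_free g (res_d \<tau> i v)"
proof (rule poly_mapping_eqI)
  interpret h: comm_ring_hom "act_cov g" by (rule act_cov_hom)
  fix k
  consider "i = 0" | "i = 1" | "i \<ge> 2" using nat_cases3[of i] by blast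
  then show "Poly_Mapping.lookup (res_d \<tau> i (act_free g v)) k = Poly_Mapping.lookup (act_free g (res_d \<tau> i v)) k"
  proof cases
    case 1
    show ?thesis unfolding 1 lookup_act_free res_d_lookup
      by (simp add: act_cov_transvectant[OF g] act_cov_Gamma[OF g])
  next
    case 2
    show ?thesis unfolding 2 lookup_act_free res_d_lookup
      by (simp add: relations_def h.hom_add h.hom_mult act_cov_transvectant[OF g] act_cov_quintic[OF g] act_cov_U[OF g] act_cov_V[OF g])
  next
    case 3
    then show ?thesis by (simp add: res_d_big lookup_act_free)
  qed
qed

lemma res_graded: "res_d \<tau> i ` free_deg (res_L (Suc i)) t \<subseteq> free_deg (res_L i) t"
proof
  fix y assume "y \<in> res_d \<tau> i ` free_deg (res_L (Suc i)) t"
  then obtain v where v: "v \<in> free_mod (res_L (Suc i))" "y = res_d \<tau> i v"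
    and deg: "\<And>j m. j < length (res_L (Suc i)) \<Longrightarrow>
      Poly_Mapping.lookup (Poly_Mapping.lookup v j) m \<in> ring_deg (t - int (fst (res_L (Suc i) ! j)))"
    by (auto simp: free_deg_def)
  have y: "y \<in> free_mod (res_L i)" using res_linear[of i \<tau>] v by (auto simp: linear_on_def)
  consider "i = 0" | "i = 1" | "i \<ge> 2" using nat_cases3[of i] by blast
  then show "y \<in> free_deg (res_L i) t"
  proof cases
    case 1
    have dv: "Poly_Mapping.lookup (Poly_Mapping.lookup v 0) m \<in> ring_deg (t - 17)" for m
      using deg[of 0 m] unfolding 1 by (simp add: res_L_def)
    have "Poly_Mapping.lookup v 0 \<in> forms 5" using v(1) unfolding 1 by (rule free_mod_Suc0)
    from forms_nform[OF this] obtain w where w: "Poly_Mapping.lookup v 0 = nform 5 w"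
      "\<And>i. w i = Const (1 / of_nat (5 choose i)) * Poly_Mapping.lookup (Poly_Mapping.lookup v 0) (bmon 5 i)" by blast
    have "w j \<in> ring_deg (t - 17)" for j unfolding w(2) by (rule ring_deg_Const_mult[OF dv])
    then have "gcof \<tau> j * w j \<in> ring_deg (int 17 + (t - 17))" for j
      by (rule ring_deg_mult[OF rd_gcof[folded ring_deg_rd]])
    then have "pairing \<tau> w \<in> ring_deg t"
      unfolding pairing_def by (intro ring_deg_Const_mult ring_deg_sum) simp
    then have "Poly_Mapping.lookup (Poly_Mapping.lookup y 0) m \<in> ring_deg t" for m
      unfolding v(2) 1 res_d_lookup w(1) transvectant_Gamma by (simp add: lookup_Const_0 ring_deg_0)
    then show ?thesis using y unfolding 1 by (simp add: free_deg_def res_L_def)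
  next
    case 2
    then have v2: "v \<in> free_mod (res_L 2)" using v(1) by (simp add: numeral_2_eq_2)
    from relations_eq[OF v2] obtain \<beta> where b: "\<forall>i<3. \<beta> i = Poly_Mapping.lookup (Poly_Mapping.lookup v 0) (bmon 2 i)"
      "\<beta> 3 = Poly_Mapping.lookup (Poly_Mapping.lookup v 1) 0" "\<beta> 4 = Poly_Mapping.lookup (Poly_Mapping.lookup v 2) 0"
      and rel: "relations \<tau> (Poly_Mapping.lookup v 0) (Poly_Mapping.lookup v 1) (Poly_Mapping.lookup v 2) =
          nform 5 (\<lambda>j. \<Sum>i<5. \<beta> i * alpha Const av \<tau> i j)" by blast
    have d: "Poly_Mapping.lookup (Poly_Mapping.lookup v 0) m \<in> ring_deg (t - 18)"
      "Poly_Mapping.lookup (Poly_Mapping.lookup v 1) m \<in> ring_deg (t - 22)"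
      "Poly_Mapping.lookup (Poly_Mapping.lookup v 2) m \<in> ring_deg (t - 26)" for m
      using deg[of 0 m] deg[of 1 m] deg[of 2 m] unfolding 2 by (simp_all add: res_L_def)
    \<comment> \<open>The numbers \<open>17 + row_deg i\<close> are the twists 18, 22 and 26 of the
      summands from which the coefficients come.\<close>
    have db: "\<beta> i \<in> ring_deg (t - 17 - int (row_deg i))" if "i < 5" for i
    proof -
      have "i < 3 \<or> i = 3 \<or> i = 4" using that by linarith
      then consider "i < 3" | "i = 3" | "i = 4" by blast
      then show ?thesis
      proof cases
        case 1
        then have "\<beta> i = Poly_Mapping.lookup (Poly_Mapping.lookup v 0) (bmon 2 i)" using b(1) by blast
        then show ?thesis using d(1) 1 by (simp add: row_deg_def)
      qed (use b(2,3) d in \<open>simp_all add: row_deg_def\<close>)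
    qed
    have entry: "\<beta> i * alpha Const av \<tau> i j \<in> ring_deg (t - 17)" if "i < 5" "j < 6" for i j
      using ring_deg_mult[OF db[OF that(1)] rd_alpha[OF that(2), of \<tau> i, folded ring_deg_rd]] by simp
    have "Poly_Mapping.lookup (Poly_Mapping.lookup y 0) m \<in> ring_deg (t - 17)" for m
    proof -
      have e: "Poly_Mapping.lookup y 0 = nform 5 (\<lambda>j. \<Sum>i<5. \<beta> i * alpha Const av \<tau> i j)"
        unfolding v(2) 2 res_d_lookup rel by simp
      show ?thesis unfolding e
        by (intro nform_lookup_closed ring_deg_0 ring_deg_of_nat_mult ring_deg_sum entry) auto
    qed
    then show ?thesis using y unfolding 2 by (simp add: free_deg_def res_L_def)
  next
    case 3
    then have "y = 0" by (simp add: v(2) res_d_big)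
    then show ?thesis using y by (simp add: free_deg_def ring_deg_0)
  qed
qed

lemma alpha_irrelevant: "i < 5 \<Longrightarrow> j < 6 \<Longrightarrow> alpha Const av \<tau> i j \<in> irrelevant_ideal"
  by (rule irrelevant_rd[OF rd_alpha]) (simp_all add: row_deg_def)

lemma res_minimal:
  assumes v: "v \<in> free_mod (res_L (Suc i))"
  shows "Poly_Mapping.lookup (Poly_Mapping.lookup (res_d \<tau> i v) k) m \<in> irrelevant_ideal"
proof -
  consider "i = 0" | "i = 1" | "i \<ge> 2" using nat_cases3[of i] by blast
  then show ?thesis
  proof cases
    case 1
    have "Poly_Mapping.lookup v 0 \<in> forms 5" using v unfolding 1 by (rule free_mod_Suc0)
    from forms_nform[OF this] obtain w where w: "Poly_Mapping.lookup v 0 = nform 5 w" by blast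
    have "gcof \<tau> j \<in> irrelevant_ideal" for j by (rule irrelevant_rd[OF rd_gcof]) simp
    then have "pairing \<tau> w \<in> irrelevant_ideal"
      unfolding pairing_def by (intro irrelevant_mult_left irrelevant_sum irrelevant_mult_right)
    then show ?thesis
      unfolding 1 res_d_lookup w transvectant_Gamma by (simp add: lookup_Const_0 irrelevant_0)
  next
    case 2
    then have v2: "v \<in> free_mod (res_L 2)" using v by (simp add: numeral_2_eq_2)
    from relations_eq[OF v2] obtain \<beta> where
      rel: "relations \<tau> (Poly_Mapping.lookup v 0) (Poly_Mapping.lookup v 1) (Poly_Mapping.lookup v 2) =
          nform 5 (\<lambda>j. \<Sum>i<5. \<beta> i * alpha Const av \<tau> i j)" by blast
    have "Poly_Mapping.lookup (nform 5 (\<lambda>j. \<Sum>i<5. \<beta> i * alpha Const av \<tau> i j)) m \<in> irrelevant_ideal"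
      by (intro nform_lookup_closed irrelevant_0 irrelevant_mult_left irrelevant_sum alpha_irrelevant) auto
    then show ?thesis unfolding 2 res_d_lookup rel by (simp add: irrelevant_0)
  next
    case 3
    then show ?thesis by (simp add: res_d_big irrelevant_0)
  qed
qed

lemma pairing_zero: "pairing \<tau> w = 0 \<longleftrightarrow> (\<Sum>j<6. gcof \<tau> j * w j) = 0"
proof -
  have "Const (120 ^ 5) \<noteq> (0 :: quintic_ring)"
    unfolding Const_0[symmetric] Const_inject by simp
  then show ?thesis unfolding pairing_def by (simp only: mult_eq_0_iff simp_thms)
qed

lemma res_exact_0:
  "res_d \<tau> 0 ` free_mod (res_L 1) = {v \<in> free_mod (res_L 0). Poly_Mapping.lookup (Poly_Mapping.lookup v 0) 0 \<in> cov_ideal \<tau>}"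
proof (intro equalityI subsetI)
  fix y assume "y \<in> res_d \<tau> 0 ` free_mod (res_L 1)"
  then obtain v where v: "v \<in> free_mod (res_L 1)" "y = res_d \<tau> 0 v" by blast
  then have y: "y \<in> free_mod (res_L 0)" using res_linear[of 0 \<tau>] by (auto simp: linear_on_def)
  have "Poly_Mapping.lookup v 0 \<in> forms 5" using v(1) by (simp only: free_mod_iff)
  from forms_nform[OF this] obtain w where w: "Poly_Mapping.lookup v 0 = nform 5 w" by blast
  have "(\<Sum>j<6. gcof \<tau> j * w j) \<in> cov_ideal \<tau>"
    unfolding cov_ideal_gcof ideal_gen_image by blast
  then have "pairing \<tau> w \<in> cov_ideal \<tau>"
    unfolding pairing_def cov_ideal_def by (rule ideal_scale)
  then show "y \<in> {v \<in> free_mod (res_L 0). Poly_Mapping.lookup (Poly_Mapping.lookup v 0) 0 \<in> cov_ideal \<tau>}"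
    using y unfolding v(2) by (simp add: res_d_lookup w transvectant_Gamma lookup_Const_0)
next
  fix y assume "y \<in> {v \<in> free_mod (res_L 0). Poly_Mapping.lookup (Poly_Mapping.lookup v 0) 0 \<in> cov_ideal \<tau>}"
  then have y: "Poly_Mapping.lookup y 0 \<in> forms 0" "\<And>j. j \<ge> 1 \<Longrightarrow> Poly_Mapping.lookup y j = 0"
    and I: "Poly_Mapping.lookup (Poly_Mapping.lookup y 0) 0 \<in> cov_ideal \<tau>" by (auto simp: free_mod_iff)
  obtain x where x: "Poly_Mapping.lookup (Poly_Mapping.lookup y 0) 0 = (\<Sum>j<6. gcof \<tau> j * x j)"
    using I unfolding cov_ideal_gcof ideal_gen_image by blast
  define v where "v = Poly_Mapping.single (0::nat) (nform 5 (\<lambda>j. Const (1 / 120 ^ 5) * x j))"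
  have "pairing \<tau> (\<lambda>j. Const (1 / 120 ^ 5) * x j) = Const (120 ^ 5) * Const (1 / 120 ^ 5) * (\<Sum>j<6. gcof \<tau> j * x j)"
    unfolding pairing_def sum_distrib_left by (simp only: mult_ac)
  also have "Const (120 ^ 5) * Const (1 / 120 ^ 5) = (1 :: quintic_ring)"
    unfolding Const_mult[symmetric] by simp
  finally have p: "pairing \<tau> (\<lambda>j. Const (1 / 120 ^ 5) * x j) = (\<Sum>j<6. gcof \<tau> j * x j)" by simp
  have "y = res_d \<tau> 0 v"
  proof (rule poly_mapping_eqI)
    fix k
    have "Poly_Mapping.lookup y 0 = Const (\<Sum>j<6. gcof \<tau> j * x j)"
      using forms_0_Const[OF y(1)] unfolding x .
    then show "Poly_Mapping.lookup y k = Poly_Mapping.lookup (res_d \<tau> 0 v) k"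
      using y(2)[of k] unfolding res_d_lookup v_def lookup_single_eq transvectant_Gamma p by (cases "k = 0") auto
  qed
  moreover have "v \<in> free_mod (res_L 1)"
    unfolding free_mod_iff v_def by (auto simp: lookup_single when_def)
  ultimately show "y \<in> res_d \<tau> 0 ` free_mod (res_L 1)" by blast
qed

lemma res_exact_1:
  assumes fg: "f \<in> cov_ideal \<tau>" "g \<in> cov_ideal \<tau>" "regular_pair f g"
  shows "res_d \<tau> 1 ` free_mod (res_L 2) = {v \<in> free_mod (res_L 1). res_d \<tau> 0 v = 0}"
proof (intro equalityI subsetI)
  fix y assume "y \<in> res_d \<tau> 1 ` free_mod (res_L 2)"
  then obtain v where v: "v \<in> free_mod (res_L 2)" "y = res_d \<tau> 1 v" by blast
  then have y: "y \<in> free_mod (res_L 1)" using res_linear[of 1 \<tau>] by (auto simp: linear_on_def numeral_2_eq_2)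
  from relations_eq[OF v(1)] obtain \<beta> where
      rel: "relations \<tau> (Poly_Mapping.lookup v 0) (Poly_Mapping.lookup v 1) (Poly_Mapping.lookup v 2) =
          nform 5 (\<lambda>j. \<Sum>i<5. \<beta> i * alpha Const av \<tau> i j)" by blast
  have "(\<Sum>j<6. gcof \<tau> j * (\<Sum>i<5. \<beta> i * alpha Const av \<tau> i j)) = (\<Sum>i<5. \<beta> i * (\<Sum>j<6. gcof \<tau> j * alpha Const av \<tau> i j))"
    unfolding sum_distrib_left by (subst sum.swap) (simp only: mult.left_commute)
  also have "\<dots> = 0" by (intro sum.neutral) (auto simp: Gamma_rows_zero simp del: alpha.simps)
  finally have "pairing \<tau> (\<lambda>j. \<Sum>i<5. \<beta> i * alpha Const av \<tau> i j) = 0" by (simp only: pairing_zero)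
  moreover have "Poly_Mapping.lookup y 0 = nform 5 (\<lambda>j. \<Sum>i<5. \<beta> i * alpha Const av \<tau> i j)"
    unfolding v(2) res_d_lookup rel by simp
  ultimately have "res_d \<tau> 0 y = 0"
    by (intro poly_mapping_eqI) (simp only: res_d_lookup transvectant_Gamma Const_0 lookup_zero if_cancel)
  then show "y \<in> {v \<in> free_mod (res_L 1). res_d \<tau> 0 v = 0}" using y by blast
next
  fix y assume "y \<in> {v \<in> free_mod (res_L 1). res_d \<tau> 0 v = 0}"
  then have y: "Poly_Mapping.lookup y 0 \<in> forms 5" "\<And>j. j \<ge> 1 \<Longrightarrow> Poly_Mapping.lookup y j = 0" and d: "res_d \<tau> 0 y = 0"
    by (auto simp: free_mod_iff simp del: One_nat_def)
  obtain w where w: "Poly_Mapping.lookup y 0 = nform 5 w" using forms_nform[OF y(1)] by blast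
  have "Poly_Mapping.lookup (res_d \<tau> 0 y) 0 = 0" unfolding d by simp
  then have "Const (pairing \<tau> w) = (Const 0 :: quintic_ring bform)"
    unfolding res_d_lookup w transvectant_Gamma by simp
  then have "(\<Sum>j<6. gcof \<tau> j * w j) = 0" unfolding Const_inject pairing_zero .
  from hilbert_burch_exact[OF fg(1,2)[unfolded cov_ideal_gcof] fg(3) this]
  obtain b where b: "\<And>j. j < 6 \<Longrightarrow> w j = (\<Sum>i<5. b i * alpha Const av \<tau> i j)" by blast
  define v where "v = Poly_Mapping.single (0::nat) (pform 2 b) + (Poly_Mapping.single 1 (Const (b 3)) + Poly_Mapping.single 2 (Const (b 4)))"
  have lv: "Poly_Mapping.lookup v 0 = pform 2 b" "Poly_Mapping.lookup v 1 = Const (b 3)" "Poly_Mapping.lookup v 2 = Const (b 4)"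
    "\<And>j. j \<ge> 3 \<Longrightarrow> Poly_Mapping.lookup v j = 0"
    by (simp_all add: v_def lookup_add lookup_single when_def)
  have "y = res_d \<tau> 1 v"
  proof (rule poly_mapping_eqI)
    fix k
    have "nform 5 w = nform 5 (\<lambda>j. \<Sum>i<5. b i * alpha Const av \<tau> i j)"
      by (rule nform_cong) (simp add: b del: alpha.simps)
    then show "Poly_Mapping.lookup y k = Poly_Mapping.lookup (res_d \<tau> 1 v) k"
      using y(2)[of k] w unfolding res_d_lookup lv(1-3) relations_nform by (cases "k = 0") (auto simp del: alpha.simps)
  qed
  moreover have "v \<in> free_mod (res_L 2)"
    unfolding free_mod_iff using lv by auto
  ultimately show "y \<in> res_d \<tau> 1 ` free_mod (res_L 2)" by blast
qed

lemma res_injective: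
  assumes f: "f \<in> cov_ideal \<tau>" "f \<noteq> 0" and v: "v \<in> free_mod (res_L 2)" "res_d \<tau> 1 v = 0"
  shows "v = 0"
proof -
  from relations_eq[OF v(1)] obtain \<beta> where
    l: "Poly_Mapping.lookup v 0 = pform 2 \<beta>" "Poly_Mapping.lookup v 1 = Const (\<beta> 3)" "Poly_Mapping.lookup v 2 = Const (\<beta> 4)" and
    rel: "relations \<tau> (Poly_Mapping.lookup v 0) (Poly_Mapping.lookup v 1) (Poly_Mapping.lookup v 2) =
        nform 5 (\<lambda>j. \<Sum>i<5. \<beta> i * alpha Const av \<tau> i j)" by blast
  have "Poly_Mapping.lookup (res_d \<tau> 1 v) 0 = 0" unfolding v(2) by simp
  then have z: "nform 5 (\<lambda>j. \<Sum>i<5. \<beta> i * alpha Const av \<tau> i j) = 0"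
    unfolding res_d_lookup rel by simp
  obtain k where k: "k < 6" "gcof \<tau> k \<noteq> 0" using cof_nonzero[OF f(1)[unfolded cov_ideal_gcof] f(2)] by blast
  have "\<beta> i = 0" if i: "i < 5" for i
  proof (rule rows_independent[OF k _ i])
    fix j :: nat assume j: "j < 6"
    let ?s = "\<Sum>i<5. \<beta> i * alpha Const av \<tau> i j"
    have "of_nat (5 choose j) * ?s = Poly_Mapping.lookup (nform 5 (\<lambda>j. \<Sum>i<5. \<beta> i * alpha Const av \<tau> i j)) (bmon 5 j)"
      unfolding nform_def using j by (subst lookup_pform) auto
    also have "\<dots> = of_nat (5 choose j) * 0" unfolding z by simp
    finally show "?s = 0" by (rule of_nat_cancel[rotated]) (use j in auto)
  qed
  then have "pform 2 \<beta> = pform 2 (\<lambda>_. 0)" "\<beta> 3 = 0" "\<beta> 4 = 0" by (auto intro!: pform_cong)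
  then have "Poly_Mapping.lookup v 0 = 0" "Poly_Mapping.lookup v 1 = 0" "Poly_Mapping.lookup v 2 = 0"
    unfolding l by (simp_all add: pform_def)
  moreover have "\<And>j. j \<ge> 3 \<Longrightarrow> Poly_Mapping.lookup v j = 0" using v(1) by (simp add: free_mod_iff)
  ultimately have "Poly_Mapping.lookup v j = 0" for j
  proof -
    have "j = 0 \<or> j = 1 \<or> j = 2 \<or> j \<ge> 3" by linarith
    then show ?thesis using \<open>Poly_Mapping.lookup v 0 = 0\<close> \<open>Poly_Mapping.lookup v 1 = 0\<close> \<open>Poly_Mapping.lookup v 2 = 0\<close>
        \<open>\<And>j. j \<ge> 3 \<Longrightarrow> Poly_Mapping.lookup v j = 0\<close> by blast
  qed
  then show ?thesis by (intro poly_mapping_eqI) simp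
qed

lemma cov_resolution:
  assumes fg: "f \<in> cov_ideal \<tau>" "g \<in> cov_ideal \<tau>" "regular_pair f g"
  shows "equivariant_minimal_resolution (cov_ideal \<tau>) [[(0, 0)], [(17, 5)], [(18, 2), (22, 0), (26, 0)]]"
proof -
  let ?Ls = "[[(0, 0)], [(17, 5)], [(18, 2), (22, 0), (26, 0)]] :: (nat \<times> nat) list list"
  have L: "(if i < length ?Ls then ?Ls ! i else []) = res_L i" for i
  proof -
    have "i = 0 \<or> i = 1 \<or> i = 2 \<or> i \<ge> 3" by linarith
    then show ?thesis by (auto simp: res_L_def)
  qed
  have f0: "f \<noteq> 0" using fg(3) by (simp add: regular_pair_def)
  have exact: "res_d \<tau> (Suc i) ` free_mod (res_L (Suc (Suc i))) = {v \<in> free_mod (res_L (Suc i)). res_d \<tau> i v = 0}" for i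
  proof -
    consider "i = 0" | "i = 1" | "i \<ge> 2" using nat_cases3[of i] by blast
    then show ?thesis
    proof cases
      case 1
      show ?thesis using res_exact_1[OF fg] unfolding 1 by (simp add: numeral_2_eq_2)
    next
      case 2
      have "free_mod (res_L 3) = {0}" using free_mod_iff(4)[of 3] by blast
      moreover have "{v \<in> free_mod (res_L 2). res_d \<tau> 1 v = 0} = {0}"
      proof (intro equalityI subsetI)
        fix v assume "v \<in> {v \<in> free_mod (res_L 2). res_d \<tau> 1 v = 0}"
        then show "v \<in> {0}" using res_injective[OF fg(1) f0] by blast
      next
        fix v assume "v \<in> {0 :: nat \<Rightarrow>\<^sub>0 quintic_ring bform}"
        then have "v = 0" by simp
        then show "v \<in> {v \<in> free_mod (res_L 2). res_d \<tau> 1 v = 0}" by (simp only: mem_Collect_eq free_mod_iff res_d_zero) simp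
      qed
      ultimately show ?thesis unfolding 2 by (simp add: numeral_2_eq_2 numeral_3_eq_3 res_d_zero)
    next
      case 3
      then have z: "free_mod (res_L (Suc (Suc i))) = {0}" "free_mod (res_L (Suc i)) = {0}"
        by (simp_all only: set_eq_iff free_mod_iff(4) singleton_iff simp_thms)
      show ?thesis unfolding z by (auto simp: res_d_zero)
    qed
  qed
  show ?thesis
    unfolding equivariant_minimal_resolution_def Let_def L
  proof (intro conjI exI[of _ "res_d \<tau>"] allI ballI)
    show "?Ls \<noteq> []" "hd ?Ls = [(0, 0)]" by simp_all
    show "res_d \<tau> 0 ` free_mod (res_L 1) = {v \<in> free_mod (res_L 0). Poly_Mapping.lookup (Poly_Mapping.lookup v 0) 0 \<in> cov_ideal \<tau>}"
      by (rule res_exact_0)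
    fix i
    show "linear_on scale_free (free_mod (res_L (Suc i))) (free_mod (res_L i)) (res_d \<tau> i)" by (rule res_linear)
    show "res_d \<tau> i ` free_deg (res_L (Suc i)) t \<subseteq> free_deg (res_L i) t" for t by (rule res_graded)
    show "res_d \<tau> i (act_free g v) = act_free g (res_d \<tau> i v)" if "g \<in> SL2" for g v by (rule res_equivariant[OF that])
    show "Poly_Mapping.lookup (Poly_Mapping.lookup (res_d \<tau> i v) j) m \<in> irrelevant_ideal"
      if "v \<in> free_mod (res_L (Suc i))" for v j m by (rule res_minimal[OF that])
    show "res_d \<tau> (Suc i) ` free_mod (res_L (Suc (Suc i))) = {v \<in> free_mod (res_L (Suc i)). res_d \<tau> i v = 0}"
      by (rule exact)
  qed
qed

section \<open>Polynomials as functions and slices\<close>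

lemma map_poly_hom:
  assumes "comm_ring_hom h" shows "comm_ring_hom (map_poly h)"
proof -
  interpret h: comm_ring_hom h by fact
  show ?thesis
    by (rule comm_ring_homI; rule poly_eqI)
      (simp_all add: coeff_map_poly h.hom_add h.hom_mult h.hom_sum coeff_mult h.hom_zero one_pCons coeff_pCons split: nat.split)
qed

lemma poly_hom: "comm_ring_hom (\<lambda>P. poly P (x :: 'a::comm_ring_1))"
  by (rule comm_ring_homI) simp_all

lemma pconst_hom: "comm_ring_hom (\<lambda>c :: 'a::comm_ring_1. [:c:])"
  by (rule comm_ring_homI) (simp_all add: one_pCons)

lemma map_poly_const: "comm_ring_hom h \<Longrightarrow> map_poly h [:c:] = [:h c:]"
  and map_poly_X: "comm_ring_hom h \<Longrightarrow> map_poly h [:0, c:] = [:0, h c:]"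
proof -
  assume "comm_ring_hom h"
  then interpret h: comm_ring_hom h .
  show "map_poly h [:c:] = [:h c:]" "map_poly h [:0, c:] = [:0, h c:]"
    by (rule poly_eqI, simp add: coeff_map_poly coeff_pCons h.hom_zero split: nat.split)+
qed

abbreviation ev :: "('v \<Rightarrow> complex) \<Rightarrow> ('v, complex) mpol \<Rightarrow> complex" where
  "ev \<equiv> subst_poly (\<lambda>c. c)"

lemmas ev_hom = subst_poly_hom[OF id_hom]
lemmas subst_hom = subst_poly_hom[OF Const_hom]
lemmas ev_simps = subst_poly_Const[OF id_hom] subst_poly_Var[OF id_hom] subst_poly_zero[OF id_hom]
lemmas subst_simps = subst_poly_Const[OF Const_hom] subst_poly_Var[OF Const_hom]

text \<open>Sets the variables outside S to zero. The equation \<open>restrict_vars S p = p\<close>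
  serves as the statement that p involves only variables of S.\<close>

definition restrict_vars :: "'v set \<Rightarrow> ('v, 'c::comm_ring_1) mpol \<Rightarrow> ('v, 'c) mpol" where
  "restrict_vars S = subst_poly Const (\<lambda>w. if w \<in> S then Var w else 0)"

definition as_poly :: "'v \<Rightarrow> ('v, 'c::comm_ring_1) mpol \<Rightarrow> ('v, 'c) mpol poly" where
  "as_poly v = subst_poly (\<lambda>c. [:Const c:]) (\<lambda>w. if w = v then [:0, 1:] else [:Var w:])"

lemmas as_poly_hom = subst_poly_hom[OF hom_comp[OF pconst_hom Const_hom]]
lemmas as_poly_simps = subst_poly_Const[OF hom_comp[OF pconst_hom Const_hom]] subst_poly_Var[OF hom_comp[OF pconst_hom Const_hom]]

lemma poly_as_poly: "poly (as_poly v p) q = subst_poly Const (Var(v := q)) p"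
  by (rule hom_eqI[OF hom_comp[OF poly_hom]]) (auto simp: as_poly_def as_poly_hom subst_hom as_poly_simps subst_simps)

lemma poly_as_poly_Var: "poly (as_poly v p) (Var v) = p"
  by (rule hom_eqI[OF hom_comp[OF poly_hom] id_hom]) (auto simp: as_poly_def as_poly_hom as_poly_simps)

lemma ev_1: "ev a 1 = 1"
  unfolding Const_1[symmetric] by (rule ev_simps)

lemma ev_as_poly: "poly (map_poly (ev a) (as_poly v p)) z = ev (a(v := z)) p"
  by (rule hom_eqI[OF hom_comp[OF poly_hom hom_comp[OF map_poly_hom[OF ev_hom]]] ev_hom])
    (auto simp: as_poly_def as_poly_hom as_poly_simps ev_simps map_poly_const[OF ev_hom] map_poly_X[OF ev_hom] ev_1)

lemma as_poly_restrict:
  "v \<notin> S \<Longrightarrow> map_poly (restrict_vars S) (as_poly v p) = as_poly v (restrict_vars (insert v S) p)"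
  by (rule hom_eqI[OF hom_comp[OF map_poly_hom] hom_comp])
    (auto simp: as_poly_def restrict_vars_def as_poly_hom as_poly_simps subst_hom subst_simps map_poly_const[OF subst_hom] map_poly_X[OF subst_hom]
      subst_poly_zero[OF hom_comp[OF pconst_hom Const_hom]] subst_poly_Const[OF Const_hom, of _ 1, unfolded Const_1])

text \<open>Some coefficient of p as a polynomial in v is nonzero and does not involve v, so it is
  nonzero at some point by induction. The resulting nonzero polynomial in one variable has a value
  different from zero.\<close>

lemma nonvanishing_point:
  fixes p :: "('v, complex) mpol"
  assumes "finite S" "restrict_vars S p = p" "p \<noteq> 0"
  shows "\<exists>a. ev a p \<noteq> 0"
  using assms
proof (induction S arbitrary: p rule: finite_induct)
  case empty
  have "restrict_vars {} p = Const (ev (\<lambda>_. 0) p)"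
    by (rule hom_eqI[OF _ hom_comp[OF Const_hom ev_hom]]) (auto simp: restrict_vars_def subst_hom subst_simps ev_simps)
  then show ?case using empty by (intro exI[of _ "\<lambda>_. 0"]) (metis Const_0)
next
  case (insert v S)
  let ?P = "as_poly v p"
  have "?P \<noteq> 0" using poly_as_poly_Var[of v p] insert.prems(2) by auto
  then obtain k where k: "coeff ?P k \<noteq> 0" by (meson leading_coeff_0_iff)
  have r0: "restrict_vars S 0 = (0 :: ('v, complex) mpol)" by (simp add: restrict_vars_def subst_poly_zero[OF Const_hom])
  have "map_poly (restrict_vars S) ?P = ?P"
    using as_poly_restrict[OF insert.hyps(2), of p] insert.prems(1) by simp
  then have "restrict_vars S (coeff ?P k) = coeff ?P k" by (metis coeff_map_poly r0)
  from insert.IH[OF this k] obtain a where a: "ev a (coeff ?P k) \<noteq> 0" by blast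
  have e0: "ev a 0 = 0" by (rule ev_simps)
  have "map_poly (ev a) ?P \<noteq> 0" using a by (metis coeff_map_poly e0 coeff_0)
  then obtain z where "poly (map_poly (ev a) ?P) z \<noteq> 0" by (metis poly_all_0_iff_0)
  then show ?case unfolding ev_as_poly by blast
qed

lemma nonvanishing_point_finite:
  fixes p :: "('v::finite, complex) mpol"
  assumes "p \<noteq> 0" shows "\<exists>a. ev a p \<noteq> 0"
proof (rule nonvanishing_point[of UNIV])
  show "restrict_vars UNIV p = p"
    by (rule hom_eqI[OF _ id_hom]) (auto simp: restrict_vars_def subst_hom subst_simps)
qed (use assms in auto)

lemma diff_dvd_poly: "x - y dvd poly P x - poly P (y :: 'a::comm_ring_1)"
proof (induction P)
  case (pCons a P)
  have "poly (pCons a P) x - poly (pCons a P) y = (x - y) * poly P x + y * (poly P x - poly P y)"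
    by (simp add: algebra_simps)
  then show ?case using pCons.IH by simp
qed simp

text \<open>If l is free of v, this is reduction modulo \<open>Var v - l\<close>, with a
  representative free of v in place of a residue class; \<open>slice_dvd\<close> describes the
  difference.\<close>

definition slice :: "'v \<Rightarrow> ('v, 'c::comm_ring_1) mpol \<Rightarrow> ('v, 'c) mpol \<Rightarrow> ('v, 'c) mpol" where
  "slice v l = subst_poly Const (Var(v := l))"

lemma slice_hom: "comm_ring_hom (slice v l)"
  unfolding slice_def by (rule subst_hom)

lemma slice_simps [simp]: "slice v l (Const c) = Const c" "slice v l (Var w) = (if w = v then l else Var w)"
  by (simp_all add: slice_def subst_simps)

lemma slice_dvd: "Var v - l dvd p - slice v l p"
  using diff_dvd_poly[of "Var v" l "as_poly v p"] unfolding poly_as_poly_Var poly_as_poly[of v p l] slice_def .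

lemma slice_idem: "slice v l l = l \<Longrightarrow> slice v l (slice v l p) = slice v l p"
  by (rule hom_eqI[OF hom_comp[OF slice_hom slice_hom] slice_hom]) auto

definition tdeg :: "('v, 'c::comm_ring_1) mpol \<Rightarrow> ('v, 'c) mpol poly" where
  "tdeg = subst_poly (\<lambda>c. [:Const c:]) (\<lambda>w. [:0, Var w:])"

text \<open>\<open>tdeg\<close> multiplies every variable by an auxiliary \<open>z\<close>; its degree in \<open>z\<close> is the total degree.\<close>

lemma tdeg_hom: "comm_ring_hom tdeg"
  unfolding tdeg_def by (rule as_poly_hom)

lemma tdeg_simps [simp]: "tdeg (Const c) = [:Const c:]" "tdeg (Var w) = [:0, Var w:]"
  by (simp_all add: tdeg_def as_poly_simps)

lemma poly_tdeg_1: "poly (tdeg p) 1 = p"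
  by (rule hom_eqI[OF hom_comp[OF poly_hom tdeg_hom] id_hom]) auto

definition homogeneous :: "('v, 'c::comm_ring_1) mpol \<Rightarrow> nat \<Rightarrow> bool" where
  "homogeneous p d \<longleftrightarrow> tdeg p = monom p d"

lemma tdeg_slice:
  assumes "homogeneous l 1"
  shows "tdeg (slice v l p) = map_poly (slice v l) (tdeg p)"
proof (rule hom_eqI[OF hom_comp[OF tdeg_hom slice_hom] hom_comp[OF map_poly_hom[OF slice_hom] tdeg_hom]])
  have "tdeg l = [:0, l:]" using assms by (simp add: homogeneous_def monom_altdef)
  then show "tdeg (slice v l (Var w)) = map_poly (slice v l) (tdeg (Var w))" for w
    by (simp add: map_poly_X[OF slice_hom])
qed (simp add: map_poly_const[OF slice_hom])

lemma homogeneous_slice: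
  assumes "homogeneous l 1" "homogeneous f d" shows "homogeneous (slice v l f) d"
proof -
  interpret s: comm_ring_hom "slice v l" by (rule slice_hom)
  show ?thesis unfolding homogeneous_def tdeg_slice[OF assms(1)] assms(2)[unfolded homogeneous_def]
    by (rule map_poly_monom) simp
qed

text \<open>If f divides g y, the slices give y = f c + (v - l) y' with c free of v, and f divides g
  y' again. As f and its slice are homogeneous of the same degree, f c has at most the degree of y,
  so y' has smaller degree than y and induction applies.\<close>

lemma regular_slice:
  fixes f g l :: "('v::linorder, complex) mpol"
  assumes l: "homogeneous l 1" "slice v l l = l" "Var v \<noteq> l" and f: "homogeneous f d"
    and reg: "regular_pair (slice v l f) (slice v l g)"
  shows "regular_pair f g"
proof -
  interpret s: comm_ring_hom "slice v l" by (rule slice_hom)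
  interpret t: comm_ring_hom "tdeg :: ('v, complex) mpol \<Rightarrow> _" by (rule tdeg_hom)
  let ?\<rho> = "slice v l"
  have f0: "?\<rho> f \<noteq> 0" using reg by (simp add: regular_pair_def)
  then have f0': "f \<noteq> 0" using s.hom_zero by metis
  have "f dvd y" if "f dvd g * y" for y
    using that
  proof (induction "degree (tdeg y)" arbitrary: y rule: less_induct)
    case less
    then obtain h where h: "g * y = f * h" by (auto simp: dvd_def)
    have "?\<rho> g * ?\<rho> y = ?\<rho> f * ?\<rho> h" unfolding s.hom_mult[symmetric] h ..
    then have "?\<rho> f dvd ?\<rho> y" using reg unfolding regular_pair_def by (metis dvd_triv_left)
    then obtain c where c: "?\<rho> y = ?\<rho> f * c" by (auto simp: dvd_def)
    have "?\<rho> f * ?\<rho> c = ?\<rho> (?\<rho> f * c)" by (simp only: s.hom_mult slice_idem[OF l(2)])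
    also have "\<dots> = ?\<rho> f * c" unfolding c[symmetric] by (rule slice_idem[OF l(2)])
    finally have \<rho>c: "?\<rho> c = c" using f0 by simp
    have "?\<rho> (y - f * c) = 0" by (simp only: s.hom_minus s.hom_mult c \<rho>c) simp
    then obtain y' where y': "y - f * c = (Var v - l) * y'" using slice_dvd[of v l "y - f * c"] by (auto simp: dvd_def)
    have e: "g * ((Var v - l) * y') = f * (h - g * c)"
      unfolding y'[symmetric] right_diff_distrib h by (simp only: mult_ac)
    have "?\<rho> (Var v - l) = 0" using l(2) by (simp only: s.hom_minus slice_simps) simp
    then have "?\<rho> f * ?\<rho> (h - g * c) = 0"
      unfolding s.hom_mult[symmetric] e[symmetric] by (simp only: s.hom_mult) simp
    then have "?\<rho> (h - g * c) = 0" using f0 by simp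
    then obtain h' where h': "h - g * c = (Var v - l) * h'" using slice_dvd[of v l "h - g * c"] by (auto simp: dvd_def)
    have "(Var v - l) * (g * y') = (Var v - l) * (f * h')" using e unfolding h' by (simp only: mult_ac)
    then have gy': "g * y' = f * h'" using l(3) by simp
    have "f dvd y'"
    proof (cases "y' = 0")
      case False
      have tl: "tdeg (Var v - l) = monom (Var v - l) 1"
        using l(1) by (simp add: homogeneous_def t.hom_minus monom_altdef)
      have tf: "degree (tdeg (f * c)) \<le> degree (tdeg y)"
      proof (cases "c = 0")
        case c0: False
        have tc: "tdeg c \<noteq> 0" using poly_tdeg_1[of c] c0 by auto
        have "degree (tdeg (f * c)) = degree (tdeg (?\<rho> f * c))"
          unfolding t.hom_mult using homogeneous_slice[OF l(1) f, of v] f f0 f0' tc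
          by (simp add: homogeneous_def degree_mult_eq degree_monom_eq)
        also have "\<dots> \<le> degree (tdeg y)"
          unfolding c[symmetric] tdeg_slice[OF l(1)] by (intro degree_le allI impI) (simp add: coeff_map_poly s.hom_zero coeff_eq_0)
        finally show ?thesis .
      qed (simp add: t.hom_zero)
      have ty: "tdeg y' \<noteq> 0" using poly_tdeg_1[of y'] False by auto
      have "degree (tdeg (y - f * c)) = 1 + degree (tdeg y')"
        unfolding y' t.hom_mult tl using l(3) ty by (subst degree_mult_eq) (simp_all add: degree_monom_eq)
      moreover have "degree (tdeg (y - f * c)) \<le> degree (tdeg y)"
        unfolding t.hom_minus using tf by (intro degree_diff_le) auto
      ultimately have "degree (tdeg y') < degree (tdeg y)" by simp
      moreover have "f dvd g * y'" unfolding gy' by simp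
      ultimately show ?thesis using less.hyps by blast
    qed simp
    then have d: "f dvd f * c + (Var v - l) * y'" by (intro dvd_add dvd_mult dvd_triv_left)
    have e: "f * c + (Var v - l) * y' = y"
      unfolding y'[symmetric] by (simp only: add_diff_eq add_diff_cancel_left')
    from d show "f dvd y" unfolding e .
  qed
  then show ?thesis using f0' unfolding regular_pair_def by blast
qed

section \<open>Regular pairs\<close>

lemma
  assumes "comm_ring_hom h"
  shows crh_add: "h (x + y) = h x + h y" and crh_mult: "h (x * y) = h x * h y" and crh_zero: "h 0 = 0"
    and crh_sum: "h (sum f A) = (\<Sum>i\<in>A. h (f i))" and crh_prod: "h (prod f A) = (\<Prod>i\<in>A. h (f i))"
    and crh_power: "h (x ^ n) = h x ^ n" and crh_diff: "h (x - y) = h x - h y" and crh_uminus: "h (- x) = - h x"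
    and crh_one: "h 1 = 1"
proof -
  interpret comm_ring_hom h by fact
  show "h (x + y) = h x + h y" "h (x * y) = h x * h y" "h 0 = 0" "h (sum f A) = (\<Sum>i\<in>A. h (f i))"
    "h (prod f A) = (\<Prod>i\<in>A. h (f i))" "h (x ^ n) = h x ^ n" "h (x - y) = h x - h y" "h (- x) = - h x" "h 1 = 1"
    by (simp_all add: hom_add hom_mult hom_sum hom_prod hom_power hom_minus hom_uminus)
qed

lemma regular_pair_mult:
  fixes f f' g :: "'a::idom"
  assumes "regular_pair f g" "regular_pair f' g" shows "regular_pair (f * f') g"
  unfolding regular_pair_def
proof (intro conjI allI impI)
  show "f * f' \<noteq> 0" using assms by (simp add: regular_pair_def)
  fix y assume y: "f * f' dvd g * y"
  then have "f dvd g * y" by (rule dvd_mult_left)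
  then obtain y' where y': "y = f * y'" using assms(1) unfolding regular_pair_def dvd_def by blast
  have "f * f' dvd f * (g * y')" using y unfolding y' by (simp only: mult.left_commute)
  then have "f' dvd g * y'" using assms(1) by (simp add: regular_pair_def)
  then have "f' dvd y'" using assms(2) unfolding regular_pair_def by blast
  then show "f * f' dvd y" unfolding y' by simp
qed

lemma regular_pair_linear:
  fixes g l :: "('v::linorder, complex) mpol"
  assumes l: "slice v l l = l" "Var v \<noteq> l" and g: "slice v l g \<noteq> 0"
  shows "regular_pair (Var v - l) g"
  unfolding regular_pair_def
proof (intro conjI allI impI)
  interpret s: comm_ring_hom "slice v l" by (rule slice_hom)
  show "Var v - l \<noteq> 0" using l(2) by simp
  fix y assume "Var v - l dvd g * y"
  then obtain h where h: "g * y = (Var v - l) * h" by (auto simp: dvd_def)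
  have "slice v l g * slice v l y = (slice v l (Var v) - slice v l l) * slice v l h"
    unfolding s.hom_mult[symmetric] s.hom_minus[symmetric] h ..
  then have "slice v l g * slice v l y = 0" unfolding l(1) slice_simps by (simp only: if_True refl diff_self mult_zero_left)
  then have "slice v l y = 0" using g by simp
  then show "Var v - l dvd y" using slice_dvd[of v l y] by simp
qed

lemma ev_homogeneous:
  assumes "homogeneous f d" shows "ev (\<lambda>v. k * a v) f = k ^ d * ev a f"
proof -
  have "poly (map_poly (ev a) (tdeg f)) k = ev (\<lambda>v. k * a v) f"
    by (rule hom_eqI[OF hom_comp[OF poly_hom hom_comp[OF map_poly_hom[OF ev_hom] tdeg_hom]] ev_hom])
      (auto simp: ev_simps map_poly_const[OF ev_hom] map_poly_X[OF ev_hom])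
  moreover have "map_poly (ev a) (monom f d) = monom (ev a f) d" by (rule map_poly_monom) (rule ev_simps)
  ultimately show ?thesis using assms by (simp add: homogeneous_def poly_monom mult.commute)
qed

lemma ev_slice: "ev a (slice v l p) = ev (a(v := ev a l)) p"
  by (rule hom_eqI[OF hom_comp[OF ev_hom slice_hom] ev_hom]) (auto simp: ev_simps)

lemma restrict_hom: "comm_ring_hom (restrict_vars S)"
  unfolding restrict_vars_def by (rule subst_hom)

lemma restrict_simps [simp]: "restrict_vars S (Const c) = Const c" "restrict_vars S (Var w) = (if w \<in> S then Var w else 0)"
  by (simp_all add: restrict_vars_def subst_simps)

lemma restrict_slice:
  "restrict_vars S l = l \<Longrightarrow> restrict_vars S (slice v l (restrict_vars S f)) = slice v l (restrict_vars S f)"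
  by (rule hom_eqI[OF hom_comp[OF restrict_hom hom_comp[OF slice_hom restrict_hom]] hom_comp[OF slice_hom restrict_hom]])
    (auto simp: crh_zero[OF slice_hom] crh_zero[OF restrict_hom])

lemma ev_restrict: "ev a (restrict_vars S p) = ev (\<lambda>v. if v \<in> S then a v else 0) p"
  by (rule hom_eqI[OF hom_comp[OF ev_hom restrict_hom] ev_hom]) (auto simp: ev_simps)

lemma homogeneous_0_Const: "homogeneous f 0 \<Longrightarrow> f = Const (ev (\<lambda>_. 0) f)"
proof -
  assume f: "homogeneous f 0"
  have "poly (tdeg f) 0 = Const (ev (\<lambda>_. 0) f)"
    by (rule hom_eqI[OF hom_comp[OF poly_hom tdeg_hom] hom_comp[OF Const_hom ev_hom]]) (auto simp: ev_simps)
  then show ?thesis using f by (simp add: homogeneous_def poly_monom)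
qed

lemma homogeneous_quotient:
  fixes f' :: "('v::linorder, complex) mpol"
  assumes "homogeneous (l * f') (Suc d)" "homogeneous l 1" "l \<noteq> 0" shows "homogeneous f' d"
proof -
  interpret t: comm_ring_hom "tdeg :: ('v, complex) mpol \<Rightarrow> _" by (rule tdeg_hom)
  have "monom l 1 * tdeg f' = monom l 1 * monom f' d"
    using assms(1,2) by (simp add: homogeneous_def t.hom_mult mult_monom)
  then show ?thesis using assms(3) by (simp add: homogeneous_def)
qed

text \<open>A binary form that does not depend on the ratio \<open>z\<close> in the chart \<open>(z, 1)\<close> is a power of the
  second variable, hence vanishes at \<open>(1, 0)\<close>.\<close>

lemma binary_root:
  fixes f :: "('v, complex) mpol"
  assumes uw: "u \<noteq> w" and f: "homogeneous f (Suc d)"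
  shows "\<exists>s t. (s, t) \<noteq> (0, 0) \<and> ev ((\<lambda>_. 0)(u := s, w := t)) f = 0"
proof -
  let ?pt = "\<lambda>s t. (\<lambda>_. 0 :: complex)(u := s, w := t)"
  define P where "P = map_poly (ev (?pt 0 1)) (as_poly u f)"
  have P: "poly P z = ev (?pt z 1) f" for z
    unfolding P_def ev_as_poly using uw by (simp add: fun_upd_twist)
  show ?thesis
  proof (cases "\<exists>z. poly P z = 0")
    case True
    then show ?thesis unfolding P by (metis prod.inject zero_neq_one)
  next
    case False
    then have "constant (poly P)" using fundamental_theorem_of_algebra by blast
    then have c: "poly P z = poly P 0" for z by (auto simp: constant_def)
    define Q where "Q = map_poly (ev (?pt 1 0)) (as_poly w f)"
    have Q: "poly Q t = ev (?pt 1 t) f" for t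
      unfolding Q_def ev_as_poly by simp
    have Q': "poly Q t = t ^ Suc d * poly P 0" if "t \<noteq> 0" for t
    proof -
      have "?pt 1 t = (\<lambda>v. t * ?pt (1 / t) 1 v)" using that uw by auto
      then have "poly Q t = t ^ Suc d * ev (?pt (1 / t) 1) f"
        unfolding Q by (simp only: ev_homogeneous[OF f])
      then show ?thesis unfolding P[symmetric] c[of "1 / t"] .
    qed
    \<comment> \<open>The formula for Q is available only for nonzero t. The extra factor vanishes
      at t = 0, so the product is the zero polynomial, and then so is the first factor.\<close>
    have "poly ((Q - monom (poly P 0) (Suc d)) * [:0, 1:]) t = 0" for t
      using Q'[of t] by (cases "t = 0") (simp_all add: poly_monom)
    then have "(Q - monom (poly P 0) (Suc d)) * [:0, 1:] = 0" by (metis poly_all_0_iff_0)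
    then have "Q = monom (poly P 0) (Suc d)" by simp
    then have "poly Q 0 = 0" by (simp add: poly_monom)
    then show ?thesis unfolding Q by (metis prod.inject zero_neq_one)
  qed
qed

lemma homogeneous_Const_Var: "homogeneous (Const c * Var v) 1"
  by (simp add: homogeneous_def crh_mult[OF tdeg_hom] monom_altdef)

lemma homogeneous_Var_diff: "homogeneous l 1 \<Longrightarrow> homogeneous (Var v - l) 1"
  by (simp add: homogeneous_def crh_diff[OF tdeg_hom] monom_altdef)

lemma homogeneous_Var_add: "homogeneous l 1 \<Longrightarrow> homogeneous (Var v + l) 1"
  by (simp add: homogeneous_def crh_add[OF tdeg_hom] monom_altdef)

lemma Var_neq:
  "ev a (Var v) \<noteq> ev a l \<Longrightarrow> Var v \<noteq> l" by auto

text \<open>A binary form splits into linear factors, and Z collects one root of each. A linear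
  factor generates a prime ideal, so it forms a regular pair with g as soon as g does not vanish at
  its root; products preserve this.\<close>

lemma regular_pair_binary:
  fixes f :: "('v::linorder, complex) mpol"
  assumes uw: "u \<noteq> w"
  shows "homogeneous f d \<Longrightarrow> restrict_vars {u, w} f = f \<Longrightarrow> f \<noteq> 0 \<Longrightarrow>
    \<exists>Z. finite Z \<and> (0, 0) \<notin> Z \<and>
      (\<forall>g. (\<forall>(s, t)\<in>Z. ev ((\<lambda>_. 0)(u := s, w := t)) g \<noteq> 0) \<longrightarrow> regular_pair f g)"
proof (induction d arbitrary: f)
  case 0
  obtain c where c: "f = Const c" using homogeneous_0_Const[OF 0(1)] by blast
  then have c0: "c \<noteq> 0" using 0(3) by auto
  have "f dvd y" for y
  proof
    have "f * (Const (1 / c) * y) = Const (c * (1 / c)) * y" unfolding c Const_mult by (simp only: mult.assoc)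
    then show "y = f * (Const (1 / c) * y)" using c0 by simp
  qed
  then have "regular_pair f g" for g using 0(3) by (simp add: regular_pair_def)
  then show ?case by (intro exI[of _ "{}"]) simp
next
  case (Suc d)
  let ?pt = "\<lambda>s t. (\<lambda>_. 0 :: complex)(u := s, w := t)"
  interpret r: comm_ring_hom "restrict_vars {u, w} :: ('v, complex) mpol \<Rightarrow> _" by (rule restrict_hom)
  obtain s t where st: "(s, t) \<noteq> (0, 0)" "ev (?pt s t) f = 0" using binary_root[OF uw Suc.prems(1)] by blast
  \<comment> \<open>The linear factor with root (s, t), solved for one variable: v - k v', where v'
    is a variable whose coordinate at the root is not zero.\<close>
  define v where "v = (if t \<noteq> 0 then u else w)"
  define v' where "v' = (if t \<noteq> 0 then w else u)"
  define k where "k = (if t \<noteq> 0 then s / t else 0)"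
  define l :: "('v, complex) mpol" where "l = Const k * Var v'"
  have vv: "v \<noteq> v'" "v \<in> {u, w}" "v' \<in> {u, w}" using uw by (auto simp: v_def v'_def)
  have sl: "slice v l l = l" unfolding l_def crh_mult[OF slice_hom] using vv by (simp add: l_def)
  have hl: "homogeneous l 1" unfolding l_def by (rule homogeneous_Const_Var)
  have nl: "Var v \<noteq> l"
  proof (rule Var_neq)
    show "ev ((\<lambda>_. 0)(v := 1)) (Var v) \<noteq> ev ((\<lambda>_. 0)(v := 1)) l"
      using vv unfolding l_def crh_mult[OF ev_hom] by (simp add: ev_simps)
  qed
  have hvl: "homogeneous (Var v - l) 1" by (rule homogeneous_Var_diff[OF hl])
  have rl: "restrict_vars {u, w} l = l" unfolding l_def r.hom_mult using vv by simp
  have evl: "ev a l = k * a v'" for a unfolding l_def crh_mult[OF ev_hom] by (simp add: ev_simps)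
  have "slice v l f = 0"
  proof (rule ccontr)
    assume ne: "slice v l f \<noteq> 0"
    have "restrict_vars {u, w} (slice v l (restrict_vars {u, w} f)) = slice v l (restrict_vars {u, w} f)"
      by (rule restrict_slice[OF rl])
    then have "restrict_vars {u, w} (slice v l f) = slice v l f" unfolding Suc.prems(2) .
    from nonvanishing_point[OF _ this ne] obtain a where a: "ev a (slice v l f) \<noteq> 0" by auto
    \<comment> \<open>On the slice the coordinates u and w are proportional to (s, t), and c is the
      factor. Homogeneity reduces the value of f there to its value at the root.\<close>
    define c where "c = (if t \<noteq> 0 then a w / t else a u / s)"
    have s0: "t = 0 \<Longrightarrow> s \<noteq> 0" using st(1) by auto
    have pt: "(\<lambda>x. if x \<in> {u, w} then (a(v := k * a v')) x else 0) = (\<lambda>x. c * ?pt s t x)"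
      using uw s0 by (auto simp: fun_eq_iff v_def v'_def k_def c_def)
    have "ev a (slice v l f) = ev (a(v := k * a v')) (restrict_vars {u, w} f)" unfolding ev_slice evl Suc.prems(2) ..
    also have "\<dots> = c ^ Suc d * ev (?pt s t) f" unfolding ev_restrict pt ev_homogeneous[OF Suc.prems(1)] ..
    finally show False using a st(2) by simp
  qed
  then obtain f' where f': "f = (Var v - l) * f'" using slice_dvd[of v l f] by (auto simp: dvd_def)
  have nz: "Var v - l \<noteq> 0" using nl by simp
  have "(Var v - l) * restrict_vars {u, w} f' = (Var v - l) * f'"
    using Suc.prems(2) unfolding f' r.hom_mult r.hom_minus rl using vv(2) by simp
  then have rf': "restrict_vars {u, w} f' = f'" using nz by simp
  have hf': "homogeneous f' d" using Suc.prems(1) unfolding f' by (rule homogeneous_quotient[OF _ hvl nz])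
  have "f' \<noteq> 0" using Suc.prems(3) f' by auto
  from Suc.IH[OF hf' rf' this] obtain Z where Z: "finite Z" "(0, 0) \<notin> Z"
    "\<And>g. (\<forall>(s, t)\<in>Z. ev (?pt s t) g \<noteq> 0) \<Longrightarrow> regular_pair f' g" by blast
  have "regular_pair f g" if g: "\<forall>(s, t)\<in>insert (s, t) Z. ev (?pt s t) g \<noteq> 0" for g
  proof -
    have "k * ?pt s t v' = ?pt s t v" using uw by (auto simp: v_def v'_def k_def)
    then have "ev (?pt s t) (slice v l g) = ev (?pt s t) g" unfolding ev_slice evl by (simp only: fun_upd_triv)
    then have "slice v l g \<noteq> 0" using g by (auto simp: ev_simps)
    then have "regular_pair (Var v - l) g" by (rule regular_pair_linear[OF sl nl])
    moreover have "regular_pair f' g" using g Z(3) by blast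
    ultimately show ?thesis unfolding f' by (rule regular_pair_mult)
  qed
  then have "\<forall>g. (\<forall>(s, t)\<in>insert (s, t) Z. ev (?pt s t) g \<noteq> 0) \<longrightarrow> regular_pair f g" by blast
  moreover have "finite (insert (s, t) Z)" "(0, 0) \<notin> insert (s, t) Z" using Z(1,2) st(1) by auto
  ultimately show ?case by blast
qed

text \<open>With powers of a single \<zeta> as weights, each sum is a nonzero polynomial in \<zeta>;
  finitely many of these have only finitely many roots in total.\<close>

lemma combination_nonvanishing:
  fixes c :: "'z \<Rightarrow> nat \<Rightarrow> complex"
  assumes "finite Z" "\<And>z. z \<in> Z \<Longrightarrow> \<exists>j<n. c z j \<noteq> 0"
  shows "\<exists>\<zeta>. \<forall>z\<in>Z. (\<Sum>j<n. \<zeta> ^ j * c z j) \<noteq> 0"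
proof -
  define P where "P z = (\<Sum>j<n. monom (c z j) j)" for z
  have P: "poly (P z) \<zeta> = (\<Sum>j<n. \<zeta> ^ j * c z j)" for z \<zeta>
    by (simp add: P_def poly_sum poly_monom mult.commute)
  have "P z \<noteq> 0" if z: "z \<in> Z" for z
  proof -
    obtain j where j: "j < n" "c z j \<noteq> 0" using assms(2)[OF z] by blast
    then have "coeff (P z) j = c z j" by (simp add: P_def coeff_sum)
    then show ?thesis using j by auto
  qed
  then have "finite (\<Union>z\<in>Z. {\<zeta>. poly (P z) \<zeta> = 0})" using assms(1) by (intro finite_UN_I poly_roots_finite)
  then obtain \<zeta> where "\<zeta> \<notin> (\<Union>z\<in>Z. {\<zeta>. poly (P z) \<zeta> = 0})" using ex_new_if_finite infinite_UNIV_char_0 by blast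
  then show ?thesis unfolding P by blast
qed

text \<open>A parametrised line in the space of quintics joining \<open>(1,0,0,1,0,0)\<close> to a point on which its
  intersection with finitely many orbits is controlled.\<close>

definition line_point :: "(nat \<Rightarrow> complex) \<Rightarrow> complex \<Rightarrow> complex \<Rightarrow> 6 \<Rightarrow> complex" where
  "line_point p s t v = (if v = 0 then s else if v = 1 then t else if v = 2 then p 2 * t
     else if v = 3 then s + p 3 * t else if v = 4 then p 4 * t else p 5 * t)"

text \<open>On the line a generator that is nonzero at (1, 0) becomes a binary form with finitely
  many roots, and some combination of the generators is nonzero at all of them. The pair found on
  the line is lifted to six variables one slice at a time.\<close>

lemma regular_pair_line:
  fixes h :: "nat \<Rightarrow> quintic_ring"
  assumes h: "\<And>j. j < n \<Longrightarrow> homogeneous (h j) d"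
    and line: "\<And>s t. (s, t) \<noteq> (0, 0) \<Longrightarrow> \<exists>j<n. ev (line_point p s t) (h j) \<noteq> 0"
  shows "\<exists>f\<in>ideal_gen (h ` {..<n}). \<exists>g\<in>ideal_gen (h ` {..<n}). regular_pair f g"
proof -
  \<comment> \<open>Coordinates 2 to 5 of \<open>line_point\<close> as linear forms in coordinates 0
    and 1. Slicing along the four of them restricts a polynomial to the line.\<close>
  define l :: "6 \<Rightarrow> quintic_ring" where "l v = (if v = 3 then Var 0 + Const (p 3) * Var 1 else
    Const (if v = 2 then p 2 else if v = 4 then p 4 else p 5) * Var 1)" for v
  let ?s = "\<lambda>v. slice v (l v)"
  define \<rho> where "\<rho> q = ?s 5 (?s 4 (?s 3 (?s 2 q)))" for q
  have d: "(2::6) \<noteq> 0" "(2::6) \<noteq> 1" "(3::6) \<noteq> 0" "(3::6) \<noteq> 1" "(4::6) \<noteq> 0" "(4::6) \<noteq> 1" "(5::6) \<noteq> 0" "(5::6) \<noteq> 1"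
    "(1::6) \<noteq> 0" "(3::6) \<noteq> 2" "(4::6) \<noteq> 2" "(5::6) \<noteq> 2" "(4::6) \<noteq> 3" "(5::6) \<noteq> 3" "(5::6) \<noteq> 4"
    by simp_all
  note d' = d d[symmetric]
  have hl: "homogeneous (l v) 1" for v
    unfolding l_def by (simp add: homogeneous_Const_Var homogeneous_Var_add[OF homogeneous_Const_Var] del: One_nat_def)
  have sl: "?s v (l v) = l v" "Var v \<noteq> l v" if "v \<in> {2, 3, 4, 5}" for v
  proof -
    interpret s: comm_ring_hom "slice v (l v)" by (rule slice_hom)
    interpret e: comm_ring_hom "ev ((\<lambda>_. 0)(v := 1))" by (rule ev_hom)
    have v: "v \<noteq> 0" "v \<noteq> 1" using that d by auto
    have "?s v (Var 0) = Var 0" "?s v (Var 1) = Var 1" using v by auto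
    then show "?s v (l v) = l v" by (subst (2) l_def, subst (2) l_def) (simp add: crh_add[OF slice_hom] crh_mult[OF slice_hom])
    show "Var v \<noteq> l v"
    proof (rule Var_neq)
      show "ev ((\<lambda>_. 0)(v := 1)) (Var v) \<noteq> ev ((\<lambda>_. 0)(v := 1)) (l v)"
        using v unfolding l_def by (simp add: crh_add[OF ev_hom] crh_mult[OF ev_hom] ev_simps)
    qed
  qed
  have reg: "regular_pair f g" if "regular_pair (\<rho> f) (\<rho> g)" "homogeneous f d" for f g
  proof -
    have h1: "homogeneous (?s 2 f) d" by (rule homogeneous_slice[OF hl that(2)])
    have h2: "homogeneous (?s 3 (?s 2 f)) d" by (rule homogeneous_slice[OF hl h1])
    have h3: "homogeneous (?s 4 (?s 3 (?s 2 f))) d" by (rule homogeneous_slice[OF hl h2])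
    note r = regular_slice[OF hl sl]
    have "regular_pair (?s 4 (?s 3 (?s 2 f))) (?s 4 (?s 3 (?s 2 g)))"
      using that(1) unfolding \<rho>_def by (intro r[OF _ _ h3]) simp_all
    then have "regular_pair (?s 3 (?s 2 f)) (?s 3 (?s 2 g))" by (intro r[OF _ _ h2, of 4]) simp_all
    then have "regular_pair (?s 2 f) (?s 2 g)" by (intro r[OF _ _ h1, of 3]) simp_all
    then show ?thesis by (intro r[OF _ _ that(2), of 2]) simp_all
  qed
  have \<rho>_hom: "comm_ring_hom \<rho>" unfolding \<rho>_def[abs_def] by (intro hom_comp[OF slice_hom] slice_hom)
  have ev\<rho>: "ev ((\<lambda>_. 0)(0 := s, 1 := t)) (\<rho> q) = ev (line_point p s t) q" for s t q
  proof (rule hom_eqI[OF hom_comp[OF ev_hom \<rho>_hom] ev_hom])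
    interpret \<rho>: comm_ring_hom \<rho> by (rule \<rho>_hom)
    show "ev ((\<lambda>_. 0)(0 := s, 1 := t)) (\<rho> (Const c)) = ev (line_point p s t) (Const c)" for c
      by (simp add: \<rho>_def ev_simps)
    have evl: "ev a (l v) = (if v = 3 then a 0 + p 3 * a 1 else (if v = 2 then p 2 else if v = 4 then p 4 else p 5) * a 1)" for a v
      unfolding l_def by (simp add: crh_add[OF ev_hom] crh_mult[OF ev_hom] ev_simps)
    fix v :: 6
    obtain i where i: "i < 6" "v = of_nat i" using surj_of_nat_6 by blast
    then have "v = 0 \<or> v = 1 \<or> v = 2 \<or> v = 3 \<or> v = 4 \<or> v = 5"
      by (auto simp: eval_nat_numeral less_Suc_eq)
    then show "ev ((\<lambda>_. 0)(0 := s, 1 := t)) (\<rho> (Var v)) = ev (line_point p s t) (Var v)"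
      unfolding \<rho>_def ev_slice evl by (elim disjE) (simp_all add: line_point_def ev_simps d')
  qed
  have r\<rho>: "restrict_vars {0, 1} (\<rho> q) = \<rho> q" for q
  proof (rule hom_eqI[OF hom_comp[OF restrict_hom \<rho>_hom] \<rho>_hom])
    interpret r: comm_ring_hom "restrict_vars {0, 1} :: quintic_ring \<Rightarrow> _" by (rule restrict_hom)
    show "restrict_vars {0, 1} (\<rho> (Const c)) = \<rho> (Const c)" for c by (simp add: \<rho>_def)
    have rl: "restrict_vars {0, 1} (l v) = l v" for v
      unfolding l_def by (simp add: r.hom_add r.hom_mult)
    have sl': "?s w (l v) = l v" if "w \<in> {2, 3, 4, 5}" for w v
    proof -
      interpret s: comm_ring_hom "slice w (l w)" by (rule slice_hom)
      have "?s w (Var 0) = Var 0" "?s w (Var 1) = Var 1" using that d by auto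
      then show ?thesis by (subst (2) l_def, subst (2) l_def) (simp add: crh_add[OF slice_hom] crh_mult[OF slice_hom])
    qed
    fix v :: 6
    obtain i where i: "i < 6" "v = of_nat i" using surj_of_nat_6 by blast
    then have "v = 0 \<or> v = 1 \<or> v \<in> {2, 3, 4, 5}"
      by (auto simp: eval_nat_numeral less_Suc_eq)
    then have "\<rho> (Var v) = (if v = 0 \<or> v = 1 then Var v else l v)"
      unfolding \<rho>_def by (elim disjE) (auto simp: sl' d')
    then show "restrict_vars {0, 1} (\<rho> (Var v)) = \<rho> (Var v)" by (auto simp: rl)
  qed
  obtain j where j: "j < n" "ev (line_point p 1 0) (h j) \<noteq> 0" using line[of 1 0] by auto
  have "\<rho> (h j) \<noteq> 0" using j(2) unfolding ev\<rho>[symmetric] by (auto simp: ev_simps)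
  moreover have "homogeneous (\<rho> (h j)) d" unfolding \<rho>_def by (intro homogeneous_slice hl h j(1))
  ultimately obtain Z where Z: "finite Z" "(0, 0) \<notin> Z"
    "\<And>g. (\<forall>(s, t)\<in>Z. ev (line_point p s t) g \<noteq> 0) \<Longrightarrow> regular_pair (\<rho> (h j)) (\<rho> g)"
    using regular_pair_binary[of 0 1 "\<rho> (h j)" d] r\<rho> unfolding ev\<rho>[symmetric] by fastforce
  have "\<exists>j<n. ev (line_point p (fst z) (snd z)) (h j) \<noteq> 0" if "z \<in> Z" for z
    using line[of "fst z" "snd z"] Z(2) that by (cases z) auto
  from combination_nonvanishing[where c = "\<lambda>z j. ev (line_point p (fst z) (snd z)) (h j)", OF Z(1) this] obtain \<zeta> where
    \<zeta>: "\<And>z. z \<in> Z \<Longrightarrow> (\<Sum>j<n. \<zeta> ^ j * ev (line_point p (fst z) (snd z)) (h j)) \<noteq> 0" by blast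
  define g where "g = (\<Sum>j<n. Const (\<zeta> ^ j) * h j)"
  have "ev a g = (\<Sum>j<n. \<zeta> ^ j * ev a (h j))" for a
    unfolding g_def by (simp only: crh_sum[OF ev_hom] crh_mult[OF ev_hom] ev_simps)
  then have "\<forall>(s, t)\<in>Z. ev (line_point p s t) g \<noteq> 0" using \<zeta> by fastforce
  then have "regular_pair (h j) g" by (rule reg[OF Z(3) h[OF j(1)]])
  moreover have "h j \<in> ideal_gen (h ` {..<n})" using j(1) by (intro ideal_base) auto
  moreover have "g \<in> ideal_gen (h ` {..<n})"
    unfolding g_def by (intro module.span_sum[OF module_ring] ideal_scale ideal_base) auto
  ultimately show ?thesis by blast
qed

section \<open>Algebraic relations and height\<close>

definition exp_bound :: "nat \<Rightarrow> ('v, complex) mpol \<Rightarrow> bool" where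
  "exp_bound N p \<longleftrightarrow> (\<forall>m\<in>Poly_Mapping.keys p. \<forall>v. Poly_Mapping.lookup m v \<le> N)"

lemma exp_bound_mult: "exp_bound M p \<Longrightarrow> exp_bound N q \<Longrightarrow> exp_bound (M + N) (p * q)"
  unfolding exp_bound_def using keys_mult[of p q] by (fastforce simp: lookup_add intro!: add_mono)

lemma exp_bound_1: "exp_bound 0 1"
  by (simp add: exp_bound_def)

lemma exp_bound_power: "exp_bound N p \<Longrightarrow> exp_bound (k * N) (p ^ k)"
  by (induction k) (simp_all add: exp_bound_1 exp_bound_mult)

lemma exp_bound_prod: "(\<And>i. i \<in> A \<Longrightarrow> exp_bound (N i) (p i)) \<Longrightarrow> exp_bound (sum N A) (prod p A)"
  by (induction A rule: infinite_finite_induct) (simp_all add: exp_bound_1 exp_bound_mult)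

lemma exp_bound_mono: "exp_bound M p \<Longrightarrow> M \<le> N \<Longrightarrow> exp_bound N p"
  unfolding exp_bound_def using le_trans by blast

lemma exp_bound_exists:
  fixes p :: "('v::finite, complex) mpol"
  shows "\<exists>N. exp_bound N p"
proof -
  let ?A = "(\<lambda>(m, v). Poly_Mapping.lookup m v) ` (Poly_Mapping.keys p \<times> UNIV)"
  have "exp_bound (Max ?A) p"
    unfolding exp_bound_def
  proof (intro ballI allI)
    fix m v assume "m \<in> Poly_Mapping.keys p"
    then have "Poly_Mapping.lookup m v \<in> ?A" by force
    then show "Poly_Mapping.lookup m v \<le> Max ?A" by (intro Max_ge) auto
  qed
  then show ?thesis ..
qed

lemma card_exponents:
  "finite {m :: 'v::finite \<Rightarrow>\<^sub>0 nat. \<forall>v. Poly_Mapping.lookup m v \<le> N}"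
  "card {m :: 'v::finite \<Rightarrow>\<^sub>0 nat. \<forall>v. Poly_Mapping.lookup m v \<le> N} \<le> Suc N ^ CARD('v)"
proof -
  let ?A = "{m :: 'v \<Rightarrow>\<^sub>0 nat. \<forall>v. Poly_Mapping.lookup m v \<le> N}" and ?B = "(UNIV :: 'v set) \<rightarrow>\<^sub>E {..N}"
  have inj: "inj_on Poly_Mapping.lookup ?A" by (auto simp: inj_on_def intro: poly_mapping_eqI)
  have sub: "Poly_Mapping.lookup ` ?A \<subseteq> ?B" by auto
  have fin: "finite ?B" by (intro finite_PiE) auto
  show "finite ?A" using inj_on_finite[OF inj sub fin] .
  have "card ?A \<le> card ?B" using card_inj_on_le[OF inj sub fin] .
  then show "card ?A \<le> Suc N ^ CARD('v)" by (simp add: card_PiE)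
qed

lemma vector_space_mpol: "vector_space (\<lambda>c (p :: ('v, complex) mpol). Const c * p)"
  by unfold_locales (simp_all add: ring_distribs Const_add Const_mult mult.assoc)

lemma module_mpol: "Modules.module (\<lambda>c (p :: ('v, complex) mpol). Const c * p)"
  by unfold_locales (simp_all add: ring_distribs Const_add Const_mult mult.assoc)

text \<open>More elements than the dimension of the space that contains them. Linear dependence is a
  property of sets, so a family with a repeated member is treated first, by the difference of two
  equal members.\<close>

lemma linear_relation:
  fixes M :: "'e \<Rightarrow> ('v::finite, complex) mpol"
  assumes E: "finite E" "card E > Suc N ^ CARD('v)" and M: "\<And>e. e \<in> E \<Longrightarrow> exp_bound N (M e)"
  shows "\<exists>u. (\<exists>e\<in>E. u e \<noteq> 0) \<and> (\<Sum>e\<in>E. Const (u e) * M e) = 0"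
proof (cases "inj_on M E")
  case False
  then obtain e e' where e: "e \<in> E" "e' \<in> E" "e \<noteq> e'" "M e = M e'" by (auto simp: inj_on_def)
  let ?u = "\<lambda>x. if x = e then 1 else if x = e' then -1 else 0 :: complex"
  have "(\<Sum>x\<in>E. Const (?u x) * M x) = (\<Sum>x\<in>{e, e'}. Const (?u x) * M x)"
    using e E(1) by (intro sum.mono_neutral_right) auto
  also have "\<dots> = 0" using e(3,4) by (simp add: Const.hom_uminus)
  finally show ?thesis using e(1) by (intro exI[of _ ?u]) auto
next
  case True
  let ?s = "\<lambda>c (p :: ('v, complex) mpol). Const c * p"
  let ?X = "{m :: 'v \<Rightarrow>\<^sub>0 nat. \<forall>v. Poly_Mapping.lookup m v \<le> N}"
  let ?T = "(\<lambda>m. Poly_Mapping.single m (1 :: complex)) ` ?X"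
  have span: "M ` E \<subseteq> module.span ?s ?T"
  proof
    fix p assume "p \<in> M ` E"
    then have p: "exp_bound N p" using M by auto
    have "p = (\<Sum>m\<in>Poly_Mapping.keys p. Poly_Mapping.single m (Poly_Mapping.lookup p m))" by (rule mpol_sum_single)
    also have "\<dots> = (\<Sum>m\<in>Poly_Mapping.keys p. ?s (Poly_Mapping.lookup p m) (Poly_Mapping.single m 1))"
      by (simp add: Const_def mult_single)
    finally have e: "p = \<dots>" .
    have "\<dots> \<in> module.span ?s ?T"
      by (intro module.span_sum[OF module_mpol] module.span_scale[OF module_mpol] module.span_base[OF module_mpol] imageI)
        (use p in \<open>auto simp: exp_bound_def\<close>)
    then show "p \<in> module.span ?s ?T" unfolding e[symmetric] .
  qed
  have "card ?T \<le> Suc N ^ CARD('v)" using card_image_le[OF card_exponents(1)] card_exponents(2) le_trans by blast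
  then have "\<not> card (M ` E) \<le> card ?T" using E(2) by (simp add: card_image[OF True])
  then have "module.dependent ?s (M ` E)"
    using vector_space.independent_span_bound[OF vector_space_mpol _ _ span] card_exponents(1) by blast
  then obtain u where u: "\<exists>v\<in>M ` E. u v \<noteq> 0" "(\<Sum>v\<in>M ` E. ?s (u v) v) = 0"
    using module.dependent_finite[OF module_mpol finite_imageI[OF E(1)]] by blast
  show ?thesis
  proof (intro exI[of _ "\<lambda>e. u (M e)"] conjI)
    show "(\<Sum>e\<in>E. ?s (u (M e)) (M e)) = 0" using u(2) by (simp add: sum.reindex[OF True])
  qed (use u(1) in auto)
qed

text \<open>There are \<open>B ^ k\<close> monomials of exponents below \<open>B\<close> in \<open>k\<close> polynomials, while the space
  containing them has dimension \<open>O(B ^ n)\<close>, \<open>n\<close> being the number of variables.\<close>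

lemma algebraic_relation:
  fixes P :: "nat \<Rightarrow> ('v::finite, complex) mpol"
  assumes k: "k > CARD('v)"
  shows "\<exists>H :: (nat, complex) mpol. H \<noteq> 0 \<and> restrict_vars {..<k} H = H \<and> subst_poly Const P H = 0"
proof -
  have "\<forall>i. \<exists>N. exp_bound N (P i)" using exp_bound_exists by blast
  then obtain N0 where N0: "\<And>i. exp_bound (N0 i) (P i)" by metis
  define D where "D = (\<Sum>i<k. N0 i)"
  have D: "exp_bound D (P i)" if "i < k" for i
    using N0[of i] by (rule exp_bound_mono) (use that in \<open>auto simp: D_def intro!: member_le_sum\<close>)
  let ?n = "CARD('v)"
  \<comment> \<open>Chosen so that B exceeds (k D + 1)^n. Then there are B^k, that is at least B^n
    B, exponent vectors, whereas the dimension is at most (k B D + 1)^n, which does not exceed B^n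
    (k D + 1)^n.\<close>
  define B where "B = Suc (k * D) ^ ?n + 1"
  define E where "E = {..<k} \<rightarrow>\<^sub>E {..<B}"
  define M where "M e = (\<Prod>i<k. P i ^ e i)" for e :: "nat \<Rightarrow> nat"
  have finE: "finite E" unfolding E_def by (intro finite_PiE) auto
  have bound: "exp_bound (k * (B * D)) (M e)" if "e \<in> E" for e
  proof -
    have "exp_bound (\<Sum>i<k. e i * D) (M e)"
      unfolding M_def by (intro exp_bound_prod exp_bound_power D) simp
    moreover have "(\<Sum>i<k. e i * D) \<le> (\<Sum>i<k. B * D)"
      using that by (intro sum_mono mult_right_mono) (auto simp: E_def PiE_iff less_imp_le)
    ultimately show ?thesis by (auto elim!: exp_bound_mono)
  qed
  have "Suc (k * (B * D)) \<le> B * Suc (k * D)"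
  proof -
    have "1 \<le> B" by (simp add: B_def)
    then show ?thesis by (simp add: algebra_simps)
  qed
  then have "Suc (k * (B * D)) ^ ?n \<le> (B * Suc (k * D)) ^ ?n" by (rule power_mono) simp
  also have "\<dots> = B ^ ?n * Suc (k * D) ^ ?n" by (rule power_mult_distrib)
  also have "\<dots> < B ^ ?n * B" by (rule mult_strict_left_mono) (simp_all add: B_def)
  also have "\<dots> = B ^ Suc ?n" by simp
  also have "\<dots> \<le> B ^ k" using k by (intro power_increasing) (simp_all add: B_def)
  also have "\<dots> = card E" by (simp add: E_def card_PiE)
  finally have "card E > Suc (k * (B * D)) ^ ?n" .
  then have "\<exists>u. (\<exists>e\<in>E. u e \<noteq> 0) \<and> (\<Sum>e\<in>E. Const (u e) * M e) = 0"
    by (rule linear_relation[OF finE _ bound])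
  then obtain u where ne: "\<exists>e\<in>E. u e \<noteq> 0" and rel: "(\<Sum>e\<in>E. Const (u e) * M e) = 0"
    by (elim exE conjE)
  from ne obtain e0 where u: "e0 \<in> E" "u e0 \<noteq> 0" by (elim bexE)
  define m where "m e = (\<Sum>i<k. Poly_Mapping.single i (e i))" for e :: "nat \<Rightarrow> nat"
  define H where "H = (\<Sum>e\<in>E. Const (u e) * (\<Prod>i<k. Var i ^ e i) :: (nat, complex) mpol)"
  have mon: "(\<Prod>i\<in>A. Var i ^ e i :: (nat, complex) mpol) = Poly_Mapping.single (\<Sum>i\<in>A. Poly_Mapping.single i (e i)) 1"
    if "finite A" for A e
    using that by (induction A rule: finite_induct) (simp_all add: Var_power mult_single)
  have lm: "Poly_Mapping.lookup (m e) i = (if i < k then e i else 0)" for e i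
    by (simp add: m_def lookup_sum lookup_single when_def)
  have minj: "m e = m e0 \<longleftrightarrow> e = e0" if e: "e \<in> E" for e
  proof
    assume me: "m e = m e0"
    show "e = e0"
    proof (rule PiE_ext[OF e[unfolded E_def] u(1)[unfolded E_def]])
      fix i assume "i \<in> {..<k}"
      then show "e i = e0 i" using lm[of e i] lm[of e0 i] me by simp
    qed
  qed simp
  have "Poly_Mapping.lookup H (m e0) = (\<Sum>e\<in>E. if e = e0 then u e else 0)"
    unfolding H_def lookup_sum
    by (intro sum.cong refl) (simp add: mon m_def[symmetric] lookup_single when_def minj)
  also have "\<dots> = u e0" using finE u(1) by simp
  finally have "H \<noteq> 0" using u(2) by auto
  moreover have "restrict_vars {..<k} H = H"
    unfolding H_def crh_sum[OF restrict_hom] crh_mult[OF restrict_hom] crh_prod[OF restrict_hom] crh_power[OF restrict_hom]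
    by (intro sum.cong prod.cong arg_cong2[of _ _ _ _ "(*)"] refl) simp_all
  moreover have "subst_poly Const P H = 0"
    unfolding H_def crh_sum[OF subst_hom] crh_mult[OF subst_hom] crh_prod[OF subst_hom] crh_power[OF subst_hom] subst_simps
    using rel by (simp add: M_def)
  ultimately show ?thesis by blast
qed

text \<open>Algebraic independence of the residue classes of z 0, ..., z (n - 1) modulo Q, stated
  without the quotient ring.\<close>

definition independent_mod :: "('v, complex) mpol set \<Rightarrow> nat \<Rightarrow> (nat \<Rightarrow> ('v, complex) mpol) \<Rightarrow> bool" where
  "independent_mod Q n z \<longleftrightarrow> (\<forall>H. restrict_vars {..<n} H = H \<longrightarrow> subst_poly Const z H \<in> Q \<longrightarrow> H = 0)"

text \<open>Consider a relation modulo Q as a polynomial in x. Modulo Q', which contains x, only its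
  constant coefficient survives, and this is zero by independence. Since Q is prime and x is outside
  Q, the factor x can be removed, and the remaining coefficients follow in turn.\<close>

lemma independent_mod_extend:
  fixes Q Q' :: "('v::finite, complex) mpol set"
  assumes Q: "prime_ideal Q" "prime_ideal Q'" "Q \<subseteq> Q'" and x: "x \<in> Q'" "x \<notin> Q"
    and z: "independent_mod Q' n z"
  shows "independent_mod Q (Suc n) (z(n := x))"
  unfolding independent_mod_def
proof (intro allI impI)
  let ?z = "z(n := x)" and ?\<sigma> = "subst_poly Const z :: (nat, complex) mpol \<Rightarrow> ('v, complex) mpol"
  fix H :: "(nat, complex) mpol"
  assume H: "restrict_vars {..<Suc n} H = H" "subst_poly Const ?z H \<in> Q"
  note Qs = subspace_ideal[OF prime_ideal_D(1)[OF Q(1)]] and Qs' = subspace_ideal[OF prime_ideal_D(1)[OF Q(2)]]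
  have A: "A = 0" if "map_poly (restrict_vars {..<n}) A = A" "poly (map_poly ?\<sigma> A) x \<in> Q" for A
    using that
  proof (induction A)
    case (pCons c A)
    have r0: "restrict_vars {..<n} 0 = (0 :: (nat, complex) mpol)" by (rule crh_zero[OF restrict_hom])
    have coeffs: "restrict_vars {..<n} (coeff (pCons c A) i) = coeff (pCons c A) i" for i
      using pCons.prems(1) by (metis coeff_map_poly r0)
    have rc: "restrict_vars {..<n} c = c" using coeffs[of 0] by simp
    have rA: "map_poly (restrict_vars {..<n}) A = A"
    proof (rule poly_eqI)
      fix i show "coeff (map_poly (restrict_vars {..<n}) A) i = coeff A i"
        using coeffs[of "Suc i"] by (simp add: coeff_map_poly r0)
    qed
    have e: "map_poly ?\<sigma> (pCons c A) = pCons (?\<sigma> c) (map_poly ?\<sigma> A)"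
      by (rule poly_eqI) (simp add: coeff_map_poly crh_zero[OF subst_hom] coeff_pCons split: nat.split)
    have s: "?\<sigma> c + x * poly (map_poly ?\<sigma> A) x \<in> Q" using pCons.prems(2) unfolding e by simp
    have "?\<sigma> c + x * poly (map_poly ?\<sigma> A) x \<in> Q'" using s Q(3) by blast
    moreover have "- poly (map_poly ?\<sigma> A) x * x \<in> Q'" by (rule Qs'(3)[OF x(1)])
    ultimately have "(?\<sigma> c + x * poly (map_poly ?\<sigma> A) x) + - poly (map_poly ?\<sigma> A) x * x \<in> Q'" by (rule Qs'(2))
    moreover have "(?\<sigma> c + x * poly (map_poly ?\<sigma> A) x) + - poly (map_poly ?\<sigma> A) x * x = ?\<sigma> c" by simp
    ultimately have "?\<sigma> c \<in> Q'" by (simp only:)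
    then have c: "c = 0" using z rc unfolding independent_mod_def by blast
    have "x * poly (map_poly ?\<sigma> A) x \<in> Q" using s unfolding c crh_zero[OF subst_hom] by simp
    then have "poly (map_poly ?\<sigma> A) x \<in> Q" using Q(1) x(2) unfolding prime_ideal_def by blast
    then have "A = 0" using pCons.IH rA by blast
    then show ?case using c by simp
  qed simp
  have P: "poly (map_poly ?\<sigma> (as_poly n H)) x = subst_poly Const ?z H"
    by (rule hom_eqI[OF hom_comp[OF poly_hom hom_comp[OF map_poly_hom[OF subst_hom]]] subst_hom])
      (auto simp: as_poly_def as_poly_hom as_poly_simps subst_simps map_poly_const[OF subst_hom] map_poly_X[OF subst_hom] crh_one[OF subst_hom])
  have "map_poly (restrict_vars {..<n}) (as_poly n H) = as_poly n H"
    using as_poly_restrict[of n "{..<n}" H] H(1) by (simp add: lessThan_Suc)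
  then have "as_poly n H = 0" by (rule A) (simp only: P H(2))
  then show "H = 0" using poly_as_poly_Var[of n H] by simp
qed

lemma prime_chain_independent:
  fixes Q :: "nat \<Rightarrow> ('v::finite, complex) mpol set"
  assumes "prime_chain n Q" "independent_mod (Q n) k z"
  shows "\<exists>z. independent_mod (Q 0) (k + n) z"
  using assms
proof (induction n arbitrary: k z)
  case (Suc n)
  have p: "prime_ideal (Q n)" "prime_ideal (Q (Suc n))" "Q n \<subset> Q (Suc n)" and c: "prime_chain n Q"
    using Suc.prems(1) by (auto simp: prime_chain_def)
  then obtain x where "x \<in> Q (Suc n)" "x \<notin> Q n" by blast
  then have "independent_mod (Q n) (Suc k) (z(k := x))"
    by (rule independent_mod_extend[OF p(1,2) psubset_imp_subset[OF p(3)] _ _ Suc.prems(2)])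
  from Suc.IH[OF c this] show ?case by simp
qed auto

text \<open>A chain of length n below P provides k + n independent elements modulo its lowest prime.
  If these outnumbered the variables, \<open>algebraic_relation\<close> would give a nontrivial
  relation among them, and its value 0 lies in every ideal.\<close>

lemma prime_height_le:
  fixes P :: "('v::finite, complex) mpol set"
  assumes "independent_mod P k z" "k + h = CARD('v)"
  shows "prime_height P \<le> enat h"
  unfolding prime_height_def
proof (rule Sup_least)
  fix y assume "y \<in> {enat n | n. \<exists>Q. (\<forall>i\<le>n. prime_ideal (Q i)) \<and> (\<forall>i<n. Q i \<subset> Q (Suc i)) \<and> Q n = P}"
  then obtain n Q where y: "y = enat n" and Q: "prime_chain n Q" "Q n = P" by (auto simp: prime_chain_def)
  obtain z' where z': "independent_mod (Q 0) (k + n) z'" using prime_chain_independent[OF Q(1)] assms(1) Q(2) by blast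
  have "prime_ideal (Q 0)" using Q(1) by (simp add: prime_chain_def)
  then have z0: "0 \<in> Q 0" by (rule subspace_ideal(1)[OF prime_ideal_D(1)])
  have "\<not> k + n > CARD('v)"
  proof
    assume "k + n > CARD('v)"
    from algebraic_relation[OF this, of z'] obtain H where
      H: "H \<noteq> 0" "restrict_vars {..<k + n} H = H" "subst_poly Const z' H = 0" by (elim exE conjE)
    have "subst_poly Const z' H \<in> Q 0" unfolding H(3) by (rule z0)
    then have "H = 0" using z'[unfolded independent_mod_def, rule_format, OF H(2)] by simp
    then show False using H(1) by simp
  qed
  then show "y \<le> enat h" using assms(2) y by simp
qed

lemma prime_kernel:
  fixes \<phi> :: "'a::comm_ring_1 \<Rightarrow> 'b::idom"
  assumes "comm_ring_hom \<phi>" shows "prime_ideal {p. \<phi> p = 0}"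
proof -
  have "module.subspace (*) {p. \<phi> p = 0}"
    unfolding module.subspace_def[OF module_ring] by (simp add: crh_zero[OF assms] crh_add[OF assms] crh_mult[OF assms])
  moreover have "{p. \<phi> p = 0} \<noteq> UNIV" using crh_one[OF assms] by (metis UNIV_I mem_Collect_eq zero_neq_one)
  ultimately show ?thesis by (auto simp: prime_ideal_def crh_mult[OF assms])
qed

section \<open>Points of the zero locus\<close>

definition vanish :: "rat \<times> rat \<times> rat \<Rightarrow> (nat \<Rightarrow> complex) \<Rightarrow> bool" where
  "vanish \<tau> b \<longleftrightarrow> (\<forall>j<6. cof (alpha (\<lambda>c. c) b \<tau>) j = 0)"

lemma rows_hom:
  assumes h: "comm_ring_hom \<phi>"
  shows "j < 6 \<Longrightarrow> \<phi> (alpha \<kappa> a \<tau> i j) = alpha (\<lambda>c. \<phi> (\<kappa> c)) (\<lambda>i. \<phi> (a i)) \<tau> i j"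
proof -
  assume j: "j < 6"
  obtain \<alpha> \<beta> \<gamma> where \<tau>: "\<tau> = (\<alpha>, \<beta>, \<gamma>)" by (cases \<tau>)
  interpret comm_ring_hom \<phi> by fact
  note hs = hom_add hom_mult hom_minus hom_power hom_uminus
  have t: "\<phi> (tq a 0) = tq (\<lambda>i. \<phi> (a i)) 0" "\<phi> (tq a (Suc 0)) = tq (\<lambda>i. \<phi> (a i)) (Suc 0)" "\<phi> (tq a 2) = tq (\<lambda>i. \<phi> (a i)) 2"
    by (simp_all add: tq_def hs hom_numeral)
  note t2 = t(3)[unfolded numeral_2_eq_2]
  have r: "\<phi> (rq a k) = rq (\<lambda>i. \<phi> (a i)) k" for k by (simp add: rq_def hs t hom_numeral)
  have i4: "\<phi> (I4 a) = I4 (\<lambda>i. \<phi> (a i))" by (simp add: I4_def hs t hom_numeral)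
  have w: "\<phi> (wq a k) = wq (\<lambda>i. \<phi> (a i)) k" if "k \<in> {0, Suc 0, 2, 3, 4}" for k
    using that by (auto simp: wq_def hs t t2 hom_numeral eval_nat_numeral)
  have s: "\<phi> (sq a k) = sq (\<lambda>i. \<phi> (a i)) k" for k by (simp add: sq_def hs w)
  have z: "\<phi> (zq a k) = zq (\<lambda>i. \<phi> (a i)) k" "\<phi> (yq a k) = yq (\<lambda>i. \<phi> (a i)) k" if "k \<le> 6" for k
    using that unfolding le_cases by (auto simp: zq_def yq_def hs t t2 hom_numeral eval_nat_numeral)
  have i8: "\<phi> (I8 \<kappa> a) = I8 (\<lambda>c. \<phi> (\<kappa> c)) (\<lambda>i. \<phi> (a i))"
    unfolding I8_def hom_sum by (intro sum.cong refl) (simp add: hs z)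
  have "j = 0 \<or> j = 1 \<or> j = 2 \<or> j = 3 \<or> j = 4 \<or> j = 5" using j by linarith
  then have p: "\<phi> (pq a j) = pq (\<lambda>i. \<phi> (a i)) j" "\<phi> (qq a j) = qq (\<lambda>i. \<phi> (a i)) j"
    by (auto simp: pq_def qq_def hs t t2 r s w hom_numeral eval_nat_numeral)
  show ?thesis unfolding \<tau> by (simp add: rowE_def rowH_def rowF_def rowU_def rowV_def hs p i4 i8)
qed

lemma cof_cong: "(\<And>i k. i < 5 \<Longrightarrow> k < 6 \<Longrightarrow> \<alpha> i k = \<alpha>' i k) \<Longrightarrow> cof \<alpha> j = cof \<alpha>' j"
proof -
  assume "\<And>i k. i < 5 \<Longrightarrow> k < 6 \<Longrightarrow> \<alpha> i k = \<alpha>' i k"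
  then have "mat 6 6 (\<lambda>(i, k). if i < 5 then \<alpha> i k else 0) = mat 6 6 (\<lambda>(i, k). if i < 5 then \<alpha>' i k else 0)"
    by (intro eq_matI) auto
  then show ?thesis by (simp only: cof_def)
qed

lemma ev_gcof: "ev a (gcof \<tau> j) = cof (alpha (\<lambda>c. c) (\<lambda>i. a (of_nat i)) \<tau>) j"
proof -
  have "ev a (gcof \<tau> j) = cof (\<lambda>i k. ev a (alpha Const av \<tau> i k)) j" by (rule cof_hom[OF ev_hom])
  also have "\<dots> = cof (alpha (\<lambda>c. c) (\<lambda>i. a (of_nat i)) \<tau>) j"
    by (rule cof_cong) (simp add: rows_hom[OF ev_hom] ev_simps av_def del: alpha.simps)
  finally show ?thesis .
qed

lemma vanish_ev: "vanish \<tau> (\<lambda>i. a (of_nat i)) \<longleftrightarrow> (\<forall>j<6. ev a (gcof \<tau> j) = 0)"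
  by (simp add: vanish_def ev_gcof del: alpha.simps)

lemma coord_idx: "\<exists>a :: 6 \<Rightarrow> complex. \<forall>i<6. a (of_nat i) = b i"
  by (rule exI[of _ "\<lambda>v. b (idx v)"]) (simp add: idx_of_nat)

text \<open>The exceptional entry is the last one of \<open>rowE\<close>, which refers to a
  coefficient of index 6 and carries the factor zero; it is dealt with in
  \<open>vanish_cong\<close>.\<close>

lemma rows_cong:
  assumes "\<And>i. i < 6 \<Longrightarrow> b i = b' i" "k < 6"
  shows "alpha (\<lambda>c :: complex. c) b \<tau> i k = alpha (\<lambda>c. c) b' \<tau> i k \<or> k = 5 \<and> i = 0"
proof -
  obtain \<alpha> \<beta> \<gamma> where \<tau>: "\<tau> = (\<alpha>, \<beta>, \<gamma>)" by (cases \<tau>)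
  have b: "b 0 = b' 0" "b (Suc 0) = b' (Suc 0)" "b 2 = b' 2" "b 3 = b' 3" "b 4 = b' 4" "b 5 = b' 5" using assms(1) by auto
  have b2: "b (Suc (Suc 0)) = b' (Suc (Suc 0))" "b (Suc (Suc (Suc 0))) = b' (Suc (Suc (Suc 0)))" using assms(1) by simp_all
  have t: "tq b 0 = tq b' 0" "tq b (Suc 0) = tq b' (Suc 0)" "tq b 2 = tq b' 2"
    by (simp_all add: tq_def b)
  have r: "rq b 0 = rq b' 0" "rq b (Suc 0) = rq b' (Suc 0)" "rq b 2 = rq b' 2" "rq b 3 = rq b' 3" by (simp_all add: rq_def b b2 t)
  have i4: "I4 b = I4 b'" by (simp add: I4_def t)
  have w: "wq b k = wq b' k" for k by (simp add: wq_def t)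
  have s: "sq b 0 = sq b' 0" "sq b (Suc 0) = sq b' (Suc 0)" by (simp_all add: sq_def w b b2)
  have z: "zq b k = zq b' k" "yq b k = yq b' k" for k by (simp_all add: zq_def yq_def b t)
  have i8: "I8 (\<lambda>c. c) b = I8 (\<lambda>c. c) b'" unfolding I8_def z ..
  have pq: "pq b k = pq b' k" "qq b k = qq b' k" by (simp_all add: pq_def qq_def t r s w)
  have "b k = b' k" "b (k - 1) = b' (k - 1)" using assms by auto
  moreover have "b (k + 1) = b' (k + 1) \<or> k = 5" using assms(1)[of "k + 1"] assms(2) by auto
  ultimately show ?thesis unfolding \<tau> by (auto simp: rowE_def rowH_def rowF_def rowU_def rowV_def pq i4 i8)
qed

lemma vanish_cong: "(\<And>i. i < 6 \<Longrightarrow> b i = b' i) \<Longrightarrow> vanish \<tau> b = vanish \<tau> b'"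
proof -
  assume b: "\<And>i. i < 6 \<Longrightarrow> b i = b' i"
  have "alpha (\<lambda>c :: complex. c) b \<tau> 0 5 = alpha (\<lambda>c. c) b' \<tau> 0 5"
    by (cases \<tau>) (simp add: rowE_def)
  then have "cof (alpha (\<lambda>c. c) b \<tau>) j = cof (alpha (\<lambda>c. c) b' \<tau>) j" for j
    using rows_cong[of b b', OF b] by (intro cof_cong) blast
  then show ?thesis by (simp add: vanish_def del: alpha.simps)
qed

lemma homogeneous_rd: "rd p n \<Longrightarrow> homogeneous p n"
proof -
  assume p: "rd p n"
  have monom_sum: "(\<Sum>i\<in>A. monom (f i) n) = monom (sum f A) n" for f :: "(6 \<Rightarrow>\<^sub>0 nat) \<Rightarrow> quintic_ring" and A
    by (rule poly_eqI) (simp add: coeff_sum)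
  have prod: "(\<Prod>v\<in>A. [:0, Var v :: quintic_ring:] ^ f v) = monom (\<Prod>v\<in>A. Var v ^ f v) (\<Sum>v\<in>A. f v)"
    if "finite A" for A and f :: "6 \<Rightarrow> nat"
  proof -
    have X: "[:0, Var v :: quintic_ring:] = monom (Var v) 1" for v by (simp add: monom_altdef)
    show ?thesis using that unfolding X
      by (induction A rule: finite_induct) (simp_all add: monom_power mult_monom)
  qed
  have "tdeg p = (\<Sum>m\<in>Poly_Mapping.keys p. monom (Const (Poly_Mapping.lookup p m) * (\<Prod>v\<in>Poly_Mapping.keys m. Var v ^ Poly_Mapping.lookup m v)) n)"
    unfolding tdeg_def subst_poly_def
  proof (rule sum.cong)
    fix m assume "m \<in> Poly_Mapping.keys p"
    then have m: "(\<Sum>v\<in>Poly_Mapping.keys m. Poly_Mapping.lookup m v) = n" using p by (simp add: rd_def mdeg_def)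
    show "[:Const (Poly_Mapping.lookup p m):] * (\<Prod>v\<in>Poly_Mapping.keys m. [:0, Var v:] ^ Poly_Mapping.lookup m v) =
      monom (Const (Poly_Mapping.lookup p m) * (\<Prod>v\<in>Poly_Mapping.keys m. Var v ^ Poly_Mapping.lookup m v)) n"
      unfolding prod[OF finite_keys] m by (simp add: smult_monom)
  qed simp
  also have "\<dots> = monom (subst_poly Const Var p) n" unfolding monom_sum subst_poly_def ..
  also have "subst_poly Const Var p = p" by (rule hom_eqI[OF subst_hom id_hom]) (simp_all add: subst_simps)
  finally show ?thesis by (simp only: homogeneous_def)
qed

lemma vanish_scale:
  assumes "vanish \<tau> b" shows "vanish \<tau> (\<lambda>i. c * b i)"
proof -
  obtain a :: "6 \<Rightarrow> complex" where a: "\<And>i. i < 6 \<Longrightarrow> a (of_nat i) = b i" using coord_idx by blast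
  have "vanish \<tau> (\<lambda>i. a (of_nat i))" using assms vanish_cong[of "\<lambda>i. a (of_nat i)" b \<tau>] a by blast
  then have "\<forall>j<6. ev (\<lambda>v. c * a v) (gcof \<tau> j) = 0"
    unfolding vanish_ev by (simp add: ev_homogeneous[OF homogeneous_rd[OF rd_gcof]] del: alpha.simps)
  then have "vanish \<tau> (\<lambda>i. c * a (of_nat i))" by (rule iffD2[OF vanish_ev[of \<tau> "\<lambda>v. c * a v"]])
  then show ?thesis using vanish_cong[of "\<lambda>i. c * a (of_nat i)" "\<lambda>i. c * b i" \<tau>] a by simp
qed

section \<open>Linear equivalence of quintics\<close>

definition m2 :: "'c \<Rightarrow> 'c \<Rightarrow> 'c \<Rightarrow> 'c \<Rightarrow> 'c::comm_ring_1 mat" where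
  "m2 p q r s = mat 2 2 (\<lambda>(i, j). if j = 0 then (if i = 0 then p else q) else (if i = 0 then r else s))"

lemma m2_simps [simp]: "m2 p q r s \<in> carrier_mat 2 2" "m2 p q r s $$ (0, 0) = p" "m2 p q r s $$ (Suc 0, 0) = q"
  "m2 p q r s $$ (0, Suc 0) = r" "m2 p q r s $$ (Suc 0, Suc 0) = s" "m2 p q r s $$ (1, 0) = q"
  "m2 p q r s $$ (0, 1) = r" "m2 p q r s $$ (1, 1) = s"
  by (simp_all add: m2_def)

lemma m2_SL2: "p * s - q * r = 1 \<Longrightarrow> m2 p q r s \<in> SL2"
  by (simp add: SL2_def det_2 mult.commute)

lemma m2_all: "g \<in> carrier_mat 2 2 \<Longrightarrow> g = m2 (g $$ (0,0)) (g $$ (1,0)) (g $$ (0,1)) (g $$ (1,1))"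
  by (rule mat_2_eqI) simp_all

text \<open>The arguments of \<open>m2\<close> are listed by columns: \<open>m2 p q r s\<close>
  substitutes p x1 + q x2 for x1 and r x1 + s x2 for x2.\<close>

lemma act_m2_comp:
  "act_form (m2 p q r s) (act_form (m2 p' q' r' s') A) =
    act_form (m2 (p' * p + q' * r) (p' * q + q' * s) (r' * p + s' * r) (r' * q + s' * s)) A"
proof (rule hom_eqI[OF hom_comp[OF act_form_hom act_form_hom] act_form_hom])
  fix v :: 2
  show "act_form (m2 p q r s) (act_form (m2 p' q' r' s') (Var v)) =
    act_form (m2 (p' * p + q' * r) (p' * q + q' * s) (r' * p + s' * r) (r' * q + s' * s)) (Var v)"
    using two_cases[of v]
    by (auto simp: act_form_x1 act_form_x2 crh_add[OF act_form_hom] crh_mult[OF act_form_hom] Const_add Const_mult algebra_simps)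
qed simp

lemma act_m2_one: "act_form (m2 1 0 0 1) A = A"
proof (rule hom_eqI[OF act_form_hom id_hom])
  fix v :: 2
  show "act_form (m2 1 0 0 1) (Var v) = Var v"
    using two_cases[of v] by (auto simp: act_form_x1 act_form_x2)
qed simp

text \<open>Up to the factor n, the normalised coefficients of the derivative of a form of order n
  in direction (p, r).\<close>

definition contract :: "'c::comm_ring_1 \<Rightarrow> 'c \<Rightarrow> (nat \<Rightarrow> 'c) \<Rightarrow> nat \<Rightarrow> 'c" where
  "contract p r b i = p * b i + r * b (Suc i)"

lemma contract_comm: "contract p r (contract q s b) = contract q s (contract p r b)"
  by (rule ext) (simp add: contract_def algebra_simps)

lemma contract_pow_comm: "(contract p r ^^ n) (contract q s b) = contract q s ((contract p r ^^ n) b)"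
  by (induction n) (simp_all add: contract_comm)

text \<open>Coefficient \<open>j\<close> of a transformed form is the polarisation of the form at \<open>n - j\<close> copies of
  the first and \<open>j\<close> copies of the second column of the transformation.\<close>

definition trn :: "nat \<Rightarrow> 'c::comm_ring_1 \<Rightarrow> 'c \<Rightarrow> 'c \<Rightarrow> 'c \<Rightarrow> (nat \<Rightarrow> 'c) \<Rightarrow> nat \<Rightarrow> 'c" where
  "trn n p q r s b j = (contract p r ^^ (n - j)) ((contract q s ^^ j) b) 0"

lemma nform_Suc: "nform (Suc n) f = x1 * nform n f + x2 * nform n (\<lambda>i. f (Suc i))"
proof -
  let ?c = "\<lambda>m i. of_nat (m choose i) :: 'a" and ?T = "\<lambda>i. x1 ^ (n - i) * x2 ^ i :: 'a bform"
  have tail: "(\<Sum>i\<le>n. Const (?c n (Suc i) * f (Suc i)) * x1 ^ (n - i) * x2 ^ Suc i) =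
      (\<Sum>i\<le>n. if i = 0 then 0 else Const (?c n i * f i) * x1 ^ (Suc n - i) * x2 ^ i)"
  proof -
    have "(\<Sum>i\<le>n. Const (?c n (Suc i) * f (Suc i)) * x1 ^ (n - i) * x2 ^ Suc i :: 'a bform) =
        (\<Sum>i\<le>Suc n. if i = 0 then 0 else Const (?c n i * f i) * x1 ^ (Suc n - i) * x2 ^ i)"
      by (simp only: sum.atMost_Suc_shift if_True refl add_0 diff_Suc_Suc nat.simps if_False)
    then show ?thesis by (simp add: binomial_eq_0)
  qed
  have "nform (Suc n) f = Const (f 0) * x1 ^ Suc n + (\<Sum>i\<le>n. Const (?c (Suc n) (Suc i) * f (Suc i)) * x1 ^ (n - i) * x2 ^ Suc i)"
    unfolding nform_def pform_def by (simp only: sum.atMost_Suc_shift) simp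
  also have "(\<Sum>i\<le>n. Const (?c (Suc n) (Suc i) * f (Suc i)) * x1 ^ (n - i) * x2 ^ Suc i :: 'a bform) =
      (\<Sum>i\<le>n. Const (?c n i * f (Suc i)) * x1 ^ (n - i) * x2 ^ Suc i) +
      (\<Sum>i\<le>n. Const (?c n (Suc i) * f (Suc i)) * x1 ^ (n - i) * x2 ^ Suc i)"
    by (simp only: binomial_Suc_Suc of_nat_add ring_distribs Const_add sum.distrib)
  also have "(\<Sum>i\<le>n. Const (?c n i * f (Suc i)) * x1 ^ (n - i) * x2 ^ Suc i :: 'a bform) = x2 * nform n (\<lambda>i. f (Suc i))"
    unfolding nform_def pform_def sum_distrib_left by (intro sum.cong refl) (simp only: power_Suc mult_ac)
  finally have e: "nform (Suc n) f = x2 * nform n (\<lambda>i. f (Suc i)) + (Const (f 0) * x1 ^ Suc n +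
      (\<Sum>i\<le>n. if i = 0 then 0 else Const (?c n i * f i) * x1 ^ (Suc n - i) * x2 ^ i))"
    unfolding tail by (simp only: add_ac)
  have "x1 * nform n f = (\<Sum>i\<le>n. Const (?c n i * f i) * x1 ^ (Suc n - i) * x2 ^ i)"
    unfolding nform_def pform_def sum_distrib_left
    by (intro sum.cong refl) (simp only: Suc_diff_le atMost_iff power_Suc mult_ac)
  also have "\<dots> = (\<Sum>i\<le>n. (if i = 0 then Const (f 0) * x1 ^ Suc n else 0) +
      (if i = 0 then 0 else Const (?c n i * f i) * x1 ^ (Suc n - i) * x2 ^ i))"
    by (intro sum.cong refl) auto
  also have "\<dots> = Const (f 0) * x1 ^ Suc n +
      (\<Sum>i\<le>n. if i = 0 then 0 else Const (?c n i * f i) * x1 ^ (Suc n - i) * x2 ^ i)"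
    unfolding sum.distrib by simp
  finally show ?thesis unfolding e by (simp only: add_ac)
qed

lemma act_nform: "act_form (m2 p q r s) (nform n b) = nform n (trn n p q r s b)"
proof (induction n arbitrary: b)
  case 0
  show ?case by (simp add: nform_def pform_def trn_def)
next
  case (Suc n)
  let ?A = "act_form (m2 p q r s)"
  have l: "trn n p q r s b k = trn (Suc n) p q r s b' k'"
    if "\<And>i. (contract p r ^^ (n - k)) ((contract q s ^^ k) b) 0 = (contract p r ^^ (Suc n - k')) ((contract q s ^^ k') b') 0" for b b' k k'
    unfolding trn_def by (rule that)
  have "?A (nform (Suc n) b) = (Const p * x1 + Const q * x2) * ?A (nform n b) + (Const r * x1 + Const s * x2) * ?A (nform n (\<lambda>i. b (Suc i)))"
    unfolding nform_Suc crh_add[OF act_form_hom] crh_mult[OF act_form_hom] act_form_x1 act_form_x2 by simp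
  also have "\<dots> = x1 * ?A (Const p * nform n b + Const r * nform n (\<lambda>i. b (Suc i))) + x2 * ?A (Const q * nform n b + Const s * nform n (\<lambda>i. b (Suc i)))"
    unfolding crh_add[OF act_form_hom] crh_mult[OF act_form_hom] act_form_Const by (simp only: ring_distribs mult_ac add_ac)
  also have "\<dots> = x1 * nform n (trn n p q r s (contract p r b)) + x2 * nform n (trn n p q r s (contract q s b))"
    unfolding Suc.IH[symmetric] nform_Const_mult[symmetric] nform_add[symmetric] contract_def[symmetric] ..
  also have "nform n (trn n p q r s (contract p r b)) = nform n (trn (Suc n) p q r s b)"
    by (rule nform_cong) (simp only: trn_def Suc_diff_le funpow.simps(2) o_apply contract_pow_comm)
  also have "trn n p q r s (contract q s b) = (\<lambda>i. trn (Suc n) p q r s b (Suc i))"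
    by (rule ext) (simp add: trn_def funpow_swap1)
  finally show ?case unfolding nform_Suc .
qed

abbreviation tr :: "complex \<Rightarrow> complex \<Rightarrow> complex \<Rightarrow> complex \<Rightarrow> (nat \<Rightarrow> complex) \<Rightarrow> nat \<Rightarrow> complex" where
  "tr \<equiv> trn 5"

text \<open>Equivalence under GL2 in place of SL2 and scalars. Over the complex numbers nothing is
  lost: a scalar multiple comes from a scalar matrix by a fifth root, and division by a square root
  of the determinant leads back to SL2.\<close>

definition eqv :: "(nat \<Rightarrow> complex) \<Rightarrow> (nat \<Rightarrow> complex) \<Rightarrow> bool" where
  "eqv b b' \<longleftrightarrow> (\<exists>p q r s. p * s - q * r \<noteq> 0 \<and> nform 5 b' = act_form (m2 p q r s) (nform 5 b))"

lemma nform_inject: "nform 5 b = nform 5 (b' :: nat \<Rightarrow> complex) \<longleftrightarrow> (\<forall>i<6. b i = b' i)"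
proof -
  have "(5 choose i) \<noteq> 0" if "i \<le> 5" for i using that by simp
  then show ?thesis unfolding nform_def pform_inject by (auto simp: less_Suc_eq_le eval_nat_numeral)
qed

lemma eqv_iff: "eqv b b' \<longleftrightarrow> (\<exists>p q r s. p * s - q * r \<noteq> 0 \<and> (\<forall>i<6. b' i = tr p q r s b i))"
  unfolding eqv_def act_nform nform_inject ..

lemma eqv_tr: "p * s - q * r \<noteq> 0 \<Longrightarrow> (\<And>i. i < 6 \<Longrightarrow> b' i = tr p q r s b i) \<Longrightarrow> eqv b b'"
  unfolding eqv_iff by blast

lemma eqv_cong: "(\<And>i. i < 6 \<Longrightarrow> b i = b' i) \<Longrightarrow> eqv b b'"
proof -
  assume "\<And>i. i < 6 \<Longrightarrow> b i = b' i"
  then have "nform 5 b' = act_form (m2 1 0 0 1) (nform 5 b)" unfolding act_m2_one nform_inject by simp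
  then show ?thesis unfolding eqv_def
    by (rule_tac x = 1 in exI, rule_tac x = 0 in exI, rule_tac x = 0 in exI, rule_tac x = 1 in exI) simp
qed

lemma eqv_trans [trans]: "eqv a b \<Longrightarrow> eqv b c \<Longrightarrow> eqv a c"
proof -
  assume "eqv a b" "eqv b c"
  then obtain p q r s p' q' r' s' where d: "p * s - q * r \<noteq> 0" "p' * s' - q' * r' \<noteq> 0"
    and b: "nform 5 b = act_form (m2 p q r s) (nform 5 a)" and c: "nform 5 c = act_form (m2 p' q' r' s') (nform 5 b)"
    unfolding eqv_def by (elim exE conjE) blast
  have "(p * p' + q * r') * (r * q' + s * s') - (p * q' + q * s') * (r * p' + s * r') = (p * s - q * r) * (p' * s' - q' * r')"
    by (simp add: algebra_simps)
  then have "(p * p' + q * r') * (r * q' + s * s') - (p * q' + q * s') * (r * p' + s * r') \<noteq> 0" using d by simp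
  then show "eqv a c" unfolding eqv_def c b act_m2_comp by blast
qed

lemma eqv_sym: "eqv a b \<Longrightarrow> eqv b a"
proof -
  assume "eqv a b"
  then obtain p q r s where d: "p * s - q * r \<noteq> 0" and b: "nform 5 b = act_form (m2 p q r s) (nform 5 a)"
    unfolding eqv_def by blast
  let ?d = "p * s - q * r"
  have e: "p * (s / ?d) + q * (- r / ?d) = 1" "p * (- q / ?d) + q * (p / ?d) = 0" "r * (s / ?d) + s * (- r / ?d) = 0" "r * (- q / ?d) + s * (p / ?d) = 1"
    using d by (simp_all add: divide_simps)
  have "act_form (m2 (s / ?d) (- q / ?d) (- r / ?d) (p / ?d)) (nform 5 b) = nform 5 a"
    unfolding b act_m2_comp e act_m2_one ..
  moreover have "(s / ?d) * (p / ?d) - (- q / ?d) * (- r / ?d) = ?d / (?d * ?d)" by (simp add: diff_divide_distrib mult_ac)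
  then have "(s / ?d) * (p / ?d) - (- q / ?d) * (- r / ?d) \<noteq> 0" using d by simp
  ultimately show "eqv b a" unfolding eqv_def by metis
qed

lemmas tr_simps = trn_def contract_def eval_nat_numeral

lemma less_6: "(i::nat) < 6 \<longleftrightarrow> i = 0 \<or> i = 1 \<or> i = 2 \<or> i = 3 \<or> i = 4 \<or> i = 5"
  by auto

lemma tr_diag: "i < 6 \<Longrightarrow> tr l 0 0 m b i = l ^ (5 - i) * m ^ i * b i"
  unfolding less_6 by (elim disjE) (simp_all add: tr_simps)

lemma root_exists: "n > 0 \<Longrightarrow> \<exists>z. z ^ n = (c :: complex)"
proof -
  assume n: "n > 0"
  have "\<not> constant (poly (monom 1 n + [:- c:]))"
  proof -
    have "degree (monom 1 n + [:- c:]) = n" using n by (subst degree_add_eq_left) (simp_all add: degree_monom_eq)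
    then show ?thesis using n by (simp add: constant_degree)
  qed
  then obtain z where "poly (monom 1 n + [:- c:]) z = 0" using fundamental_theorem_of_algebra by blast
  then show ?thesis by (auto simp: poly_monom)
qed

lemma eqv_scale: "c \<noteq> 0 \<Longrightarrow> eqv b (\<lambda>i. c * b i)"
proof -
  assume c: "c \<noteq> 0"
  obtain z where z: "z ^ 5 = c" using root_exists[of 5] by auto
  have "z \<noteq> 0" using z c by auto
  moreover have "c * b i = tr z 0 0 z b i" if "i < 6" for i
  proof -
    have "z ^ (5 - i) * z ^ i = z ^ 5" using that by (simp flip: power_add)
    then show ?thesis using that z by (simp add: tr_diag)
  qed
  ultimately show ?thesis by (intro eqv_tr[of z z 0 0]) simp_all
qed

lemma ev_coefficients:
  assumes h: "comm_ring_hom (h :: quintic_ring \<Rightarrow> complex)"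
  defines "\<psi> \<equiv> subst_poly (\<lambda>p. Const (h p)) Var"
  shows "comm_ring_hom \<psi>" "\<psi> (Const c) = Const (h c)" "\<psi> (Var v) = Var v" "\<psi> (pform n p) = pform n (\<lambda>i. h (p i))"
    "\<psi> (nform n p) = nform n (\<lambda>i. h (p i))"
proof -
  note H = hom_comp[OF Const_hom h]
  show 1: "comm_ring_hom \<psi>" "\<psi> (Const c) = Const (h c)" "\<psi> (Var v) = Var v" for c v
    unfolding \<psi>_def by (rule subst_poly_hom[OF H], rule subst_poly_Const[OF H], rule subst_poly_Var[OF H])
  show 2: "\<psi> (pform n p) = pform n (\<lambda>i. h (p i))" for n p
    unfolding pform_def crh_sum[OF 1(1)] crh_mult[OF 1(1)] crh_power[OF 1(1)] 1 ..
  interpret h: comm_ring_hom h by (rule h)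
  show "\<psi> (nform n p) = nform n (\<lambda>i. h (p i))" unfolding nform_def 2 by (simp add: h.hom_mult h.hom_of_nat)
qed

text \<open>Evaluating the invariance of \<Gamma> at b expresses \<Gamma> at b by its coefficients
  at the transformed point b' and a substitution in x1, x2. If all coefficients at b' vanish, so
  does the form at b.\<close>

lemma vanish_SL2:
  assumes g: "g \<in> SL2" and b': "nform 5 b' = act_form (adj_mat g) (nform 5 b)" and v: "vanish \<tau> b'"
  shows "vanish \<tau> b"
proof -
  obtain a :: "6 \<Rightarrow> complex" where a: "\<And>i. i < 6 \<Longrightarrow> a (of_nat i) = b i" using coord_idx by blast
  define \<psi> where "\<psi> = (subst_poly (\<lambda>p. Const (ev a p)) Var :: quintic_ring bform \<Rightarrow> complex bform)"
  note \<psi> = ev_coefficients[OF ev_hom[of a], folded \<psi>_def]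
  define a' where "a' v = ev a (act_coeff g (Var v))" for v
  have ev': "ev a (act_coeff g p) = ev a' p" for p
    by (rule hom_eqI[OF hom_comp[OF ev_hom act_coeff_hom] ev_hom]) (simp_all add: ev_simps a'_def)
  have k: "\<psi> (act_form (map_mat Const (adj_mat g)) A) = act_form (adj_mat g) (\<psi> A)" for A
  proof (rule hom_eqI[OF hom_comp[OF \<psi>(1) act_form_hom] hom_comp[OF act_form_hom \<psi>(1)]])
    fix v :: 2
    show "\<psi> (act_form (map_mat Const (adj_mat g)) (Var v)) = act_form (adj_mat g) (\<psi> (Var v))"
      using two_cases[of v] adj_mat_mult(3)[OF g]
      by (auto simp: act_form_x1 act_form_x2 crh_add[OF \<psi>(1)] crh_mult[OF \<psi>(1)] \<psi>(2,3) ev_simps)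
  qed (simp add: \<psi>(2))
  have "nform 5 (\<lambda>i. a' (of_nat i)) = \<psi> (map_coeff (act_coeff g) generic_quintic)"
    unfolding generic_quintic_nform nform_def map_coeff_pform[OF act_coeff_hom] \<psi>(4)
    by (rule pform_cong) (simp add: crh_mult[OF act_coeff_hom] crh_mult[OF ev_hom] Const.hom_of_nat[symmetric] ev_simps a'_def av_def)
  also have "\<dots> = act_form (adj_mat g) (nform 5 (\<lambda>i. a (of_nat i)))"
    unfolding map_coeff_act_coeff_quintic k by (simp only: generic_quintic_nform \<psi>(5) av_def ev_simps)
  also have "nform 5 (\<lambda>i. a (of_nat i)) = nform 5 b" unfolding nform_inject using a by blast
  also have "act_form (adj_mat g) (nform 5 b) = nform 5 b'" by (rule b'[symmetric])
  finally have "\<And>i. i < 6 \<Longrightarrow> a' (of_nat i) = b' i" unfolding nform_inject by blast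
  then have "vanish \<tau> (\<lambda>i. a' (of_nat i))" using v vanish_cong[of "\<lambda>i. a' (of_nat i)" b' \<tau>] by blast
  then have z: "\<And>j. j < 6 \<Longrightarrow> ev a' (gcof \<tau> j) = 0" unfolding vanish_ev by blast
  let ?c = "\<lambda>i. Const (120 ^ 5) * (- ((-1) ^ (5 - i) * gcof \<tau> (5 - i))) :: quintic_ring"
  have ev_c: "ev d (?c i) = 120 ^ 5 * (- ((-1) ^ (5 - i) * ev d (gcof \<tau> (5 - i))))" for d i
    by (simp only: crh_mult[OF ev_hom] crh_uminus[OF ev_hom] crh_power[OF ev_hom] crh_one[OF ev_hom] ev_simps)
  have "\<psi> (cov_Gamma \<tau>) = \<psi> (act_cov g (pform 5 ?c))"
    by (simp only: cov_Gamma_pform[symmetric] act_cov_Gamma[OF g])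
  also have "\<dots> = (\<Sum>i\<le>5. Const (ev a (act_coeff g (?c i))) * \<psi> (act_cov g x1) ^ (5 - i) * \<psi> (act_cov g x2) ^ i)"
    unfolding pform_def crh_sum[OF act_cov_hom] crh_sum[OF \<psi>(1)] crh_mult[OF act_cov_hom] crh_mult[OF \<psi>(1)]
      crh_power[OF act_cov_hom] crh_power[OF \<psi>(1)] act_cov_Const \<psi>(2) ..
  also have "\<dots> = 0"
    unfolding ev' ev_c by (rule sum.neutral) (simp add: z)
  finally have "pform 5 (\<lambda>i. ev a (?c i)) = pform 5 (\<lambda>i. 0)"
    unfolding cov_Gamma_pform \<psi>(4) by (simp add: pform_def)
  then have c0: "\<And>i. i \<le> 5 \<Longrightarrow> ev a (?c i) = 0" unfolding pform_inject by blast
  have "ev a (gcof \<tau> j) = 0" if "j < 6" for j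
    using c0[of "5 - j"] that unfolding ev_c by simp
  then have "vanish \<tau> (\<lambda>i. a (of_nat i))" unfolding vanish_ev by blast
  then show ?thesis using vanish_cong[of "\<lambda>i. a (of_nat i)" b \<tau>] a by blast
qed

lemma adj_adj:
  assumes g: "g \<in> SL2" shows "adj_mat g \<in> SL2" "adj_mat (adj_mat g) = g"
proof -
  have c: "g \<in> carrier_mat 2 2" "adj_mat g \<in> carrier_mat 2 2" using g adj_mat_mult(3)[OF g] by (auto simp: SL2_def)
  have "det g * det (adj_mat g) = det (1\<^sub>m 2)" using det_mult[OF c] adj_mat_mult(1)[OF g] by simp
  then show s: "adj_mat g \<in> SL2" using g c by (simp add: SL2_def)
  have c': "adj_mat (adj_mat g) \<in> carrier_mat 2 2" by (rule adj_mat_mult(3)[OF s])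
  have "g = g * (adj_mat g * adj_mat (adj_mat g))" using adj_mat_mult(1)[OF s] c by simp
  also have "\<dots> = (g * adj_mat g) * adj_mat (adj_mat g)" using c c' by (simp add: assoc_mult_mat[of g 2 2 _ 2 _ 2])
  also have "\<dots> = adj_mat (adj_mat g)" unfolding adj_mat_mult(1)[OF g] using c' by simp
  finally show "adj_mat (adj_mat g) = g" ..
qed

lemma eqv_SL2:
  assumes "eqv b b'"
  shows "\<exists>c g. c \<noteq> 0 \<and> g \<in> SL2 \<and> nform 5 (\<lambda>i. c * b' i) = act_form g (nform 5 b)"
proof -
  obtain p q r s where d: "p * s - q * r \<noteq> 0" and b': "nform 5 b' = act_form (m2 p q r s) (nform 5 b)"
    using assms unfolding eqv_def by blast
  obtain \<mu> where \<mu>: "\<mu> ^ 2 = p * s - q * r" using root_exists[of 2] by auto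
  have \<mu>0: "\<mu> \<noteq> 0" using \<mu> d by auto
  let ?k = "1 / \<mu>"
  have "p * ?k * (s * ?k) - q * ?k * (r * ?k) = (p * s - q * r) / \<mu> ^ 2" by (simp add: power2_eq_square diff_divide_distrib)
  then have "p * ?k * (s * ?k) - q * ?k * (r * ?k) = 1" using \<mu> d by simp
  then have g: "m2 (p * ?k) (q * ?k) (r * ?k) (s * ?k) \<in> SL2" by (rule m2_SL2)
  have "nform 5 (\<lambda>i. ?k ^ 5 * b' i) = act_form (m2 ?k 0 0 ?k) (nform 5 b')"
    unfolding act_nform nform_inject
  proof (intro allI impI)
    fix i :: nat assume i: "i < 6"
    have "?k ^ (5 - i) * ?k ^ i = ?k ^ 5" using i by (simp flip: power_add)
    then show "?k ^ 5 * b' i = tr ?k 0 0 ?k b' i" using i by (simp only: tr_diag)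
  qed
  also have "\<dots> = act_form (m2 (p * ?k) (q * ?k) (r * ?k) (s * ?k)) (nform 5 b)"
    unfolding b' act_m2_comp by simp
  finally show ?thesis using g \<mu>0 by (intro exI[of _ "?k ^ 5"] exI conjI) auto
qed

lemma vanish_eqv_imp: "eqv b b' \<Longrightarrow> vanish \<tau> b' \<Longrightarrow> vanish \<tau> b"
proof -
  assume "eqv b b'" and v: "vanish \<tau> b'"
  then obtain c g where g: "g \<in> SL2" "nform 5 (\<lambda>i. c * b' i) = act_form g (nform 5 b)" using eqv_SL2 by blast
  show ?thesis
    by (rule vanish_SL2[OF adj_adj(1)[OF g(1)] _ vanish_scale[OF v, of c]]) (simp only: adj_adj(2)[OF g(1)] g(2))
qed

lemma vanish_eqv: "eqv b b' \<Longrightarrow> vanish \<tau> b \<longleftrightarrow> vanish \<tau> b'"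
  using vanish_eqv_imp eqv_sym by blast

section \<open>Points of projective space and orbits\<close>

definition coords :: "complex bform \<Rightarrow> nat \<Rightarrow> complex" where
  "coords f i = quintic_coord f (of_nat i)"

lemma nform_coords: "f \<in> forms 5 \<Longrightarrow> nform 5 (coords f) = f"
proof -
  assume f: "f \<in> forms 5"
  have "nform 5 (coords f) = pform 5 (\<lambda>i. Poly_Mapping.lookup f (bmon 5 i))"
    unfolding nform_def by (rule pform_cong) (simp add: coords_def quintic_coord_def idx_of_nat quintic_mon_bmon)
  also have "\<dots> = f" using forms_pform[OF f] by (rule sym)
  finally show ?thesis .
qed

lemma coords_nform: "i < 6 \<Longrightarrow> coords (nform 5 b) i = b i"
  using nform_coords[OF nform_in_forms, of b] unfolding nform_inject by blast

lemma nform_scale: "Const c * nform 5 b = nform 5 (\<lambda>i. c * b i)"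
  by (rule nform_Const_mult[symmetric])

lemma cov_ideal_vanish:
  "(\<forall>p\<in>cov_ideal \<tau>. ev (quintic_coord f) p = 0) \<longleftrightarrow> vanish \<tau> (coords f)"
proof
  assume "\<forall>p\<in>cov_ideal \<tau>. ev (quintic_coord f) p = 0"
  then show "vanish \<tau> (coords f)"
    unfolding coords_def[abs_def] vanish_ev cov_ideal_gcof by (auto intro: ideal_base)
next
  assume v: "vanish \<tau> (coords f)"
  show "\<forall>p\<in>cov_ideal \<tau>. ev (quintic_coord f) p = 0"
    unfolding cov_ideal_gcof ideal_gen_image
    using v unfolding coords_def[abs_def] vanish_ev by (auto simp: crh_sum[OF ev_hom] crh_mult[OF ev_hom])
qed

lemma line_in_zero_locus:
  "line (nform 5 b) \<in> zero_locus (cov_ideal \<tau>) \<longleftrightarrow> (\<exists>i<6. b i \<noteq> 0) \<and> vanish \<tau> b"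
proof -
  have n0: "nform 5 b = 0 \<longleftrightarrow> (\<forall>i<6. b i = 0)" for b :: "nat \<Rightarrow> complex"
    using nform_inject[of b "\<lambda>_. 0"] by (simp add: nform_def pform_def)
  have c: "vanish \<tau> (coords (nform 5 b)) = vanish \<tau> b" for b
    by (rule vanish_cong) (rule coords_nform)
  have self: "nform 5 b \<in> line (nform 5 b)" unfolding line_def by (rule CollectI, rule exI[of _ 1]) simp
  show ?thesis
  proof
    assume "line (nform 5 b) \<in> zero_locus (cov_ideal \<tau>)"
    then have q: "line (nform 5 b) \<in> quintic_space" and v: "\<forall>f\<in>line (nform 5 b). \<forall>p\<in>cov_ideal \<tau>. ev (quintic_coord f) p = 0"
      unfolding zero_locus_def by blast+
    from q obtain f where f: "line (nform 5 b) = line f" "f \<noteq> 0"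
      unfolding quintic_space_def mem_Collect_eq by (elim exE conjE)
    have "f \<in> line f" unfolding line_def by (rule CollectI, rule exI[of _ 1]) simp
    then have "f \<in> line (nform 5 b)" by (simp only: f(1))
    then obtain d where d: "f = Const d * nform 5 b" unfolding line_def mem_Collect_eq by (elim exE conjE)
    have "nform 5 b \<noteq> 0"
    proof
      assume "nform 5 b = 0"
      then show False using f(2) unfolding d by simp
    qed
    moreover have "vanish \<tau> b" using v self cov_ideal_vanish c by blast
    ultimately show "(\<exists>i<6. b i \<noteq> 0) \<and> vanish \<tau> b" unfolding n0 by blast
  next
    assume a: "(\<exists>i<6. b i \<noteq> 0) \<and> vanish \<tau> b"
    have "vanish \<tau> (coords f)" if f: "f \<in> line (nform 5 b)" for f
    proof -
      obtain d where "f = Const d * nform 5 b" using f unfolding line_def mem_Collect_eq by (elim exE conjE)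
      then have f: "f = nform 5 (\<lambda>i. d * b i)" by (simp only: nform_scale)
      have "vanish \<tau> (\<lambda>i. d * b i)" using a by (intro vanish_scale) blast
      then show ?thesis unfolding f c .
    qed
    moreover have "line (nform 5 b) \<in> quintic_space"
      unfolding quintic_space_def mem_Collect_eq
      by (intro exI[of _ "nform 5 b"] conjI refl nform_in_forms) (use a n0[of b] in blast)
    ultimately show "line (nform 5 b) \<in> zero_locus (cov_ideal \<tau>)"
      unfolding zero_locus_def cov_ideal_vanish by blast
  qed
qed

lemma quintic_space_nform:
  assumes "P \<in> quintic_space" shows "\<exists>b. P = line (nform 5 b)"
proof -
  obtain f where f: "P = line f" "f \<in> forms 5"
    using assms unfolding quintic_space_def mem_Collect_eq by (elim exE conjE)
  have "P = line (nform 5 (coords f))" by (simp only: nform_coords[OF f(2)] f(1))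
  then show ?thesis by (rule exI[of _ "coords f"])
qed

lemma line_scale:
  assumes c: "c \<noteq> 0" shows "line (nform 5 (\<lambda>i. c * b i)) = line (nform 5 b)"
  unfolding nform_scale[symmetric]
proof (intro equalityI subsetI)
  fix x assume "x \<in> line (Const c * nform 5 b)"
  then obtain d where d: "x = Const d * (Const c * nform 5 b)" "d \<noteq> 0" unfolding line_def mem_Collect_eq by (elim exE conjE)
  have "x = Const (d * c) * nform 5 b" by (simp only: d(1) Const_mult mult.assoc)
  moreover have "d * c \<noteq> 0" using d(2) c by simp
  ultimately show "x \<in> line (nform 5 b)" unfolding line_def mem_Collect_eq by (intro exI conjI)
next
  fix x assume "x \<in> line (nform 5 b)"
  then obtain d where d: "x = Const d * nform 5 b" "d \<noteq> 0" unfolding line_def mem_Collect_eq by (elim exE conjE)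
  have "d = d / c * c" using c by simp
  then have "x = Const (d / c * c) * nform 5 b" using d(1) by simp
  then have "x = Const (d / c) * (Const c * nform 5 b)" by (simp only: Const_mult mult.assoc)
  moreover have "d / c \<noteq> 0" using d(2) c by simp
  ultimately show "x \<in> line (Const c * nform 5 b)" unfolding line_def mem_Collect_eq by (intro exI conjI)
qed

lemma orbit_eqv: "eqv r b \<Longrightarrow> line (nform 5 b) \<in> SL2_orbit (nform 5 r)"
proof -
  assume "eqv r b"
  then obtain c g where g: "c \<noteq> 0" "g \<in> SL2" "nform 5 (\<lambda>i. c * b i) = act_form g (nform 5 r)" using eqv_SL2 by blast
  have "line (nform 5 b) = line (act_form g (nform 5 r))" unfolding g(3)[symmetric] line_scale[OF g(1)] ..
  then show ?thesis using g(2) unfolding SL2_orbit_def by blast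
qed

lemma orbit_in_zero_locus:
  assumes "P \<in> SL2_orbit (nform 5 r)" "vanish \<tau> r" "\<exists>i<6. r i \<noteq> 0"
  shows "P \<in> zero_locus (cov_ideal \<tau>)"
proof -
  obtain g where g: "g \<in> SL2" "P = line (act_form g (nform 5 r))" using assms(1) unfolding SL2_orbit_def by blast
  have gc: "g \<in> carrier_mat 2 2" using g(1) by (simp add: SL2_def)
  obtain p q r' s where m: "g = m2 p q r' s" using m2_all[OF gc] by blast
  have d: "p * s - q * r' \<noteq> 0" using g(1) unfolding m by (simp add: SL2_def det_2 mult.commute)
  let ?b = "tr p q r' s r"
  have P: "P = line (nform 5 ?b)" unfolding g(2) m act_nform ..
  have e: "eqv r ?b" by (rule eqv_tr[OF d]) simp
  obtain p' q' s' t' where "\<forall>i<6. r i = tr p' q' s' t' ?b i" using eqv_sym[OF e] unfolding eqv_iff by blast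
  moreover have "tr p' q' s' t' (\<lambda>_. 0) i = 0" for i
  proof -
    have "contract x y (\<lambda>_. 0) = (\<lambda>_. 0 :: complex)" for x y by (rule ext) (simp add: contract_def)
    then have "(contract x y ^^ n) (\<lambda>_. 0) = (\<lambda>_. 0 :: complex)" for x y n by (induction n) simp_all
    then show ?thesis by (simp add: trn_def)
  qed
  moreover have "tr p' q' s' t' ?b i = tr p' q' s' t' (\<lambda>_. 0) i" if "\<forall>i<6. ?b i = 0" "i < 6" for i
  proof -
    have "nform 5 ?b = nform 5 (\<lambda>_. 0)" unfolding nform_inject using that(1) by blast
    then have "nform 5 (tr p' q' s' t' ?b) = nform 5 (tr p' q' s' t' (\<lambda>_. 0))" unfolding act_nform[symmetric] by simp
    then show ?thesis unfolding nform_inject using that(2) by blast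
  qed
  ultimately have "\<exists>i<6. ?b i \<noteq> 0" using assms(3) by metis
  then show ?thesis unfolding P line_in_zero_locus using vanish_eqv[OF e] assms(2) by blast
qed

text \<open>If all minors vanish, \<open>aug\<close> is singular for every added row w, so there is
  always a nontrivial relation. If one of these does not involve w, it is a relation between the
  five rows. Otherwise every unit vector is a combination of five rows, and a 6 by 6 matrix with a
  zero row would have a left inverse.\<close>

lemma vanish_dependent:
  "vanish \<tau> b \<longleftrightarrow> (\<exists>v. (\<exists>i<5. v i \<noteq> 0) \<and> (\<forall>j<6. (\<Sum>i<5. v i * alpha (\<lambda>c. c) b \<tau> i j) = 0))"
proof
  let ?\<alpha> = "alpha (\<lambda>c. c) b \<tau>"
  assume "\<exists>v. (\<exists>i<5. v i \<noteq> 0) \<and> (\<forall>j<6. (\<Sum>i<5. v i * ?\<alpha> i j) = 0)"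
  then obtain v i where v: "i < 5" "v i \<noteq> 0" "\<And>j. j < 6 \<Longrightarrow> (\<Sum>i<5. v i * ?\<alpha> i j) = 0" by blast
  show "vanish \<tau> b"
    unfolding vanish_def
  proof (intro allI impI, rule ccontr)
    fix j :: nat assume j: "j < 6" "cof ?\<alpha> j \<noteq> 0"
    have "v i = 0" by (rule rows_independent[OF j v(3) v(1)])
    then show False using v(2) by simp
  qed
next
  let ?\<alpha> = "alpha (\<lambda>c. c) b \<tau>"
  assume z: "vanish \<tau> b"
  have "\<exists>u. u \<in> carrier_vec 6 \<and> u \<noteq> 0\<^sub>v 6 \<and> (aug ?\<alpha> w)\<^sup>T *\<^sub>v u = 0\<^sub>v 6" for w
  proof -
    have "det (aug ?\<alpha> w) = 0" using z unfolding det_aug vanish_def by simp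
    then have "det (aug ?\<alpha> w)\<^sup>T = 0" by (simp add: det_transpose[of _ 6])
    then show ?thesis using det_0_iff_vec_prod_zero[of "(aug ?\<alpha> w)\<^sup>T" 6] by simp
  qed
  then obtain u where u: "\<And>w. u w \<in> carrier_vec 6" "\<And>w. u w \<noteq> 0\<^sub>v 6" "\<And>w. (aug ?\<alpha> w)\<^sup>T *\<^sub>v u w = 0\<^sub>v 6" by metis
  have six: "(\<Sum>i<6. f i) = (\<Sum>i<5. f i) + f 5" for f :: "nat \<Rightarrow> complex"
    by (simp add: eval_nat_numeral)
  have rel: "(\<Sum>i<5. u w $ i * ?\<alpha> i j) + u w $ 5 * w j = 0" if j: "j < 6" for w j
  proof -
    have "((aug ?\<alpha> w)\<^sup>T *\<^sub>v u w) $ j = (\<Sum>i<6. (if i < 5 then ?\<alpha> i j else w j) * u w $ i)"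
      using j u(1)[of w] by (simp add: scalar_prod_def aug_def atLeast0LessThan del: alpha.simps)
    then have "(\<Sum>i<6. (if i < 5 then ?\<alpha> i j else w j) * u w $ i) = 0" unfolding u(3) using j by simp
    then show ?thesis unfolding six by (simp add: mult.commute del: alpha.simps)
  qed
  show "\<exists>v. (\<exists>i<5. v i \<noteq> 0) \<and> (\<forall>j<6. (\<Sum>i<5. v i * ?\<alpha> i j) = 0)"
  proof (cases "\<exists>w. u w $ 5 = 0")
    case True
    then obtain w where w: "u w $ 5 = 0" by blast
    have "\<exists>i<5. u w $ i \<noteq> 0"
    proof (rule ccontr)
      assume c: "\<not> (\<exists>i<5. u w $ i \<noteq> 0)"
      have "u w $ i = 0" if "i < 6" for i using c w that by (cases "i = 5") auto
      then have "u w = 0\<^sub>v 6" using u(1)[of w] by (intro eq_vecI) auto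
      then show False using u(2) by blast
    qed
    moreover have "\<forall>j<6. (\<Sum>i<5. u w $ i * ?\<alpha> i j) = 0" using rel[of _ w] unfolding w by (simp del: alpha.simps)
    ultimately show ?thesis by (intro exI[of _ "\<lambda>i. u w $ i"] conjI)
  next
    case False
    let ?e = "\<lambda>k j. if j = k then 1 else 0 :: complex"
    define C where "C = mat 6 6 (\<lambda>(k, i). if i < 5 then - u (?e k) $ i / u (?e k) $ 5 else 0)"
    define A where "A = mat 6 6 (\<lambda>(i, j). if i < 5 then ?\<alpha> i j else 0)"
    have CA: "C \<in> carrier_mat 6 6" "A \<in> carrier_mat 6 6" by (simp_all add: C_def A_def)
    have "C * A = 1\<^sub>m 6"
    proof (rule eq_matI)
      fix k j assume "k < dim_row (1\<^sub>m 6 :: complex mat)" "j < dim_col (1\<^sub>m 6 :: complex mat)"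
      then have kj: "k < 6" "j < 6" by simp_all
      let ?u = "u (?e k)"
      have n: "?u $ 5 \<noteq> 0" using False by blast
      have "(C * A) $$ (k, j) = (\<Sum>i<6. C $$ (k, i) * A $$ (i, j))"
        using kj CA by (simp add: scalar_prod_def atLeast0LessThan)
      also have "\<dots> = (\<Sum>i<5. (- ?u $ i / ?u $ 5) * ?\<alpha> i j)"
        unfolding six using kj by (simp add: C_def A_def del: alpha.simps)
      also have "\<dots> = - (\<Sum>i<5. ?u $ i * ?\<alpha> i j) / ?u $ 5"
        by (simp add: sum_divide_distrib sum_negf del: alpha.simps)
      also have "\<dots> = ?e k j" using rel[OF kj(2), of "?e k"] n by (simp add: add_eq_0_iff2 del: alpha.simps)
      finally show "(C * A) $$ (k, j) = 1\<^sub>m 6 $$ (k, j)" using kj by auto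
    qed (use CA in auto)
    then have "det C * det A = 1" using det_mult[OF CA] by simp
    moreover have "det A = 0"
    proof -
      have "A = aug ?\<alpha> (\<lambda>_. 0)" unfolding A_def aug_def ..
      then show ?thesis by (simp add: det_aug)
    qed
    ultimately show ?thesis by simp
  qed
qed

section \<open>Reduction to even forms\<close>

lemma vanish_rows:
  assumes "vanish (\<alpha>, \<beta>, \<gamma>) b"
  obtains v0 v1 v2 v3 v4 where "v0 \<noteq> 0 \<or> v1 \<noteq> 0 \<or> v2 \<noteq> 0 \<or> v3 \<noteq> 0 \<or> v4 \<noteq> (0 :: complex)"
    "\<And>j. j < 6 \<Longrightarrow> v0 * rowE (\<lambda>c. c) b j + v1 * rowH (\<lambda>c. c) b j + v2 * rowF (\<lambda>c. c) b j
      + v3 * rowU (\<lambda>c. c) b \<alpha> j + v4 * rowV (\<lambda>c. c) b \<beta> \<gamma> j = 0"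
proof -
  obtain v where v: "\<exists>i<5. v i \<noteq> 0" "\<forall>j<6. (\<Sum>i<5. v i * alpha (\<lambda>c. c) b (\<alpha>, \<beta>, \<gamma>) i j) = 0"
    using assms unfolding vanish_dependent by blast
  show ?thesis
  proof (rule that[of "v 0" "v 1" "v 2" "v 3" "v 4"])
    show "v 0 \<noteq> 0 \<or> v 1 \<noteq> 0 \<or> v 2 \<noteq> 0 \<or> v 3 \<noteq> 0 \<or> v 4 \<noteq> 0"
      using v(1) unfolding less_5_cases by blast
    show "v 0 * rowE (\<lambda>c. c) b j + v 1 * rowH (\<lambda>c. c) b j + v 2 * rowF (\<lambda>c. c) b j
      + v 3 * rowU (\<lambda>c. c) b \<alpha> j + v 4 * rowV (\<lambda>c. c) b \<beta> \<gamma> j = 0" if "j < 6" for j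
      using v(2)[rule_format, OF that] unfolding lessThan_5 by (simp add: add.assoc)
  qed
qed

lemma vanishI:
  assumes "v0 \<noteq> 0 \<or> v1 \<noteq> 0 \<or> v2 \<noteq> 0 \<or> v3 \<noteq> 0 \<or> v4 \<noteq> (0 :: complex)"
    "\<And>j. j < 6 \<Longrightarrow> v0 * rowE (\<lambda>c. c) b j + v1 * rowH (\<lambda>c. c) b j + v2 * rowF (\<lambda>c. c) b j
      + v3 * rowU (\<lambda>c. c) b \<alpha> j + v4 * rowV (\<lambda>c. c) b \<beta> \<gamma> j = 0"
  shows "vanish (\<alpha>, \<beta>, \<gamma>) b"
  unfolding vanish_dependent
proof (rule exI[of _ "\<lambda>i. [v0, v1, v2, v3, v4] ! i"], intro conjI allI impI)
  let ?v = "\<lambda>i. [v0, v1, v2, v3, v4] ! i"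
  show "\<exists>i<5. ?v i \<noteq> 0"
  proof -
    have "?v 0 = v0" "?v 1 = v1" "?v 2 = v2" "?v 3 = v3" "?v 4 = v4" by simp_all
    then show ?thesis using assms(1) unfolding less_5_cases by metis
  qed
  fix j :: nat assume "j < 6"
  from assms(2)[OF this] show "(\<Sum>i<5. ?v i * alpha (\<lambda>c. c) b (\<alpha>, \<beta>, \<gamma>) i j) = 0"
    unfolding lessThan_5 by (simp add: add.assoc)
qed

section \<open>Shears, the swap and the quadratic covariant\<close>

definition even_form :: "(nat \<Rightarrow> complex) \<Rightarrow> bool" where
  "even_form e \<longleftrightarrow> e 1 = 0 \<and> e 3 = 0 \<and> e 5 = 0"

lemma tq_values:
  "tq b 0 = 2 * (b 0 * b 4 - 4 * b 1 * b 3 + 3 * b 2 ^ 2)"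
  "tq b 1 = b 0 * b 5 - 3 * b 1 * b 4 + 2 * b 2 * b 3"
  "tq b 2 = 2 * (b 1 * b 5 - 4 * b 2 * b 4 + 3 * b 3 ^ 2)"
  by (simp_all add: tq_def)

lemma tq_zero:
  "tq b 0 = 0 \<longleftrightarrow> b 0 * b 4 - 4 * b 1 * b 3 + 3 * b 2 ^ 2 = (0 :: complex)"
  "tq b 2 = 0 \<longleftrightarrow> b 1 * b 5 - 4 * b 2 * b 4 + 3 * b 3 ^ 2 = (0 :: complex)"
  unfolding tq_values mult_eq_0_iff by simp_all

lemma tr_upper:
  "tr 1 c 0 1 b 0 = b 0" "tr 1 c 0 1 b 1 = b 1 + c * b 0" "tr 1 c 0 1 b 2 = b 2 + 2 * c * b 1 + c ^ 2 * b 0"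
  "tr 1 c 0 1 b 3 = b 3 + 3 * c * b 2 + 3 * c ^ 2 * b 1 + c ^ 3 * b 0"
  "tr 1 c 0 1 b 4 = b 4 + 4 * c * b 3 + 6 * c ^ 2 * b 2 + 4 * c ^ 3 * b 1 + c ^ 4 * b 0"
  "tr 1 c 0 1 b 5 = b 5 + 5 * c * b 4 + 10 * c ^ 2 * b 3 + 10 * c ^ 3 * b 2 + 5 * c ^ 4 * b 1 + c ^ 5 * b 0"
  by (simp_all add: tr_simps algebra_simps)

lemma tr_lower:
  "tr 1 0 c 1 b 5 = b 5" "tr 1 0 c 1 b 4 = b 4 + c * b 5" "tr 1 0 c 1 b 3 = b 3 + 2 * c * b 4 + c ^ 2 * b 5"
  "tr 1 0 c 1 b 2 = b 2 + 3 * c * b 3 + 3 * c ^ 2 * b 4 + c ^ 3 * b 5"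
  "tr 1 0 c 1 b 1 = b 1 + 4 * c * b 2 + 6 * c ^ 2 * b 3 + 4 * c ^ 3 * b 4 + c ^ 4 * b 5"
  "tr 1 0 c 1 b 0 = b 0 + 5 * c * b 1 + 10 * c ^ 2 * b 2 + 10 * c ^ 3 * b 3 + 5 * c ^ 4 * b 4 + c ^ 5 * b 5"
  by (simp_all add: tr_simps algebra_simps)

lemma tr_swap:
  "tr 0 1 1 0 b 0 = b 5" "tr 0 1 1 0 b 1 = b 4" "tr 0 1 1 0 b 2 = b 3" "tr 0 1 1 0 b 3 = b 2" "tr 0 1 1 0 b 4 = b 1" "tr 0 1 1 0 b 5 = b 0"
  by (simp_all add: tr_simps)

lemma eqv_upper: "eqv b (tr 1 c 0 1 b)" and eqv_lower: "eqv b (tr 1 0 c 1 b)" and eqv_swap: "eqv b (tr 0 1 1 0 b)"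
  by (rule eqv_tr[OF _ refl], simp)+

lemma tq_upper:
  "tq (tr 1 c 0 1 b) 0 = tq b 0" "tq (tr 1 c 0 1 b) 1 = tq b 1 + c * tq b 0"
  "tq (tr 1 c 0 1 b) 2 = tq b 2 + 2 * c * tq b 1 + c ^ 2 * tq b 0"
  unfolding tq_values tr_upper by (simp add: algebra_simps eval_nat_numeral)+

lemma tq_lower:
  "tq (tr 1 0 c 1 b) 2 = tq b 2" "tq (tr 1 0 c 1 b) 1 = tq b 1 + c * tq b 2"
  "tq (tr 1 0 c 1 b) 0 = tq b 0 + 2 * c * tq b 1 + c ^ 2 * tq b 2"
  unfolding tq_values tr_lower by (simp add: algebra_simps eval_nat_numeral)+

lemma tq_swap: "tq (tr 0 1 1 0 b) 0 = tq b 2" "tq (tr 0 1 1 0 b) 1 = tq b 1" "tq (tr 0 1 1 0 b) 2 = tq b 0"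
  unfolding tq_values tr_swap by (simp add: algebra_simps)+

text \<open>The quadratic covariant is a multiple of x1 x2, and contraction with it preserves
  weights. Both rows are thus entrywise multiples of the coefficients, with multipliers symmetric
  under j to 5 - j; the factor 5 clears denominators.\<close>

lemma rows_hyperbolic:
  assumes "tq b 0 = 0" "tq b 2 = 0" "j < 6"
  shows "5 * rowU (\<lambda>c. c) b \<alpha> j = ([0, -4, -6, -6, -4, 0] ! j + 10 * of_rat \<alpha>) * tq b 1 ^ 2 * b j"
    "5 * rowV (\<lambda>c. c) b \<beta> \<gamma> j = ([0, 0, 8, 8, 0, 0] ! j * tq b 1 ^ 4 - 5 * (of_rat \<beta> * I4 b ^ 2 + of_rat \<gamma> * I8 (\<lambda>c. c) b)) * b j"
proof -
  define T where "T = tq b (Suc 0)"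
  note T = T_def[symmetric]
  have r: "rq b k = - (2 * T * b (Suc k))" for k by (simp add: rq_def assms(1,2) T)
  have w: "wq b 0 = 0" "wq b (Suc 0) = 0" "wq b 2 = 4 * T ^ 2" "wq b 3 = 0" "wq b 4 = 0"
    by (simp_all add: wq_def assms(1,2) T)
  have s: "sq b k = 4 * T ^ 2 * b (Suc (Suc k))" for k by (simp add: sq_def w)
  have p: "pq b 0 = 0" "pq b (Suc 0) = - (4 * T ^ 2 * b (Suc 0))" "pq b 2 = - (12 * T ^ 2 * b 2)" "pq b 3 = - (12 * T ^ 2 * b 3)"
    "pq b 4 = - (4 * T ^ 2 * b 4)" "pq b 5 = 0"
    by (simp_all add: pq_def r assms(1,2) T suc_simps power2_eq_square)
  have q: "qq b 0 = 0" "qq b (Suc 0) = 0" "qq b 2 = 16 * T ^ 4 * b 2" "qq b 3 = 16 * T ^ 4 * b 3" "qq b 4 = 0" "qq b 5 = 0"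
    by (simp_all add: qq_def s w suc_simps power4_eq_xxxx power2_eq_square)
  have i4: "I4 b = - (2 * T ^ 2)" by (simp add: I4_def assms(1,2) T)
  have j: "j = 0 \<or> j = Suc 0 \<or> j = 2 \<or> j = 3 \<or> j = 4 \<or> j = 5" using assms(3) by auto
  have u: "5 * (1 / of_nat (5 choose j) * pq b j) = [0, -4, -6, -6, -4, 0] ! j * T ^ 2 * b j"
    "5 * (1 / of_nat (5 choose j) * qq b j) = [0, 0, 8, 8, 0, 0] ! j * T ^ 4 * b j"
    using j by (elim disjE; simp add: p q choose_simps)+
  show "5 * rowU (\<lambda>c. c) b \<alpha> j = ([0, -4, -6, -6, -4, 0] ! j + 10 * of_rat \<alpha>) * tq b 1 ^ 2 * b j"
    unfolding rowU_def right_diff_distrib u i4 One_nat_def T by (simp add: algebra_simps)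
  show "5 * rowV (\<lambda>c. c) b \<beta> \<gamma> j = ([0, 0, 8, 8, 0, 0] ! j * tq b 1 ^ 4 - 5 * (of_rat \<beta> * I4 b ^ 2 + of_rat \<gamma> * I8 (\<lambda>c. c) b)) * b j"
    unfolding rowV_def right_diff_distrib u One_nat_def T by (simp add: algebra_simps)
qed

text \<open>The equation is what a diagonal scaling needs in order to make the inner four
  coefficients palindromic: for nonzero b 3 it says that b 1 = \<rho>^3 b 4 with \<rho> = b 2 / b
  3.\<close>

lemma vanish_hyperbolic:
  assumes v: "vanish (\<alpha>, \<beta>, \<gamma>) b" and t: "tq b 0 = 0" "tq b 2 = 0" "tq b 1 \<noteq> 0"
  shows "b 1 * b 3 ^ 3 = b 2 ^ 3 * b 4"
proof -
  obtain v0 v1 v2 v3 v4 where nz: "v0 \<noteq> 0 \<or> v1 \<noteq> 0 \<or> v2 \<noteq> 0 \<or> v3 \<noteq> 0 \<or> v4 \<noteq> (0 :: complex)"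
    and r: "\<And>j. j < 6 \<Longrightarrow> v0 * rowE (\<lambda>c. c) b j + v1 * rowH (\<lambda>c. c) b j + v2 * rowF (\<lambda>c. c) b j
      + v3 * rowU (\<lambda>c. c) b \<alpha> j + v4 * rowV (\<lambda>c. c) b \<beta> \<gamma> j = 0" using vanish_rows[OF v] by blast
  let ?T = "tq b 1"
  \<comment> \<open>A dependence is sorted by its effect on b: h collects the weight part, d the
    scalar part, e the additional multiplier at indices 1 and 4, and f that at indices 2 and
    3.\<close>
  define h where "h = v1 / 10"
  define e where "e = - (4 / 5) * ?T ^ 2 * v3"
  define f where "f = - (6 / 5) * ?T ^ 2 * v3 + 8 / 5 * ?T ^ 4 * v4"
  define d where "d = 2 * of_rat \<alpha> * ?T ^ 2 * v3 - v4 * (of_rat \<beta> * I4 b ^ 2 + of_rat \<gamma> * I8 (\<lambda>c. c) b)"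
  have r5: "v0 * (5 * rowE (\<lambda>c. c) b j) + v1 * (5 * rowH (\<lambda>c. c) b j) + v2 * (5 * rowF (\<lambda>c. c) b j)
      + v3 * (5 * rowU (\<lambda>c. c) b \<alpha> j) + v4 * (5 * rowV (\<lambda>c. c) b \<beta> \<gamma> j) = 0" if "j < 6" for j
    using arg_cong[OF r[OF that], of "\<lambda>x. 5 * x"] by (simp add: ring_distribs mult.left_commute)
  have q: "v0 * (5 * rowE (\<lambda>c. c) b j) + v2 * (5 * rowF (\<lambda>c. c) b j)
      + (5 * (d + (2 * of_nat j - 5) * h) + [0, 5 * e, 5 * f, 5 * f, 5 * e, 0] ! j) * b j = 0" if "j < 6" for j
    using r5[OF that] unfolding rows_hyperbolic[OF t(1,2) that] using that unfolding less_6
    by (elim disjE; simp add: rowH_def h_def e_def f_def d_def; simp add: algebra_simps)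
  have q0: "v0 * b 1 + (d - 5 * h) * b 0 = 0"
  proof -
    have "5 * (v0 * b 1 + (d - 5 * h) * b 0) = v0 * (5 * rowE (\<lambda>c. c) b 0) + v2 * (5 * rowF (\<lambda>c. c) b 0)
      + (5 * (d + (2 * of_nat 0 - 5) * h) + [0, 5 * e, 5 * f, 5 * f, 5 * e, 0] ! 0) * b 0"
      by (simp add: rowE_def rowF_def; simp add: algebra_simps)
    also have "\<dots> = 0" by (rule q) simp
    finally have "(5 :: complex) = 0 \<or> v0 * b 1 + (d - 5 * h) * b 0 = 0" by (simp only: mult_eq_0_iff)
    then show ?thesis by (elim disjE) (simp, assumption)
  qed
  have q1: "4 * v0 * b 2 - v2 * b 0 + 5 * (d - 3 * h + e) * b 1 = 0"
    using q[of 1] by (simp add: rowE_def rowF_def numeral_2_eq_2; simp add: algebra_simps)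
  have q2: "3 * v0 * b 3 - 2 * v2 * b 1 + 5 * (d - h + f) * b 2 = 0"
    using q[of 2] by (simp add: rowE_def rowF_def; simp add: algebra_simps)
  have q3: "2 * v0 * b 4 - 3 * v2 * b 2 + 5 * (d + h + f) * b 3 = 0"
    using q[of 3] by (simp add: rowE_def rowF_def; simp add: algebra_simps)
  have q4: "v0 * b 5 - 4 * v2 * b 3 + 5 * (d + 3 * h + e) * b 4 = 0"
    using q[of 4] by (simp add: rowE_def rowF_def; simp add: algebra_simps)
  have q5: "- (v2 * b 4) + (d + 5 * h) * b 5 = 0"
  proof -
    have "5 * (- (v2 * b 4) + (d + 5 * h) * b 5) = v0 * (5 * rowE (\<lambda>c. c) b 5) + v2 * (5 * rowF (\<lambda>c. c) b 5)
      + (5 * (d + (2 * of_nat 5 - 5) * h) + [0, 5 * e, 5 * f, 5 * f, 5 * e, 0] ! 5) * b 5"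
      by (simp add: rowE_def rowF_def; simp add: algebra_simps)
    also have "\<dots> = 0" by (rule q) simp
    finally have "(5 :: complex) = 0 \<or> - (v2 * b 4) + (d + 5 * h) * b 5 = 0" by (simp only: mult_eq_0_iff)
    then show ?thesis by (elim disjE) (simp, assumption)
  qed
  have x0: "b 0 * b 4 - 4 * b 1 * b 3 + 3 * b 2 ^ 2 = 0" and x2: "b 1 * b 5 - 4 * b 2 * b 4 + 3 * b 3 ^ 2 = 0"
    using t(1,2) unfolding tq_zero by simp_all
  \<comment> \<open>Equations for opposite indices are subtracted so that the symmetric parts d, e,
    f drop out. Together with the vanishing of \<open>tq b 0\<close> and \<open>tq b 2\<close> this
    isolates h times the nonzero \<open>tq b 1\<close>.\<close>
  have "- 10 * h * ?T =
      (b 5 * (v0 * b 1 + (d - 5 * h) * b 0) - b 0 * (- (v2 * b 4) + (d + 5 * h) * b 5)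
        - 2 * (v0 * (b 1 * b 5 - 4 * b 2 * b 4 + 3 * b 3 ^ 2)) - 2 * (v2 * (b 0 * b 4 - 4 * b 1 * b 3 + 3 * b 2 ^ 2)))
      + 2 * (b 3 * (3 * v0 * b 3 - 2 * v2 * b 1 + 5 * (d - h + f) * b 2) - b 2 * (2 * v0 * b 4 - 3 * v2 * b 2 + 5 * (d + h + f) * b 3))
      - (b 4 * (4 * v0 * b 2 - v2 * b 0 + 5 * (d - 3 * h + e) * b 1) - b 1 * (v0 * b 5 - 4 * v2 * b 3 + 5 * (d + 3 * h + e) * b 4))"
    unfolding tq_values by (simp add: algebra_simps eval_nat_numeral)
  also have "\<dots> = 0" unfolding q0 q1 q2 q3 q4 q5 x0 x2 by simp
  finally have h0: "h = 0" using t(3) by simp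
  have "3 * (v0 * b 3 ^ 2 + v2 * b 2 ^ 2) = b 4 * (4 * v0 * b 2 - v2 * b 0 + 5 * (d - 3 * h + e) * b 1)
      - b 1 * (v0 * b 5 - 4 * v2 * b 3 + 5 * (d + 3 * h + e) * b 4)
      + v0 * (b 1 * b 5 - 4 * b 2 * b 4 + 3 * b 3 ^ 2) + v2 * (b 0 * b 4 - 4 * b 1 * b 3 + 3 * b 2 ^ 2)"
    unfolding h0 by (simp add: algebra_simps eval_nat_numeral)
  then have A: "v0 * b 3 ^ 2 + v2 * b 2 ^ 2 = 0" unfolding q1 q4 x0 x2 by (simp del: distrib_left_numeral)
  have "2 * (v0 * b 2 * b 4 + v2 * b 1 * b 3) = 3 * (v0 * b 3 ^ 2 + v2 * b 2 ^ 2)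
      - (b 3 * (3 * v0 * b 3 - 2 * v2 * b 1 + 5 * (d - h + f) * b 2) - b 2 * (2 * v0 * b 4 - 3 * v2 * b 2 + 5 * (d + h + f) * b 3))"
    unfolding h0 by (simp add: algebra_simps eval_nat_numeral)
  then have C: "v0 * b 2 * b 4 + v2 * b 1 * b 3 = 0" unfolding A q2 q3 by (simp del: distrib_left_numeral)
  \<comment> \<open>\<open>A\<close> and \<open>C\<close> are two linear equations for v0 and v2
    with determinant \<open>?R\<close>, so both unknowns are annihilated by it.\<close>
  let ?R = "b 1 * b 3 ^ 3 - b 2 ^ 3 * b 4"
  have "v0 * ?R = b 1 * b 3 * (v0 * b 3 ^ 2 + v2 * b 2 ^ 2) - b 2 ^ 2 * (v0 * b 2 * b 4 + v2 * b 1 * b 3)" by (simp add: algebra_simps eval_nat_numeral)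
  then have R0: "v0 * ?R = 0" unfolding A C by simp
  have "v2 * ?R = b 3 ^ 2 * (v0 * b 2 * b 4 + v2 * b 1 * b 3) - b 2 * b 4 * (v0 * b 3 ^ 2 + v2 * b 2 ^ 2)" by (simp add: algebra_simps eval_nat_numeral)
  then have R2: "v2 * ?R = 0" unfolding A C by simp
  have "?R = 0"
  proof (cases "v0 = 0 \<and> v2 = 0")
    case False
    then show ?thesis using R0 R2 by auto
  next
    case True
    then have v02: "v0 = 0" "v2 = 0" by auto
    \<comment> \<open>Without v0 and v2 the dependence is diagonal. For nonzero d the outer
      coefficients vanish and the two relations of the quadratic covariant suffice; for d = 0 one of
      e, f is nonzero and kills an inner pair of coefficients.\<close>
    have z: "d * b 0 = 0" "(d + e) * b 1 = 0" "(d + f) * b 2 = 0" "(d + f) * b 3 = 0" "(d + e) * b 4 = 0" "d * b 5 = 0"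
      using q0 q1 q2 q3 q4 q5 unfolding h0 v02 by (simp_all del: distrib_left_numeral)
    show ?thesis
    proof (cases "d = 0")
      case False
      then have "b 0 = 0" "b 5 = 0" using z by auto
      then have "3 * b 2 ^ 2 = 4 * b 1 * b 3" "3 * b 3 ^ 2 = 4 * b 2 * b 4" using x0 x2 by (simp_all add: algebra_simps)
      moreover have "4 * ?R = (4 * b 1 * b 3) * b 3 ^ 2 - b 2 ^ 2 * (4 * b 2 * b 4)" by (simp add: algebra_simps eval_nat_numeral)
      ultimately have "4 * ?R = 3 * b 2 ^ 2 * b 3 ^ 2 - b 2 ^ 2 * (3 * b 3 ^ 2)" by metis
      then show ?thesis by simp
    next
      case True
      have "e \<noteq> 0 \<or> f \<noteq> 0"
      proof (rule ccontr)
        assume "\<not> (e \<noteq> 0 \<or> f \<noteq> 0)"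
        then have ef: "e = 0" "f = 0" by auto
        then have "v3 = 0" using t(3) by (simp add: e_def)
        moreover from this have "v4 = 0" using t(3) ef(2) by (simp add: f_def)
        ultimately show False using nz v02 h0 by (simp add: h_def)
      qed
      then show ?thesis using z True by auto
    qed
  qed
  then show ?thesis by simp
qed

text \<open>Under a diagonal change of variables the form becomes palindromic; the palindromic forms are
  the even ones in the variables \<open>x\<^sub>1 + x\<^sub>2\<close>, \<open>x\<^sub>1 - x\<^sub>2\<close>.\<close>

lemma palindromic_even:
  assumes \<rho>: "\<rho> \<noteq> 0" and b: "b 0 = \<rho> ^ 5 * b 5" "b 1 = \<rho> ^ 3 * b 4" "b 2 = \<rho> * b 3"
  shows "\<exists>e. eqv b e \<and> even_form e"
proof -
  let ?c = "tr 1 0 0 \<rho> b"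
  have c: "?c 0 = b 0" "?c 1 = \<rho> * b 1" "?c 2 = \<rho> ^ 2 * b 2" "?c 3 = \<rho> ^ 3 * b 3" "?c 4 = \<rho> ^ 4 * b 4" "?c 5 = \<rho> ^ 5 * b 5"
    by (subst tr_diag; simp)+
  have p: "?c 0 = ?c 5" "?c 1 = ?c 4" "?c 2 = ?c 3"
    unfolding c b by (simp_all add: eval_nat_numeral)
  have "eqv b ?c" using \<rho> by (intro eqv_tr[OF _ refl]) simp
  also have "eqv ?c (tr 1 1 1 (-1) ?c)" by (rule eqv_tr[OF _ refl]) simp
  finally have e: "eqv b (tr 1 1 1 (-1) ?c)" .
  have t: "tr 1 1 1 (-1) w 1 = w 0 + 3 * w 1 + 2 * w 2 - 2 * w 3 - 3 * w 4 - w 5"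
    "tr 1 1 1 (-1) w 3 = w 0 - w 1 - 2 * w 2 + 2 * w 3 + w 4 - w 5"
    "tr 1 1 1 (-1) w 5 = w 0 - 5 * w 1 + 10 * w 2 - 10 * w 3 + 5 * w 4 - w 5" for w
    by (simp_all add: tr_simps)
  have "even_form (tr 1 1 1 (-1) ?c)" unfolding even_form_def t p by simp
  then show ?thesis using e by blast
qed

text \<open>A palindromic scaling forces \<rho> = b 2 / b 3 if these are nonzero, and the condition
  on the outer pair follows from the relations of the quadratic covariant. If b 2 = b 3 = 0, only
  one of the pairs (0, 5) and (1, 4) is present, and a fifth or third root serves as \<rho>.\<close>

lemma hyperbolic_even:
  assumes v: "vanish (\<alpha>, \<beta>, \<gamma>) b" and t: "tq b 0 = 0" "tq b 2 = 0" "tq b 1 \<noteq> 0"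
  shows "\<exists>e. eqv b e \<and> even_form e"
proof -
  have R: "b 1 * b 3 ^ 3 = b 2 ^ 3 * b 4" by (rule vanish_hyperbolic[OF v t])
  have x0: "b 0 * b 4 - 4 * b 1 * b 3 + 3 * b 2 ^ 2 = 0" and x2: "b 1 * b 5 - 4 * b 2 * b 4 + 3 * b 3 ^ 2 = 0"
    and x1: "b 0 * b 5 - 3 * b 1 * b 4 + 2 * b 2 * b 3 \<noteq> 0"
    using t(1,2) t(3)[unfolded tq_values] unfolding tq_zero by simp_all
  show ?thesis
  proof (cases "b 2 = 0"; cases "b 3 = 0")
    assume b: "b 2 = 0" "b 3 = 0"
    then have z: "b 0 = 0 \<or> b 4 = 0" "b 1 = 0 \<or> b 5 = 0" and nz: "b 0 * b 5 \<noteq> 0 \<or> b 1 * b 4 \<noteq> 0" using x0 x1 x2 by auto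
    show ?thesis
    proof (cases "b 0 * b 5 = 0")
      case False
      then have "b 4 = 0" "b 1 = 0" "b 0 \<noteq> 0" "b 5 \<noteq> 0" using z by auto
      moreover obtain \<rho> where "\<rho> ^ 5 = b 0 / b 5" using root_exists[of 5] by auto
      moreover from calculation have "\<rho> \<noteq> 0" by auto
      ultimately show ?thesis using b by (intro palindromic_even[of \<rho>]) auto
    next
      case True
      then have "b 1 \<noteq> 0" "b 4 \<noteq> 0" "b 0 = 0" "b 5 = 0" using z nz by auto
      moreover obtain \<rho> where "\<rho> ^ 3 = b 1 / b 4" using root_exists[of 3] by auto
      moreover from calculation have "\<rho> \<noteq> 0" by auto
      ultimately show ?thesis using b by (intro palindromic_even[of \<rho>]) auto
    qed
  next
    assume b: "b 2 = 0" "b 3 \<noteq> 0"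
    then have "b 1 = 0" using R by simp
    then show ?thesis using x2 b by simp
  next
    assume b: "b 2 \<noteq> 0" "b 3 = 0"
    then have "b 4 = 0" using R by simp
    then show ?thesis using x0 b by simp
  next
    assume b: "b 2 \<noteq> 0" "b 3 \<noteq> 0"
    define \<rho> where "\<rho> = b 2 / b 3"
    have \<rho>: "\<rho> \<noteq> 0" "b 2 = \<rho> * b 3" using b by (simp_all add: \<rho>_def)
    have "b 3 ^ 3 * b 1 = b 3 ^ 3 * (\<rho> ^ 3 * b 4)" using R unfolding \<rho>(2) by (simp add: power_mult_distrib mult_ac)
    then have b1: "b 1 = \<rho> ^ 3 * b 4" using b by simp
    have "b 4 * (b 0 - \<rho> ^ 5 * b 5) = (b 0 * b 4 - 4 * b 1 * b 3 + 3 * b 2 ^ 2) - \<rho> ^ 2 * (b 1 * b 5 - 4 * b 2 * b 4 + 3 * b 3 ^ 2)"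
      unfolding b1 \<rho>(2) by (simp add: algebra_simps eval_nat_numeral)
    then have "b 4 * (b 0 - \<rho> ^ 5 * b 5) = 0" unfolding x0 x2 by simp
    moreover have "b 4 \<noteq> 0"
    proof
      assume "b 4 = 0"
      then show False using x0 b b1 by simp
    qed
    ultimately have "b 0 = \<rho> ^ 5 * b 5" by simp
    then show ?thesis using b1 \<rho> by (intro palindromic_even[of \<rho>]) auto
  qed
qed

text \<open>The quadratic covariant is a multiple of x1^2, so the invariant of degree four vanishes,
  and contraction with it or its square merely shifts the coefficients by two or four
  places.\<close>

lemma rows_parabolic:
  assumes "tq b 1 = 0" "tq b 2 = 0" "j < 6"
  shows "10 * rowU (\<lambda>c. c) b \<alpha> j = [10 * b 2, 6 * b 3, 3 * b 4, b 5, 0, 0] ! j * tq b 0 ^ 2"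
    "5 * rowV (\<lambda>c. c) b \<beta> \<gamma> j = [5 * b 4, b 5, 0, 0, 0, 0] ! j * tq b 0 ^ 4 - 5 * (of_rat \<gamma> * I8 (\<lambda>c. c) b) * b j"
proof -
  define T where "T = tq b 0"
  note T = T_def[symmetric]
  have t1: "tq b (Suc 0) = 0" using assms(1) by simp
  have r: "rq b k = T * b (k + 2)" for k by (simp add: rq_def t1 assms(2) T)
  have w: "wq b 0 = T ^ 2" "wq b (Suc 0) = 0" "wq b 2 = 0" "wq b 3 = 0" "wq b 4 = 0"
    by (simp_all add: wq_def t1 assms(2) T)
  have s: "sq b k = T ^ 2 * b (k + 4)" for k by (simp add: sq_def w)
  have p: "pq b 0 = T ^ 2 * b 2" "pq b (Suc 0) = 3 * T ^ 2 * b 3" "pq b 2 = 3 * T ^ 2 * b 4" "pq b 3 = T ^ 2 * b 5"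
    "pq b 4 = 0" "pq b 5 = 0"
    by (simp_all add: pq_def r t1 assms(2) T suc_simps power2_eq_square mult_ac)
  have q: "qq b 0 = T ^ 4 * b 4" "qq b (Suc 0) = T ^ 4 * b 5" "qq b 2 = 0" "qq b 3 = 0" "qq b 4 = 0" "qq b 5 = 0"
    by (simp_all add: qq_def s w suc_simps power4_eq_xxxx power2_eq_square mult_ac)
  have i4: "I4 b = 0" by (simp add: I4_def t1 assms(2))
  have j: "j = 0 \<or> j = Suc 0 \<or> j = 2 \<or> j = 3 \<or> j = 4 \<or> j = 5" using assms(3) by auto
  have u: "10 * (1 / of_nat (5 choose j) * pq b j) = [10 * b 2, 6 * b 3, 3 * b 4, b 5, 0, 0] ! j * T ^ 2"
    "5 * (1 / of_nat (5 choose j) * qq b j) = [5 * b 4, b 5, 0, 0, 0, 0] ! j * T ^ 4"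
    using j by (elim disjE; simp add: p q choose_simps)+
  show "10 * rowU (\<lambda>c. c) b \<alpha> j = [10 * b 2, 6 * b 3, 3 * b 4, b 5, 0, 0] ! j * tq b 0 ^ 2"
    unfolding rowU_def right_diff_distrib u i4 T by simp
  show "5 * rowV (\<lambda>c. c) b \<beta> \<gamma> j = [5 * b 4, b 5, 0, 0, 0, 0] ! j * tq b 0 ^ 4 - 5 * (of_rat \<gamma> * I8 (\<lambda>c. c) b) * b j"
    unfolding rowV_def right_diff_distrib u i4 T by (simp add: mult_ac)
qed

text \<open>With b 4 = 0 as well, the conclusion leaves only odd indices, so the swap of variables
  makes the form even.\<close>

lemma vanish_parabolic:
  assumes v: "vanish (\<alpha>, \<beta>, \<gamma>) b" and t: "tq b 1 = 0" "tq b 2 = 0" "tq b 0 \<noteq> 0" and b: "b 5 \<noteq> 0" "b 4 = 0"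
  shows "b 0 = 0 \<and> b 2 = 0"
proof -
  obtain v0 v1 v2 v3 v4 where nz: "v0 \<noteq> 0 \<or> v1 \<noteq> 0 \<or> v2 \<noteq> 0 \<or> v3 \<noteq> 0 \<or> v4 \<noteq> (0 :: complex)"
    and r: "\<And>j. j < 6 \<Longrightarrow> v0 * rowE (\<lambda>c. c) b j + v1 * rowH (\<lambda>c. c) b j + v2 * rowF (\<lambda>c. c) b j
      + v3 * rowU (\<lambda>c. c) b \<alpha> j + v4 * rowV (\<lambda>c. c) b \<beta> \<gamma> j = 0" using vanish_rows[OF v] by blast
  let ?T = "tq b 0"
  define h where "h = v1 / 10"
  define x where "x = ?T ^ 2 * v3 / 2"
  define y where "y = ?T ^ 4 * v4"
  define d where "d = - v4 * (of_rat \<gamma> * I8 (\<lambda>c. c) b)"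
  have r5: "v0 * (5 * rowE (\<lambda>c. c) b j) + v1 * (5 * rowH (\<lambda>c. c) b j) + v2 * (5 * rowF (\<lambda>c. c) b j)
      + v3 * (10 * rowU (\<lambda>c. c) b \<alpha> j) / 2 + v4 * (5 * rowV (\<lambda>c. c) b \<beta> \<gamma> j) = 0" if "j < 6" for j
    using arg_cong[OF r[OF that], of "\<lambda>x. 5 * x"] by (simp add: ring_distribs mult.left_commute)
  have q: "v0 * (5 * rowE (\<lambda>c. c) b j) + v2 * (5 * rowF (\<lambda>c. c) b j)
      + 5 * (d + (2 * of_nat j - 5) * h) * b j + [10 * b 2, 6 * b 3, 3 * b 4, b 5, 0, 0] ! j * x + [5 * b 4, b 5, 0, 0, 0, 0] ! j * y = 0"
    if "j < 6" for j
    using r5[OF that] unfolding rows_parabolic[OF t(1,2) that] using that unfolding less_6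
    by (elim disjE; simp add: rowH_def h_def x_def y_def d_def; simp add: algebra_simps)
  have q0: "v0 * b 1 + (d - 5 * h) * b 0 + 2 * b 2 * x = 0"
  proof -
    have "5 * (v0 * b 1 + (d - 5 * h) * b 0 + 2 * b 2 * x) = v0 * (5 * rowE (\<lambda>c. c) b 0) + v2 * (5 * rowF (\<lambda>c. c) b 0)
      + 5 * (d + (2 * of_nat 0 - 5) * h) * b 0 + [10 * b 2, 6 * b 3, 3 * b 4, b 5, 0, 0] ! 0 * x + [5 * b 4, b 5, 0, 0, 0, 0] ! 0 * y"
      by (simp add: rowE_def rowF_def b(2); simp add: algebra_simps)
    also have "\<dots> = 0" by (rule q) simp
    finally have "(5 :: complex) = 0 \<or> v0 * b 1 + (d - 5 * h) * b 0 + 2 * b 2 * x = 0" by (simp only: mult_eq_0_iff)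
    then show ?thesis by (elim disjE) (simp, assumption)
  qed
  have q1: "4 * v0 * b 2 - v2 * b 0 + 5 * (d - 3 * h) * b 1 + 6 * b 3 * x + b 5 * y = 0"
    using q[of 1] b(2) by (simp add: rowE_def rowF_def numeral_2_eq_2; simp add: algebra_simps)
  have q2: "3 * v0 * b 3 - 2 * v2 * b 1 + 5 * (d - h) * b 2 = 0"
    using q[of 2] b(2) by (simp add: rowE_def rowF_def; simp add: algebra_simps)
  have q3: "- 3 * v2 * b 2 + 5 * (d + h) * b 3 + b 5 * x = 0"
    using q[of 3] b(2) by (simp add: rowE_def rowF_def; simp add: algebra_simps)
  have q4: "v0 * b 5 - 4 * v2 * b 3 = 0"
    using q[of 4] b(2) by (simp add: rowE_def rowF_def; simp add: algebra_simps)
  have "(d + 5 * h) * b 5 = 0"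
  proof -
    have "5 * ((d + 5 * h) * b 5) = v0 * (5 * rowE (\<lambda>c. c) b 5) + v2 * (5 * rowF (\<lambda>c. c) b 5)
      + 5 * (d + (2 * of_nat 5 - 5) * h) * b 5 + [10 * b 2, 6 * b 3, 3 * b 4, b 5, 0, 0] ! 5 * x + [5 * b 4, b 5, 0, 0, 0, 0] ! 5 * y"
      by (simp add: rowE_def rowF_def b(2); simp add: algebra_simps)
    also have "\<dots> = 0" by (rule q) simp
    finally have "(5 :: complex) = 0 \<or> (d + 5 * h) * b 5 = 0" by (simp only: mult_eq_0_iff)
    then show ?thesis by (elim disjE) (simp, assumption)
  qed
  then have d: "d = - 5 * h" using b(1) by (simp add: add_eq_0_iff2)
  have x0: "3 * b 2 ^ 2 - 4 * b 1 * b 3 \<noteq> 0" using t(3) unfolding tq_zero b(2) by (simp add: algebra_simps)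
  have x1: "b 0 * b 5 + 2 * b 2 * b 3 = 0" using t(1) unfolding tq_values b(2) by simp
  have x2: "b 1 * b 5 + 3 * b 3 ^ 2 = 0" using t(2) unfolding tq_zero b(2) by simp
  \<comment> \<open>An elimination identity: the right-hand side is a combination of row equations
    and of the equations for \<open>tq b 1\<close> and \<open>tq b 2\<close>. Hence v2 vanishes,
    since for b 4 = 0 the bracket is half of the nonzero \<open>tq b 0\<close>.\<close>
  have "2 * v2 * (3 * b 2 ^ 2 - 4 * b 1 * b 3) * b 5 =
      b 5 ^ 2 * (v0 * b 1 + (- 5 * h - 5 * h) * b 0 + 2 * b 2 * x) + 2 * b 3 * b 5 * (3 * v0 * b 3 - 2 * v2 * b 1 + 5 * (- 5 * h - h) * b 2)
      - (v0 * b 5 - 4 * v2 * b 3) * (b 1 * b 5 + 6 * b 3 ^ 2) + 10 * h * b 5 * (b 0 * b 5 + 2 * b 2 * b 3)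
      - 2 * b 2 * b 5 * (- 3 * v2 * b 2 + 5 * (- 5 * h + h) * b 3 + b 5 * x) - 8 * v2 * b 3 * (b 1 * b 5 + 3 * b 3 ^ 2)"
    by (simp add: algebra_simps eval_nat_numeral)
  also have "\<dots> = 0" using q0 q2 q3 q4 x1 x2 unfolding d by simp
  finally have v2: "v2 = 0" using x0 b(1) by simp
  then have v0: "v0 = 0" using q4 b(1) by simp
  have hb: "h * b 2 = 0" using q2 unfolding v0 v2 d by (simp add: algebra_simps)
  have "b 2 = 0"
  proof (rule ccontr)
    assume "b 2 \<noteq> 0"
    then have h: "h = 0" using hb by simp
    have x: "x = 0" using q3 b(1) unfolding v2 d h by simp
    have y: "y = 0" using q1 b(1) unfolding v0 v2 d h x by simp
    have "v3 = 0" "v4 = 0" "v1 = 0" using x y h t(3) by (simp_all add: x_def y_def h_def)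
    then show False using nz v0 v2 by simp
  qed
  then show ?thesis using x1 b(1) by simp
qed

lemma even_formI:
  assumes "e 1 = 0" "e 3 = 0" "e 5 = 0" shows "\<exists>e'. eqv e e' \<and> even_form e'"
  using assms eqv_cong[of e e] unfolding even_form_def by blast

lemma even_form_swap:
  assumes "e 0 = 0" "e 2 = 0" "e 4 = 0" shows "\<exists>e'. eqv e e' \<and> even_form e'"
proof (intro exI conjI)
  show "eqv e (tr 0 1 1 0 e)" by (rule eqv_swap)
  show "even_form (tr 0 1 1 0 e)" unfolding even_form_def tr_swap using assms by simp
qed

lemma even_via: "eqv b c \<Longrightarrow> \<exists>e. eqv c e \<and> even_form e \<Longrightarrow> \<exists>e. eqv b e \<and> even_form e"
  using eqv_trans by blast

text \<open>If x1 divides the form, shears that preserve x1 remove the odd coefficients one after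
  the other. Otherwise such a shear moves b 4 to zero and \<open>vanish_parabolic\<close> shows that
  the swapped form is even.\<close>

lemma parabolic_even:
  assumes v: "vanish (\<alpha>, \<beta>, \<gamma>) b" and t: "tq b 1 = 0" "tq b 2 = 0" "tq b 0 \<noteq> 0"
  shows "\<exists>e. eqv b e \<and> even_form e"
proof (cases "b 5 = 0")
  case False
  define c where "c = tr 1 0 (- (b 4 / b 5)) 1 b"
  have c5: "c 5 = b 5" "c 4 = 0" unfolding c_def tr_lower using False by simp_all
  have bc: "eqv b c" unfolding c_def by (rule eqv_lower)
  have tc: "tq c 1 = 0" "tq c 2 = 0" "tq c 0 \<noteq> 0" unfolding c_def tq_lower using t by simp_all
  have "vanish (\<alpha>, \<beta>, \<gamma>) c" using vanish_eqv[OF bc] v by blast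
  from vanish_parabolic[OF this tc] c5 False have "c 0 = 0" "c 2 = 0" by auto
  then show ?thesis using c5 by (intro even_via[OF bc] even_form_swap) auto
next
  case b5: True
  show ?thesis
  proof (cases "b 4 = 0")
    case False
    define c where "c = tr 1 0 (- (b 3 / (2 * b 4))) 1 b"
    have c5: "c 5 = 0" "c 4 = b 4" "c 3 = 0" unfolding c_def tr_lower using False b5 by simp_all
    have bc: "eqv b c" unfolding c_def by (rule eqv_lower)
    have tc: "tq c 1 = 0" "tq c 2 = 0" unfolding c_def tq_lower using t by simp_all
    have "c 2 = 0" using tc(2) c5 False unfolding tq_values by simp
    then have "c 1 = 0" using tc(1) c5 False unfolding tq_values by simp
    then show ?thesis using c5 by (intro even_via[OF bc] even_formI) auto
  next
    case b4: True
    then have b3: "b 3 = 0" using t(2) b5 unfolding tq_values by simp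
    then have b2: "b 2 \<noteq> 0" using t(3) b4 unfolding tq_values by auto
    define c where "c = tr 1 0 (- (b 1 / (4 * b 2))) 1 b"
    have c: "c 5 = 0" "c 3 = 0" "c 1 = 0" unfolding c_def tr_lower using b2 b3 b4 b5 by simp_all
    have bc: "eqv b c" unfolding c_def by (rule eqv_lower)
    show ?thesis using c by (intro even_via[OF bc] even_formI) auto
  qed
qed

lemma poly_root_5:
  fixes c0 c1 c2 c3 c4 c5 :: complex
  assumes "c5 \<noteq> 0" shows "\<exists>z. c0 + c1 * z + c2 * z ^ 2 + c3 * z ^ 3 + c4 * z ^ 4 + c5 * z ^ 5 = 0"
proof -
  have "degree [:c0, c1, c2, c3, c4, c5:] = 5" using assms by simp
  then have "\<not> constant (poly [:c0, c1, c2, c3, c4, c5:])" by (simp add: constant_degree)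
  then obtain z where "poly [:c0, c1, c2, c3, c4, c5:] z = 0" using fundamental_theorem_of_algebra by blast
  then have "c0 + c1 * z + c2 * z ^ 2 + c3 * z ^ 3 + c4 * z ^ 4 + c5 * z ^ 5 = 0"
    by (simp add: algebra_simps eval_nat_numeral)
  then show ?thesis by blast
qed

text \<open>After a root has been moved to x1 = 0, so that b 5 = 0, the three equations of the
  quadratic covariant eliminate coefficients from the top and a single shear completes the
  reduction.\<close>

lemma null_even:
  assumes t: "tq b 0 = 0" "tq b 1 = 0" "tq b 2 = 0"
  shows "\<exists>e. eqv b e \<and> even_form e"
proof -
  have *: "\<exists>e. eqv b e \<and> even_form e" if t: "tq b 0 = 0" "tq b 1 = 0" "tq b 2 = 0" and b5: "b 5 = 0" for b
  proof (cases "b 4 = 0")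
    case False
    define c where "c = tr 1 0 (- (b 3 / (2 * b 4))) 1 b"
    have c5: "c 5 = 0" "c 4 = b 4" "c 3 = 0" unfolding c_def tr_lower using False b5 by simp_all
    have bc: "eqv b c" unfolding c_def by (rule eqv_lower)
    have tc: "tq c 0 = 0" "tq c 1 = 0" "tq c 2 = 0" unfolding c_def tq_lower using t by simp_all
    have "c 2 = 0" using tc(3) c5 False unfolding tq_values by simp
    then have "c 1 = 0" using tc(2) c5 False unfolding tq_values by simp
    then show ?thesis using c5 by (intro even_via[OF bc] even_formI) auto
  next
    case b4: True
    then have b3: "b 3 = 0" using t(3) b5 unfolding tq_values by simp
    then have b2: "b 2 = 0" using t(1) b4 unfolding tq_values by auto
    show ?thesis
    proof (cases "b 1 = 0")
      case True
      then show ?thesis using b3 b5 by (intro even_formI) auto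
    next
      case False
      define c where "c = tr 1 0 (- (b 0 / (5 * b 1))) 1 b"
      have c: "c 0 = 0" "c 2 = 0" "c 4 = 0" unfolding c_def tr_lower using False b2 b3 b4 b5 by simp_all
      have bc: "eqv b c" unfolding c_def by (rule eqv_lower)
      show ?thesis using c by (intro even_via[OF bc] even_form_swap) auto
    qed
  qed
  show ?thesis
  proof (cases "b 0 = 0")
    case True
    have "\<exists>e. eqv (tr 0 1 1 0 b) e \<and> even_form e" by (rule *) (use t True in \<open>simp_all only: tq_swap tr_swap\<close>)
    then show ?thesis by (rule even_via[OF eqv_swap])
  next
    case False
    obtain c where c: "b 5 + (5 * b 4) * c + (10 * b 3) * c ^ 2 + (10 * b 2) * c ^ 3 + (5 * b 1) * c ^ 4 + b 0 * c ^ 5 = 0"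
      using poly_root_5[OF False] by blast
    have "\<exists>e. eqv (tr 1 c 0 1 b) e \<and> even_form e"
    proof (rule *)
      show "tr 1 c 0 1 b 5 = 0" unfolding tr_upper using c by (simp add: mult_ac)
    qed (use t in \<open>simp_all add: tq_upper del: One_nat_def\<close>)
    then show ?thesis by (rule even_via[OF eqv_upper])
  qed
qed

text \<open>A root of the quadratic covariant is moved so that \<open>tq b 2\<close> vanishes. If
  \<open>tq b 1\<close> is nonzero, a lower shear removes \<open>tq b 0\<close> and gives the
  hyperbolic case; otherwise the covariant is a square or zero.\<close>

lemma vanish_even:
  assumes v: "vanish (\<alpha>, \<beta>, \<gamma>) b"
  shows "\<exists>e. eqv b e \<and> even_form e"
proof -
  have **: "\<exists>e. eqv b e \<and> even_form e" if v: "vanish (\<alpha>, \<beta>, \<gamma>) b" and t2: "tq b 2 = 0" for b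
  proof (cases "tq b 1 = 0")
    case True
    show ?thesis
    proof (cases "tq b 0 = 0")
      case True
      then show ?thesis using null_even \<open>tq b 1 = 0\<close> t2 by blast
    next
      case False
      then show ?thesis by (rule parabolic_even[OF v True t2])
    qed
  next
    case False
    define c where "c = tr 1 0 (- (tq b 0 / (2 * tq b 1))) 1 b"
    have bc: "eqv b c" unfolding c_def by (rule eqv_lower)
    have tc: "tq c 0 = 0" "tq c 2 = 0" "tq c 1 \<noteq> 0" unfolding c_def tq_lower using False t2 by simp_all
    have "vanish (\<alpha>, \<beta>, \<gamma>) c" using vanish_eqv[OF bc] v by blast
    then show ?thesis by (intro even_via[OF bc] hyperbolic_even[OF _ tc])
  qed
  show ?thesis
  proof (cases "tq b 0 = 0")
    case True
    have "\<exists>e. eqv (tr 0 1 1 0 b) e \<and> even_form e"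
      by (rule **) (use v vanish_eqv[OF eqv_swap, of "(\<alpha>, \<beta>, \<gamma>)" b] True in \<open>auto simp: tq_swap\<close>)
    then show ?thesis by (rule even_via[OF eqv_swap])
  next
    case False
    have "degree [:tq b 2, 2 * tq b 1, tq b 0:] = 2" using False by simp
    then have "\<not> constant (poly [:tq b 2, 2 * tq b 1, tq b 0:])" by (simp add: constant_degree)
    then obtain c where "poly [:tq b 2, 2 * tq b 1, tq b 0:] c = 0" using fundamental_theorem_of_algebra by blast
    then have c: "tq b 2 + 2 * c * tq b 1 + c ^ 2 * tq b 0 = 0" by (simp add: algebra_simps power2_eq_square)
    have "\<exists>e. eqv (tr 1 c 0 1 b) e \<and> even_form e"
      by (rule **) (use v vanish_eqv[OF eqv_upper, of "(\<alpha>, \<beta>, \<gamma>)" b c] c in \<open>simp_all only: tq_upper\<close>)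
    then show ?thesis by (rule even_via[OF eqv_upper])
  qed
qed

section \<open>Even forms and orbits\<close>

text \<open>A null vector is formed from the 2 by 2 minors of two of the columns. If all these
  minors vanish, the rank is at most one and a relation between the first two rows is
  enough.\<close>

lemma det3_null:
  fixes h0 h2 h4 u0 u2 u4 w0 w2 w4 :: complex
  assumes "h0 * (u2 * w4 - u4 * w2) - h2 * (u0 * w4 - u4 * w0) + h4 * (u0 * w2 - u2 * w0) = 0"
  shows "\<exists>x y z. (x \<noteq> 0 \<or> y \<noteq> 0 \<or> z \<noteq> 0) \<and> x * h0 + y * u0 + z * w0 = 0 \<and> x * h2 + y * u2 + z * w2 = 0 \<and> x * h4 + y * u4 + z * w4 = 0"
proof -
  have minor: ?thesis if nz: "u * w' - u' * w \<noteq> 0 \<or> w * h' - w' * h \<noteq> 0 \<or> h * u' - h' * u \<noteq> 0"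
    and d: "\<And>k. k \<in> {(h0, u0, w0), (h2, u2, w2), (h4, u4, w4)} \<Longrightarrow>
      (u * w' - u' * w) * fst k + (w * h' - w' * h) * fst (snd k) + (h * u' - h' * u) * snd (snd k) = 0" for h u w h' u' w'
    using nz d[of "(h0, u0, w0)"] d[of "(h2, u2, w2)"] d[of "(h4, u4, w4)"]
    by (intro exI[of _ "u * w' - u' * w"] exI[of _ "w * h' - w' * h"] exI[of _ "h * u' - h' * u"]) simp
  note D = assms
  show ?thesis
  proof (cases "u0 * w2 - u2 * w0 \<noteq> 0 \<or> w0 * h2 - w2 * h0 \<noteq> 0 \<or> h0 * u2 - h2 * u0 \<noteq> 0")
    case True
    then show ?thesis by (rule minor) (use D in \<open>auto simp: algebra_simps\<close>)
  next
    case m02: False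
    show ?thesis
    proof (cases "u0 * w4 - u4 * w0 \<noteq> 0 \<or> w0 * h4 - w4 * h0 \<noteq> 0 \<or> h0 * u4 - h4 * u0 \<noteq> 0")
      case True
      then show ?thesis by (rule minor) (use D in \<open>auto simp: algebra_simps\<close>)
    next
      case m04: False
      show ?thesis
      proof (cases "u2 * w4 - u4 * w2 \<noteq> 0 \<or> w2 * h4 - w4 * h2 \<noteq> 0 \<or> h2 * u4 - h4 * u2 \<noteq> 0")
        case True
        then show ?thesis by (rule minor) (use D in \<open>auto simp: algebra_simps\<close>)
      next
        case m24: False
        have e: "h0 * u2 = h2 * u0" "h0 * u4 = h4 * u0" "h2 * u4 = h4 * u2" using m02 m04 m24 by auto
        consider "h0 = 0 \<and> h2 = 0 \<and> h4 = 0" | "h0 \<noteq> 0" | "h2 \<noteq> 0" | "h4 \<noteq> 0" by blast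
        then show ?thesis
        proof cases
          case 1
          then show ?thesis by (intro exI[of _ 1] exI[of _ 0]) simp
        next
          case 2
          then show ?thesis using e by (intro exI[of _ "- u0"] exI[of _ h0] exI[of _ 0]) (simp add: mult_ac)
        next
          case 3
          then show ?thesis using e by (intro exI[of _ "- u2"] exI[of _ h2] exI[of _ 0]) (simp add: mult_ac)
        next
          case 4
          then show ?thesis using e by (intro exI[of _ "- u4"] exI[of _ h4] exI[of _ 0]) (simp add: mult_ac)
        qed
      qed
    qed
  qed
qed

text \<open>The quartic controlling the even forms in the zero locus; its arguments are \<open>a\<^sub>0 a\<^sub>4\<close> and \<open>a\<^sub>2\<^sup>2\<close>.\<close>

definition quartic :: "rat \<Rightarrow> rat \<Rightarrow> rat \<Rightarrow> complex \<Rightarrow> complex \<Rightarrow> complex" where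
  "quartic \<alpha> \<beta> \<gamma> x y = - 720 * (x - y) ^ 4
     - of_rat \<alpha> * y * (x + 3 * y) * (230400 * y ^ 2 + 358400 * x * y + 66560 * x ^ 2)
     + 122880 * of_rat \<beta> * y * (x + 3 * y) ^ 2 * (x + y)
     - of_rat \<gamma> * (203904 * y ^ 4 + 387840 * x * y ^ 3 + 187392 * x ^ 2 * y ^ 2 + 5376 * x ^ 3 * y + 1920 * x ^ 4)"

text \<open>Parity splits the matrix: for an even form the rows E and F live in columns 1, 3, 5 and
  the rows H, U, V in columns 0, 2, 4. This is what reduces the vanishing of 5 by 5 minors to a
  single 3 by 3 determinant.\<close>

lemma rows_even:
  fixes \<alpha> \<beta> \<gamma> :: rat and b :: "nat \<Rightarrow> complex"
  assumes e: "even_form b"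
  defines "a \<equiv> b 0" and "c \<equiv> b 2" and "d \<equiv> b 4"
  defines "t0 \<equiv> 2 * (a * d + 3 * c ^ 2)" and "t2 \<equiv> - 8 * c * d" and "r0 \<equiv> 6 * c * (c ^ 2 - a * d)" and "r2 \<equiv> 2 * d * (a * d - c ^ 2)"
    and "s0 \<equiv> 4 * d * (a * d - c ^ 2) * (a * d + 15 * c ^ 2)"
    and "i8 \<equiv> - (d ^ 2 / 5) * (80 * a ^ 3 * d ^ 3 + 144 * a ^ 2 * c ^ 2 * d ^ 2 + 7664 * a * c ^ 4 * d + 8496 * c ^ 6)"
  defines "p \<equiv> of_rat \<alpha> * (2 * t0 * t2)" and "q \<equiv> of_rat \<beta> * (2 * t0 * t2) ^ 2 + of_rat \<gamma> * i8"
  shows "rowU (\<lambda>c. c) b \<alpha> 0 = r0 * t0 - p * a" "rowU (\<lambda>c. c) b \<alpha> 2 = (r0 * t2 + 3 * r2 * t0) / 10 - p * c"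
    "rowU (\<lambda>c. c) b \<alpha> 4 = 3 * r2 * t2 / 5 - p * d"
    "rowU (\<lambda>c. c) b \<alpha> 1 = 0" "rowU (\<lambda>c. c) b \<alpha> 3 = 0" "rowU (\<lambda>c. c) b \<alpha> 5 = 0"
    "rowV (\<lambda>c. c) b \<beta> \<gamma> 0 = s0 * t0 ^ 2 - q * a" "rowV (\<lambda>c. c) b \<beta> \<gamma> 2 = s0 * t0 * t2 / 5 - q * c"
    "rowV (\<lambda>c. c) b \<beta> \<gamma> 4 = s0 * t2 ^ 2 / 5 - q * d"
    "rowV (\<lambda>c. c) b \<beta> \<gamma> 1 = 0" "rowV (\<lambda>c. c) b \<beta> \<gamma> 3 = 0" "rowV (\<lambda>c. c) b \<beta> \<gamma> 5 = 0"
proof -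
  have z: "b (Suc 0) = 0" "b 3 = 0" "b (Suc (Suc (Suc 0))) = 0" "b 5 = 0" using e by (simp_all add: even_form_def numeral_3_eq_3)
  have b2: "b (Suc (Suc 0)) = c" by (simp add: c_def numeral_2_eq_2)
  have t: "tq b 0 = t0" "tq b (Suc 0) = 0" "tq b 2 = t2"
    by (simp_all add: tq_def z t0_def t2_def a_def c_def d_def)
  have r: "rq b 0 = r0" "rq b (Suc 0) = 0" "rq b 2 = r2" "rq b 3 = 0"
    by (simp_all add: rq_def t z b2 a_def[symmetric] c_def[symmetric] d_def[symmetric]; simp add: r0_def r2_def t0_def t2_def algebra_simps power2_eq_square)+
  have w: "wq b 0 = t0 ^ 2" "wq b (Suc 0) = 0" "wq b 2 = 2 * t0 * t2" "wq b 3 = 0" "wq b 4 = t2 ^ 2"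
    by (simp_all add: wq_def t)
  have s: "sq b 0 = s0" "sq b (Suc 0) = 0"
  proof -
    have "sq b 0 = t0 ^ 2 * d + 2 * t0 * t2 * c + t2 ^ 2 * a"
      by (simp add: sq_def w b2 a_def[symmetric] c_def[symmetric] d_def[symmetric])
    also have "\<dots> = s0" unfolding s0_def t0_def t2_def by (simp add: algebra_simps eval_nat_numeral)
    finally show "sq b 0 = s0" .
    show "sq b (Suc 0) = 0" by (simp add: sq_def w z)
  qed
  have i4: "I4 b = 2 * t0 * t2" by (simp add: I4_def t)
  have i8: "I8 (\<lambda>c. c) b = i8"
  proof -
    have "5 * I8 (\<lambda>c. c) b = - 10 * t0 ^ 3 * d ^ 2 + 6 * t0 ^ 2 * t2 * (c * d) + 6 * t0 * t2 ^ 2 * (a * d - 2 * c ^ 2) + 10 * t2 ^ 3 * (a * c)"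
      by (simp add: I8_def atMost_simps choose_simps zq_def yq_def t z a_def c_def d_def; simp add: algebra_simps)
    also have "\<dots> = 5 * i8" unfolding i8_def t0_def t2_def by (simp add: field_simps eval_nat_numeral)
    finally show ?thesis by simp
  qed
  show "rowU (\<lambda>c. c) b \<alpha> 0 = r0 * t0 - p * a" "rowU (\<lambda>c. c) b \<alpha> 2 = (r0 * t2 + 3 * r2 * t0) / 10 - p * c"
    "rowU (\<lambda>c. c) b \<alpha> 4 = 3 * r2 * t2 / 5 - p * d"
    "rowU (\<lambda>c. c) b \<alpha> 1 = 0" "rowU (\<lambda>c. c) b \<alpha> 3 = 0" "rowU (\<lambda>c. c) b \<alpha> 5 = 0"
    "rowV (\<lambda>c. c) b \<beta> \<gamma> 0 = s0 * t0 ^ 2 - q * a" "rowV (\<lambda>c. c) b \<beta> \<gamma> 2 = s0 * t0 * t2 / 5 - q * c"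
    "rowV (\<lambda>c. c) b \<beta> \<gamma> 4 = s0 * t2 ^ 2 / 5 - q * d"
    "rowV (\<lambda>c. c) b \<beta> \<gamma> 1 = 0" "rowV (\<lambda>c. c) b \<beta> \<gamma> 3 = 0" "rowV (\<lambda>c. c) b \<beta> \<gamma> 5 = 0"
    by (simp_all add: rowU_def rowV_def pq_def qq_def r t w s i4 i8 z choose_simps p_def q_def a_def[symmetric] c_def[symmetric] d_def[symmetric];
        simp add: field_simps)+
qed

text \<open>Rows U and V are leading parts minus multiples p and q of the form itself, and V has the
  common factor \<open>s0\<close>. Multilinear expansion leaves three determinants, as the one with
  the form occurring twice is zero. Computed in A = a d and Y = c^2, they produce the constants of
  \<open>quartic\<close>.\<close>

lemma even_det:
  fixes a c d :: complex and \<alpha> \<beta> \<gamma> :: rat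
  defines "t0 \<equiv> 2 * (a * d + 3 * c ^ 2)" and "t2 \<equiv> - 8 * c * d" and "r0 \<equiv> 6 * c * (c ^ 2 - a * d)" and "r2 \<equiv> 2 * d * (a * d - c ^ 2)"
    and "s0 \<equiv> 4 * d * (a * d - c ^ 2) * (a * d + 15 * c ^ 2)"
    and "i8 \<equiv> - (d ^ 2 / 5) * (80 * a ^ 3 * d ^ 3 + 144 * a ^ 2 * c ^ 2 * d ^ 2 + 7664 * a * c ^ 4 * d + 8496 * c ^ 6)"
  defines "p \<equiv> of_rat \<alpha> * (2 * t0 * t2)" and "q \<equiv> of_rat \<beta> * (2 * t0 * t2) ^ 2 + of_rat \<gamma> * i8"
  defines "u0 \<equiv> r0 * t0 - p * a" and "u2 \<equiv> (r0 * t2 + 3 * r2 * t0) / 10 - p * c" and "u4 \<equiv> 3 * r2 * t2 / 5 - p * d"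
    and "w0 \<equiv> s0 * t0 ^ 2 - q * a" and "w2 \<equiv> s0 * t0 * t2 / 5 - q * c" and "w4 \<equiv> s0 * t2 ^ 2 / 5 - q * d"
  shows "(- a / 2) * (u2 * w4 - u4 * w2) - (- c / 10) * (u0 * w4 - u4 * w0) + (3 * d / 10) * (u0 * w2 - u2 * w0) =
    d ^ 3 * (a * d - c ^ 2) * (a * d + 15 * c ^ 2) * quartic \<alpha> \<beta> \<gamma> (a * d) (c ^ 2) / 125"
proof -
  define U0 where "U0 = r0 * t0"
  define U2 where "U2 = (r0 * t2 + 3 * r2 * t0) / 10"
  define U4 where "U4 = 3 * r2 * t2 / 5"
  define W0 where "W0 = t0 ^ 2"
  define W2 where "W2 = t0 * t2 / 5"
  define W4 where "W4 = t2 ^ 2 / 5"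
  define A where "A = a * d"
  define Y where "Y = c ^ 2"
  define k where "k = A - Y"
  let ?D = "\<lambda>x0 x2 x4 y0 y2 y4. (- a / 2) * (x2 * y4 - x4 * y2) - (- c / 10) * (x0 * y4 - x4 * y0) + (3 * d / 10) * (x0 * y2 - x2 * y0)"
  have u: "u0 = U0 - p * a" "u2 = U2 - p * c" "u4 = U4 - p * d" "w0 = s0 * W0 - q * a" "w2 = s0 * W2 - q * c" "w4 = s0 * W4 - q * d"
    by (simp_all add: u0_def u2_def u4_def w0_def w2_def w4_def U0_def U2_def U4_def W0_def W2_def W4_def)
  have split: "?D u0 u2 u4 w0 w2 w4 = s0 * ?D U0 U2 U4 W0 W2 W4 - q * ?D U0 U2 U4 a c d - p * s0 * ?D a c d W0 W2 W4"
    unfolding u by (simp add: field_simps)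
  have UW: "?D U0 U2 U4 W0 W2 W4 = - (36 / 25) * k ^ 4 * d ^ 2"
    unfolding U0_def U2_def U4_def W0_def W2_def W4_def r0_def r2_def t0_def t2_def k_def A_def Y_def
    by (simp add: field_simps eval_nat_numeral)
  have UF: "?D U0 U2 U4 a c d = - (24 / 25) * k * d * (A + 15 * Y) * (A + Y)"
    unfolding U0_def U2_def U4_def r0_def r2_def t0_def t2_def k_def A_def Y_def by (simp add: field_simps eval_nat_numeral)
  have FW: "?D a c d W0 W2 W4 = - (8 / 25) * c * d * (13 * A ^ 2 + 70 * A * Y + 45 * Y ^ 2)"
    unfolding W0_def W2_def W4_def t0_def t2_def A_def Y_def by (simp add: field_simps eval_nat_numeral)
  have s0: "s0 = 4 * d * k * (A + 15 * Y)" by (simp add: s0_def k_def A_def Y_def)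
  have tt: "2 * t0 * t2 = - 32 * c * d * (A + 3 * Y)" by (simp add: t0_def t2_def A_def Y_def algebra_simps)
  have i8: "i8 = - (d ^ 2 / 5) * (80 * A ^ 3 + 144 * A ^ 2 * Y + 7664 * A * Y ^ 2 + 8496 * Y ^ 3)"
    by (simp add: i8_def A_def Y_def power_mult_distrib flip: power_mult)
  have cY: "c * c = Y" "c * (c * z) = Y * z" for z by (simp_all add: Y_def power2_eq_square mult.assoc)
  have p: "p * c = - 32 * of_rat \<alpha> * Y * d * (A + 3 * Y)" unfolding p_def tt cY(1)[symmetric] by (simp only: mult_ac mult_minus_left mult_minus_right)
  have q: "q = 1024 * of_rat \<beta> * Y * d ^ 2 * (A + 3 * Y) ^ 2 + of_rat \<gamma> * i8"
    unfolding q_def tt by (simp add: power_mult_distrib Y_def)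
  let ?K = "d ^ 3 * k * (A + 15 * Y)"
  have 1: "s0 * ?D U0 U2 U4 W0 W2 W4 = ?K * (- 720 * k ^ 4) / 125"
    unfolding UW s0 by (simp add: field_simps eval_nat_numeral)
  have 2: "q * ?D U0 U2 U4 a c d = - (?K * (122880 * of_rat \<beta> * Y * (A + 3 * Y) ^ 2 * (A + Y)
     - of_rat \<gamma> * (203904 * Y ^ 4 + 387840 * A * Y ^ 3 + 187392 * A ^ 2 * Y ^ 2 + 5376 * A ^ 3 * Y + 1920 * A ^ 4)) / 125)"
    unfolding UF q i8 by (simp add: field_simps eval_nat_numeral)
  have "p * s0 * ?D a c d W0 W2 W4 = - (8 / 25) * (p * c) * s0 * d * (13 * A ^ 2 + 70 * A * Y + 45 * Y ^ 2)"
    unfolding FW by (simp only: mult_ac mult_minus_left mult_minus_right)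
  also have "\<dots> = ?K * (of_rat \<alpha> * Y * (A + 3 * Y) * (230400 * Y ^ 2 + 358400 * A * Y + 66560 * A ^ 2)) / 125"
    unfolding p s0 by (simp add: field_simps eval_nat_numeral)
  finally have 3: "p * s0 * ?D a c d W0 W2 W4 = ?K * (of_rat \<alpha> * Y * (A + 3 * Y) * (230400 * Y ^ 2 + 358400 * A * Y + 66560 * A ^ 2)) / 125" .
  have "?D u0 u2 u4 w0 w2 w4 = ?K * quartic \<alpha> \<beta> \<gamma> A Y / 125"
    unfolding split 1 2 3 quartic_def k_def[symmetric] by (simp add: diff_divide_distrib add_divide_distrib right_diff_distrib distrib_left)
  then show ?thesis unfolding k_def A_def Y_def .
qed

lemma vanish_even_iff:
  assumes e: "even_form b"
  shows "vanish (\<alpha>, \<beta>, \<gamma>) b \<longleftrightarrow> b 4 = 0 \<or> b 0 * b 4 = b 2 ^ 2 \<or> b 0 * b 4 = - 15 * b 2 ^ 2 \<or> quartic \<alpha> \<beta> \<gamma> (b 0 * b 4) (b 2 ^ 2) = 0"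
proof -
  let ?U = "rowU (\<lambda>c. c) b \<alpha>" and ?V = "rowV (\<lambda>c. c) b \<beta> \<gamma>" and ?H = "rowH (\<lambda>c. c) b"
  let ?D = "?H 0 * (?U 2 * ?V 4 - ?U 4 * ?V 2) - ?H 2 * (?U 0 * ?V 4 - ?U 4 * ?V 0) + ?H 4 * (?U 0 * ?V 2 - ?U 2 * ?V 0)"
  have z: "b 1 = 0" "b (Suc 0) = 0" "b 3 = 0" "b 5 = 0" using e by (simp_all add: even_form_def)
  have h: "?H 0 = - b 0 / 2" "?H 2 = - b 2 / 10" "?H 4 = 3 * b 4 / 10" "?H 1 = 0" "?H 3 = 0" "?H 5 = 0"
    by (simp_all add: rowH_def z)
  have D: "?D = b 4 ^ 3 * (b 0 * b 4 - b 2 ^ 2) * (b 0 * b 4 + 15 * b 2 ^ 2) * quartic \<alpha> \<beta> \<gamma> (b 0 * b 4) (b 2 ^ 2) / 125"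
    unfolding rows_even[OF e] h by (rule even_det)
  have D0: "?D = 0 \<longleftrightarrow> b 4 = 0 \<or> b 0 * b 4 = b 2 ^ 2 \<or> b 0 * b 4 = - 15 * b 2 ^ 2 \<or> quartic \<alpha> \<beta> \<gamma> (b 0 * b 4) (b 2 ^ 2) = 0"
    unfolding D by (simp add: add_eq_0_iff2)
  show ?thesis
  proof
    assume v: "vanish (\<alpha>, \<beta>, \<gamma>) b"
    obtain v0 v1 v2 v3 v4 where nz: "v0 \<noteq> 0 \<or> v1 \<noteq> 0 \<or> v2 \<noteq> 0 \<or> v3 \<noteq> 0 \<or> v4 \<noteq> (0 :: complex)"
      and r: "\<And>j. j < 6 \<Longrightarrow> v0 * rowE (\<lambda>c. c) b j + v1 * ?H j + v2 * rowF (\<lambda>c. c) b j + v3 * ?U j + v4 * ?V j = 0"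
      using vanish_rows[OF v] by blast
    have "?D = 0" if b4: "b 4 \<noteq> 0"
    proof -
      \<comment> \<open>The odd columns contain only E and F: column 5 forces v2 = 0, and then
        column 3 forces v0 = 0, because b 4 is nonzero. Cramer's rule for the remaining three rows
        finishes the argument.\<close>
      have "v2 = 0" using r[of 5] b4 unfolding rows_even(6,12)[OF e] h by (simp add: rowE_def rowF_def)
      moreover from this have "v0 = 0" using r[of 3] b4 unfolding rows_even(5,11)[OF e] h by (simp add: rowE_def rowF_def)
      ultimately have q: "v1 * ?H 0 + v3 * ?U 0 + v4 * ?V 0 = 0" "v1 * ?H 2 + v3 * ?U 2 + v4 * ?V 2 = 0" "v1 * ?H 4 + v3 * ?U 4 + v4 * ?V 4 = 0"
        and nz': "v1 \<noteq> 0 \<or> v3 \<noteq> 0 \<or> v4 \<noteq> 0" using r[of 0] r[of 2] r[of 4] nz by simp_all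
      have id: "x * D = 0 \<and> y * D = 0 \<and> w * D = 0" if "x * h0 + y * u0 + w * w0 = 0" "x * h2 + y * u2 + w * w2 = 0" "x * h4 + y * u4 + w * w4 = 0"
        and "D = h0 * (u2 * w4 - u4 * w2) - h2 * (u0 * w4 - u4 * w0) + h4 * (u0 * w2 - u2 * w0)"
        for x y w h0 h2 h4 u0 u2 u4 w0 w2 w4 D :: complex
      proof -
        have "x * D = (u2 * w4 - u4 * w2) * (x * h0 + y * u0 + w * w0) - (u0 * w4 - u4 * w0) * (x * h2 + y * u2 + w * w2)
            + (u0 * w2 - u2 * w0) * (x * h4 + y * u4 + w * w4)"
          "y * D = - ((h2 * w4 - h4 * w2) * (x * h0 + y * u0 + w * w0)) + (h0 * w4 - h4 * w0) * (x * h2 + y * u2 + w * w2)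
            - (h0 * w2 - h2 * w0) * (x * h4 + y * u4 + w * w4)"
          "w * D = (h2 * u4 - h4 * u2) * (x * h0 + y * u0 + w * w0) - (h0 * u4 - h4 * u0) * (x * h2 + y * u2 + w * w2)
            + (h0 * u2 - h2 * u0) * (x * h4 + y * u4 + w * w4)"
          unfolding that(4) by (simp_all add: algebra_simps)
        then show ?thesis unfolding that(1-3) by simp
      qed
      from id[OF q refl] show ?thesis using nz' by auto
    qed
    then show "b 4 = 0 \<or> b 0 * b 4 = b 2 ^ 2 \<or> b 0 * b 4 = - 15 * b 2 ^ 2 \<or> quartic \<alpha> \<beta> \<gamma> (b 0 * b 4) (b 2 ^ 2) = 0"
      unfolding D0[symmetric] using D0 by blast
  next
    assume "b 4 = 0 \<or> b 0 * b 4 = b 2 ^ 2 \<or> b 0 * b 4 = - 15 * b 2 ^ 2 \<or> quartic \<alpha> \<beta> \<gamma> (b 0 * b 4) (b 2 ^ 2) = 0"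
    then have "?D = 0" unfolding D0 .
    from det3_null[OF this] obtain x y w where n: "x \<noteq> 0 \<or> y \<noteq> 0 \<or> w \<noteq> 0"
      and q: "x * ?H 0 + y * ?U 0 + w * ?V 0 = 0" "x * ?H 2 + y * ?U 2 + w * ?V 2 = 0" "x * ?H 4 + y * ?U 4 + w * ?V 4 = 0" by blast
    show "vanish (\<alpha>, \<beta>, \<gamma>) b"
    proof (rule vanishI[of 0 x 0 y w])
      fix j :: nat assume "j < 6"
      then show "0 * rowE (\<lambda>c. c) b j + x * ?H j + 0 * rowF (\<lambda>c. c) b j + y * ?U j + w * ?V j = 0"
        unfolding less_6 using q h(4-6) rows_even(4-6,10-12)[OF e] by (elim disjE) (simp_all del: One_nat_def)
    qed (use n in blast)
  qed
qed

section \<open>Representatives of the orbits\<close>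

definition rep :: "nat \<Rightarrow> nat \<Rightarrow> complex" where
  "rep k i = [[1, 0, 0, 0, 0, 1], [0, 1/5, 0, 0, - 1/5, 0], [0, 1/5, 1/10, 0, 0, 0], [0, 0, 1/10, 0, 0, 0],
     [0, 1/5, 0, 0, 0, 0], [1, 0, 0, 0, 0, 0]] ! k ! i"

lemma rep_forms:
  "x1 ^ 5 + x2 ^ 5 = nform 5 (rep 0)" "x1 * x2 * (x1 - x2) * (x1 ^ 2 + x1 * x2 + x2 ^ 2) = nform 5 (rep 1)"
  "x1 ^ 3 * x2 * (x1 + x2) = nform 5 (rep 2)" "x1 ^ 3 * x2 ^ 2 = nform 5 (rep 3)" "x1 ^ 4 * x2 = nform 5 (rep 4)" "x1 ^ 5 = nform 5 (rep 5)"
  by (simp_all add: nform_def pform_def atMost_simps choose_simps rep_def Const.hom_uminus; simp add: algebra_simps eval_nat_numeral)+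

lemma locus_B_rep: "locus_B = (\<Union>k<6. SL2_orbit (nform 5 (rep k)))"
proof -
  have "{..<6::nat} = {0, 1, 2, 3, 4, 5}" by auto
  then show ?thesis
    unfolding locus_B_def rep_forms(1-5) unfolding rep_forms(6) by (simp only: UN_insert UN_empty Un_assoc Un_empty_right)
qed

lemma eqv_multiple: "c \<noteq> 0 \<Longrightarrow> (\<And>i. i < 6 \<Longrightarrow> b' i = c * b i) \<Longrightarrow> eqv b b'"
  using eqv_trans[OF eqv_scale eqv_cong] by metis

lemma even_rep:
  assumes e: "even_form e" and nz: "\<exists>i<6. e i \<noteq> 0"
    and c: "e 4 = 0 \<or> e 0 * e 4 = e 2 ^ 2 \<or> e 0 * e 4 = - 15 * e 2 ^ 2"
  shows "\<exists>k<6. eqv (rep k) e"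
proof -
  have z: "e 1 = 0" "e (Suc 0) = 0" "e 3 = 0" "e 5 = 0" using e by (simp_all add: even_form_def)
  have multiple: "eqv b e" if "l \<noteq> 0" "p * s - q * r \<noteq> 0" "\<And>i. i < 6 \<Longrightarrow> tr p q r s b i = l * e i" for b l p q r s
  proof -
    have "eqv b (tr p q r s b)" by (rule eqv_tr[OF that(2) refl])
    moreover have "eqv (tr p q r s b) e" by (rule eqv_multiple[of "1 / l"]) (use that in auto)
    ultimately show ?thesis by (rule eqv_trans)
  qed
  show ?thesis
  proof (cases "e 4 = 0")
    case e4: True
    show ?thesis
    proof (cases "e 2 = 0")
      case True
      then have "e 0 \<noteq> 0" using nz z e4 unfolding less_6 by (auto simp del: One_nat_def)
      then have "eqv (rep 5) e" by (rule eqv_multiple) (use z e4 True in \<open>auto simp: less_6 rep_def\<close>)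
      then show ?thesis by (intro exI[of _ 5]) simp
    next
      case e2: False
      show ?thesis
      proof (cases "e 0 = 0")
        case True
        have "10 * e 2 \<noteq> 0" using e2 by simp
        then have "eqv (rep 3) e" by (rule eqv_multiple) (use z e4 True in \<open>auto simp: less_6 rep_def\<close>)
        then show ?thesis by (intro exI[of _ 3]) simp
      next
        case False
        \<comment> \<open>The even form is x1^3 times a multiple of x2^2 - k^2 x1^2. The
          substitution of 2 k x1 for x1 and of x2 - k x1 for x2 turns x2 and x1 + x2 into its two
          factors.\<close>
        obtain k where k: "k ^ 2 = - (e 0 / (10 * e 2))" using root_exists[of 2] by auto
        have k0: "k \<noteq> 0" using k False e2 by auto
        have "eqv (rep 2) e"
        proof (rule multiple[of "8 * k ^ 3 / (10 * e 2)" "2 * k" 1 0 "- k"])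
          fix i :: nat assume i: "i < 6"
          have k5: "8 * k ^ 5 * (10 * e 2) = - (8 * k ^ 3 * e 0)"
          proof -
            have "k ^ 5 = k ^ 3 * k ^ 2" by (simp flip: power_add)
            then show ?thesis unfolding k using e2 by (simp add: field_simps)
          qed
          have t: "tr (2 * k) 0 (- k) 1 (rep 2) 0 = - (8 * k ^ 5)" "tr (2 * k) 0 (- k) 1 (rep 2) 1 = 0"
            "tr (2 * k) 0 (- k) 1 (rep 2) 2 = 8 * k ^ 3 / 10" "tr (2 * k) 0 (- k) 1 (rep 2) 3 = 0"
            "tr (2 * k) 0 (- k) 1 (rep 2) 4 = 0" "tr (2 * k) 0 (- k) 1 (rep 2) 5 = 0"
            by (simp_all add: tr_simps rep_def; simp add: algebra_simps)+
          show "tr (2 * k) 0 (- k) 1 (rep 2) i = 8 * k ^ 3 / (10 * e 2) * e i"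
            using i z e4 e2 k5 t unfolding less_6 by (elim disjE) (simp_all add: field_simps del: One_nat_def)
        qed (use k0 e2 in auto)
        then show ?thesis by (intro exI[of _ 2]) simp
      qed
    qed
  next
    case e4: False
    show ?thesis
    proof (cases "e 2 = 0")
      case True
      then have "e 0 = 0" using c e4 by auto
      then have "eqv (rep 4) e"
      proof (intro multiple[of "1 / (5 * e 4)" 0 0 1 1])
        fix i :: nat assume e0: "e 0 = 0" and "i < 6"
        then show "tr 0 1 1 0 (rep 4) i = 1 / (5 * e 4) * e i"
          using tr_swap[of "rep 4"] z e4 True unfolding less_6 by (elim disjE) (simp_all add: rep_def del: One_nat_def)
      qed (use e4 in auto)
      then show ?thesis by (intro exI[of _ 4]) simp
    next
      case e2: False
      define m where "m = e 2 / e 4"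
      have m: "m \<noteq> 0" "e 2 = m * e 4" using e2 e4 by (simp_all add: m_def)
      show ?thesis
      proof (cases "e 0 * e 4 = e 2 ^ 2")
        case True
        then have "e 4 * e 0 = e 4 * (m ^ 2 * e 4)" unfolding m(2) by (simp add: power2_eq_square mult_ac)
        then have e0: "e 0 = m ^ 2 * e 4" using e4 by simp
        \<comment> \<open>The form (k x1 + x2)^5 + (k x1 - x2)^5 has normalised even coefficients 2
          k^5, 2 k^3, 2 k, and e 0, e 2, e 4 are in geometric progression too, with ratio m = k^2
          read from the end.\<close>
        obtain k where k: "k ^ 2 = m" using root_exists[of 2] by auto
        have k0: "k \<noteq> 0" using k m(1) by auto
        have "eqv (rep 0) e"
        proof (rule multiple[of "2 * k / e 4" k "- 1" 1 k])
          fix i :: nat assume i: "i < 6"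
          have t: "tr k 1 k (- 1) (rep 0) 0 = 2 * k * (k ^ 2) ^ 2" "tr k 1 k (- 1) (rep 0) 1 = 0"
            "tr k 1 k (- 1) (rep 0) 2 = 2 * k * k ^ 2" "tr k 1 k (- 1) (rep 0) 3 = 0"
            "tr k 1 k (- 1) (rep 0) 4 = 2 * k" "tr k 1 k (- 1) (rep 0) 5 = 0"
            by (simp_all add: tr_simps rep_def; simp add: algebra_simps)+
          show "tr k 1 k (- 1) (rep 0) i = 2 * k / e 4 * e i"
            using i z e4 e0 m(2) t unfolding less_6 k by (elim disjE) (simp_all add: field_simps del: One_nat_def)
        qed (use k0 e4 in auto)
        then show ?thesis by (intro exI[of _ 0]) simp
      next
        case False
        then have "e 0 * e 4 = - 15 * e 2 ^ 2" using c e4 by blast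
        then have "e 4 * e 0 = e 4 * (- 15 * m ^ 2 * e 4)" unfolding m(2) by (simp add: power2_eq_square mult_ac)
        then have e0: "e 0 = - 15 * m ^ 2 * e 4" using e4 by (simp only: mult_cancel_left) blast
        \<comment> \<open>Substituting s x1 + x2 and x2 - s x1 in x1 x2 (x1^3 - x2^3) gives
          normalised even coefficients - 2 s^5, - 2 s^3 / 5, 6 s / 5. Comparing the ratio of the
          last two with m gives s^2 = - 3 m.\<close>
        obtain s where s: "s ^ 2 = - 3 * m" using root_exists[of 2] by auto
        have s0: "s \<noteq> 0" using s m(1) by auto
        have "eqv (rep 1) e"
        proof (rule multiple[of "6 * s / (5 * e 4)" s 1 1 "- s"])
          fix i :: nat assume i: "i < 6"
          have t: "tr s 1 (- s) 1 (rep 1) 0 = - 2 * s * (s ^ 2) ^ 2" "tr s 1 (- s) 1 (rep 1) 1 = 0"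
            "tr s 1 (- s) 1 (rep 1) 2 = - 2 / 5 * s * s ^ 2" "tr s 1 (- s) 1 (rep 1) 3 = 0"
            "tr s 1 (- s) 1 (rep 1) 4 = 6 / 5 * s" "tr s 1 (- s) 1 (rep 1) 5 = 0"
            by (simp_all add: tr_simps rep_def; simp add: field_simps)+
          have c: "6 * s / (5 * e 4) * e 0 = - 2 * s * (s ^ 2) ^ 2" "6 * s / (5 * e 4) * e 2 = - 2 / 5 * s * s ^ 2"
            "6 * s / (5 * e 4) * e 4 = 6 / 5 * s"
            unfolding s e0 m(2) using e4 by (simp_all add: field_simps power2_eq_square)
          show "tr s 1 (- s) 1 (rep 1) i = 6 * s / (5 * e 4) * e i"
            using i unfolding less_6 by (elim disjE) (simp_all only: t c z mult_zero_right)
        qed (use s0 e4 in auto)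
        then show ?thesis by (intro exI[of _ 1]) simp
      qed
    qed
  qed
qed

lemma vanish_rep: "k < 6 \<Longrightarrow> vanish \<tau> (rep k)"
proof -
  assume k: "k < 6"
  obtain \<alpha> \<beta> \<gamma> where \<tau>: "\<tau> = (\<alpha>, \<beta>, \<gamma>)" by (cases \<tau>)
  have via: "vanish \<tau> b" if "eqv b e" "even_form e" "e 4 = 0 \<or> e 0 * e 4 = e 2 ^ 2 \<or> e 0 * e 4 = - 15 * e 2 ^ 2" for b e
    using vanish_eqv[OF that(1)] vanish_even_iff[OF that(2)] that(3) unfolding \<tau> by blast
  have "vanish \<tau> (rep 0)"
    by (rule via[of _ "tr 1 1 1 (- 1) (rep 0)"], rule eqv_tr[OF _ refl]) (simp_all add: even_form_def tr_simps rep_def)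
  moreover have "vanish \<tau> (rep 1)"
    by (rule via[of _ "tr 1 1 (- 1) 1 (rep 1)"], rule eqv_tr[OF _ refl]) (simp_all add: even_form_def tr_simps rep_def)
  moreover have "vanish \<tau> (rep 2)"
  proof (rule via)
    show "eqv (rep 2) (tr 2 0 (- 1) 1 (rep 2))" by (rule eqv_tr[OF _ refl]) simp
    have "tr 2 0 (- 1) 1 (rep 2) 1 = 0" "tr 2 0 (- 1) 1 (rep 2) 3 = 0" "tr 2 0 (- 1) 1 (rep 2) 4 = 0" "tr 2 0 (- 1) 1 (rep 2) 5 = 0"
      by (simp_all add: tr_simps rep_def)
    then show "even_form (tr 2 0 (- 1) 1 (rep 2))" "tr 2 0 (- 1) 1 (rep 2) 4 = 0 \<or>
      tr 2 0 (- 1) 1 (rep 2) 0 * tr 2 0 (- 1) 1 (rep 2) 4 = tr 2 0 (- 1) 1 (rep 2) 2 ^ 2 \<or>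
      tr 2 0 (- 1) 1 (rep 2) 0 * tr 2 0 (- 1) 1 (rep 2) 4 = - 15 * tr 2 0 (- 1) 1 (rep 2) 2 ^ 2"
      unfolding even_form_def by (blast intro: disjI1)+
  qed
  moreover have "vanish \<tau> (rep 3)"
    by (rule via[of _ "rep 3"], rule eqv_cong) (simp_all add: even_form_def rep_def)
  moreover have "vanish \<tau> (rep 4)"
    by (rule via[OF eqv_swap]) (simp_all only: even_form_def tr_swap, simp_all add: rep_def)
  moreover have "vanish \<tau> (rep 5)"
    by (rule via[of _ "rep 5"], rule eqv_cong) (simp_all add: even_form_def rep_def)
  ultimately show ?thesis using k unfolding less_6 by blast
qed

lemma rep_nonzero: "k < 6 \<Longrightarrow> \<exists>i<6. rep k i \<noteq> 0"
proof (intro exI)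
  assume "k < 6"
  then show "[0, 1, 1, 2, 1, 0] ! k < (6 :: nat) \<and> rep k ([0, 1, 1, 2, 1, 0] ! k) \<noteq> 0"
    unfolding less_6[of k] by (elim disjE) (simp_all add: rep_def)
qed

lemma locus_B_subset: "locus_B \<subseteq> zero_locus (cov_ideal \<tau>)"
  unfolding locus_B_rep using orbit_in_zero_locus[OF _ vanish_rep rep_nonzero] by blast

lemma eqv_nonzero:
  assumes "eqv b e" "\<exists>i<6. b i \<noteq> 0" shows "\<exists>i<6. e i \<noteq> 0"
proof (rule ccontr)
  assume "\<not> (\<exists>i<6. e i \<noteq> 0)"
  then have "nform 5 e = nform 5 (\<lambda>_. 0)" unfolding nform_inject by blast
  then have e0: "nform 5 e = 0" by (simp add: nform_def pform_def)
  obtain p q r s where "nform 5 b = act_form (m2 p q r s) (nform 5 e)" using eqv_sym[OF assms(1)] unfolding eqv_def by blast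
  then have "nform 5 b = 0" unfolding e0 crh_zero[OF act_form_hom] .
  then have "nform 5 b = nform 5 (\<lambda>_. 0)" by (simp add: nform_def pform_def)
  then show False using assms(2) unfolding nform_inject by blast
qed

section \<open>The exceptional parameters\<close>

lemma quartic_special:
  assumes "(\<alpha>, \<beta>, \<gamma>) \<in> {(0, 0, 0), (2/5, 14/75, -2/5), (1/6, 2/45, -1/3)}" "quartic \<alpha> \<beta> \<gamma> x y = 0"
  shows "x = y \<or> x = - 15 * y"
proof -
  have "quartic 0 0 0 x y = - 720 * (x - y) ^ 4" by (simp add: quartic_def)
  moreover have "quartic (2/5) (14/75) (-2/5) x y = 48 * (x - y) ^ 2 * (x + 15 * y) ^ 2"
    unfolding quartic_def by (simp add: of_rat_divide of_rat_minus of_rat_numeral_eq; simp add: field_simps eval_nat_numeral)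
  moreover have "quartic (1/6) (2/45) (-1/3) x y = - 80 * (x - y) ^ 3 * (x + 15 * y)"
    unfolding quartic_def by (simp add: of_rat_divide of_rat_minus of_rat_numeral_eq; simp add: field_simps eval_nat_numeral)
  ultimately have e: "quartic 0 0 0 x y = - 720 * (x - y) ^ 4" "quartic (2/5) (14/75) (-2/5) x y = 48 * (x - y) ^ 2 * (x + 15 * y) ^ 2"
    "quartic (1/6) (2/45) (-1/3) x y = - 80 * (x - y) ^ 3 * (x + 15 * y)" by blast+
  consider "\<alpha> = 0" "\<beta> = 0" "\<gamma> = 0" | "\<alpha> = 2/5" "\<beta> = 14/75" "\<gamma> = -2/5" | "\<alpha> = 1/6" "\<beta> = 2/45" "\<gamma> = -1/3"
    using assms(1) by blast
  then show ?thesis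
  proof cases
    case 1
    then show ?thesis using assms(2) e(1) by simp
  next
    case 2
    have "48 * (x - y) ^ 2 * (x + 15 * y) ^ 2 = 0" using assms(2) unfolding 2 e(2) .
    then show ?thesis by (simp add: add_eq_0_iff2)
  next
    case 3
    have "- 80 * (x - y) ^ 3 * (x + 15 * y) = 0" using assms(2) unfolding 3 e(3) .
    then show ?thesis by (simp add: add_eq_0_iff2)
  qed
qed

text \<open>Coefficients in the chart y = 1, in ascending order. They are kept rational, so that
  conditions on them become linear arithmetic in the parameters.\<close>

definition quartic_coeffs :: "rat \<Rightarrow> rat \<Rightarrow> rat \<Rightarrow> rat list" where
  "quartic_coeffs \<alpha> \<beta> \<gamma> = [- 720 - 691200 * \<alpha> + 1105920 * \<beta> - 203904 * \<gamma>, 2880 - 1305600 * \<alpha> + 1843200 * \<beta> - 387840 * \<gamma>,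
     - 4320 - 558080 * \<alpha> + 860160 * \<beta> - 187392 * \<gamma>, 2880 - 66560 * \<alpha> + 122880 * \<beta> - 5376 * \<gamma>, - 720 - 1920 * \<gamma>]"

lemma quartic_poly:
  "quartic \<alpha> \<beta> \<gamma> x 1 = poly (Poly (map of_rat (quartic_coeffs \<alpha> \<beta> \<gamma>))) x"
  unfolding quartic_def quartic_coeffs_def
  by (simp add: of_rat_add of_rat_diff of_rat_mult of_rat_minus of_rat_numeral_eq; simp add: algebra_simps eval_nat_numeral)

lemma quartic_coeffs_nth:
  "quartic_coeffs \<alpha> \<beta> \<gamma> ! 0 = - 720 - 691200 * \<alpha> + 1105920 * \<beta> - 203904 * \<gamma>"
  "quartic_coeffs \<alpha> \<beta> \<gamma> ! 1 = 2880 - 1305600 * \<alpha> + 1843200 * \<beta> - 387840 * \<gamma>"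
  "quartic_coeffs \<alpha> \<beta> \<gamma> ! 2 = - 4320 - 558080 * \<alpha> + 860160 * \<beta> - 187392 * \<gamma>"
  "quartic_coeffs \<alpha> \<beta> \<gamma> ! 3 = 2880 - 66560 * \<alpha> + 122880 * \<beta> - 5376 * \<gamma>"
  "quartic_coeffs \<alpha> \<beta> \<gamma> ! 4 = - 720 - 1920 * \<gamma>"
  "length (quartic_coeffs \<alpha> \<beta> \<gamma>) = 5"
  by (simp_all add: quartic_coeffs_def)

lemma quartic_coeff:
  "i < 5 \<Longrightarrow> coeff (Poly (map of_rat (quartic_coeffs \<alpha> \<beta> \<gamma>)) :: complex poly) i = of_rat (quartic_coeffs \<alpha> \<beta> \<gamma> ! i)"
  by (simp add: nth_default_def quartic_coeffs_nth)

text \<open>Five linear conditions on three parameters, which are inconsistent. For every \<tau> the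
  quartic therefore has finitely many roots, and the zero locus finitely many orbits.\<close>

lemma quartic_coeffs_nonzero: "\<exists>i<5. quartic_coeffs \<alpha> \<beta> \<gamma> ! i \<noteq> 0"
proof (rule ccontr)
  assume "\<not> ?thesis"
  then have z: "quartic_coeffs \<alpha> \<beta> \<gamma> ! i = 0" if "i < 5" for i using that by blast
  have "- 720 - 691200 * \<alpha> + 1105920 * \<beta> - 203904 * \<gamma> = 0" "2880 - 1305600 * \<alpha> + 1843200 * \<beta> - 387840 * \<gamma> = 0"
    "- 4320 - 558080 * \<alpha> + 860160 * \<beta> - 187392 * \<gamma> = 0" "2880 - 66560 * \<alpha> + 122880 * \<beta> - 5376 * \<gamma> = 0"
    unfolding quartic_coeffs_nth(1-4)[symmetric] by (rule z; simp)+
  moreover have "quartic_coeffs \<alpha> \<beta> \<gamma> ! 4 = 0" by (rule z) simp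
  then have "- 720 - 1920 * \<gamma> = 0" unfolding quartic_coeffs_nth(5) .
  ultimately show False by linarith
qed

lemma poly_splits:
  fixes p :: "complex poly"
  shows "degree p = n \<Longrightarrow> \<exists>as. length as = n \<and> p = smult (lead_coeff p) (\<Prod>a\<leftarrow>as. [:- a, 1:])"
proof (induction n arbitrary: p)
  case 0
  then obtain c where "p = [:c:]" by (rule degree_eq_zeroE)
  then show ?case by simp
next
  case (Suc n)
  then have "\<not> constant (poly p)" by (simp add: constant_degree)
  then obtain z where "poly p z = 0" using fundamental_theorem_of_algebra by blast
  then obtain r where r: "p = [:- z, 1:] * r" by (auto simp: poly_eq_0_iff_dvd dvd_def)
  then have r0: "r \<noteq> 0" using Suc.prems by auto
  have "degree p = 1 + degree r" unfolding r using r0 by (subst degree_mult_eq) auto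
  then have "degree r = n" using Suc.prems by simp
  from Suc.IH[OF this] obtain as where as: "length as = n" "r = smult (lead_coeff r) (\<Prod>a\<leftarrow>as. [:- a, 1:])" by blast
  have l: "lead_coeff p = lead_coeff r" unfolding r lead_coeff_mult by simp
  have "p = smult (lead_coeff r) ([:- z, 1:] * (\<Prod>a\<leftarrow>as. [:- a, 1:]))"
    unfolding mult_smult_right[symmetric] as(2)[symmetric] by (rule r)
  then have "p = smult (lead_coeff p) (\<Prod>a\<leftarrow>z # as. [:- a, 1:])" unfolding l by simp
  then show ?case using as(1) by (intro exI[of _ "z # as"]) simp
qed

text \<open>If all roots were 1 or -15, the coefficients would be the leading one times the
  elementary symmetric functions of four such numbers. The five possible multiplicities give linear
  systems for the parameters: with at most two roots -15 the solutions are the three triples, with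
  three or four there is none.\<close>

lemma quartic_root:
  assumes "(\<alpha>, \<beta>, \<gamma>) \<notin> {(0, 0, 0), (2/5, 14/75, -2/5), (1/6, 2/45, -1/3)}"
  shows "\<exists>x y. x \<noteq> y \<and> x \<noteq> - 15 * y \<and> quartic \<alpha> \<beta> \<gamma> x y = 0"
proof (cases "quartic_coeffs \<alpha> \<beta> \<gamma> ! 4 = 0")
  case True
  then have "\<gamma> = - 3 / 8" unfolding quartic_coeffs_nth by simp
  \<comment> \<open>When the coefficient of x^4 vanishes, the point (1, 0) at infinity is a
    root.\<close>
  then have "quartic \<alpha> \<beta> \<gamma> 1 0 = 0" by (simp add: quartic_def of_rat_divide of_rat_minus of_rat_numeral_eq)
  then show ?thesis by (intro exI[of _ 1] exI[of _ 0]) simp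
next
  case False
  let ?C = "quartic_coeffs \<alpha> \<beta> \<gamma>"
  define p :: "complex poly" where "p = Poly (map of_rat ?C)"
  have co: "coeff p i = of_rat (?C ! i)" if "i < 5" for i unfolding p_def by (rule quartic_coeff[OF that])
  have qp: "quartic \<alpha> \<beta> \<gamma> x 1 = poly p x" for x unfolding p_def by (rule quartic_poly)
  have c4: "coeff p 4 \<noteq> 0" using co[of 4] False by simp
  have deg: "degree p = 4"
  proof (rule antisym)
    show "degree p \<le> 4" unfolding p_def by (intro degree_le allI impI) (simp add: nth_default_def quartic_coeffs_nth)
    show "4 \<le> degree p" by (rule le_degree[OF c4])
  qed
  obtain as where as: "length as = 4" "p = smult (lead_coeff p) (\<Prod>a\<leftarrow>as. [:- a, 1:])"
    using poly_splits[OF deg] by blast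
  have root: "poly p a = 0" if "a \<in> set as" for a
  proof -
    have "poly (\<Prod>a\<leftarrow>as. [:- a, 1:]) a = 0" using that by (induction as) auto
    then have "poly (smult (lead_coeff p) (\<Prod>a\<leftarrow>as. [:- a, 1:])) a = 0" by simp
    then show ?thesis unfolding as(2)[symmetric] .
  qed
  show ?thesis
  proof (rule ccontr)
    assume c: "\<not> ?thesis"
    have in1: "a = 1 \<or> a = - 15" if "a \<in> set as" for a
    proof (rule ccontr)
      assume "\<not> (a = 1 \<or> a = - 15)"
      moreover have "quartic \<alpha> \<beta> \<gamma> a 1 = 0" unfolding qp by (rule root[OF that])
      ultimately have "a \<noteq> 1 \<and> a \<noteq> - 15 * 1 \<and> quartic \<alpha> \<beta> \<gamma> a 1 = 0" by simp
      then show False using c by blast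
    qed
    obtain a b c' d where l: "as = [a, b, c', d]"
      using as(1) by (auto simp: eval_nat_numeral length_Suc_conv)
    have rat: "\<exists>r :: rat. a = of_rat r \<and> (r = 1 \<or> r = - 15)" if "a \<in> set as" for a
      using in1[OF that]
    proof
      assume "a = 1"
      then show ?thesis by (intro exI[of _ 1]) simp
    next
      assume "a = - 15"
      then show ?thesis by (intro exI[of _ "- 15"]) (simp add: of_rat_minus of_rat_numeral_eq)
    qed
    have mem: "a \<in> set as" "b \<in> set as" "c' \<in> set as" "d \<in> set as" unfolding l by simp_all
    obtain r where r: "a = of_rat r" "r = 1 \<or> r = - 15" using rat[OF mem(1)] by blast
    obtain s where s: "b = of_rat s" "s = 1 \<or> s = - 15" using rat[OF mem(2)] by blast
    obtain t where t: "c' = of_rat t" "t = 1 \<or> t = - 15" using rat[OF mem(3)] by blast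
    obtain u where u: "d = of_rat u" "u = 1 \<or> u = - 15" using rat[OF mem(4)] by blast
    let ?k = "of_rat (?C ! 4) :: complex"
    have "lead_coeff p = ?k" unfolding deg using co[of 4] by simp
    then have P: "p = smult ?k ([:- a, 1:] * ([:- b, 1:] * ([:- c', 1:] * [:- d, 1:])))" using as(2) unfolding l by simp
    have e: "coeff p 3 = - (a + b + c' + d) * ?k" "coeff p 2 = (a * b + a * c' + a * d + b * c' + b * d + c' * d) * ?k"
      "coeff p 1 = - (a * b * c' + a * b * d + a * c' * d + b * c' * d) * ?k" "coeff p 0 = (a * b * c' * d) * ?k"
      by (subst P, simp add: eval_nat_numeral algebra_simps)+
    define e1 where "e1 = r + s + t + u"
    define e2 where "e2 = r * s + r * t + r * u + s * t + s * u + t * u"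
    define e3 where "e3 = r * s * t + r * s * u + r * t * u + s * t * u"
    define e4 where "e4 = r * s * t * u"
    have q: "of_rat (?C ! 3) = (of_rat (- e1 * ?C ! 4) :: complex)" "of_rat (?C ! 2) = (of_rat (e2 * ?C ! 4) :: complex)"
      "of_rat (?C ! 1) = (of_rat (- e3 * ?C ! 4) :: complex)" "of_rat (?C ! 0) = (of_rat (e4 * ?C ! 4) :: complex)"
      using e co[of 3] co[of 2] co[of 1] co[of 0]
      unfolding e1_def e2_def e3_def e4_def r(1) s(1) t(1) u(1) of_rat_add of_rat_mult of_rat_minus by simp_all
    have L: "2880 - 66560 * \<alpha> + 122880 * \<beta> - 5376 * \<gamma> = - e1 * (- 720 - 1920 * \<gamma>)"
      "- 4320 - 558080 * \<alpha> + 860160 * \<beta> - 187392 * \<gamma> = e2 * (- 720 - 1920 * \<gamma>)"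
      "2880 - 1305600 * \<alpha> + 1843200 * \<beta> - 387840 * \<gamma> = - e3 * (- 720 - 1920 * \<gamma>)"
      "- 720 - 691200 * \<alpha> + 1105920 * \<beta> - 203904 * \<gamma> = e4 * (- 720 - 1920 * \<gamma>)"
      using q unfolding of_rat_eq_iff quartic_coeffs_nth .
    have "(e1 = 4 \<and> e2 = 6 \<and> e3 = 4 \<and> e4 = 1) \<or> (e1 = - 12 \<and> e2 = - 42 \<and> e3 = - 44 \<and> e4 = - 15) \<or>
      (e1 = - 28 \<and> e2 = 166 \<and> e3 = 420 \<and> e4 = 225) \<or> (e1 = - 44 \<and> e2 = 630 \<and> e3 = - 2700 \<and> e4 = - 3375) \<or>
      (e1 = - 60 \<and> e2 = 1350 \<and> e3 = - 13500 \<and> e4 = 50625)"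
      using r(2) s(2) t(2) u(2) unfolding e1_def e2_def e3_def e4_def by (elim disjE) simp_all
    then have "(\<alpha> = 0 \<and> \<beta> = 0 \<and> \<gamma> = 0) \<or> (\<alpha> = 1/6 \<and> \<beta> = 2/45 \<and> \<gamma> = -1/3) \<or> (\<alpha> = 2/5 \<and> \<beta> = 14/75 \<and> \<gamma> = -2/5)"
    proof (elim disjE conjE)
      assume v: "e1 = 4" "e2 = 6" "e3 = 4" "e4 = 1"
      have "\<alpha> = 0" "\<beta> = 0" "\<gamma> = 0" using L unfolding v by linarith+
      then show ?thesis by blast
    next
      assume v: "e1 = - 12" "e2 = - 42" "e3 = - 44" "e4 = - 15"
      have "\<alpha> = 1/6" "\<beta> = 2/45" "\<gamma> = -1/3" using L unfolding v by linarith+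
      then show ?thesis by blast
    next
      assume v: "e1 = - 28" "e2 = 166" "e3 = 420" "e4 = 225"
      have "\<alpha> = 2/5" "\<beta> = 14/75" "\<gamma> = -2/5" using L unfolding v by linarith+
      then show ?thesis by blast
    next
      assume v: "e1 = - 44" "e2 = 630" "e3 = - 2700" "e4 = - 3375"
      have z: "2880 - 66560 * \<alpha> + 122880 * \<beta> - 5376 * \<gamma> - 44 * (- 720 - 1920 * \<gamma>) = 0"
        "- 4320 - 558080 * \<alpha> + 860160 * \<beta> - 187392 * \<gamma> - 630 * (- 720 - 1920 * \<gamma>) = 0"
        "2880 - 1305600 * \<alpha> + 1843200 * \<beta> - 387840 * \<gamma> - 2700 * (- 720 - 1920 * \<gamma>) = 0"
        "- 720 - 691200 * \<alpha> + 1105920 * \<beta> - 203904 * \<gamma> - - 3375 * (- 720 - 1920 * \<gamma>) = 0"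
        using L unfolding v by (simp_all only: minus_minus right_minus_eq)
      \<comment> \<open>The multipliers eliminate all three parameters from the four equations and
        leave a nonzero constant. The next case has the same form.\<close>
      have "750 * (2880 - 66560 * \<alpha> + 122880 * \<beta> - 5376 * \<gamma> - 44 * (- 720 - 1920 * \<gamma>))
        + (- 345) * (- 4320 - 558080 * \<alpha> + 860160 * \<beta> - 187392 * \<gamma> - 630 * (- 720 - 1920 * \<gamma>))
        + 96 * (2880 - 1305600 * \<alpha> + 1843200 * \<beta> - 387840 * \<gamma> - 2700 * (- 720 - 1920 * \<gamma>))
        + 25 * (- 720 - 691200 * \<alpha> + 1105920 * \<beta> - 203904 * \<gamma> - - 3375 * (- 720 - 1920 * \<gamma>)) = (- 2949120)"
        by (simp add: algebra_simps)
      then have False unfolding z by simp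
      then show ?thesis by blast
    next
      assume v: "e1 = - 60" "e2 = 1350" "e3 = - 13500" "e4 = 50625"
      have z: "2880 - 66560 * \<alpha> + 122880 * \<beta> - 5376 * \<gamma> - 60 * (- 720 - 1920 * \<gamma>) = 0"
        "- 4320 - 558080 * \<alpha> + 860160 * \<beta> - 187392 * \<gamma> - 1350 * (- 720 - 1920 * \<gamma>) = 0"
        "2880 - 1305600 * \<alpha> + 1843200 * \<beta> - 387840 * \<gamma> - 13500 * (- 720 - 1920 * \<gamma>) = 0"
        "- 720 - 691200 * \<alpha> + 1105920 * \<beta> - 203904 * \<gamma> - 50625 * (- 720 - 1920 * \<gamma>) = 0"
        using L unfolding v by (simp_all only: minus_minus right_minus_eq)
      have "(- 3350) * (2880 - 66560 * \<alpha> + 122880 * \<beta> - 5376 * \<gamma> - 60 * (- 720 - 1920 * \<gamma>))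
        + 1205 * (- 4320 - 558080 * \<alpha> + 860160 * \<beta> - 187392 * \<gamma> - 1350 * (- 720 - 1920 * \<gamma>))
        + (- 384) * (2880 - 1305600 * \<alpha> + 1843200 * \<beta> - 387840 * \<gamma> - 13500 * (- 720 - 1920 * \<gamma>))
        + 75 * (- 720 - 691200 * \<alpha> + 1105920 * \<beta> - 203904 * \<gamma> - 50625 * (- 720 - 1920 * \<gamma>)) = 11796480"
        by (simp add: algebra_simps)
      then have False unfolding z by simp
      then show ?thesis by blast
    qed
    then show False using assms by blast
  qed
qed

lemma locus_B_eq_iff:
  "locus_B = zero_locus (cov_ideal (\<alpha>, \<beta>, \<gamma>)) \<longleftrightarrow> (\<alpha>, \<beta>, \<gamma>) \<in> {(0, 0, 0), (2/5, 14/75, -2/5), (1/6, 2/45, -1/3)}"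
proof
  assume s: "(\<alpha>, \<beta>, \<gamma>) \<in> {(0, 0, 0), (2/5, 14/75, -2/5), (1/6, 2/45, -1/3)}"
  have "P \<in> locus_B" if P: "P \<in> zero_locus (cov_ideal (\<alpha>, \<beta>, \<gamma>))" for P
  proof -
    obtain b where b: "P = line (nform 5 b)" using P quintic_space_nform unfolding zero_locus_def by blast
    have v: "\<exists>i<6. b i \<noteq> 0" "vanish (\<alpha>, \<beta>, \<gamma>) b" using P unfolding b line_in_zero_locus by auto
    obtain e where e: "eqv b e" "even_form e" using vanish_even[OF v(2)] by blast
    have "vanish (\<alpha>, \<beta>, \<gamma>) e" using v(2) vanish_eqv[OF e(1)] by blast
    then have "e 4 = 0 \<or> e 0 * e 4 = e 2 ^ 2 \<or> e 0 * e 4 = - 15 * e 2 ^ 2"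
      using quartic_special[OF s] unfolding vanish_even_iff[OF e(2)] by blast
    from even_rep[OF e(2) eqv_nonzero[OF e(1) v(1)] this] obtain k where k: "k < 6" "eqv (rep k) e" by blast
    have "eqv (rep k) b" by (rule eqv_trans[OF k(2) eqv_sym[OF e(1)]])
    then show ?thesis using k(1) orbit_eqv unfolding b locus_B_rep by blast
  qed
  then show "locus_B = zero_locus (cov_ideal (\<alpha>, \<beta>, \<gamma>))" using locus_B_subset by blast
next
  assume eq: "locus_B = zero_locus (cov_ideal (\<alpha>, \<beta>, \<gamma>))"
  show "(\<alpha>, \<beta>, \<gamma>) \<in> {(0, 0, 0), (2/5, 14/75, -2/5), (1/6, 2/45, -1/3)}"
  proof (rule ccontr)
    assume "(\<alpha>, \<beta>, \<gamma>) \<notin> {(0, 0, 0), (2/5, 14/75, -2/5), (1/6, 2/45, -1/3)}"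
    then obtain x y where xy: "x \<noteq> y" "x \<noteq> - 15 * y" "quartic \<alpha> \<beta> \<gamma> x y = 0" using quartic_root by blast
    \<comment> \<open>The even form with coefficients x, k, 1 realises the prescribed values x of
      a_0 a_4 and y of a_2^2.\<close>
    obtain k where k: "k ^ 2 = y" using root_exists[of 2] by auto
    define e where "e i = [x, 0, k, 0, 1, 0] ! i" for i
    have e: "even_form e" "e 0 = x" "e 2 = k" "e 4 = 1" by (simp_all add: even_form_def e_def)
    have nz: "\<exists>i<6. e i \<noteq> 0" using e(4) by (intro exI[of _ 4]) simp
    have "vanish (\<alpha>, \<beta>, \<gamma>) e" unfolding vanish_even_iff[OF e(1)] e(2-4) using xy(3) k by simp
    \<comment> \<open>By the assumed equality the point lies in \<open>locus_B\<close>, hence in the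
      zero locus for the triple (0, 0, 0), whose quartic vanishes only for x = y. No invariant
      separating the orbits is required.\<close>
    then have "line (nform 5 e) \<in> zero_locus (cov_ideal (0, 0, 0))"
      using nz eq locus_B_subset line_in_zero_locus by blast
    then have "vanish (0, 0, 0) e" unfolding line_in_zero_locus by blast
    then have "quartic 0 0 0 x y = 0" unfolding vanish_even_iff[OF e(1)] e(2-4) using xy k by simp
    then show False using quartic_special[of 0 0 0 x y] xy by simp
  qed
qed

section \<open>Finitely many orbits and a line avoiding them\<close>

lemma finite_quartic_roots: "finite {u. quartic \<alpha> \<beta> \<gamma> u 1 = 0}"
proof -
  let ?p = "Poly (map of_rat (quartic_coeffs \<alpha> \<beta> \<gamma>)) :: complex poly"
  obtain i where i: "i < 5" "quartic_coeffs \<alpha> \<beta> \<gamma> ! i \<noteq> 0" using quartic_coeffs_nonzero by blast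
  have "coeff ?p i = of_rat (quartic_coeffs \<alpha> \<beta> \<gamma> ! i)"
    by (rule quartic_coeff[OF i(1)])
  then have ne: "coeff ?p i \<noteq> 0" using i(2) by (simp only: of_rat_eq_0_iff not_False_eq_True)
  have "?p \<noteq> 0"
  proof
    assume "?p = 0"
    then have "coeff ?p i = 0" by (simp only: coeff_0)
    then show False using ne by contradiction
  qed
  then show ?thesis unfolding quartic_poly by (rule poly_roots_finite)
qed

lemma quartic_homogeneous: "quartic \<alpha> \<beta> \<gamma> (k * x) (k * y) = k ^ 4 * quartic \<alpha> \<beta> \<gamma> x y"
  unfolding quartic_def by (simp add: algebra_simps eval_nat_numeral)

text \<open>A finite set meeting every orbit of the zero locus; it may contain further forms.
  Besides the six representatives there is the even form with a_2 = 0, which is the point (1, 0) of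
  the quartic, and one even form for each root in the chart y = 1.\<close>

definition orbit_reps :: "rat \<times> rat \<times> rat \<Rightarrow> (nat \<Rightarrow> complex) set" where
  "orbit_reps = (\<lambda>(\<alpha>, \<beta>, \<gamma>). rep ` {..<6} \<union> {\<lambda>i. [1, 0, 0, 0, 1, 0] ! i} \<union>
     (\<lambda>u i. [u, 0, 1, 0, 1, 0] ! i) ` {u. quartic \<alpha> \<beta> \<gamma> u 1 = 0})"

lemma finite_orbit_reps: "finite (orbit_reps \<tau>)"
  by (cases \<tau>) (simp add: orbit_reps_def finite_quartic_roots)

lemma vanish_orbit_reps:
  assumes v: "vanish \<tau> b" "\<exists>i<6. b i \<noteq> 0"
  shows "\<exists>F\<in>orbit_reps \<tau>. eqv F b"
proof -
  obtain \<alpha> \<beta> \<gamma> where \<tau>: "\<tau> = (\<alpha>, \<beta>, \<gamma>)" by (cases \<tau>)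
  obtain e where e: "eqv b e" "even_form e" using vanish_even v(1) unfolding \<tau> by blast
  have z: "e 1 = 0" "e 3 = 0" "e 5 = 0" using e(2) by (simp_all add: even_form_def)
  have "vanish (\<alpha>, \<beta>, \<gamma>) e" using v(1) vanish_eqv[OF e(1)] unfolding \<tau> by blast
  then have c: "e 4 = 0 \<or> e 0 * e 4 = e 2 ^ 2 \<or> e 0 * e 4 = - 15 * e 2 ^ 2 \<or> quartic \<alpha> \<beta> \<gamma> (e 0 * e 4) (e 2 ^ 2) = 0"
    unfolding vanish_even_iff[OF e(2)] .
  have diag: "eqv F e" if "l \<noteq> 0" "m \<noteq> 0" "\<And>i. i < 6 \<Longrightarrow> e i = l ^ (5 - i) * m ^ i * F i" for F l m
    by (rule eqv_tr[of l m 0 0]) (use that in \<open>simp_all add: tr_diag\<close>)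
  have "\<exists>F\<in>orbit_reps \<tau>. eqv F e"
  proof (cases "e 4 = 0 \<or> e 0 * e 4 = e 2 ^ 2 \<or> e 0 * e 4 = - 15 * e 2 ^ 2")
    case True
    then show ?thesis using even_rep[OF e(2) eqv_nonzero[OF e(1) v(2)]] unfolding \<tau> orbit_reps_def by auto
  next
    case False
    then have e4: "e 4 \<noteq> 0" and n: "e 0 * e 4 \<noteq> e 2 ^ 2" and q: "quartic \<alpha> \<beta> \<gamma> (e 0 * e 4) (e 2 ^ 2) = 0" using c by blast+
    show ?thesis
    proof (cases "e 2 = 0")
      case True
      then have e0: "e 0 \<noteq> 0" using n by auto
      obtain l where l: "l ^ 5 = e 0" using root_exists[of 5] by auto
      have l0: "l \<noteq> 0" using l e0 by auto
      obtain m where m: "m ^ 4 = e 4 / l" using root_exists[of 4] by auto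
      have m0: "m \<noteq> 0" using m e4 l0 by auto
      have "eqv (\<lambda>i. [1, 0, 0, 0, 1, 0] ! i) e"
      proof (rule diag[OF l0 m0])
        fix i :: nat assume "i < 6"
        then show "e i = l ^ (5 - i) * m ^ i * [1, 0, 0, 0, 1, 0] ! i"
          unfolding less_6 using z True l m l0 by (elim disjE) (simp_all del: One_nat_def)
      qed
      then show ?thesis unfolding \<tau> orbit_reps_def by auto
    next
      case e2: False
      \<comment> \<open>Diagonal scaling multiplies the even coefficients by l^5, l^3 m^2 and l m^4.
        Requiring e 2 = l^3 m^2 and e 4 = l m^4 and eliminating m yields this equation for l; the
        first coefficient is then determined by the ratio \<open>?u\<close>.\<close>
      obtain l where l: "l ^ 5 = e 2 ^ 2 / e 4" using root_exists[of 5] by auto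
      have l0: "l \<noteq> 0" using l e2 e4 by auto
      obtain m where m: "m ^ 2 = e 2 / l ^ 3" using root_exists[of 2] by auto
      have m0: "m \<noteq> 0" using m e2 l0 by auto
      let ?u = "e 0 * e 4 / e 2 ^ 2"
      have "eqv (\<lambda>i. [?u, 0, 1, 0, 1, 0] ! i) e"
      proof (rule diag[OF l0 m0])
        fix i :: nat assume i: "i < 6"
        have m4: "l * m ^ 4 = e 4"
        proof -
          have "l * m ^ 4 = l * (m ^ 2) ^ 2" by (simp flip: power_mult)
          also have "\<dots> = l * (e 2 ^ 2 / (l ^ 3) ^ 2)" unfolding m by (simp add: power_divide)
          also have "(l ^ 3) ^ 2 = l * l ^ 5" by (simp flip: power_mult power_Suc)
          also have "l * (e 2 ^ 2 / (l * l ^ 5)) = e 4" unfolding l using l0 e2 e4 by (simp add: field_simps)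
          finally show ?thesis .
        qed
        have m2: "l ^ 3 * m ^ 2 = e 2" unfolding m using l0 by simp
        have m0': "l ^ 5 * ?u = e 0" unfolding l using e2 e4 by (simp add: field_simps)
        show "e i = l ^ (5 - i) * m ^ i * [?u, 0, 1, 0, 1, 0] ! i"
          using i unfolding less_6 using z m4 m2 m0' by (elim disjE) (simp_all del: One_nat_def)
      qed
      moreover have "quartic \<alpha> \<beta> \<gamma> ?u 1 = 0"
        using quartic_homogeneous[of \<alpha> \<beta> \<gamma> "1 / e 2 ^ 2" "e 0 * e 4" "e 2 ^ 2"] q e2 by simp
      ultimately show ?thesis unfolding \<tau> orbit_reps_def by auto
    qed
  qed
  then show ?thesis using eqv_trans[OF _ eqv_sym[OF e(1)]] by blast
qed

lemma trn_hom:
  assumes "comm_ring_hom h" shows "h (trn n p q r s b j) = trn n (h p) (h q) (h r) (h s) (\<lambda>i. h (b i)) j"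
proof -
  have c: "h (contract x y b i) = contract (h x) (h y) (\<lambda>i. h (b i)) i" for x y b i
    by (simp add: contract_def crh_add[OF assms] crh_mult[OF assms])
  have P: "h ((contract x y ^^ k) b i) = (contract (h x) (h y) ^^ k) (\<lambda>i. h (b i)) i" for x y k b i
  proof (induction k arbitrary: i)
    case (Suc k)
    show ?case by (simp add: c Suc.IH)
  qed simp
  show ?thesis by (simp only: trn_def P)
qed

lemma hom_subst: "ev a (subst_poly Const f p) = ev (\<lambda>v. ev a (f v)) p"
  by (rule hom_eqI[OF hom_comp[OF ev_hom subst_hom] ev_hom]) (simp_all add: ev_simps subst_simps)

text \<open>Transformed coefficients are polynomials in four matrix entries, so any five of their
  linear combinations are algebraically dependent. The five chosen ones are the linear forms that
  vanish at (1, 0, 0, 1, 0, 0), the point through which the line will pass.\<close>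

lemma orbit_relation:
  "\<exists>H :: (nat, complex) mpol. H \<noteq> 0 \<and> restrict_vars {..<5} H = H \<and>
    (\<forall>b. eqv F b \<longrightarrow> ev (\<lambda>i. [b 1, b 2, b 3 - b 0, b 4, b 5] ! i) H = 0)"
proof -
  let ?b = "trn 5 (Var 0) (Var 1) (Var 2) (Var 3) (\<lambda>i. Const (F i)) :: nat \<Rightarrow> (4, complex) mpol"
  let ?P = "\<lambda>i. [?b 1, ?b 2, ?b 3 - ?b 0, ?b 4, ?b 5] ! i"
  have "CARD(4) < 5" by simp
  from algebraic_relation[OF this, of ?P] obtain H where H: "H \<noteq> 0" "restrict_vars {..<5} H = H" "subst_poly Const ?P H = 0"
    by (elim exE conjE)
  have "ev (\<lambda>i. [b 1, b 2, b 3 - b 0, b 4, b 5] ! i) H = 0" if "eqv F b" for b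
  proof -
    obtain p q r s where b: "\<And>i. i < 6 \<Longrightarrow> b i = tr p q r s F i" using \<open>eqv F b\<close> unfolding eqv_iff by blast
    let ?a = "\<lambda>v :: 4. if v = 0 then p else if v = 1 then q else if v = 2 then r else s"
    have eb: "ev ?a (?b i) = b i" if "i < 6" for i
      unfolding trn_hom[OF ev_hom] ev_simps b[OF that] by simp
    have P: "ev ?a (?P i) = [b 1, b 2, b 3 - b 0, b 4, b 5] ! i" if "i < 5" for i
      using that unfolding less_5_cases by (elim disjE) (simp_all add: eb crh_diff[OF ev_hom])
    have "(\<lambda>v. if v \<in> {..<5} then ev ?a (?P v) else 0) = (\<lambda>v. if v \<in> {..<5} then [b 1, b 2, b 3 - b 0, b 4, b 5] ! v else 0)"
      using P by auto
    then have "ev (\<lambda>i. [b 1, b 2, b 3 - b 0, b 4, b 5] ! i) (restrict_vars {..<5} H) = ev (\<lambda>v. ev ?a (?P v)) (restrict_vars {..<5} H)"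
      unfolding ev_restrict by simp
    also have "\<dots> = 0" unfolding H(2) hom_subst[symmetric] H(3) by (rule ev_simps)
    finally show ?thesis unfolding H(2) .
  qed
  then show ?thesis using H by blast
qed

text \<open>After the swap this quintic has a multiple of x1^2 as quadratic covariant and satisfies
  the hypotheses of \<open>vanish_parabolic\<close>, but its coefficient of index 2 is 1.\<close>

lemma not_vanish_base: "\<not> vanish \<tau> (\<lambda>i. [1, 0, 0, 1, 0, 0] ! i)"
proof
  let ?Q = "\<lambda>i. [1, 0, 0, 1, 0, 0] ! i :: complex"
  assume "vanish \<tau> ?Q"
  moreover obtain \<alpha> \<beta> \<gamma> where \<tau>: "\<tau> = (\<alpha>, \<beta>, \<gamma>)" by (cases \<tau>)
  ultimately have v: "vanish (\<alpha>, \<beta>, \<gamma>) (tr 0 1 1 0 ?Q)" using vanish_eqv[OF eqv_swap] by blast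
  have "tr 0 1 1 0 ?Q 2 = 0"
    by (rule conjunct2[OF vanish_parabolic[OF v]]) (simp_all only: tq_values tr_swap, simp_all)
  then show False unfolding tr_swap by simp
qed

text \<open>The direction a of the line is taken off the hypersurfaces of all orbits. A point of the
  line other than the base point projects to a multiple of a; if it were in the zero locus, the
  relation of its orbit would vanish at a.\<close>

lemma cov_regular_pair: "\<exists>f\<in>cov_ideal \<tau>. \<exists>g\<in>cov_ideal \<tau>. regular_pair f g"
proof -
  have "\<forall>F. \<exists>H :: (nat, complex) mpol. H \<noteq> 0 \<and> restrict_vars {..<5} H = H \<and>
    (\<forall>b. eqv F b \<longrightarrow> ev (\<lambda>i. [b 1, b 2, b 3 - b 0, b 4, b 5] ! i) H = 0)" using orbit_relation by blast
  then obtain H :: "(nat \<Rightarrow> complex) \<Rightarrow> (nat, complex) mpol" where H: "\<And>F. H F \<noteq> 0" "\<And>F. restrict_vars {..<5} (H F) = H F"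
    "\<And>F b. eqv F b \<Longrightarrow> ev (\<lambda>i. [b 1, b 2, b 3 - b 0, b 4, b 5] ! i) (H F) = 0" by metis
  \<comment> \<open>The factor \<open>Var 0\<close> makes a 0 nonzero, so that the direction can be
    normalised to have coordinate 1 equal to t on the line.\<close>
  define K where "K = Var 0 * (\<Prod>F\<in>orbit_reps \<tau>. H F)"
  have "K \<noteq> 0" using H(1) finite_orbit_reps by (simp add: K_def)
  moreover have "restrict_vars {..<5} K = K"
    unfolding K_def crh_mult[OF restrict_hom] crh_prod[OF restrict_hom] H(2) by simp
  ultimately obtain a where a: "ev a K \<noteq> 0" using nonvanishing_point[of "{..<5}" K] by auto
  then have a0: "a 0 \<noteq> 0" and aH: "\<And>F. F \<in> orbit_reps \<tau> \<Longrightarrow> ev a (H F) \<noteq> 0"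
    using finite_orbit_reps[of \<tau>] unfolding K_def crh_mult[OF ev_hom] crh_prod[OF ev_hom] ev_simps by auto
  define p where "p i = a (i - 1) / a 0" for i :: nat
  let ?l = "\<lambda>s t i. [s, t, p 2 * t, s + p 3 * t, p 4 * t, p 5 * t] ! i"
  have l: "line_point p s t (of_nat i) = ?l s t i" if "i < 6" for s t i
    using that unfolding less_6 by (elim disjE) (simp_all add: line_point_def)
  have "\<not> vanish \<tau> (?l s t)" if st: "(s, t) \<noteq> (0, 0)" for s t
  proof
    assume v: "vanish \<tau> (?l s t)"
    show False
    proof (cases "t = 0")
      case True
      then have s: "s \<noteq> 0" using st by simp
      have v': "vanish \<tau> (\<lambda>i. 1 / s * ?l s t i)" by (rule vanish_scale[OF v])
      have "1 / s * ?l s t i = [1, 0, 0, 1, 0, 0] ! i" if "i < 6" for i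
        using that s True unfolding less_6 by (elim disjE) simp_all
      then have "vanish \<tau> (\<lambda>i. [1, 0, 0, 1, 0, 0] ! i)" by (rule iffD1[OF vanish_cong, OF _ v'])
      then show False using not_vanish_base by blast
    next
      case t: False
      \<comment> \<open>The relations need not be homogeneous, so the point is rescaled until its
        projection from the base point is exactly a.\<close>
      define b where "b i = a 0 / t * ?l s t i" for i
      have vb: "vanish \<tau> b" unfolding b_def by (rule vanish_scale[OF v])
      have b: "b 0 = a 0 * s / t" "b 1 = a 0" "b 2 = a 1" "b 3 = b 0 + a 2" "b 4 = a 3" "b 5 = a 4"
        using t a0 by (simp_all add: b_def p_def field_simps)
      have "\<exists>i<6. b i \<noteq> 0" using b(2) a0 by (intro exI[of _ 1]) simp
      from vanish_orbit_reps[OF vb this] obtain F where F: "F \<in> orbit_reps \<tau>" "eqv F b" by blast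
      have "ev (\<lambda>i. [b 1, b 2, b 3 - b 0, b 4, b 5] ! i) (restrict_vars {..<5} (H F)) = 0" using H(2,3)[of F] F(2) by simp
      moreover have "(\<lambda>v. if v \<in> {..<5} then [b 1, b 2, b 3 - b 0, b 4, b 5] ! v else 0) = (\<lambda>v. if v \<in> {..<5} then a v else 0)"
      proof
        fix v :: nat
        have "[b 1, b 2, b 3 - b 0, b 4, b 5] ! v = a v" if "v < 5"
          using that b unfolding less_5_cases by (elim disjE) simp_all
        then show "(if v \<in> {..<5} then [b 1, b 2, b 3 - b 0, b 4, b 5] ! v else 0) = (if v \<in> {..<5} then a v else 0)" by simp
      qed
      ultimately have "ev a (restrict_vars {..<5} (H F)) = 0" unfolding ev_restrict by simp
      then show False using aH[OF F(1)] unfolding H(2) by simp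
    qed
  qed
  then have "\<exists>j<6. ev (line_point p s t) (gcof \<tau> j) \<noteq> 0" if "(s, t) \<noteq> (0, 0)" for s t
    using vanish_ev[of \<tau> "line_point p s t"] vanish_cong[of "\<lambda>i. line_point p s t (of_nat i)" "?l s t" \<tau>] l that by blast
  from regular_pair_line[of 6 "gcof \<tau>" 17 p, OF homogeneous_rd[OF rd_gcof] this]
  show ?thesis unfolding cov_ideal_gcof by blast
qed

text \<open>For a form divisible by x1^3 the quadratic covariant is a multiple of x1^2, and its
  square contracts with the form to zero; both invariants vanish as well. The last row is then zero,
  which is a relation by itself.\<close>

lemma vanish_triple:
  assumes b: "b 3 = 0" "b 4 = 0" "b 5 = 0" shows "vanish \<tau> b"
proof -
  obtain \<alpha> \<beta> \<gamma> where \<tau>: "\<tau> = (\<alpha>, \<beta>, \<gamma>)" by (cases \<tau>)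
  have t: "tq b 1 = 0" "tq b 2 = 0" unfolding tq_values b by simp_all
  have i8: "I8 (\<lambda>c. c) b = 0" using t by (simp add: I8_def atMost_simps choose_simps zq_def yq_def b)
  have "5 * rowV (\<lambda>c. c) b \<beta> \<gamma> j = 0" if "j < 6" for j
    unfolding rows_parabolic(2)[OF t that] i8 b using that unfolding less_6 by (elim disjE) simp_all
  then have "rowV (\<lambda>c. c) b \<beta> \<gamma> j = 0" if "j < 6" for j using that by simp
  then show ?thesis unfolding \<tau> by (intro vanishI[of 0 0 0 0 1]) simp_all
qed

text \<open>The prime consists of the polynomials vanishing on all quintics divisible by the cube of
  some x1 + t x2. It is the kernel of a homomorphism to a polynomial ring in four variables, three
  coefficients and the shear t; four independent coordinates modulo it bound its height by 6 -
  4.\<close>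

lemma cov_ideal_prime: "\<exists>P. prime_ideal P \<and> cov_ideal \<tau> \<subseteq> P \<and> prime_height P \<le> 2"
proof -
  let ?B = "\<lambda>i. [Var 0, Var 1, Var 2, 0, 0, 0] ! i :: (4, complex) mpol"
  let ?c = "\<lambda>v. trn 5 1 (Var 3) 0 1 ?B (idx v)"
  define \<phi> where "\<phi> = (subst_poly Const ?c :: quintic_ring \<Rightarrow> (4, complex) mpol)"
  have \<phi>: "comm_ring_hom \<phi>" unfolding \<phi>_def by (rule subst_hom)
  have coord: "ev a (?c (of_nat i)) = tr 1 (a 3) 0 1 (\<lambda>i. ev a (?B i)) i" if "i < 6" for a i
    unfolding idx_of_nat[OF that] trn_hom[OF ev_hom] by (simp only: ev_simps ev_1)
  have B: "ev a (?B 0) = a 0" "ev a (?B 1) = a 1" "ev a (?B 2) = a 2" "ev a (?B 3) = 0" "ev a (?B 4) = 0" "ev a (?B 5) = 0" for a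
    by (simp_all add: ev_simps)
  let ?P = "{p. \<phi> p = 0}"
  have P: "prime_ideal ?P" by (rule prime_kernel[OF \<phi>])
  have "\<phi> (gcof \<tau> j) = 0" if j: "j < 6" for j
  proof (rule ccontr)
    assume "\<phi> (gcof \<tau> j) \<noteq> 0"
    from nonvanishing_point_finite[OF this] obtain a where a: "ev a (\<phi> (gcof \<tau> j)) \<noteq> 0" by blast
    let ?b = "\<lambda>i. ev a (?B i)"
    have "vanish \<tau> ?b" by (rule vanish_triple) (rule B)+
    then have "vanish \<tau> (tr 1 (a 3) 0 1 ?b)" using vanish_eqv[OF eqv_upper] by blast
    then have "vanish \<tau> (\<lambda>i. (\<lambda>v. ev a (?c v)) (of_nat i))"
      using vanish_cong[of "\<lambda>i. ev a (?c (of_nat i))" "tr 1 (a 3) 0 1 ?b" \<tau>] coord by blast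
    then have "ev (\<lambda>v. ev a (?c v)) (gcof \<tau> j) = 0"
      using vanish_ev[of \<tau> "\<lambda>v. ev a (?c v)"] j by blast
    then show False using a unfolding \<phi>_def hom_subst by simp
  qed
  then have I: "cov_ideal \<tau> \<subseteq> ?P"
    unfolding cov_ideal_gcof by (intro ideal_minimal prime_ideal_D(1)[OF P]) auto
  have "independent_mod ?P 4 (\<lambda>i. Var (of_nat i))"
    unfolding independent_mod_def
  proof (intro allI impI, rule ccontr)
    fix H :: "(nat, complex) mpol"
    assume H: "restrict_vars {..<4} H = H" "subst_poly Const (\<lambda>i. Var (of_nat i)) H \<in> ?P" "H \<noteq> 0"
    have "Var 0 * H \<noteq> 0" using H(3) by simp
    moreover have "restrict_vars {..<4} (Var 0 * H) = Var 0 * H" unfolding crh_mult[OF restrict_hom] H(1) by simp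
    ultimately obtain a where "ev a (Var 0 * H) \<noteq> 0" using nonvanishing_point[of "{..<4}" "Var 0 * H"] by auto
    then have a: "a 0 \<noteq> 0" "ev a H \<noteq> 0" unfolding crh_mult[OF ev_hom] ev_simps by auto
    \<comment> \<open>Prescribed values of the first four coefficients are attained in the family: c
      0, c 1, c 2 follow from a 0, a 1, a 2 and t, and the equation for a 3 becomes a cubic in t.
      Its leading coefficient a 0 is nonzero thanks to the factor \<open>Var 0\<close>.\<close>
    have "degree [:- a 3, 3 * a 2, - 3 * a 1, a 0:] = 3" using a(1) by simp
    then have "\<not> constant (poly [:- a 3, 3 * a 2, - 3 * a 1, a 0:])" by (simp add: constant_degree)
    then obtain t where "poly [:- a 3, 3 * a 2, - 3 * a 1, a 0:] t = 0" using fundamental_theorem_of_algebra by blast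
    then have t: "a 3 = 3 * t * a 2 - 3 * t ^ 2 * a 1 + t ^ 3 * a 0" by (simp add: algebra_simps eval_nat_numeral)
    define c where "c v = (if v = 0 then a 0 else if v = 1 then a 1 - t * a 0 else if v = 2 then a 2 - 2 * t * a 1 + t ^ 2 * a 0 else t)" for v :: 4
    have c: "c 0 = a 0" "c 1 = a 1 - t * a 0" "c 2 = a 2 - 2 * t * a 1 + t ^ 2 * a 0" "c 3 = t" by (simp_all add: c_def)
    have co: "ev c (\<phi> (Var (of_nat i))) = a i" if i: "i < 4" for i
    proof -
      have "ev c (\<phi> (Var (of_nat i))) = tr 1 t 0 1 (\<lambda>i. ev c (?B i)) i"
        using coord[of i c] i unfolding \<phi>_def subst_simps c by simp
      moreover have "i = 0 \<or> i = 1 \<or> i = 2 \<or> i = 3" using i by linarith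
      ultimately show ?thesis
        by (elim disjE) (simp_all only: tr_upper B c t, simp_all add: algebra_simps eval_nat_numeral)
    qed
    have "(\<lambda>v. if v \<in> {..<4} then ev c (\<phi> (Var (of_nat v))) else 0) = (\<lambda>v. if v \<in> {..<4} then a v else 0)"
      using co by auto
    then have "ev a (restrict_vars {..<4} H) = ev (\<lambda>v. ev c (\<phi> (Var (of_nat v)))) (restrict_vars {..<4} H)"
      unfolding ev_restrict by simp
    also have "\<dots> = ev c (\<phi> (subst_poly Const (\<lambda>i. Var (of_nat i)) H))"
      unfolding H(1) \<phi>_def hom_subst subst_simps ev_simps ..
    also have "\<dots> = 0" using H(2) by (simp add: ev_simps)
    finally show False using a(2) unfolding H(1) by simp
  qed
  then have "prime_height ?P \<le> enat 2" by (rule prime_height_le) simp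
  then show ?thesis using P I by (auto simp: numeral_eq_enat)
qed

lemma cov_ideal_perfect:
  "ideal_height (cov_ideal \<tau>) = 2" "perfect_ideal (cov_ideal \<tau>)"
  "equivariant_minimal_resolution (cov_ideal \<tau>) [[(0, 0)], [(17, 5)], [(18, 2), (22, 0), (26, 0)]]"
proof -
  obtain f g where fg: "f \<in> cov_ideal \<tau>" "g \<in> cov_ideal \<tau>" "regular_pair f g" using cov_regular_pair by blast
  obtain P where P: "prime_ideal P" "cov_ideal \<tau> \<subseteq> P" "prime_height P \<le> 2" using cov_ideal_prime by blast
  show "ideal_height (cov_ideal \<tau>) = 2" "perfect_ideal (cov_ideal \<tau>)"
    using perfect_height_two[of f "alpha Const av \<tau>" g P] fg P unfolding cov_ideal_gcof by blast+
  show "equivariant_minimal_resolution (cov_ideal \<tau>) [[(0, 0)], [(17, 5)], [(18, 2), (22, 0), (26, 0)]]"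
    by (rule cov_resolution[OF fg])
qed

theorem theorem4p1:
  shows "(\<forall>\<tau> :: rat \<times> rat \<times> rat.
            ideal_height (cov_ideal \<tau>) = 2 \<and> perfect_ideal (cov_ideal \<tau>) \<and>
            equivariant_minimal_resolution (cov_ideal \<tau>)
              [[(0, 0)], [(17, 5)], [(18, 2), (22, 0), (26, 0)]]) \<and>
         (\<forall>\<tau> :: rat \<times> rat \<times> rat.
            locus_B \<subseteq> zero_locus (cov_ideal \<tau>) \<and>
            (locus_B = zero_locus (cov_ideal \<tau>) \<longleftrightarrow>
               \<tau> \<in> {(0, 0, 0), (2/5, 14/75, -2/5), (1/6, 2/45, -1/3)}))"
  using cov_ideal_perfect locus_B_subset locus_B_eq_iff by (simp add: split_paired_all)

end
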